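(* Let $\Lambda$ be a $d$-dimensional lattice and let $\bm\alpha\in\mathbb{N}^d$. Then the regularized anisotropic Epstein zeta function $Z^{\rm reg}_{\Lambda,\nu,\bm\alpha}(\bm x,\bm y)$ can be holomorphically extended to $$ (\nu,\bm x, \bm y)\in \big(\mathbb{C}\setminus (d+2|\lceil \bm\alpha/2\rceil| +2\mathbb{N})\big)\times D_\Lambda\times D_{\Lambda^*\setminus\{\bm 0\}}. $$ For (fixed) $\nu\in (d+2|\lceil \bm\alpha/2\rceil| +2 \mathbb{N})$, it can be holomorphically extended to $$(\bm x, \bm y) \in D_\Lambda\times D_{\Lambda^*\setminus\{\bm 0\}}.$$ Finally, for (fixed) $\bm x\in \Lambda$, it can be holomorphically extended to $$ (\nu,\bm y) \in \big(\mathbb{C}\setminus (d+2|\lceil \bm\alpha/2\rceil| +2\mathbb{N})\big)\times D_{\Lambda^*\setminus\{\bm 0\}}. $$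
   Context: $\mathbb{N}=\{0,1,2,\dots\}$, $d\ge 1$ is an integer, $0^0=1$. For $\bm\alpha\in\mathbb{N}^d$: $|\bm\alpha|=\sum_j\alpha^{(j)}$, $\bm z^{\bm\alpha}=\prod_j (z^{(j)})^{\alpha^{(j)}}$; the ceiling $\lceil\cdot\rceil$ is componentwise; for vectors $|\cdot|$ is the Euclidean norm and $\bm y^2=|\bm y|^2$ on $\mathbb{R}^d$. A $d$-dimensional lattice is $\Lambda=A\mathbb{Z}^d$, $A\in\mathbb{R}^{d\times d}$ regular; $V_\Lambda=|\det A|$, $\Lambda^*=A^{-T}\mathbb{Z}^d$. For $L\subseteq\mathbb{R}^d$, $D_L=\{\bm u\in\mathbb{C}^d:|\mathrm{Re}(\bm u)-\bm z|>|\mathrm{Im}(\bm u)|\ \text{ for all } \bm z\in L\}$ (real and imaginary parts componentwise). Anisotropic Epstein zeta function: $Z_{\Lambda,\nu,\bm\alpha}(\bm x,\bm y)$, $\bm x,\bm y\in\mathbb{R}^d$, is the meromorphic continuation in $\nu$ to $\mathbb{C}$ of $\sum_{\bm z\in\Lambda,\,\bm z\ne\bm x} e^{-2\pi i\bm y\cdot\bm z}(\bm z-\bm x)^{\bm\alpha}|\bm z-\bm x|^{-\nu}$, $\mathrm{Re}(\nu)>d+|\bm\alpha|$. Regularized version: $$Z_{\Lambda, \nu,\bm\alpha}^{\mathrm{reg}}(\bm x,\bm y) =e^{2\pi i\bm x\cdot\bm y} Z_{\Lambda,\nu,\bm\alpha}(\bm x,\bm y) -\frac{\hat s^{(\bm\alpha)}_{\nu}(\bm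 y)}{(-2\pi i)^{|\bm\alpha|}V_{\Lambda}},\qquad \bm y\neq \bm 0,$$ continuously extended to $\bm y=\bm 0$, where $\hat s^{(\bm\alpha)}_\nu$ is the $\bm\alpha$-th partial derivative of $\hat s_\nu$, with $\hat{s}_\nu(\bm y) = \frac{\pi^{\nu/2}}{\Gamma(\nu/2)}\Gamma((d-\nu)/2)(\pi \bm y^2)^{(\nu - d)/2}$ for $\nu\notin d+2\mathbb{N}$ ($1/\Gamma$ being the entire reciprocal Gamma function), and $\hat s_{d+2\ell}(\bm y)= \frac{\pi^{\ell+d/2}}{\Gamma(\ell+d/2)}\frac{(-1)^{\ell+1}}{\ell!} ( \pi \bm y^2 )^{\ell} \log (\pi \bm y^{2})$ for $\ell\in\mathbb{N}$. "Can be holomorphically extended to" a set means: there is a jointly holomorphic function on that set agreeing with $Z^{\rm reg}_{\Lambda,\nu,\bm\alpha}(\bm x,\bm y)$ at the real vector arguments contained in it (real $\bm x\notin\Lambda$ in the first two cases, and real $\bm y\in(\mathbb{R}^d\setminus\Lambda^* )\cup\{\bm 0\}$). *)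

theory Defs
  imports "HOL-Complex_Analysis.Complex_Analysis"
begin

class complex_normed_vector = real_normed_vector +
  fixes scaleC :: "complex \<Rightarrow> 'a \<Rightarrow> 'a"  (infixr \<open>*\<^sub>C\<close> 75)
  assumes scaleC_add_right: "c *\<^sub>C (x + y) = c *\<^sub>C x + c *\<^sub>C y"
    and scaleC_add_left: "(b + c) *\<^sub>C x = b *\<^sub>C x + c *\<^sub>C x"
    and scaleC_scaleC: "b *\<^sub>C c *\<^sub>C x = (b * c) *\<^sub>C x"
    and scaleC_of_real: "complex_of_real r *\<^sub>C x = r *\<^sub>R x"
    and norm_scaleC: "norm (c *\<^sub>C x) = cmod c * norm x"

instantiation complex :: complex_normed_vector
begin
definition scaleC_complex_def: "c *\<^sub>C (x::complex) = c * x"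
instance
  by standard (simp_all add: scaleC_complex_def algebra_simps scaleR_conv_of_real norm_mult)
end

instantiation prod :: (complex_normed_vector, complex_normed_vector) complex_normed_vector
begin
definition scaleC_prod_def: "c *\<^sub>C x = (c *\<^sub>C fst x, c *\<^sub>C snd x)"
instance
proof
  fix c :: complex and x :: "'a \<times> 'b"
  have "norm (c *\<^sub>C x) = sqrt ((cmod c)\<^sup>2 * ((norm (fst x))\<^sup>2 + (norm (snd x))\<^sup>2))"
    by (simp add: scaleC_prod_def norm_prod_def norm_scaleC power_mult_distrib algebra_simps)
  then show "norm (c *\<^sub>C x) = cmod c * norm x"
    by (simp add: real_sqrt_mult norm_prod_def)
qed (simp_all add: scaleC_prod_def scaleC_add_right scaleC_add_left scaleC_scaleC
      scaleC_of_real scaleR_prod_def)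
end

instantiation vec :: (complex_normed_vector, finite) complex_normed_vector
begin
definition scaleC_vec_def: "c *\<^sub>C x = (\<chi> i. c *\<^sub>C (x $ i))"
instance
  by standard (simp_all add: scaleC_vec_def vec_eq_iff scaleC_add_right scaleC_add_left
      scaleC_scaleC scaleC_of_real norm_vec_def norm_scaleC L2_set_right_distrib)
end

text \<open>Complex Frechet differentiability: \<open>D\<close> is real-linear by \<open>has_derivative\<close>, and the second
  conjunct makes it complex-linear. The derivative is taken in a full neighbourhood of \<open>p\<close>,
  as is appropriate for open \<open>U\<close>.\<close>

definition jointly_holomorphic_on ::
    "('a::complex_normed_vector \<Rightarrow> complex) \<Rightarrow> 'a set \<Rightarrow> bool"
    (infixl \<open>jointly'_holomorphic'_on\<close> 50) where
  "f jointly_holomorphic_on U \<longleftrightarrow>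
     (\<forall>p\<in>U. \<exists>D. (f has_derivative D) (at p) \<and> (\<forall>c v. D (c *\<^sub>C v) = c * D v))"

definition cvec :: "real ^ 'd \<Rightarrow> complex ^ 'd" where
  "cvec x = (\<chi> i. complex_of_real (x $ i))"

definition Re_vec :: "complex ^ 'd \<Rightarrow> real ^ 'd" where
  "Re_vec u = (\<chi> i. Re (u $ i))"

definition Im_vec :: "complex ^ 'd \<Rightarrow> real ^ 'd" where
  "Im_vec u = (\<chi> i. Im (u $ i))"

definition cdomain :: "(real ^ 'd::finite) set \<Rightarrow> (complex ^ 'd) set" where
  "cdomain L = {u. \<forall>z\<in>L. norm (Re_vec u - z) > norm (Im_vec u)}"

definition mi_abs :: "nat ^ 'd::finite \<Rightarrow> nat" where
  "mi_abs \<alpha> = (\<Sum>i\<in>UNIV. \<alpha> $ i)"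

definition mi_half_ceil :: "nat ^ 'd::finite \<Rightarrow> nat ^ 'd" where
  "mi_half_ceil \<alpha> = (\<chi> i. nat \<lceil>real (\<alpha> $ i) / 2\<rceil>)"

definition mi_power :: "real ^ 'd::finite \<Rightarrow> nat ^ 'd \<Rightarrow> real" where
  "mi_power z \<alpha> = (\<Prod>i\<in>UNIV. (z $ i) ^ (\<alpha> $ i))"

definition partial_deriv ::
    "'d::finite \<Rightarrow> (real ^ 'd \<Rightarrow> complex) \<Rightarrow> real ^ 'd \<Rightarrow> complex" where
  "partial_deriv i f y = vector_derivative (\<lambda>t. f (y + t *\<^sub>R axis i 1)) (at 0)"

text \<open>The index type carries no order, so an enumeration of the coordinates is chosen. The
  choice is immaterial for functions that are smooth near the point of evaluation, since
  their partial derivatives commute.\<close>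

definition mi_deriv ::
    "nat ^ 'd::finite \<Rightarrow> (real ^ 'd \<Rightarrow> complex) \<Rightarrow> real ^ 'd \<Rightarrow> complex" where
  "mi_deriv \<alpha> f =
     foldr (\<lambda>i. partial_deriv i ^^ (\<alpha> $ i)) (SOME js. distinct js \<and> set js = UNIV) f"

definition lattice_of :: "real ^ 'd ^ 'd::finite \<Rightarrow> (real ^ 'd) set" where
  "lattice_of A = range (\<lambda>n :: int ^ 'd. A *v (\<chi> i. real_of_int (n $ i)))"

definition dual_lattice_of :: "real ^ 'd ^ 'd::finite \<Rightarrow> (real ^ 'd) set" where
  "dual_lattice_of A = lattice_of (transpose (matrix_inv A))"

text \<open>Requiring the continuation to be nicely meromorphic makes it unique as a
  function on the whole plane: it is continuous off its poles and \<open>0\<close> at its poles.\<close>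

definition epstein_zeta ::
    "(real ^ 'd::finite) set \<Rightarrow> complex \<Rightarrow> nat ^ 'd \<Rightarrow> real ^ 'd \<Rightarrow> real ^ 'd \<Rightarrow> complex" where
  "epstein_zeta \<Lambda> \<nu> \<alpha> x y =
     (THE F. F nicely_meromorphic_on UNIV \<and>
        (\<forall>s. Re s > real (CARD('d) + mi_abs \<alpha>) \<longrightarrow>
           F s = (\<Sum>\<^sub>\<infinity>z\<in>\<Lambda> - {x}. exp (- 2 * pi * \<i> * complex_of_real (y \<bullet> z)) *
                    complex_of_real (mi_power (z - x) \<alpha>) *
                    complex_of_real (norm (z - x)) powr (- s)))) \<nu>"

definition s_hat :: "complex \<Rightarrow> real ^ 'd::finite \<Rightarrow> complex" where
  "s_hat \<nu> y =
     (if \<exists>l::nat. \<nu> = of_nat (CARD('d) + 2 * l) then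
        (let l = (THE l::nat. \<nu> = of_nat (CARD('d) + 2 * l)) in
          complex_of_real
            (pi powr (real l + real CARD('d) / 2) / Gamma (real l + real CARD('d) / 2) *
             ((-1) ^ (l + 1) / fact l) * (pi * (norm y)\<^sup>2) ^ l * ln (pi * (norm y)\<^sup>2)))
      else
        complex_of_real pi powr (\<nu> / 2) * rGamma (\<nu> / 2) *
        Gamma ((of_nat CARD('d) - \<nu>) / 2) *
        complex_of_real (pi * (norm y)\<^sup>2) powr ((\<nu> - of_nat CARD('d)) / 2))"

definition epstein_zeta_reg_raw ::
    "real ^ 'd ^ 'd::finite \<Rightarrow> complex \<Rightarrow> nat ^ 'd \<Rightarrow> real ^ 'd \<Rightarrow> real ^ 'd \<Rightarrow> complex" where
  "epstein_zeta_reg_raw A \<nu> \<alpha> x y =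
     exp (2 * pi * \<i> * complex_of_real (x \<bullet> y)) * epstein_zeta (lattice_of A) \<nu> \<alpha> x y -
     mi_deriv \<alpha> (s_hat \<nu>) y / ((- 2 * pi * \<i>) ^ mi_abs \<alpha> * complex_of_real \<bar>det A\<bar>)"

definition epstein_zeta_reg ::
    "real ^ 'd ^ 'd::finite \<Rightarrow> complex \<Rightarrow> nat ^ 'd \<Rightarrow> real ^ 'd \<Rightarrow> real ^ 'd \<Rightarrow> complex" where
  "epstein_zeta_reg A \<nu> \<alpha> x y =
     (if y = 0 then Lim (at 0) (epstein_zeta_reg_raw A \<nu> \<alpha> x)
      else epstein_zeta_reg_raw A \<nu> \<alpha> x y)"

definition exceptional_exponents :: "nat ^ 'd::finite \<Rightarrow> complex set" where
  "exceptional_exponents \<alpha> =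
     range (\<lambda>n::nat. of_nat (CARD('d) + 2 * mi_abs (mi_half_ceil \<alpha>) + 2 * n))"

end

theory Submission
  imports Defs "HOL-Probability.Characteristic_Functions"
begin

text \<open>
  For \<open>Re \<nu>\<close> large write \<open>\<bar>v\<bar> powr (- \<nu>)\<close> as a Mellin integral of Gaussians over the scale
  \<open>\<tau>\<close> and split it at \<open>\<tau> = 1\<close>. On the part \<open>\<tau> > 1\<close> the lattice sum converges superexponentially;
  the part \<open>\<tau> < 1\<close> is moved by Poisson summation to a sum over the dual lattice that converges
  equally fast (Crandall's formula). A term at \<open>z\<close> stays holomorphic and Gaussian in size as long as
  \<open>Re ((u - z) \<cdot> (u - z)) > 0\<close>, which is exactly the condition defining \<open>cdomain\<close>. The formula therefore
  continues the zeta function to all \<open>\<nu>\<close> and to complex \<open>u\<close>, \<open>w\<close>.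

  The only singularity at \<open>y = 0\<close> comes from the dual term \<open>k = 0\<close>, an upper incomplete Gamma function
  of \<open>\<pi> y\<^sup>2\<close>. It differs from \<open>s_hat\<close> by the power series of the lower incomplete Gamma function,
  whose \<open>n\<close>-th coefficient has a pole at \<open>\<nu> = d + 2n\<close>. Since \<open>\<alpha>\<close>-th derivatives annihilate \<open>y\<^sup>2\<close> to the
  power \<open>n\<close> when \<open>n < \<bar>\<lceil>\<alpha>/2\<rceil>\<bar>\<close>, only the poles at the exceptional exponents survive.
\<close>

unbundle no fps_syntax

section \<open>Joint holomorphy from lines\<close>

text \<open>The weight in the multi-index is never expanded on the dual side. A direct term carries
  the phase \<open>exp ((- 2 * pi * \<i>) * cdot w (cvec z - u))\<close>, so its \<alpha>-th
  derivative in \<open>w\<close> is the weighted term up to a constant, and the weighted dual side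
  is the \<alpha>-th derivative of the unweighted one. The subtracted term is an \<alpha>-th
  derivative too, so both meet under one \<open>cmi_deriv\<close>, which is what removes the low
  powers of the square. Holomorphy must therefore be joint in all variables and survive
  differentiation. This is reduced to local boundedness and holomorphy on complex lines; lattice
  sums, power series and scale integrals are then all integrals with a locally uniform majorant, and
  Cauchy's estimates convert such a majorant into one for every derivative. Identities are needed at
  real vectors only: derivatives of holomorphic functions there are determined by real partial
  derivatives. Points \<open>y\<close> of the dual lattice are avoided until the term
  \<open>k = 0\<close> has cancelled; \<open>y = 0\<close> is then reached by continuity.\<close>

lemma scaleC_zero_left [simp]: "0 *\<^sub>C (x::'a::complex_normed_vector) = 0"
  using scaleC_of_real[of 0 x] by simp

lemma scaleC_one [simp]: "1 *\<^sub>C (x::'a::complex_normed_vector) = x"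
  using scaleC_of_real[of 1 x] by simp

lemma scaleC_zero_right [simp]: "c *\<^sub>C (0::'a::complex_normed_vector) = 0"
  using norm_scaleC[of c "0::'a"] by simp

lemma scaleC_minus_left: "(- c) *\<^sub>C (x::'a::complex_normed_vector) = - (c *\<^sub>C x)"
  using scaleC_add_left[of "-c" c x] by (simp add: eq_neg_iff_add_eq_0)

lemma scaleC_diff_left: "(b - c) *\<^sub>C (x::'a::complex_normed_vector) = b *\<^sub>C x - c *\<^sub>C x"
  using scaleC_add_left[of b "-c" x] by (simp add: scaleC_minus_left)

lemma bounded_linear_scaleC_left: "bounded_linear (\<lambda>c. c *\<^sub>C (x::'a::complex_normed_vector))"
  by (rule bounded_linear_intro[where K="norm x"])
     (simp_all add: scaleC_add_left norm_scaleC scaleR_conv_of_real flip: scaleC_scaleC scaleC_of_real)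

lemma continuous_scaleC_left [continuous_intros]:
  "continuous_on S (\<lambda>c. c *\<^sub>C (x::'a::complex_normed_vector))"
  by (rule bounded_linear.continuous_on[OF bounded_linear_scaleC_left continuous_on_id])

text \<open>Gateaux differentiability in all complex directions. It reduces questions about several
  variables to one complex variable, where Cauchy's theory is available.\<close>

definition line_differentiable :: "('a::complex_normed_vector \<Rightarrow> complex) \<Rightarrow> 'a \<Rightarrow> bool" where
  "line_differentiable f q \<longleftrightarrow> (\<forall>v. (\<lambda>\<zeta>. f (q + \<zeta> *\<^sub>C v)) field_differentiable (at 0))"

definition dir_deriv :: "'a::complex_normed_vector \<Rightarrow> ('a \<Rightarrow> complex) \<Rightarrow> 'a \<Rightarrow> complex" where
  "dir_deriv v f p = deriv (\<lambda>\<zeta>. f (p + \<zeta> *\<^sub>C v)) 0"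

lemma line_differentiable_shift:
  assumes "line_differentiable f (q + \<zeta> *\<^sub>C v)"
  shows "((\<lambda>\<eta>. f (q + \<eta> *\<^sub>C v)) has_field_derivative dir_deriv v f (q + \<zeta> *\<^sub>C v)) (at \<zeta>)"
proof -
  have "((\<lambda>\<eta>. f ((q + \<zeta> *\<^sub>C v) + \<eta> *\<^sub>C v)) has_field_derivative dir_deriv v f (q + \<zeta> *\<^sub>C v)) (at 0)"
    using assms unfolding line_differentiable_def dir_deriv_def
    by (simp add: field_differentiable_derivI)
  then have "((\<lambda>\<eta>. f ((q + \<zeta> *\<^sub>C v) + (\<eta> - \<zeta>) *\<^sub>C v)) has_field_derivative
      dir_deriv v f (q + \<zeta> *\<^sub>C v)) (at \<zeta>)"
    using DERIV_shift[of "\<lambda>\<eta>. f ((q + \<zeta> *\<^sub>C v) + (\<eta> - \<zeta>) *\<^sub>C v)"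
        "dir_deriv v f (q + \<zeta> *\<^sub>C v)" 0 \<zeta>] by simp
  moreover have "q + \<zeta> *\<^sub>C v + (\<eta> - \<zeta>) *\<^sub>C v = q + \<eta> *\<^sub>C v" for \<eta>
    by (simp add: scaleC_diff_left)
  ultimately show ?thesis by simp
qed

text \<open>Discs of radius \<open>R/4\<close> about points of the half disc stay inside
  \<open>ball 0 R\<close>, so Cauchy's inequality bounds the derivative there by
  \<open>4 * B / R\<close>; the mean value inequality turns this into a Lipschitz bound.\<close>

lemma holomorphic_lipschitz_bound:
  fixes g :: "complex \<Rightarrow> complex"
  assumes g: "g holomorphic_on ball 0 R" and R: "R > 0"
    and B: "\<And>\<zeta>. \<zeta> \<in> ball 0 R \<Longrightarrow> norm (g \<zeta>) \<le> B"
    and \<zeta>: "\<zeta> \<in> ball 0 (R/2)"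
  shows "norm (deriv g \<zeta>) \<le> 4 * B / R" "norm (g \<zeta> - g 0) \<le> 4 * B / R * norm \<zeta>"
proof -
  have d: "norm (deriv g z) \<le> 4 * B / R" if z: "z \<in> ball 0 (R/2)" for z
  proof -
    have sub: "cball z (R/4) \<subseteq> ball 0 R"
    proof
      fix w assume "w \<in> cball z (R/4)"
      then have "norm w \<le> norm z + R/4"
        using norm_triangle_ineq[of z "w - z"] by (simp add: dist_norm norm_minus_commute)
      then show "w \<in> ball 0 R" using z R by simp
    qed
    have "norm ((deriv ^^ 1) g z) \<le> fact 1 * B / (R/4) ^ 1"
    proof (rule Cauchy_inequality)
      show "g holomorphic_on ball z (R/4)"
        using g sub by (meson ball_subset_cball holomorphic_on_subset)
      show "continuous_on (cball z (R/4)) g"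
        using g sub by (meson holomorphic_on_imp_continuous_on holomorphic_on_subset)
      show "norm (g x) \<le> B" if "norm (z - x) = R/4" for x
        using B that sub by (auto simp: dist_norm)
    qed (use R in simp)
    then show ?thesis using R by (simp add: field_simps)
  qed
  show "norm (deriv g \<zeta>) \<le> 4 * B / R" using d \<zeta> by blast
  have "norm (g \<zeta> - g 0) \<le> 4 * B / R * norm (\<zeta> - 0)"
  proof (rule field_differentiable_bound[of "ball 0 (R/2)" g "deriv g"])
    fix z :: complex assume "z \<in> ball 0 (R/2)"
    then have "z \<in> ball 0 R" using R by simp
    then show "(g has_field_derivative deriv g z) (at z within ball 0 (R/2))"
      using g holomorphic_derivI by blast
  qed (use d \<zeta> R in auto)
  then show "norm (g \<zeta> - g 0) \<le> 4 * B / R * norm \<zeta>" by simp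
qed

text \<open>The Lipschitz bound is applied to \<open>deriv g\<close>, which is bounded by
  \<open>4 * B / R\<close> on the half disc; this gives the constant
  \<open>4 * (4 * B / R) / (R/2)\<close>. The mean value inequality for \<open>g\<close> minus its
  linear part then yields the square.\<close>

lemma holomorphic_taylor_bound:
  fixes g :: "complex \<Rightarrow> complex"
  assumes g: "g holomorphic_on ball 0 R" and R: "R > 0"
    and B: "\<And>\<zeta>. \<zeta> \<in> ball 0 R \<Longrightarrow> norm (g \<zeta>) \<le> B"
    and \<zeta>: "\<zeta> \<in> ball 0 (R/4)"
  shows "norm (g \<zeta> - g 0 - \<zeta> * deriv g 0) \<le> 32 * B / R\<^sup>2 * (norm \<zeta>)\<^sup>2"
proof -
  have hd: "deriv g holomorphic_on ball 0 (R/2)"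
    using g R by (intro holomorphic_deriv) (auto intro: holomorphic_on_subset)
  have bd: "norm (deriv g z - deriv g 0) \<le> 32 * B / R\<^sup>2 * norm \<zeta>" if "z \<in> cball 0 (norm \<zeta>)" for z
  proof -
    have z: "z \<in> ball 0 (R/2/2)" using that \<zeta> by simp
    have "norm (deriv g z - deriv g 0) \<le> 4 * (4 * B / R) / (R/2) * norm z"
      by (rule holomorphic_lipschitz_bound(2)[OF hd _ _ z])
         (use R in \<open>auto intro!: holomorphic_lipschitz_bound(1)[OF g R B]\<close>)
    also have "\<dots> = 32 * B / R\<^sup>2 * norm z" by (simp add: power2_eq_square)
    also have "\<dots> \<le> 32 * B / R\<^sup>2 * norm \<zeta>"
    proof (rule mult_left_mono)
      have "0 \<le> B" using B[of 0] R norm_ge_zero[of "g 0"] by (simp del: norm_ge_zero)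
      then show "0 \<le> 32 * B / R\<^sup>2" by simp
    qed (use that in simp)
    finally show ?thesis .
  qed
  let ?h = "\<lambda>z. g z - z * deriv g 0"
  have "norm (?h \<zeta> - ?h 0) \<le> 32 * B / R\<^sup>2 * norm \<zeta> * norm (\<zeta> - 0)"
  proof (rule field_differentiable_bound[of "cball 0 (norm \<zeta>)" ?h "\<lambda>z. deriv g z - deriv g 0"])
    fix z :: complex assume "z \<in> cball 0 (norm \<zeta>)"
    then have "z \<in> ball 0 R" using R \<zeta> by simp
    then have "(g has_field_derivative deriv g z) (at z within cball 0 (norm \<zeta>))"
      using g holomorphic_derivI by blast
    then show "(?h has_field_derivative deriv g z - deriv g 0) (at z within cball 0 (norm \<zeta>))"
      by (auto intro!: derivative_eq_intros)
  qed (use bd in auto)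
  then show ?thesis by (simp add: power2_eq_square algebra_simps)
qed

text \<open>Cauchy's estimates along lines need one bound for all lines; \<open>B\<close> provides
  it, and continuity comes out as a consequence.\<close>

definition bounded_lines :: "('a::complex_normed_vector \<Rightarrow> complex) \<Rightarrow> 'a \<Rightarrow> real \<Rightarrow> real \<Rightarrow> bool" where
  "bounded_lines f p r B \<longleftrightarrow>
     r > 0 \<and> (\<forall>q\<in>ball p r. norm (f q) \<le> B \<and> line_differentiable f q)"

lemma add_scaleC_in_ball:
  assumes "q \<in> ball p (r/2)" "norm \<zeta> * norm v < r/2"
  shows "q + \<zeta> *\<^sub>C v \<in> ball p r"
proof -
  have "norm (q + \<zeta> *\<^sub>C v - p) \<le> norm (q - p) + norm (\<zeta> *\<^sub>C v)"
    using norm_triangle_ineq[of "q - p" "\<zeta> *\<^sub>C v"] by (simp add: algebra_simps)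
  also have "\<dots> < r/2 + r/2"
    using assms by (simp add: norm_scaleC dist_norm norm_minus_commute)
  finally show ?thesis by (simp add: dist_norm norm_minus_commute)
qed

lemma bounded_lines_holomorphic:
  assumes "bounded_lines f p r B" and q: "q \<in> ball p (r/2)" and R: "R * norm v \<le> r/2" "R > 0"
  shows "(\<lambda>\<zeta>. f (q + \<zeta> *\<^sub>C v)) holomorphic_on ball 0 R"
    and "\<And>\<zeta>. \<zeta> \<in> ball 0 R \<Longrightarrow> norm (f (q + \<zeta> *\<^sub>C v)) \<le> B"
proof -
  have in_ball: "q + \<zeta> *\<^sub>C v \<in> ball p r" if "\<zeta> \<in> ball 0 R" for \<zeta>
  proof (cases "v = 0")
    case True
    moreover have "r > 0" using assms by (auto simp: bounded_lines_def)
    ultimately show ?thesis using q by auto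
  next
    case False
    then have "norm \<zeta> * norm v < R * norm v" using that by simp
    then show ?thesis using q R add_scaleC_in_ball by fastforce
  qed
  show "(\<lambda>\<zeta>. f (q + \<zeta> *\<^sub>C v)) holomorphic_on ball 0 R"
    unfolding holomorphic_on_def
  proof
    fix \<zeta> assume "\<zeta> \<in> ball (0::complex) R"
    then have "line_differentiable f (q + \<zeta> *\<^sub>C v)"
      using assms(1) in_ball by (auto simp: bounded_lines_def)
    from line_differentiable_shift[OF this]
    show "(\<lambda>\<zeta>. f (q + \<zeta> *\<^sub>C v)) field_differentiable at \<zeta> within ball 0 R"
      using field_differentiable_at_within field_differentiable_def by blast
  qed
  show "\<And>\<zeta>. \<zeta> \<in> ball 0 R \<Longrightarrow> norm (f (q + \<zeta> *\<^sub>C v)) \<le> B"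
    using assms(1) in_ball by (auto simp: bounded_lines_def)
qed

lemma bounded_lines_estimates:
  assumes f: "bounded_lines f p r B" and q: "q \<in> ball p (r/2)"
  shows dir_deriv_bound: "norm (dir_deriv v f q) \<le> 8 * B / r * norm v"
    and dir_deriv_lipschitz: "norm v < r/4 \<Longrightarrow> norm (f (q + v) - f q) \<le> 8 * B / r * norm v"
    and dir_deriv_taylor:
      "norm v < r/8 \<Longrightarrow> norm (f (q + v) - f q - dir_deriv v f q) \<le> 128 * B / r\<^sup>2 * (norm v)\<^sup>2"
proof -
  have r: "r > 0" using f by (simp add: bounded_lines_def)
  define g where "g \<zeta> = f (q + \<zeta> *\<^sub>C v)" for \<zeta>
  have g0: "g 0 = f q" "g 1 = f (q + v)" "deriv g 0 = dir_deriv v f q"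
    by (simp_all add: g_def[abs_def] dir_deriv_def)
  have "norm (dir_deriv v f q) \<le> 8 * B / r * norm v \<and>
    (norm v < r/4 \<longrightarrow> norm (f (q + v) - f q) \<le> 8 * B / r * norm v) \<and>
    (norm v < r/8 \<longrightarrow> norm (f (q + v) - f q - dir_deriv v f q) \<le> 128 * B / r\<^sup>2 * (norm v)\<^sup>2)"
  proof (cases "v = 0")
    case True
    then have "g = (\<lambda>_. f q)" by (simp add: g_def[abs_def])
    then have "dir_deriv v f q = 0" using g0(3) by simp
    with True show ?thesis by simp
  next
    case False
    \<comment> \<open>The multiples of \<open>v\<close> by this disc fill the ball of radius
      \<open>r/2\<close>, so bounds in terms of \<open>R\<close> become bounds in terms of
      \<open>norm v\<close>. For \<open>v = 0\<close> there is no such radius, hence the case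
      split.\<close>
    define R where "R = r / 2 / norm v"
    have R: "R > 0" "R * norm v \<le> r/2" using False r by (simp_all add: R_def)
    note h = bounded_lines_holomorphic[OF f q R(2,1), folded g_def]
    have gh: "g holomorphic_on ball 0 R" using h(1) by (simp add: g_def[abs_def])
    have e: "4 * B / R = 8 * B / r * norm v" "32 * B / R\<^sup>2 = 128 * B / r\<^sup>2 * (norm v)\<^sup>2"
      using False r by (simp_all add: R_def field_simps power2_eq_square)
    have "norm (dir_deriv v f q) \<le> 8 * B / r * norm v"
      using holomorphic_lipschitz_bound(1)[OF gh R(1) h(2), of 0] R g0 e by simp
    moreover have "norm (f (q + v) - f q) \<le> 8 * B / r * norm v" if "norm v < r/4"
    proof -
      have "1 \<in> ball (0::complex) (R/2)" using that False by (simp add: R_def field_simps)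
      from holomorphic_lipschitz_bound(2)[OF gh R(1) h(2) this] show ?thesis using g0 e by simp
    qed
    moreover have "norm (f (q + v) - f q - dir_deriv v f q) \<le> 128 * B / r\<^sup>2 * (norm v)\<^sup>2" if "norm v < r/8"
    proof -
      have "1 \<in> ball (0::complex) (R/4)" using that False by (simp add: R_def field_simps)
      from holomorphic_taylor_bound[OF gh R(1) h(2) this] show ?thesis using g0 e by simp
    qed
    ultimately show ?thesis by blast
  qed
  then show "norm (dir_deriv v f q) \<le> 8 * B / r * norm v"
    "norm v < r/4 \<Longrightarrow> norm (f (q + v) - f q) \<le> 8 * B / r * norm v"
    "norm v < r/8 \<Longrightarrow> norm (f (q + v) - f q - dir_deriv v f q) \<le> 128 * B / r\<^sup>2 * (norm v)\<^sup>2"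
    by blast+
qed

lemma dir_deriv_scaleC:
  assumes "line_differentiable f p"
  shows "dir_deriv (c *\<^sub>C v) f p = c * dir_deriv v f p"
proof -
  have "((\<lambda>\<zeta>. f (p + \<zeta> *\<^sub>C v)) has_field_derivative dir_deriv v f p) (at (0 * c))"
    using line_differentiable_shift[of f p 0 v] assms by simp
  then have "((\<lambda>\<zeta>. f (p + (\<zeta> * c) *\<^sub>C v)) has_field_derivative dir_deriv v f p * c) (at 0)"
    by (rule DERIV_chain2) (auto intro!: derivative_eq_intros)
  then have "((\<lambda>\<zeta>. f (p + \<zeta> *\<^sub>C c *\<^sub>C v)) has_field_derivative c * dir_deriv v f p) (at 0)"
    by (simp add: scaleC_scaleC mult.commute)
  then show ?thesis unfolding dir_deriv_def by (rule DERIV_imp_deriv)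
qed

lemma dir_deriv_diff:
  assumes "line_differentiable f p" "line_differentiable g p"
  shows "dir_deriv v (\<lambda>p. f p - g p) p = dir_deriv v f p - dir_deriv v g p"
  using assms unfolding dir_deriv_def line_differentiable_def by (intro deriv_diff) auto

lemma dir_deriv_shift_arg: "dir_deriv v (\<lambda>p. f (p + a)) p = dir_deriv v f (p + a)"
  unfolding dir_deriv_def by (simp add: algebra_simps)

lemma line_differentiable_shift_arg:
  "line_differentiable (\<lambda>p. f (p + a)) p \<longleftrightarrow> line_differentiable f (p + a)"
  unfolding line_differentiable_def by (simp add: algebra_simps)

text \<open>The increment \<open>\<lambda>q. f (q + a) - f q\<close> is itself holomorphic on lines
  and bounded by a multiple of \<open>norm a\<close>, so Cauchy's estimate for its directional
  derivative shows how slowly \<open>dir_deriv w f\<close> varies with the base point.\<close>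

lemma dir_deriv_lipschitz_base:
  assumes f: "bounded_lines f p r B" and a: "norm a < r/4"
  shows "norm (dir_deriv w f (p + a) - dir_deriv w f p) \<le> 256 * B / r\<^sup>2 * norm a * norm w"
proof -
  have r: "r > 0" using f by (simp add: bounded_lines_def)
  define g where "g q = f (q + a) - f q" for q
  have in_ball: "q + a \<in> ball p r" if "q \<in> ball p (r/4)" for q
  proof -
    have "norm (q + a - p) \<le> norm (q - p) + norm a"
      using norm_triangle_ineq[of "q - p" a] by (simp add: algebra_simps)
    moreover have "norm (q - p) < r/4" using that by (simp add: dist_norm norm_minus_commute)
    ultimately have "norm (q + a - p) < r" using a norm_ge_zero[of a] by linarith
    then show ?thesis by (simp add: dist_norm norm_minus_commute)
  qed
  have ld: "line_differentiable f q" "line_differentiable (\<lambda>q. f (q + a)) q" if "q \<in> ball p (r/4)" for q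
    using f in_ball[OF that] that r by (auto simp: line_differentiable_shift_arg bounded_lines_def)
  have g: "bounded_lines g p (r/4) (8 * B / r * norm a)"
    unfolding bounded_lines_def
  proof (intro conjI ballI)
    fix q assume q: "q \<in> ball p (r/4)"
    then have "q \<in> ball p (r/2)" using r by simp
    then show "norm (g q) \<le> 8 * B / r * norm a"
      unfolding g_def using dir_deriv_lipschitz[OF f _ a] by blast
    show "line_differentiable g q"
      using ld[OF q] unfolding g_def line_differentiable_def by (auto intro!: derivative_intros)
  qed (use r in simp)
  have "norm (dir_deriv w g p) \<le> 8 * (8 * B / r * norm a) / (r/4) * norm w"
    using dir_deriv_bound[OF g, of p w] r by simp
  also have "dir_deriv w g p = dir_deriv w f (p + a) - dir_deriv w f p"
    unfolding g_def using ld[of p] r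
    by (subst dir_deriv_diff) (auto simp: dir_deriv_shift_arg)
  finally show ?thesis by (simp add: power2_eq_square field_simps)
qed

text \<open>Additivity in the direction is the part of linearity that lines through \<open>p\<close>
  alone do not show. The step from \<open>p\<close> by \<open>t\<close> times \<open>v + w\<close>
  is made through \<open>p\<close> plus \<open>t\<close> times \<open>v\<close>: three Taylor
  remainders and the variation of \<open>dir_deriv w f\<close> between the two base points are all
  bounded by multiples of \<open>t\<^sup>2\<close>, so dividing by \<open>t\<close> and letting it
  tend to 0 proves the claim.\<close>

lemma dir_deriv_add:
  assumes f: "bounded_lines f p r B"
  shows "dir_deriv (v + w) f p = dir_deriv v f p + dir_deriv w f p"
proof -
  have r: "r > 0" using f by (simp add: bounded_lines_def)
  have p: "p \<in> ball p (r/2)" "line_differentiable f p" using f r by (auto simp: bounded_lines_def)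
  define K where "K = norm v + norm w + 1"
  have K: "K > 0" "norm v \<le> K" "norm w \<le> K" "norm (v + w) \<le> K"
    using norm_triangle_ineq[of v w] by (auto simp: K_def intro: add_nonneg_pos)
  have "norm (f p) \<le> B" using f r by (simp add: bounded_lines_def)
  then have B: "B \<ge> 0" using norm_ge_zero[of "f p"] by linarith
  define C where "C = 128 * B / r\<^sup>2 * K\<^sup>2 * 3 + 256 * B / r\<^sup>2 * K * K"
  define E where "E = dir_deriv (v + w) f p - (dir_deriv v f p + dir_deriv w f p)"
  have main: "norm E \<le> C * t" if t: "0 < t" "t * K < r/8" for t :: real
  proof -
    let ?t = "complex_of_real t"
    have nt: "norm (?t *\<^sub>C x) = t * norm x" for x using t by (simp add: norm_scaleC)
    have small: "norm (?t *\<^sub>C x) < r/8" if "norm x \<le> K" for x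
    proof -
      have "t * norm x \<le> t * K" using that t by simp
      then show ?thesis using t(2) unfolding nt by simp
    qed
    have sq: "128 * B / r\<^sup>2 * (norm (?t *\<^sub>C x))\<^sup>2 \<le> 128 * B / r\<^sup>2 * K\<^sup>2 * t\<^sup>2" if "norm x \<le> K" for x
    proof -
      have "(norm (?t *\<^sub>C x))\<^sup>2 \<le> (t * K)\<^sup>2" unfolding nt using that t by (intro power_mono) auto
      then have "128 * B / r\<^sup>2 * (norm (?t *\<^sub>C x))\<^sup>2 \<le> 128 * B / r\<^sup>2 * (t * K)\<^sup>2"
        using B by (intro mult_left_mono) auto
      then show ?thesis by (simp add: power_mult_distrib algebra_simps)
    qed
    define q where "q = p + ?t *\<^sub>C v"
    have q: "q \<in> ball p (r/2)" "line_differentiable f q"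
      using small[OF K(2)] r f by (auto simp: q_def dist_norm bounded_lines_def)
    have 1: "norm (f (p + ?t *\<^sub>C (v + w)) - f p - ?t * dir_deriv (v + w) f p) \<le> 128 * B / r\<^sup>2 * K\<^sup>2 * t\<^sup>2"
      using dir_deriv_taylor[OF f p(1) small[OF K(4)]] sq[OF K(4)] dir_deriv_scaleC[OF p(2)] by simp
    have 2: "norm (f (p + ?t *\<^sub>C v) - f p - ?t * dir_deriv v f p) \<le> 128 * B / r\<^sup>2 * K\<^sup>2 * t\<^sup>2"
      using dir_deriv_taylor[OF f p(1) small[OF K(2)]] sq[OF K(2)] dir_deriv_scaleC[OF p(2)] by simp
    have 3: "norm (f (q + ?t *\<^sub>C w) - f q - ?t * dir_deriv w f q) \<le> 128 * B / r\<^sup>2 * K\<^sup>2 * t\<^sup>2"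
      using dir_deriv_taylor[OF f q(1) small[OF K(3)]] sq[OF K(3)] dir_deriv_scaleC[OF q(2)] by simp
    have "norm (dir_deriv w f q - dir_deriv w f p) \<le> 256 * B / r\<^sup>2 * norm (?t *\<^sub>C v) * norm w"
      unfolding q_def using small[OF K(2)] r by (intro dir_deriv_lipschitz_base[OF f]) simp
    also have "\<dots> \<le> 256 * B / r\<^sup>2 * (t * K) * K"
      unfolding nt using K t B by (intro mult_mono) auto
    finally have "t * norm (dir_deriv w f q - dir_deriv w f p) \<le> t * (256 * B / r\<^sup>2 * (t * K) * K)"
      using t by (intro mult_left_mono) auto
    also have "\<dots> = 256 * B / r\<^sup>2 * K * K * t\<^sup>2" by (simp add: power2_eq_square)
    finally have 4: "norm (?t * (dir_deriv w f q - dir_deriv w f p)) \<le> 256 * B / r\<^sup>2 * K * K * t\<^sup>2"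
      using t by (simp add: norm_mult)
    have tri: "norm (b + c + d - a) \<le> norm b + norm c + norm d + norm a" for a b c d :: complex
      using norm_triangle_ineq4[of "b + c + d" a] norm_triangle_ineq[of "b + c" d]
        norm_triangle_ineq[of b c] by linarith
    have eq: "q + ?t *\<^sub>C w = p + ?t *\<^sub>C (v + w)" by (simp add: q_def scaleC_add_right)
    have "norm (?t * E) \<le> C * t\<^sup>2"
    proof -
      let ?a = "f (p + ?t *\<^sub>C (v + w)) - f p - ?t * dir_deriv (v + w) f p"
      let ?b = "f (p + ?t *\<^sub>C v) - f p - ?t * dir_deriv v f p"
      let ?c = "f (q + ?t *\<^sub>C w) - f q - ?t * dir_deriv w f q"
      let ?d = "?t * (dir_deriv w f q - dir_deriv w f p)"
      have "?t * E = ?b + ?c + ?d - ?a"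
        unfolding eq by (simp add: E_def q_def algebra_simps)
      then have "norm (?t * E) \<le> norm ?b + norm ?c + norm ?d + norm ?a"
        by (simp only: tri)
      also have "\<dots> \<le> 128 * B / r\<^sup>2 * K\<^sup>2 * t\<^sup>2 + 128 * B / r\<^sup>2 * K\<^sup>2 * t\<^sup>2
          + 256 * B / r\<^sup>2 * K * K * t\<^sup>2 + 128 * B / r\<^sup>2 * K\<^sup>2 * t\<^sup>2"
        by (intro add_mono 1 2 3 4)
      also have "\<dots> = C * t\<^sup>2" unfolding C_def distrib_right by simp
      finally show ?thesis .
    qed
    then have "t * norm E \<le> t * (C * t)" using t by (simp add: norm_mult power2_eq_square algebra_simps)
    then show ?thesis using t by simp
  qed
  have "norm E \<le> 0"
  proof (rule tendsto_lowerbound)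
    show "((\<lambda>t. C * t) \<longlongrightarrow> 0) (at_right 0)" by (auto intro!: tendsto_eq_intros)
    have "\<forall>\<^sub>F t in at_right 0. t \<in> {0<..<r/8/K}" using r K by (intro eventually_at_right_real) simp
    then show "\<forall>\<^sub>F t in at_right 0. norm E \<le> C * t"
      by eventually_elim (rule main, use K in \<open>auto simp: field_simps\<close>)
  qed simp
  then show ?thesis by (simp add: E_def)
qed

lemma bounded_lines_has_derivative:
  assumes f: "bounded_lines f p r B"
  shows "(f has_derivative (\<lambda>v. dir_deriv v f p)) (at p)"
proof -
  have r: "r > 0" using f by (simp add: bounded_lines_def)
  have p: "p \<in> ball p (r/2)" "line_differentiable f p" using f r by (auto simp: bounded_lines_def)
  have "norm (f p) \<le> B" using f r by (simp add: bounded_lines_def)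
  then have B: "B \<ge> 0" using norm_ge_zero[of "f p"] by linarith
  define C where "C = 128 * B / r\<^sup>2"
  have bl: "bounded_linear (\<lambda>v. dir_deriv v f p)"
  proof (rule bounded_linear_intro[where K="8 * B / r"])
    show "dir_deriv (x + y) f p = dir_deriv x f p + dir_deriv y f p" for x y
      by (rule dir_deriv_add[OF f])
    show "dir_deriv (c *\<^sub>R x) f p = c *\<^sub>R dir_deriv x f p" for c x
      using dir_deriv_scaleC[OF p(2), of "of_real c" x]
      by (simp add: scaleC_of_real scaleR_conv_of_real)
    show "norm (dir_deriv x f p) \<le> norm x * (8 * B / r)" for x
      using dir_deriv_bound[OF f p(1), of x] by (simp add: mult.commute)
  qed
  show ?thesis
    unfolding has_derivative_at
  proof (intro conjI bl)
    show "(\<lambda>h. norm (f (p + h) - f p - dir_deriv h f p) / norm h) \<midarrow>0\<rightarrow> 0"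
    proof (rule real_tendsto_sandwich[where f="\<lambda>_. 0" and h="\<lambda>h. C * norm h"])
      have "\<forall>\<^sub>F h in at 0. h \<in> ball (0::'a) (r/8) \<and> h \<noteq> 0"
        using r by (simp add: eventually_at_ball' eventually_conj_iff eventually_at_filter)
          (auto simp: eventually_nhds intro!: exI[of _ "ball 0 (r/8)"])
      then show "\<forall>\<^sub>F h in at 0. norm (f (p + h) - f p - dir_deriv h f p) / norm h \<le> C * norm h"
      proof eventually_elim
        case (elim h)
        then have "norm (f (p + h) - f p - dir_deriv h f p) \<le> C * (norm h)\<^sup>2"
          unfolding C_def by (intro dir_deriv_taylor[OF f p(1)]) simp
        then show ?case using elim by (simp add: power2_eq_square divide_simps)
      qed
      show "((\<lambda>h. C * norm h) \<longlongrightarrow> 0) (at (0::'a))" by (auto intro!: tendsto_eq_intros)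
    qed auto
  qed
qed

text \<open>An elementary relative of Hartogs' theorem: local boundedness is assumed, and additivity
  together with the quadratic Taylor bound makes the directional derivatives a Frechet
  derivative.\<close>

theorem jointly_holomorphic_onI_lines:
  assumes "\<And>p. p \<in> U \<Longrightarrow> \<exists>r B. bounded_lines f p r B"
  shows "f jointly_holomorphic_on U"
  unfolding jointly_holomorphic_on_def
proof
  fix p assume "p \<in> U"
  then obtain r B where f: "bounded_lines f p r B" using assms by blast
  then have "line_differentiable f p" by (auto simp: bounded_lines_def)
  then show "\<exists>D. (f has_derivative D) (at p) \<and> (\<forall>c v. D (c *\<^sub>C v) = c * D v)"
    using bounded_lines_has_derivative[OF f] dir_deriv_scaleC by blast
qed

section \<open>Calculus of complex differentiability at a point\<close>

definition cdiff_at :: "('a::complex_normed_vector \<Rightarrow> 'b::complex_normed_vector) \<Rightarrow> 'a \<Rightarrow> bool" where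
  "cdiff_at f p \<longleftrightarrow> (\<exists>D. (f has_derivative D) (at p) \<and> (\<forall>c v. D (c *\<^sub>C v) = c *\<^sub>C D v))"

lemma jointly_holomorphic_on_iff: "f jointly_holomorphic_on U \<longleftrightarrow> (\<forall>p\<in>U. cdiff_at f p)"
  by (simp add: jointly_holomorphic_on_def cdiff_at_def scaleC_complex_def)

lemma cdiff_at_const [intro]: "cdiff_at (\<lambda>_. c) p"
  unfolding cdiff_at_def by (rule exI[of _ "\<lambda>_. 0"]) auto

lemma cdiff_at_bounded_linear:
  assumes "bounded_linear f" "\<And>c v. f (c *\<^sub>C v) = c *\<^sub>C f v"
  shows "cdiff_at f p"
  unfolding cdiff_at_def using assms bounded_linear.has_derivative[OF assms(1) has_derivative_ident] by blast

lemma cdiff_at_ident [intro]: "cdiff_at (\<lambda>x. x) p"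
  by (rule cdiff_at_bounded_linear) (simp_all add: bounded_linear_ident)

lemma cdiff_at_add [intro]:
  assumes "cdiff_at f p" "cdiff_at g p" shows "cdiff_at (\<lambda>x. f x + g x) p"
proof -
  obtain D E where "(f has_derivative D) (at p)" "\<forall>c v. D (c *\<^sub>C v) = c *\<^sub>C D v"
    "(g has_derivative E) (at p)" "\<forall>c v. E (c *\<^sub>C v) = c *\<^sub>C E v"
    using assms unfolding cdiff_at_def by blast
  then show ?thesis unfolding cdiff_at_def
    by (intro exI[of _ "\<lambda>v. D v + E v"]) (auto intro!: derivative_eq_intros simp: scaleC_add_right)
qed

lemma cdiff_at_Pair [intro]:
  assumes "cdiff_at f p" "cdiff_at g p" shows "cdiff_at (\<lambda>x. (f x, g x)) p"
proof -
  obtain D E where "(f has_derivative D) (at p)" "\<forall>c v. D (c *\<^sub>C v) = c *\<^sub>C D v"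
    "(g has_derivative E) (at p)" "\<forall>c v. E (c *\<^sub>C v) = c *\<^sub>C E v"
    using assms unfolding cdiff_at_def by blast
  then show ?thesis unfolding cdiff_at_def
    by (intro exI[of _ "\<lambda>v. (D v, E v)"]) (auto intro!: has_derivative_Pair simp: scaleC_prod_def)
qed

lemma cdiff_at_compose:
  assumes "cdiff_at f (g p)" "cdiff_at g p" shows "cdiff_at (\<lambda>x. f (g x)) p"
proof -
  obtain D E where "(f has_derivative D) (at (g p))" "\<forall>c v. D (c *\<^sub>C v) = c *\<^sub>C D v"
    "(g has_derivative E) (at p)" "\<forall>c v. E (c *\<^sub>C v) = c *\<^sub>C E v"
    using assms unfolding cdiff_at_def by blast
  then show ?thesis unfolding cdiff_at_def
    by (intro exI[of _ "\<lambda>v. D (E v)"]) (auto intro: has_derivative_compose)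
qed

lemma cdiff_at_field_differentiable:
  fixes f :: "complex \<Rightarrow> complex"
  assumes "f field_differentiable (at p)" shows "cdiff_at f p"
proof -
  obtain a where "(f has_derivative (*) a) (at p)"
    using assms unfolding field_differentiable_def has_field_derivative_def by blast
  moreover have "a * (c *\<^sub>C v) = c *\<^sub>C (a * v)" for c v by (simp add: scaleC_complex_def)
  ultimately show ?thesis unfolding cdiff_at_def by blast
qed

lemma cdiff_at_mult [intro]:
  fixes f g :: "'a::complex_normed_vector \<Rightarrow> complex"
  assumes "cdiff_at f p" "cdiff_at g p" shows "cdiff_at (\<lambda>x. f x * g x) p"
proof -
  obtain D E where "(f has_derivative D) (at p)" "\<forall>c v. D (c *\<^sub>C v) = c *\<^sub>C D v"
    "(g has_derivative E) (at p)" "\<forall>c v. E (c *\<^sub>C v) = c *\<^sub>C E v"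
    using assms unfolding cdiff_at_def by blast
  then show ?thesis unfolding cdiff_at_def
    by (intro exI[of _ "\<lambda>v. f p * E v + D v * g p"])
      (auto intro!: derivative_eq_intros simp: scaleC_complex_def algebra_simps)
qed

lemma cdiff_at_minus [intro]:
  fixes f :: "'a::complex_normed_vector \<Rightarrow> complex"
  shows "cdiff_at f p \<Longrightarrow> cdiff_at (\<lambda>x. - f x) p"
  using cdiff_at_mult[OF cdiff_at_const[of "-1"]] by fastforce

lemma cdiff_at_diff [intro]:
  fixes f g :: "'a::complex_normed_vector \<Rightarrow> complex"
  shows "cdiff_at f p \<Longrightarrow> cdiff_at g p \<Longrightarrow> cdiff_at (\<lambda>x. f x - g x) p"
  using cdiff_at_add[OF _ cdiff_at_minus] by fastforce

lemma cdiff_at_sum [intro]: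
  fixes f :: "'i \<Rightarrow> 'a::complex_normed_vector \<Rightarrow> complex"
  shows "(\<And>i. i \<in> I \<Longrightarrow> cdiff_at (f i) p) \<Longrightarrow> cdiff_at (\<lambda>x. \<Sum>i\<in>I. f i x) p"
  by (induction I rule: infinite_finite_induct) auto

lemma cdiff_at_prod [intro]:
  fixes f :: "'i \<Rightarrow> 'a::complex_normed_vector \<Rightarrow> complex"
  shows "(\<And>i. i \<in> I \<Longrightarrow> cdiff_at (f i) p) \<Longrightarrow> cdiff_at (\<lambda>x. \<Prod>i\<in>I. f i x) p"
  by (induction I rule: infinite_finite_induct) auto

lemma cdiff_at_power [intro]:
  fixes f :: "'a::complex_normed_vector \<Rightarrow> complex"
  shows "cdiff_at f p \<Longrightarrow> cdiff_at (\<lambda>x. f x ^ n) p"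
  by (induction n) auto

lemma cdiff_at_holomorphic:
  assumes "g holomorphic_on S" "open S" "f p \<in> S" "cdiff_at f p"
  shows "cdiff_at (\<lambda>x. g (f x)) p"
  by (rule cdiff_at_compose[where f=g])
     (use assms in \<open>auto intro!: cdiff_at_field_differentiable simp: holomorphic_on_imp_differentiable_at\<close>)

lemma cdiff_at_exp [intro]:
  fixes f :: "'a::complex_normed_vector \<Rightarrow> complex"
  shows "cdiff_at f p \<Longrightarrow> cdiff_at (\<lambda>x. exp (f x)) p"
  using cdiff_at_holomorphic[of exp UNIV f p] by (simp add: holomorphic_on_exp)

lemma cdiff_at_fst [intro]: "cdiff_at f p \<Longrightarrow> cdiff_at (\<lambda>x. fst (f x)) p"
  by (rule cdiff_at_compose[where f=fst])
     (auto intro!: cdiff_at_bounded_linear bounded_linear_fst simp: scaleC_prod_def)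

lemma cdiff_at_snd [intro]: "cdiff_at f p \<Longrightarrow> cdiff_at (\<lambda>x. snd (f x)) p"
  by (rule cdiff_at_compose[where f=snd])
     (auto intro!: cdiff_at_bounded_linear bounded_linear_snd simp: scaleC_prod_def)

lemma cdiff_at_vec_nth [intro]:
  fixes f :: "'a::complex_normed_vector \<Rightarrow> complex ^ 'd::finite"
  shows "cdiff_at f p \<Longrightarrow> cdiff_at (\<lambda>x. f x $ i) p"
  by (rule cdiff_at_compose[where f="\<lambda>x. x $ i"])
     (auto intro!: cdiff_at_bounded_linear bounded_linear_vec_nth simp: scaleC_vec_def)

lemma jointly_holomorphic_on_subset:
  "f jointly_holomorphic_on U \<Longrightarrow> V \<subseteq> U \<Longrightarrow> f jointly_holomorphic_on V"
  unfolding jointly_holomorphic_on_def by blast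

lemma jointly_holomorphic_on_isCont:
  "f jointly_holomorphic_on U \<Longrightarrow> p \<in> U \<Longrightarrow> isCont f p"
  unfolding jointly_holomorphic_on_def using has_derivative_continuous by blast

lemma jointly_holomorphic_on_line_differentiable:
  assumes "f jointly_holomorphic_on U" "p \<in> U"
  shows "line_differentiable f p"
  unfolding line_differentiable_def
proof
  fix v
  obtain D where D: "(f has_derivative D) (at p)" "\<And>c v. D (c *\<^sub>C v) = c * D v"
    using assms unfolding jointly_holomorphic_on_def by blast
  have "((\<lambda>\<zeta>. p + \<zeta> *\<^sub>C v) has_derivative (\<lambda>h. h *\<^sub>C v)) (at 0)"
    using bounded_linear_imp_has_derivative[OF bounded_linear_scaleC_left[of v]]
    by (auto intro!: derivative_eq_intros)
  moreover have "(f has_derivative D) (at (p + 0 *\<^sub>C v))" using D by simp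
  ultimately have "((\<lambda>\<zeta>. f (p + \<zeta> *\<^sub>C v)) has_derivative (\<lambda>h. D (h *\<^sub>C v))) (at 0)"
    using has_derivative_compose by blast
  then have "((\<lambda>\<zeta>. f (p + \<zeta> *\<^sub>C v)) has_field_derivative D v) (at 0)"
    unfolding has_field_derivative_def D(2) by (simp add: mult.commute[of _ "D v"])
  then show "(\<lambda>\<zeta>. f (p + \<zeta> *\<^sub>C v)) field_differentiable at 0"
    unfolding field_differentiable_def by blast
qed

lemma jointly_holomorphic_on_bounded_lines:
  assumes "f jointly_holomorphic_on U" "open U" "p \<in> U"
  obtains r B where "ball p r \<subseteq> U" "bounded_lines f p r B"
proof -
  have "isCont f p" using jointly_holomorphic_on_isCont assms by blast
  then obtain d where d: "d > 0" "\<And>q. dist q p < d \<Longrightarrow> dist (f q) (f p) < 1"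
    unfolding continuous_at_eps_delta by (meson zero_less_one)
  obtain e where e: "e > 0" "ball p e \<subseteq> U" using assms openE by blast
  have "norm (f q) \<le> norm (f p) + 1" if "q \<in> ball p d" for q
    using d(2)[of q] that norm_triangle_ineq2[of "f q" "f p"] by (simp add: dist_norm norm_minus_commute)
  then have "bounded_lines f p (min d e) (norm (f p) + 1)"
    using d e jointly_holomorphic_on_line_differentiable[OF assms(1)]
    unfolding bounded_lines_def by auto
  moreover have "ball p (min d e) \<subseteq> U" using e by auto
  ultimately show thesis using that by blast
qed

lemma dir_deriv_cong:
  assumes "open U" "p \<in> U" "\<And>q. q \<in> U \<Longrightarrow> f q = g q"
  shows "dir_deriv v f p = dir_deriv v g p"
  unfolding dir_deriv_def
proof (rule deriv_cong_ev)
  have "continuous_on UNIV (\<lambda>\<zeta>. p + \<zeta> *\<^sub>C v)" by (intro continuous_intros)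
  then have "open ((\<lambda>\<zeta>. p + \<zeta> *\<^sub>C v) -` U)" using assms(1) by (simp add: continuous_on_open_vimage)
  then show "\<forall>\<^sub>F \<zeta> in nhds 0. f (p + \<zeta> *\<^sub>C v) = g (p + \<zeta> *\<^sub>C v)"
    using assms by (auto simp: eventually_nhds intro!: exI[of _ "(\<lambda>\<zeta>. p + \<zeta> *\<^sub>C v) -` U"])
qed simp

lemma dir_deriv_taylor_quotient:
  assumes f: "bounded_lines f p r B" and q: "q \<in> ball p (r/2)" and "norm \<zeta> * norm v < r/8"
  shows "norm (f (q + \<zeta> *\<^sub>C v) - f q - \<zeta> * dir_deriv v f q) \<le> 128 * B / r\<^sup>2 * (norm v)\<^sup>2 * (norm \<zeta>)\<^sup>2"
proof -
  have "r > 0" using f by (simp add: bounded_lines_def)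
  then have "ball p (r/2) \<subseteq> ball p r" by auto
  then have "line_differentiable f q" using f q by (auto simp: bounded_lines_def)
  then show ?thesis
    using dir_deriv_taylor[OF f q, of "\<zeta> *\<^sub>C v"] assms(3)
    by (simp add: norm_scaleC dir_deriv_scaleC power_mult_distrib mult.commute mult.left_commute)
qed

text \<open>Along any line the directional derivative is a uniform limit of difference quotients
  that are holomorphic there, so Weierstrass' theorem makes it holomorphic on lines; Cauchy's
  estimate gives its local bound.\<close>

lemma dir_deriv_jointly_holomorphic:
  assumes "f jointly_holomorphic_on U" "open U"
  shows "dir_deriv v f jointly_holomorphic_on U"
proof (rule jointly_holomorphic_onI_lines)
  fix p assume "p \<in> U"
  then obtain r B where rB: "ball p r \<subseteq> U" "bounded_lines f p r B"
    using jointly_holomorphic_on_bounded_lines[OF assms] by blast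
  have r: "r > 0" using rB by (simp add: bounded_lines_def)
  \<comment> \<open>Skips the quotients whose step is too long for the Taylor bound, which asks for
    a displacement below \<open>r/8\<close>.\<close>
  obtain n0 :: nat where n0: "norm v / (r/8) < n0" using reals_Archimedean2 by blast
  let ?N = "\<lambda>n. of_nat (Suc (n + n0)) :: complex"
  have small: "norm (1 / ?N n) * norm v < r/8" for n
  proof -
    have "norm v < r/8 * n0" using n0 r by (simp add: divide_simps mult.commute)
    also have "\<dots> \<le> r/8 * of_nat (Suc (n + n0))" using r by (intro mult_left_mono) auto
    finally show ?thesis by (simp add: norm_divide divide_simps mult.commute del: of_nat_Suc)
  qed
  have ld: "line_differentiable (dir_deriv v f) q" if q: "q \<in> ball p (r/2)" for q
    unfolding line_differentiable_def
  proof
    fix w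
    define S where "S = (\<lambda>\<zeta>. q + \<zeta> *\<^sub>C w) -` ball p (r/2)"
    have "continuous_on UNIV (\<lambda>\<zeta>. q + \<zeta> *\<^sub>C w)" by (intro continuous_intros)
    then have S: "open S" "0 \<in> S" using q by (simp_all add: S_def continuous_on_open_vimage)
    define \<phi> where "\<phi> n \<zeta> = ?N n * (f (q + \<zeta> *\<^sub>C w + (1 / ?N n) *\<^sub>C v) - f (q + \<zeta> *\<^sub>C w))" for n \<zeta>
    have hol: "\<phi> n holomorphic_on S" for n
    proof -
      have 1: "(\<lambda>\<zeta>. f ((q + (1 / ?N n) *\<^sub>C v) + \<zeta> *\<^sub>C w)) field_differentiable (at \<zeta>)"
        "(\<lambda>\<zeta>. f (q + \<zeta> *\<^sub>C w)) field_differentiable (at \<zeta>)" if "\<zeta> \<in> S" for \<zeta>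
      proof -
        have q': "q + \<zeta> *\<^sub>C w \<in> ball p (r/2)" using that by (simp add: S_def)
        then have "q + \<zeta> *\<^sub>C w \<in> ball p r" using r by simp
        moreover have "norm (1 / ?N n) * norm v < r/2" using small[of n] r by linarith
        then have "q + \<zeta> *\<^sub>C w + (1 / ?N n) *\<^sub>C v \<in> ball p r" by (rule add_scaleC_in_ball[OF q'])
        ultimately have "line_differentiable f ((q + (1 / ?N n) *\<^sub>C v) + \<zeta> *\<^sub>C w)"
            "line_differentiable f (q + \<zeta> *\<^sub>C w)"
          using rB(2) by (simp_all add: bounded_lines_def algebra_simps del: of_nat_Suc)
        then show "(\<lambda>\<zeta>. f ((q + (1 / ?N n) *\<^sub>C v) + \<zeta> *\<^sub>C w)) field_differentiable (at \<zeta>)"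
          "(\<lambda>\<zeta>. f (q + \<zeta> *\<^sub>C w)) field_differentiable (at \<zeta>)"
          using line_differentiable_shift unfolding field_differentiable_def by blast+
      qed
      have eq: "\<phi> n = (\<lambda>\<zeta>. ?N n * (f ((q + (1 / ?N n) *\<^sub>C v) + \<zeta> *\<^sub>C w) - f (q + \<zeta> *\<^sub>C w)))"
        by (simp add: \<phi>_def[abs_def] add_ac del: of_nat_Suc)
      show ?thesis unfolding eq holomorphic_on_def
        by (rule ballI, rule field_differentiable_at_within)
          (intro field_differentiable_mult field_differentiable_diff field_differentiable_const 1)
    qed
    have bd: "norm (\<phi> n \<zeta> - dir_deriv v f (q + \<zeta> *\<^sub>C w)) \<le> 128 * B / r\<^sup>2 * (norm v)\<^sup>2 / of_nat (Suc (n + n0))"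
      if "\<zeta> \<in> S" for n \<zeta>
    proof -
      let ?q = "q + \<zeta> *\<^sub>C w"
      have "norm (f (?q + (1 / ?N n) *\<^sub>C v) - f ?q - (1 / ?N n) * dir_deriv v f ?q)
         \<le> 128 * B / r\<^sup>2 * (norm v)\<^sup>2 * (norm (1 / ?N n))\<^sup>2"
        using that small by (intro dir_deriv_taylor_quotient[OF rB(2)]) (auto simp: S_def)
      then have "norm (?N n) * norm (f (?q + (1 / ?N n) *\<^sub>C v) - f ?q - (1 / ?N n) * dir_deriv v f ?q)
         \<le> norm (?N n) * (128 * B / r\<^sup>2 * (norm v)\<^sup>2 * (norm (1 / ?N n))\<^sup>2)"
        by (rule mult_left_mono) simp
      also have "\<dots> = 128 * B / r\<^sup>2 * (norm v)\<^sup>2 / of_nat (Suc (n + n0))"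
        by (simp add: norm_divide power2_eq_square divide_simps del: of_nat_Suc)
      also have "norm (?N n) * norm (f (?q + (1 / ?N n) *\<^sub>C v) - f ?q - (1 / ?N n) * dir_deriv v f ?q)
          = norm (\<phi> n \<zeta> - dir_deriv v f ?q)"
        unfolding norm_mult[symmetric] \<phi>_def
        by (simp add: right_diff_distrib del: of_nat_Suc)
      finally show ?thesis .
    qed
    have ul: "uniform_limit S \<phi> (\<lambda>\<zeta>. dir_deriv v f (q + \<zeta> *\<^sub>C w)) sequentially"
    proof (rule uniform_limitI)
      fix e :: real assume e: "e > 0"
      have "(\<lambda>n. 128 * B / r\<^sup>2 * (norm v)\<^sup>2 * (1 / of_nat (Suc (n + n0)))) \<longlonglongrightarrow> 128 * B / r\<^sup>2 * (norm v)\<^sup>2 * 0"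
        using LIMSEQ_ignore_initial_segment[OF LIMSEQ_inverse_real_of_nat, of n0]
        by (intro tendsto_mult_left) (simp add: inverse_eq_divide)
      then have "\<forall>\<^sub>F n in sequentially. 128 * B / r\<^sup>2 * (norm v)\<^sup>2 * (1 / of_nat (Suc (n + n0))) < e"
        by (rule order_tendstoD) (use e in simp)
      then show "\<forall>\<^sub>F n in sequentially. \<forall>\<zeta>\<in>S. dist (\<phi> n \<zeta>) (dir_deriv v f (q + \<zeta> *\<^sub>C w)) < e"
      proof eventually_elim
        case (elim n)
        show ?case
        proof
          fix \<zeta> assume "\<zeta> \<in> S"
          from bd[OF this, of n] elim show "dist (\<phi> n \<zeta>) (dir_deriv v f (q + \<zeta> *\<^sub>C w)) < e"
            by (simp add: dist_norm del: of_nat_Suc)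
        qed
      qed
    qed
    have "(\<lambda>\<zeta>. dir_deriv v f (q + \<zeta> *\<^sub>C w)) holomorphic_on S"
    proof (rule holomorphic_uniform_sequence[OF S(1) hol])
      fix x assume "x \<in> S"
      then obtain d where "d > 0" "cball x d \<subseteq> S" using S(1) open_contains_cball by blast
      then show "\<exists>d>0. cball x d \<subseteq> S \<and>
          uniform_limit (cball x d) \<phi> (\<lambda>\<zeta>. dir_deriv v f (q + \<zeta> *\<^sub>C w)) sequentially"
        using uniform_limit_on_subset[OF ul] by blast
    qed
    then show "(\<lambda>\<zeta>. dir_deriv v f (q + \<zeta> *\<^sub>C w)) field_differentiable at 0"
      using S holomorphic_on_imp_differentiable_at by blast
  qed
  have "bounded_lines (dir_deriv v f) p (r/2) (8 * B / r * norm v)"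
    unfolding bounded_lines_def using r ld dir_deriv_bound[OF rB(2)] by simp
  then show "\<exists>r B. bounded_lines (dir_deriv v f) p r B" by blast
qed

section \<open>Parameter integrals with a locally uniform majorant\<close>

definition dominated_family ::
    "'x measure \<Rightarrow> ('a::complex_normed_vector) set \<Rightarrow> ('a \<Rightarrow> 'x \<Rightarrow> complex) \<Rightarrow> bool" where
  "dominated_family M U h \<longleftrightarrow> open U \<and>
     (\<forall>x\<in>space M. (\<lambda>p. h p x) jointly_holomorphic_on U) \<and>
     (\<forall>p\<in>U. h p \<in> borel_measurable M) \<and>
     (\<forall>p\<in>U. \<exists>r>0. \<exists>g. ball p r \<subseteq> U \<and> integrable M g \<and> (\<forall>q\<in>ball p r. \<forall>x\<in>space M. norm (h q x) \<le> g x))"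

lemma dominated_family_integrable:
  assumes "dominated_family M U h" "p \<in> U"
  shows "integrable M (h p)"
proof -
  obtain r g where "r > 0" "integrable M g" "\<forall>q\<in>ball p r. \<forall>x\<in>space M. norm (h q x) \<le> g x"
    using assms unfolding dominated_family_def by blast
  moreover have "h p \<in> borel_measurable M" using assms unfolding dominated_family_def by blast
  ultimately show ?thesis
    by (intro Bochner_Integration.integrable_bound[of M g "h p"])
       (auto intro!: AE_I2 simp: order_trans[OF _ abs_ge_self])
qed

lemma LIMSEQ_dir_deriv:
  assumes "line_differentiable f p"
  shows "(\<lambda>n. of_nat (Suc (n + n0)) * (f (p + (1 / of_nat (Suc (n + n0))) *\<^sub>C v) - f p)) \<longlonglongrightarrow> dir_deriv v f p"
proof -
  have "((\<lambda>\<zeta>. f (p + \<zeta> *\<^sub>C v)) has_field_derivative dir_deriv v f p) (at 0)"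
    using assms unfolding line_differentiable_def dir_deriv_def by (simp add: field_differentiable_derivI)
  then have *: "(\<lambda>\<zeta>. (f (p + \<zeta> *\<^sub>C v) - f p) / \<zeta>) \<midarrow>0\<rightarrow> dir_deriv v f p"
    by (simp add: DERIV_def)
  have "(\<lambda>n. 1 / of_nat (Suc (n + n0)) :: complex) \<longlonglongrightarrow> 0"
    using LIMSEQ_ignore_initial_segment[OF lim_1_over_n[where 'a=complex], of "Suc n0"]
    by (simp only: add_Suc_right)
  then have "filterlim (\<lambda>n. 1 / of_nat (Suc (n + n0)) :: complex) (at 0) sequentially"
    by (auto simp: filterlim_at eventually_at_top_linorder simp del: of_nat_Suc)
  from filterlim_compose[OF * this] show ?thesis by (simp add: divide_simps mult.commute del: of_nat_Suc)
qed

text \<open>Cauchy's estimate turns a majorant \<open>g\<close> of the family near \<open>p\<close>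
  into the majorant \<open>8 * g x / r * norm v\<close> of its directional derivatives.
  Differentiation under the integral thus reproduces its own hypothesis, which is recorded by the
  third conclusion and makes iteration possible.\<close>

theorem dominated_family_integral:
  assumes dom: "dominated_family M U h"
  shows "(\<lambda>p. \<integral>x. h p x \<partial>M) jointly_holomorphic_on U"
    and "p \<in> U \<Longrightarrow> dir_deriv v (\<lambda>p. \<integral>x. h p x \<partial>M) p = (\<integral>x. dir_deriv v (\<lambda>p. h p x) p \<partial>M)"
    and "dominated_family M U (\<lambda>p x. dir_deriv v (\<lambda>p. h p x) p)"
proof -
  let ?F = "\<lambda>p. \<integral>x. h p x \<partial>M"
  have U: "open U" using dom by (simp add: dominated_family_def)
  have jh: "(\<lambda>p. h p x) jointly_holomorphic_on U" if "x \<in> space M" for x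
    using dom that by (simp add: dominated_family_def)
  have ld: "line_differentiable (\<lambda>p. h p x) p" if "p \<in> U" "x \<in> space M" for x p
    using jh[OF that(2)] that(1) by (rule jointly_holomorphic_on_line_differentiable)
  \<comment> \<open>The derivative is a pointwise limit of difference quotients of measurable
    members of the family; \<open>n0\<close> keeps the shifted parameters inside
    \<open>U\<close>.\<close>
  have meas: "(\<lambda>x. dir_deriv v (\<lambda>p. h p x) p) \<in> borel_measurable M" if p: "p \<in> U" for p v
  proof -
    obtain e where e: "e > 0" "ball p e \<subseteq> U" using U p openE by blast
    obtain n0 :: nat where n0: "norm v / e < n0" using reals_Archimedean2 by blast
    have inU: "p + (1 / of_nat (Suc (n + n0))) *\<^sub>C v \<in> U" for n
    proof -
      have "norm v < e * of_nat (Suc (n + n0))"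
      proof -
        have "norm v < e * n0" using n0 e by (simp add: divide_simps mult.commute)
        also have "\<dots> \<le> e * of_nat (Suc (n + n0))" using e by (intro mult_left_mono) auto
        finally show ?thesis .
      qed
      then have "norm ((1 / of_nat (Suc (n + n0))) *\<^sub>C v) < e"
        by (simp add: norm_scaleC norm_divide divide_simps mult.commute del: of_nat_Suc)
      then show ?thesis using e by (auto simp: dist_norm)
    qed
    have [measurable]: "h q \<in> borel_measurable M" if "q \<in> U" for q
      using dom that by (simp add: dominated_family_def)
    have 1: "(\<lambda>x. of_nat (Suc (n + n0)) * (h (p + (1 / of_nat (Suc (n + n0))) *\<^sub>C v) x - h p x))
       \<in> borel_measurable M" for n
    proof -
      have "h (p + (1 / of_nat (Suc (n + n0))) *\<^sub>C v) \<in> borel_measurable M" "h p \<in> borel_measurable M"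
        using inU p dom by (auto simp: dominated_family_def)
      then show ?thesis by measurable
    qed
    show ?thesis
    proof (rule borel_measurable_LIMSEQ_metric)
      show "(\<lambda>x. of_nat (Suc (n + n0)) * (h (p + (1 / of_nat (Suc (n + n0))) *\<^sub>C v) x - h p x))
       \<in> borel_measurable M" for n by (rule 1)
      show "(\<lambda>n. of_nat (Suc (n + n0)) * (h (p + (1 / of_nat (Suc (n + n0))) *\<^sub>C v) x - h p x))
        \<longlonglongrightarrow> dir_deriv v (\<lambda>p. h p x) p" if "x \<in> space M" for x
        by (rule LIMSEQ_dir_deriv[OF ld[OF p that]])
    qed
  qed
  have local: "\<exists>r>0. \<exists>g. ball p r \<subseteq> U \<and> integrable M g \<and> (\<forall>x\<in>space M. bounded_lines (\<lambda>p. h p x) p r (g x))"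
    if p: "p \<in> U" for p
  proof -
    obtain r g where "r > 0" "ball p r \<subseteq> U" "integrable M g" "\<forall>q\<in>ball p r. \<forall>x\<in>space M. norm (h q x) \<le> g x"
      using dom p unfolding dominated_family_def by blast
    then show ?thesis using ld unfolding bounded_lines_def by (intro exI[of _ r] conjI exI[of _ g]) auto
  qed
  have hint: "integrable M (h p)" if "p \<in> U" for p using dominated_family_integrable[OF dom that] .
  have ddint: "integrable M (\<lambda>x. dir_deriv v (\<lambda>p. h p x) p)" if p: "p \<in> U" for p v
  proof -
    obtain r g where rg: "r > 0" "integrable M g" "\<forall>x\<in>space M. bounded_lines (\<lambda>p. h p x) p r (g x)"
      using local[OF p] by blast
    show ?thesis
    proof (rule Bochner_Integration.integrable_bound)
      show "integrable M (\<lambda>x. 8 * g x / r * norm v)" using rg by simp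
      show "AE x in M. norm (dir_deriv v (\<lambda>p. h p x) p) \<le> norm (8 * g x / r * norm v)"
      proof (rule AE_I2)
        fix x assume "x \<in> space M"
        then have "norm (dir_deriv v (\<lambda>p. h p x) p) \<le> 8 * g x / r * norm v"
          using rg by (intro dir_deriv_bound[of _ p]) auto
        then show "norm (dir_deriv v (\<lambda>p. h p x) p) \<le> norm (8 * g x / r * norm v)"
          unfolding real_norm_def using abs_ge_self order_trans by blast
      qed
    qed (rule meas[OF p])
  qed
  have der: "((\<lambda>\<zeta>. ?F (p + \<zeta> *\<^sub>C v)) has_field_derivative (\<integral>x. dir_deriv v (\<lambda>p. h p x) p \<partial>M)) (at 0)"
    if p: "p \<in> U" for p v
  proof -
    obtain r g where rg: "r > 0" "ball p r \<subseteq> U" "integrable M g"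
        "\<forall>x\<in>space M. bounded_lines (\<lambda>p. h p x) p r (g x)"
      using local[OF p] by blast
    have pr: "p \<in> ball p (r/2)" using rg by simp
    let ?I = "\<integral>x. dir_deriv v (\<lambda>p. h p x) p \<partial>M"
    define C where "C = (\<integral>x. 128 * g x / r\<^sup>2 * (norm v)\<^sup>2 \<partial>M)"
    have key: "norm ((?F (p + \<zeta> *\<^sub>C v) - ?F p) / \<zeta> - ?I) \<le> C * norm \<zeta>"
      if \<zeta>: "\<zeta> \<noteq> 0" "norm \<zeta> * norm v < r/8" for \<zeta>
    proof -
      have q: "p + \<zeta> *\<^sub>C v \<in> U"
        using rg(1,2) \<zeta>(2) by (intro subsetD[OF rg(2)] add_scaleC_in_ball) auto
      have "?F (p + \<zeta> *\<^sub>C v) - ?F p - \<zeta> * ?I =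
        (\<integral>x. h (p + \<zeta> *\<^sub>C v) x - h p x - \<zeta> * dir_deriv v (\<lambda>p. h p x) p \<partial>M)"
        using hint[OF p] hint[OF q] ddint[OF p] by simp
      also have "norm \<dots> \<le> (\<integral>x. norm (h (p + \<zeta> *\<^sub>C v) x - h p x - \<zeta> * dir_deriv v (\<lambda>p. h p x) p) \<partial>M)"
        by (rule integral_norm_bound)
      also have "\<dots> \<le> (\<integral>x. 128 * g x / r\<^sup>2 * (norm v)\<^sup>2 * (norm \<zeta>)\<^sup>2 \<partial>M)"
        using hint[OF p] hint[OF q] ddint[OF p] rg \<zeta>
        by (intro integral_mono dir_deriv_taylor_quotient[of "\<lambda>p. h p x" p for x]) auto
      also have "\<dots> = C * (norm \<zeta>)\<^sup>2" by (simp add: C_def)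
      finally have "norm (?F (p + \<zeta> *\<^sub>C v) - ?F p - \<zeta> * ?I) \<le> C * (norm \<zeta>)\<^sup>2" .
      then have "norm (?F (p + \<zeta> *\<^sub>C v) - ?F p - \<zeta> * ?I) / norm \<zeta> \<le> C * norm \<zeta>"
        using \<zeta> by (simp add: divide_simps power2_eq_square)
      moreover have "(?F (p + \<zeta> *\<^sub>C v) - ?F p) / \<zeta> - ?I = (?F (p + \<zeta> *\<^sub>C v) - ?F p - \<zeta> * ?I) / \<zeta>"
        using \<zeta> by (simp add: diff_divide_distrib)
      ultimately show ?thesis by (simp add: norm_divide)
    qed
    have "((\<lambda>\<zeta>. (?F (p + \<zeta> *\<^sub>C v) - ?F p) / \<zeta> - ?I) \<longlongrightarrow> 0) (at 0)"
    proof (rule Lim_null_comparison)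
      have "((\<lambda>\<zeta>. norm (\<zeta>::complex) * norm v) \<longlongrightarrow> 0) (at 0)" by (auto intro!: tendsto_eq_intros)
      then have "\<forall>\<^sub>F \<zeta> in at (0::complex). norm \<zeta> * norm v < r/8"
        by (rule order_tendstoD) (use rg in simp)
      moreover have "\<forall>\<^sub>F \<zeta> in at (0::complex). \<zeta> \<noteq> 0" by (simp add: eventually_at_filter)
      ultimately show "\<forall>\<^sub>F \<zeta> in at 0. norm ((?F (p + \<zeta> *\<^sub>C v) - ?F p) / \<zeta> - ?I) \<le> C * norm \<zeta>"
        by eventually_elim (use key in auto)
      show "((\<lambda>\<zeta>. C * norm (\<zeta>::complex)) \<longlongrightarrow> 0) (at 0)" by (auto intro!: tendsto_eq_intros)
    qed
    then show ?thesis by (simp add: DERIV_def LIM_zero_iff)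
  qed
  show dd: "dir_deriv v ?F p = (\<integral>x. dir_deriv v (\<lambda>p. h p x) p \<partial>M)" if "p \<in> U" for p v
    using DERIV_imp_deriv[OF der[OF that, of v]] by (simp add: dir_deriv_def)
  show "?F jointly_holomorphic_on U"
  proof (rule jointly_holomorphic_onI_lines)
    fix p assume "p \<in> U"
    then obtain r g where rg: "r > 0" "ball p r \<subseteq> U" "integrable M g"
        "\<forall>x\<in>space M. bounded_lines (\<lambda>p. h p x) p r (g x)"
      using local by blast
    have "norm (?F q) \<le> (\<integral>x. g x \<partial>M)" if "q \<in> ball p r" for q
    proof -
      have "norm (?F q) \<le> (\<integral>x. norm (h q x) \<partial>M)" by (rule integral_norm_bound)
      also have "\<dots> \<le> (\<integral>x. g x \<partial>M)"
        using rg that hint[of q] by (intro integral_mono) (auto simp: bounded_lines_def)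
      finally show ?thesis .
    qed
    moreover have "line_differentiable ?F q" if "q \<in> ball p r" for q
      unfolding line_differentiable_def field_differentiable_def
      using der[of q] that rg(2) by blast
    ultimately show "\<exists>r B. bounded_lines ?F p r B"
      unfolding bounded_lines_def using rg(1) by blast
  qed
  show "dominated_family M U (\<lambda>p x. dir_deriv v (\<lambda>p. h p x) p)"
    unfolding dominated_family_def
  proof (intro conjI ballI)
    fix p assume "p \<in> U"
    then obtain r g where rg: "r > 0" "ball p r \<subseteq> U" "integrable M g"
        "\<forall>x\<in>space M. bounded_lines (\<lambda>p. h p x) p r (g x)"
      using local by blast
    have "ball p (r/2) \<subseteq> U" using rg by auto
    moreover have "\<forall>q\<in>ball p (r/2). \<forall>x\<in>space M. norm (dir_deriv v (\<lambda>p. h p x) q) \<le> 8 * g x / r * norm v"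
      using rg by (blast intro: dir_deriv_bound)
    ultimately show "\<exists>r>0. \<exists>g. ball p r \<subseteq> U \<and> integrable M g \<and>
        (\<forall>q\<in>ball p r. \<forall>x\<in>space M. norm (dir_deriv v (\<lambda>p. h p x) q) \<le> g x)"
      using rg by (intro exI[of _ "r/2"] conjI exI[of _ "\<lambda>x. 8 * g x / r * norm v"]) auto
  qed (use U meas dir_deriv_jointly_holomorphic[OF jh U] in auto)
qed

section \<open>Multi-index derivatives\<close>

lemma foldr_dir_deriv_jointly_holomorphic:
  assumes "open U" "f jointly_holomorphic_on U"
  shows "foldr dir_deriv vs f jointly_holomorphic_on U"
  using assms by (induction vs) (auto intro: dir_deriv_jointly_holomorphic)

lemma foldr_dir_deriv_cong:
  assumes "open U" "\<And>q. q \<in> U \<Longrightarrow> f q = g q" "p \<in> U"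
  shows "foldr dir_deriv vs f p = foldr dir_deriv vs g p"
  using assms(3)
proof (induction vs arbitrary: p)
  case (Cons v vs)
  then show ?case using dir_deriv_cong[OF assms(1) Cons.prems Cons.IH] by simp
qed (use assms in simp)

lemma foldr_dir_deriv_add:
  assumes "open U" "f jointly_holomorphic_on U" "g jointly_holomorphic_on U" "p \<in> U"
  shows "foldr dir_deriv vs (\<lambda>p. f p + g p) p = foldr dir_deriv vs f p + foldr dir_deriv vs g p"
  using assms(4)
proof (induction vs arbitrary: p)
  case (Cons v vs)
  let ?F = "foldr dir_deriv vs f" and ?G = "foldr dir_deriv vs g"
  have "?F jointly_holomorphic_on U" "?G jointly_holomorphic_on U"
    using foldr_dir_deriv_jointly_holomorphic assms by blast+
  then have ld: "line_differentiable ?F p" "line_differentiable ?G p"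
    using Cons.prems jointly_holomorphic_on_line_differentiable by blast+
  have "foldr dir_deriv (v # vs) (\<lambda>p. f p + g p) p = dir_deriv v (\<lambda>p. ?F p + ?G p) p"
    unfolding foldr.simps o_apply by (rule dir_deriv_cong[OF assms(1) Cons.prems Cons.IH])
  also have "\<dots> = dir_deriv v ?F p + dir_deriv v ?G p"
    using ld unfolding dir_deriv_def line_differentiable_def by (intro deriv_add) auto
  finally show ?case by simp
qed simp

lemma foldr_dir_deriv_cmult:
  assumes "open U" "f jointly_holomorphic_on U" "p \<in> U"
  shows "foldr dir_deriv vs (\<lambda>p. c * f p) p = c * foldr dir_deriv vs f p"
  using assms(3)
proof (induction vs arbitrary: p)
  case (Cons v vs)
  let ?F = "foldr dir_deriv vs f"
  have "?F jointly_holomorphic_on U"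
    using foldr_dir_deriv_jointly_holomorphic assms by blast+
  then have ld: "line_differentiable ?F p"
    using Cons.prems jointly_holomorphic_on_line_differentiable by blast+
  have "foldr dir_deriv (v # vs) (\<lambda>p. c * f p) p = dir_deriv v (\<lambda>p. c * ?F p) p"
    unfolding foldr.simps o_apply by (rule dir_deriv_cong[OF assms(1) Cons.prems Cons.IH])
  also have "\<dots> = c * dir_deriv v ?F p"
    using ld unfolding dir_deriv_def line_differentiable_def by (intro deriv_cmult) auto
  finally show ?case by simp
qed simp

lemma foldr_dir_deriv_sum:
  assumes "open U" "\<And>i. i \<in> I \<Longrightarrow> f i jointly_holomorphic_on U" "p \<in> U"
  shows "foldr dir_deriv vs (\<lambda>p. \<Sum>i\<in>I. f i p) p = (\<Sum>i\<in>I. foldr dir_deriv vs (f i) p)"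
  using assms(2)
proof (induction I rule: infinite_finite_induct)
  case (insert i I)
  have "(\<lambda>p. \<Sum>i\<in>I. f i p) jointly_holomorphic_on U"
    using insert.prems by (auto simp: jointly_holomorphic_on_iff)
  then show ?case
    using insert foldr_dir_deriv_add[OF assms(1) _ _ assms(3), of "f i" "\<lambda>p. \<Sum>i\<in>I. f i p"] by simp
qed (use foldr_dir_deriv_cmult[OF assms(1) _ assms(3), of "\<lambda>_. 0" vs 0] in
    \<open>auto simp: jointly_holomorphic_on_iff\<close>)

lemma dominated_family_foldr_dir_deriv:
  assumes dom: "dominated_family M U h"
  shows "dominated_family M U (\<lambda>p x. foldr dir_deriv vs (\<lambda>p. h p x) p)"
    and "p \<in> U \<Longrightarrow> foldr dir_deriv vs (\<lambda>p. \<integral>x. h p x \<partial>M) p = (\<integral>x. foldr dir_deriv vs (\<lambda>p. h p x) p \<partial>M)"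
proof -
  have U: "open U" using dom by (simp add: dominated_family_def)
  have "dominated_family M U (\<lambda>p x. foldr dir_deriv vs (\<lambda>p. h p x) p) \<and>
    (\<forall>p\<in>U. foldr dir_deriv vs (\<lambda>p. \<integral>x. h p x \<partial>M) p = (\<integral>x. foldr dir_deriv vs (\<lambda>p. h p x) p \<partial>M))"
  proof (induction vs)
    case (Cons v vs)
    define k where "k = (\<lambda>p x. foldr dir_deriv vs (\<lambda>p. h p x) p)"
    have k: "dominated_family M U k"
      and eq: "\<And>p. p \<in> U \<Longrightarrow> foldr dir_deriv vs (\<lambda>p. \<integral>x. h p x \<partial>M) p = (\<integral>x. k p x \<partial>M)"
      using Cons by (simp_all add: k_def)
    have k': "foldr dir_deriv (v # vs) (\<lambda>p. h p x) = dir_deriv v (\<lambda>p. k p x)" for x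
      by (simp add: k_def)
    have "foldr dir_deriv (v # vs) (\<lambda>p. \<integral>x. h p x \<partial>M) p = (\<integral>x. dir_deriv v (\<lambda>p. k p x) p \<partial>M)"
      if "p \<in> U" for p
      unfolding foldr.simps o_apply dominated_family_integral(2)[OF k that, symmetric]
      by (rule dir_deriv_cong[OF U that eq])
    then show ?case unfolding k' using dominated_family_integral(3)[OF k] by blast
  qed (use dom in simp)
  then show "dominated_family M U (\<lambda>p x. foldr dir_deriv vs (\<lambda>p. h p x) p)"
    "p \<in> U \<Longrightarrow> foldr dir_deriv vs (\<lambda>p. \<integral>x. h p x \<partial>M) p = (\<integral>x. foldr dir_deriv vs (\<lambda>p. h p x) p \<partial>M)"
    by blast+
qed

text \<open>Derivatives in \<open>w\<close> alone are directional derivatives of the joint function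
  in directions \<open>(0, v)\<close>. In this way differentiation in \<open>w\<close> keeps
  holomorphy in the other variables.\<close>

lemma foldr_dir_deriv_Pair:
  fixes G :: "'a::complex_normed_vector \<times> 'b::complex_normed_vector \<Rightarrow> complex"
  shows "foldr dir_deriv (map (Pair 0) vs) G (a, w) = foldr dir_deriv vs (\<lambda>w. G (a, w)) w"
proof (induction vs arbitrary: w)
  case (Cons v vs)
  have "foldr dir_deriv (map (Pair 0) (v # vs)) G (a, w) =
      deriv (\<lambda>\<zeta>. foldr dir_deriv (map (Pair 0) vs) G (a, w + \<zeta> *\<^sub>C v)) 0"
    by (simp add: dir_deriv_def scaleC_prod_def)
  also have "\<dots> = deriv (\<lambda>\<zeta>. foldr dir_deriv vs (\<lambda>w. G (a, w)) (w + \<zeta> *\<^sub>C v)) 0"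
    by (simp only: Cons.IH)
  also have "\<dots> = foldr dir_deriv (v # vs) (\<lambda>w. G (a, w)) w" by (simp add: dir_deriv_def)
  finally show ?case .
qed simp

text \<open>Built from the same choice of enumeration as \<open>mi_deriv\<close>, so both
  differentiate in the same order and no commutation of partial derivatives enters.\<close>

definition mi_list :: "nat ^ 'd::finite \<Rightarrow> 'd list" where
  "mi_list \<alpha> = concat (map (\<lambda>i. replicate (\<alpha> $ i) i) (SOME js. distinct js \<and> set js = UNIV))"

definition cmi_deriv :: "nat ^ 'd::finite \<Rightarrow> (complex ^ 'd \<Rightarrow> complex) \<Rightarrow> complex ^ 'd \<Rightarrow> complex" where
  "cmi_deriv \<alpha> = foldr dir_deriv (map (\<lambda>i. axis i 1) (mi_list \<alpha>))"

lemma foldr_concat_replicate: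
  "foldr f (concat (map (\<lambda>i. replicate (n i) i) js)) x = foldr (\<lambda>i. f i ^^ n i) js x"
  by (induction js) (simp_all add: foldr_replicate)

lemma mi_deriv_list: "mi_deriv \<alpha> f = foldr partial_deriv (mi_list \<alpha>) f"
  unfolding mi_deriv_def mi_list_def by (simp add: foldr_concat_replicate)

lemma enumeration_of_UNIV:
  fixes js :: "'d::finite list"
  assumes "js = (SOME js. distinct js \<and> set js = UNIV)"
  shows "distinct js" "set js = UNIV"
  using assms someI_ex[of "\<lambda>js::'d list. distinct js \<and> set js = UNIV"] finite_distinct_list[of "UNIV::'d set"]
  by auto

lemma prod_list_mi_list:
  fixes g :: "'d::finite \<Rightarrow> 'a::comm_monoid_mult"
  shows "prod_list (map g (mi_list \<alpha>)) = (\<Prod>i\<in>UNIV. g i ^ (\<alpha> $ i))"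
proof -
  define js :: "'d list" where "js = (SOME js. distinct js \<and> set js = UNIV)"
  note js = enumeration_of_UNIV[OF js_def]
  have "prod_list (map g (concat (map (\<lambda>i. replicate (\<alpha> $ i) i) ks))) = prod_list (map (\<lambda>i. g i ^ (\<alpha> $ i)) ks)" for ks
    by (induction ks) (simp_all add: map_replicate_const)
  then show ?thesis
    using prod.distinct_set_conv_list[OF js(1), of "\<lambda>i. g i ^ (\<alpha> $ i)"] js(2)
    by (simp add: mi_list_def js_def)
qed

lemma count_list_mi_list: "count_list (mi_list \<alpha>) i = \<alpha> $ i"
proof -
  define js :: "'a list" where "js = (SOME js. distinct js \<and> set js = UNIV)"
  note js = enumeration_of_UNIV[OF js_def]
  have rep: "count_list (replicate n k) i = (if k = i then n else 0)" for n k
    by (induction n) auto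
  have "count_list (concat (map (\<lambda>i. replicate (\<alpha> $ i) i) ks)) i = (if i \<in> set ks then \<alpha> $ i else 0)"
    if "distinct ks" for ks
    using that by (induction ks) (auto simp: count_list_append rep)
  from this[OF js(1)] js(2) show ?thesis by (simp add: mi_list_def js_def)
qed

lemma cvec_nth [simp]: "cvec x $ i = complex_of_real (x $ i)"
  by (simp add: cvec_def)

lemma partial_deriv_eq_dir_deriv:
  fixes G :: "complex ^ 'd::finite \<Rightarrow> complex"
  assumes V: "open V" "y \<in> V" "\<And>y. y \<in> V \<Longrightarrow> f y = G (cvec y)"
    and G: "G jointly_holomorphic_on U" "cvec y \<in> U"
  shows "partial_deriv i f y = dir_deriv (axis i 1) G (cvec y)"
proof -
  have eq: "cvec (y + t *\<^sub>R axis i 1) = cvec y + complex_of_real t *\<^sub>C axis i 1" for t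
    by (simp add: vec_eq_iff scaleC_vec_def scaleC_complex_def axis_def)
  have "line_differentiable G (cvec y)" using jointly_holomorphic_on_line_differentiable[OF G] .
  then have "((\<lambda>\<zeta>. G (cvec y + \<zeta> *\<^sub>C axis i 1)) has_field_derivative dir_deriv (axis i 1) G (cvec y))
      (at (of_real 0))"
    unfolding line_differentiable_def dir_deriv_def by (simp add: field_differentiable_derivI)
  then have 1: "((\<lambda>t. G (cvec y + complex_of_real t *\<^sub>C axis i 1)) has_vector_derivative
      dir_deriv (axis i 1) G (cvec y)) (at 0)"
    by (rule has_vector_derivative_real_field)
  define T where "T = (\<lambda>t. y + t *\<^sub>R axis i 1) -` V"
  have "continuous_on UNIV (\<lambda>t. y + t *\<^sub>R axis i 1)" by (intro continuous_intros)
  then have T: "open T" "0 \<in> T" using V by (simp_all add: T_def continuous_on_open_vimage)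
  have "((\<lambda>t. f (y + t *\<^sub>R axis i 1)) has_vector_derivative dir_deriv (axis i 1) G (cvec y)) (at 0)"
    by (rule has_vector_derivative_transform_within_open[OF 1 T]) (use V(3) in \<open>simp add: T_def eq\<close>)
  then show ?thesis unfolding partial_deriv_def by (rule vector_derivative_at)
qed

text \<open>Equality at the real points of an open set is enough, because a real coordinate axis
  lies inside the corresponding complex line. The induction keeps the equality on all of
  \<open>V\<close>, so that the next partial derivative can be taken.\<close>

lemma mi_deriv_eq_cmi_deriv:
  fixes G :: "complex ^ 'd::finite \<Rightarrow> complex"
  assumes V: "open V" "\<And>y. y \<in> V \<Longrightarrow> f y = G (cvec y)"
    and G: "open U" "G jointly_holomorphic_on U" "\<And>y. y \<in> V \<Longrightarrow> cvec y \<in> U" and y: "y \<in> V"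
  shows "mi_deriv \<alpha> f y = cmi_deriv \<alpha> G (cvec y)"
proof -
  have "foldr partial_deriv is f y = foldr dir_deriv (map (\<lambda>i. axis i 1) is) G (cvec y)" for "is" :: "'d list"
    using y
  proof (induction "is" arbitrary: y)
    case (Cons i "is")
    show ?case
      using partial_deriv_eq_dir_deriv[OF V(1) Cons.prems Cons.IH
          foldr_dir_deriv_jointly_holomorphic[OF G(1,2)] G(3)[OF Cons.prems]] by simp
  qed (use V in simp)
  then show ?thesis by (simp add: mi_deriv_list cmi_deriv_def)
qed

lemma cmi_deriv_jointly_holomorphic:
  "open U \<Longrightarrow> f jointly_holomorphic_on U \<Longrightarrow> cmi_deriv \<alpha> f jointly_holomorphic_on U"
  unfolding cmi_deriv_def by (rule foldr_dir_deriv_jointly_holomorphic)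

text \<open>The bilinear, not the Hermitian, extension of the Euclidean inner product.\<close>

definition cdot :: "complex ^ 'd::finite \<Rightarrow> complex ^ 'd \<Rightarrow> complex" where
  "cdot u v = (\<Sum>i\<in>UNIV. u $ i * v $ i)"

lemma cdot_cvec: "cdot (cvec x) (cvec y) = complex_of_real (x \<bullet> y)"
  by (simp add: cdot_def inner_vec_def)

lemma cdiff_at_cdot [intro]:
  "cdiff_at f p \<Longrightarrow> cdiff_at g p \<Longrightarrow> cdiff_at (\<lambda>x. cdot (f x) (g x)) p"
  unfolding cdot_def by (intro cdiff_at_sum cdiff_at_mult cdiff_at_vec_nth)

lemma cdot_add_left: "cdot (u + v) w = cdot u w + cdot v w"
  by (simp add: cdot_def algebra_simps sum.distrib)

lemma cdot_axis: "cdot (\<zeta> *\<^sub>C axis i 1) v = \<zeta> * v $ i"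
proof -
  have "(\<zeta> *\<^sub>C axis i 1) $ j * v $ j = (if j = i then \<zeta> * v $ i else 0)" for j
    by (simp add: scaleC_vec_def scaleC_complex_def axis_def)
  then show ?thesis by (simp add: cdot_def)
qed

lemma foldr_dir_deriv_exp_cdot:
  "foldr dir_deriv (map (\<lambda>i. axis i 1) is) (\<lambda>w. c * exp (k * cdot w v)) =
     (\<lambda>w. prod_list (map (\<lambda>i. k * v $ i) is) * c * exp (k * cdot w v))"
proof (induction "is")
  case (Cons i "is")
  let ?c = "prod_list (map (\<lambda>i. k * v $ i) is) * c"
  have "dir_deriv (axis i 1) (\<lambda>w. ?c * exp (k * cdot w v)) w = (k * v $ i) * ?c * exp (k * cdot w v)" for w
    unfolding dir_deriv_def cdot_add_left cdot_axis
    by (rule DERIV_imp_deriv) (auto intro!: derivative_eq_intros simp: algebra_simps)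
  then show ?case
    by (intro ext) (simp only: list.map foldr.simps o_apply Cons.IH prod_list.Cons mult.assoc)
qed simp

lemma cmi_deriv_exp_cdot:
  "cmi_deriv \<alpha> (\<lambda>w. c * exp (k * cdot w v)) w =
     k ^ mi_abs \<alpha> * (\<Prod>i\<in>UNIV. v $ i ^ (\<alpha> $ i)) * c * exp (k * cdot w v)"
  unfolding cmi_deriv_def foldr_dir_deriv_exp_cdot prod_list_mi_list
  by (simp add: power_mult_distrib prod.distrib mi_abs_def power_sum)

lemma foldr_dir_deriv_monomial:
  fixes b :: "'d::finite \<Rightarrow> nat"
  assumes "count_list is i > b i"
  shows "foldr dir_deriv (map (\<lambda>i. axis i 1) is) (\<lambda>w::complex ^ 'd. \<Prod>j\<in>UNIV. w $ j ^ b j) = (\<lambda>_. 0)"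
proof -
  \<comment> \<open>Truncated subtraction keeps the formula valid after an exponent has reached
    zero: one more derivative then multiplies the constant by \<open>e i = 0\<close>.\<close>
  have "\<exists>c. foldr dir_deriv (map (\<lambda>i. axis i 1) is) (\<lambda>w::complex ^ 'd. \<Prod>j\<in>UNIV. w $ j ^ b j) =
     (\<lambda>w. c * (\<Prod>j\<in>UNIV. w $ j ^ (b j - count_list is j))) \<and> ((\<exists>i. count_list is i > b i) \<longrightarrow> c = 0)" for "is"
  proof (induction "is")
    case Nil
    show ?case by (auto intro: exI[of _ 1])
  next
    case (Cons i "is")
    then obtain c where c: "foldr dir_deriv (map (\<lambda>i. axis i 1) is) (\<lambda>w::complex ^ 'd. \<Prod>j\<in>UNIV. w $ j ^ b j) =
       (\<lambda>w. c * (\<Prod>j\<in>UNIV. w $ j ^ (b j - count_list is j)))" "(\<exists>i. count_list is i > b i) \<Longrightarrow> c = 0"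
      by blast
    define e where "e j = b j - count_list is j" for j
    have "dir_deriv (axis i 1) (\<lambda>w. c * (\<Prod>j\<in>UNIV. w $ j ^ e j)) w =
        c * of_nat (e i) * (\<Prod>j\<in>UNIV. w $ j ^ (b j - count_list (i # is) j))" for w :: "complex ^ 'd"
    proof -
      have pr: "(\<Prod>j\<in>UNIV. h j) = h i * (\<Prod>j\<in>UNIV - {i}. h j)" for h :: "'d \<Rightarrow> complex"
        by (rule prod.remove) auto
      have nth: "(w + \<zeta> *\<^sub>C axis i 1) $ j = (if j = i then w $ i + \<zeta> else w $ j)" for \<zeta> j
        by (simp add: scaleC_vec_def scaleC_complex_def axis_def)
      have "(\<Prod>j\<in>UNIV. (w + \<zeta> *\<^sub>C axis i 1) $ j ^ e j) = (w $ i + \<zeta>) ^ e i * (\<Prod>j\<in>UNIV - {i}. w $ j ^ e j)" for \<zeta>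
        unfolding pr nth by simp
      moreover have "((\<lambda>\<zeta>. c * ((w $ i + \<zeta>) ^ e i * (\<Prod>j\<in>UNIV - {i}. w $ j ^ e j))) has_field_derivative
          c * (of_nat (e i) * w $ i ^ (e i - 1) * (\<Prod>j\<in>UNIV - {i}. w $ j ^ e j))) (at 0)"
        by (auto intro!: derivative_eq_intros)
      ultimately have "dir_deriv (axis i 1) (\<lambda>w. c * (\<Prod>j\<in>UNIV. w $ j ^ e j)) w =
          c * (of_nat (e i) * w $ i ^ (e i - 1) * (\<Prod>j\<in>UNIV - {i}. w $ j ^ e j))"
        unfolding dir_deriv_def by (simp add: DERIV_imp_deriv)
      also have "(\<Prod>j\<in>UNIV - {i}. w $ j ^ e j) = (\<Prod>j\<in>UNIV - {i}. w $ j ^ (b j - count_list (i # is) j))"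
        by (intro prod.cong) (auto simp: e_def)
      also have "w $ i ^ (e i - 1) = w $ i ^ (b i - count_list (i # is) i)" by (simp add: e_def)
      finally show ?thesis unfolding pr by (simp add: algebra_simps)
    qed
    then have "foldr dir_deriv (map (\<lambda>i. axis i 1) (i # is)) (\<lambda>w::complex ^ 'd. \<Prod>j\<in>UNIV. w $ j ^ b j) =
        (\<lambda>w. (c * of_nat (e i)) * (\<Prod>j\<in>UNIV. w $ j ^ (b j - count_list (i # is) j)))"
      by (intro ext) (simp only: list.map foldr.simps o_apply c(1) e_def)
    moreover have "c * of_nat (e i) = 0" if "\<exists>k. count_list (i # is) k > b k"
      using that c(2) by (auto simp: e_def split: if_splits intro: ccontr)
    ultimately show ?case by blast
  qed
  then show ?thesis using assms by (metis mult_zero_left)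
qed

text \<open>A function \<open>g\<close> chooses one coordinate in each of the \<open>n\<close>
  factors; grouping the factors by the fibres of \<open>g\<close> shows that only even exponents
  occur.\<close>

lemma power_cdot_self:
  "cdot w w ^ n = (\<Sum>g\<in>PiE {..<n} (\<lambda>_. UNIV). \<Prod>i\<in>UNIV. w $ i ^ (2 * card {j. j < n \<and> g j = i}))"
proof -
  have "cdot w w ^ n = (\<Prod>j\<in>{..<n}. \<Sum>i\<in>UNIV. w $ i * w $ i)" by (simp add: cdot_def)
  also have "\<dots> = (\<Sum>g\<in>PiE {..<n} (\<lambda>_. UNIV). \<Prod>j<n. w $ g j * w $ g j)" by (rule prod_sum_PiE) auto
  also have "\<dots> = (\<Sum>g\<in>PiE {..<n} (\<lambda>_. UNIV). \<Prod>i\<in>UNIV. w $ i ^ (2 * card {j. j < n \<and> g j = i}))"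
  proof (rule sum.cong[OF refl])
    fix g
    have "(\<Prod>j<n. w $ g j * w $ g j) = (\<Prod>i\<in>UNIV. \<Prod>j\<in>{j. j \<in> {..<n} \<and> g j = i}. w $ g j * w $ g j)"
      by (rule prod.group[symmetric]) auto
    also have "\<dots> = (\<Prod>i\<in>UNIV. w $ i ^ (2 * card {j. j < n \<and> g j = i}))"
      by (intro prod.cong refl) (simp add: power_mult power2_eq_square)
    finally show "(\<Prod>j<n. w $ g j * w $ g j) = (\<Prod>i\<in>UNIV. w $ i ^ (2 * card {j. j < n \<and> g j = i}))" .
  qed
  finally show ?thesis .
qed

text \<open>A monomial of $(w\cdot w)^n$ has exponents $2k_i$ with $\sum k_i = n$, so for small $n$ some
  $2k_i$ is less than $\alpha_i$.\<close>

lemma cmi_deriv_power_cdot_self: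
  fixes \<alpha> :: "nat ^ 'd::finite"
  assumes "n < mi_abs (mi_half_ceil \<alpha>)"
  shows "cmi_deriv \<alpha> (\<lambda>w. cdot w w ^ n) w = 0"
proof -
  have "foldr dir_deriv (map (\<lambda>i. axis i 1) (mi_list \<alpha>))
      (\<lambda>w::complex ^ 'd. \<Prod>i\<in>UNIV. w $ i ^ (2 * card {j. j < n \<and> g j = i})) w = 0" for g
  proof -
    have "(\<Sum>i\<in>UNIV. card {j. j < n \<and> g j = i}) = n"
      using sum.group[of "{..<n}" "UNIV::'d set" g "\<lambda>_. 1::nat"] by simp
    then have "\<not> (\<forall>i. mi_half_ceil \<alpha> $ i \<le> card {j. j < n \<and> g j = i})"
      using assms sum_mono[of UNIV "\<lambda>i. mi_half_ceil \<alpha> $ i" "\<lambda>i. card {j. j < n \<and> g j = i}"]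
      by (auto simp: mi_abs_def)
    then obtain i where "card {j. j < n \<and> g j = i} < mi_half_ceil \<alpha> $ i" by (auto simp: not_le)
    \<comment> \<open>For natural numbers \<open>k < \<lceil>a / 2\<rceil>\<close> means
      \<open>2 * k < a\<close>; this is where the ceiling of half the multi-index comes
      from.\<close>
    then have "2 * card {j. j < n \<and> g j = i} < \<alpha> $ i"
      unfolding mi_half_ceil_def by simp linarith
    then have "2 * card {j. j < n \<and> g j = i} < count_list (mi_list \<alpha>) i" by (simp add: count_list_mi_list)
    from foldr_dir_deriv_monomial[where b="\<lambda>i. 2 * card {j. j < n \<and> g j = i}", OF this]
    show ?thesis by simp
  qed
  moreover have "(\<lambda>w::complex ^ 'd. \<Prod>i\<in>UNIV. w $ i ^ (2 * card {j. j < n \<and> g j = i})) jointly_holomorphic_on UNIV" for g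
    unfolding jointly_holomorphic_on_iff by (intro ballI cdiff_at_prod cdiff_at_power cdiff_at_vec_nth cdiff_at_ident)
  ultimately show ?thesis
    unfolding cmi_deriv_def power_cdot_self by (subst foldr_dir_deriv_sum[OF open_UNIV]) auto
qed

section \<open>Lattices\<close>

lemma matrix_inv_mult:
  fixes A :: "real ^ 'd ^ 'd::finite"
  assumes "invertible A"
  shows "A ** matrix_inv A = mat 1" "matrix_inv A ** A = mat 1"
  using someI_ex[OF assms[unfolded invertible_def]] by (auto simp: matrix_inv_def)

lemma invertible_dual:
  fixes A :: "real ^ 'd ^ 'd::finite"
  assumes "invertible A"
  shows "invertible (transpose (matrix_inv A))"
  unfolding invertible_def
  by (intro exI[of _ "transpose A"]) (simp add: matrix_inv_mult[OF assms] flip: matrix_transpose_mul)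

lemma inner_dual_matrix:
  fixes A :: "real ^ 'd ^ 'd::finite"
  assumes "invertible A"
  shows "(transpose (matrix_inv A) *v m) \<bullet> (A *v n) = m \<bullet> n"
  by (metis assms dot_lmul_matrix matrix_inv_mult(2) matrix_vector_mul_assoc matrix_vector_mul_lid
      vector_transpose_matrix transpose_transpose transpose_matrix_vector)

definition of_int_vec :: "int ^ 'd::finite \<Rightarrow> real ^ 'd" where
  "of_int_vec n = (\<chi> i. real_of_int (n $ i))"

lemma of_int_vec_nth [simp]: "of_int_vec n $ i = real_of_int (n $ i)"
  by (simp add: of_int_vec_def)

lemma lattice_of_eq: "lattice_of A = range (\<lambda>n. A *v of_int_vec n)"
  by (simp add: lattice_of_def of_int_vec_def[abs_def])

lemma inj_lattice_map:
  fixes A :: "real ^ 'd ^ 'd::finite"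
  assumes "invertible A"
  shows "inj (\<lambda>n. A *v of_int_vec n)"
proof (rule injI)
  fix m n :: "int ^ 'd" assume "A *v of_int_vec m = A *v of_int_vec n"
  then have "of_int_vec m = of_int_vec n"
    by (metis assms matrix_inv_mult(2) matrix_vector_mul_assoc matrix_vector_mul_lid)
  then show "m = n" by (simp add: vec_eq_iff)
qed

lemma invertible_norm_lower_bound:
  fixes A :: "real ^ 'd ^ 'd::finite"
  assumes "invertible A"
  obtains B where "B > 0" "\<And>v. B * norm v \<le> norm (A *v v)"
proof -
  have "inj ((*v) A)" using assms by (metis injI matrix_inv_mult(2) matrix_vector_mul_assoc matrix_vector_mul_lid)
  then show thesis using linear_inj_bounded_below_pos[of "(*v) A"] that by auto
qed

lemma countable_lattice [simp]: "countable (lattice_of A)"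
proof -
  have "surj (\<lambda>g::'a \<Rightarrow> int. \<chi> i. g i)" by (metis surjI vec_nth_inverse)
  moreover have "countable (UNIV :: ('a \<Rightarrow> int) set)"
    using countable_PiE[of "UNIV::'a set" "\<lambda>_. UNIV::int set"] by simp
  ultimately have "countable (UNIV :: (int ^ 'a) set)" by (metis countable_image)
  then show ?thesis by (simp add: lattice_of_eq)
qed

lemma zero_in_lattice: "0 \<in> lattice_of A"
  unfolding lattice_of_eq by (rule range_eqI[of _ _ 0]) (simp add: of_int_vec_def flip: zero_vec_def)

lemma abs_summable_int_powr:
  assumes "s > 1"
  shows "Infinite_Set_Sum.abs_summable_on (\<lambda>n::int. (1 + \<bar>real_of_int n\<bar>) powr (- s)) UNIV"
proof -
  have "summable (\<lambda>n. real (Suc n) powr (- s))"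
    using summable_Suc_iff[of "\<lambda>n. real n powr (- s)"] assms by (simp add: summable_real_powr_iff)
  then have nat: "Infinite_Set_Sum.abs_summable_on (\<lambda>n::nat. (1 + real n) powr (- s)) UNIV"
    by (simp add: abs_summable_on_nat_iff')
  have "Infinite_Set_Sum.abs_summable_on (\<lambda>n::int. (1 + \<bar>real_of_int n\<bar>) powr (- s)) (range int)"
    by (rule abs_summable_on_reindex) (use nat in \<open>auto simp: inj_on_def\<close>)
  moreover have "Infinite_Set_Sum.abs_summable_on (\<lambda>n::int. (1 + \<bar>real_of_int n\<bar>) powr (- s)) (range (\<lambda>n. - int n))"
    by (rule abs_summable_on_reindex) (use nat in \<open>auto simp: inj_on_def\<close>)
  moreover have "UNIV = range int \<union> range (\<lambda>n. - int n)"
  proof -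
    have "x \<in> range int \<union> range (\<lambda>n. - int n)" for x by (cases x rule: int_cases2) auto
    then show ?thesis by blast
  qed
  ultimately show ?thesis by (metis abs_summable_on_union)
qed

text \<open>With \<open>s / CARD('d) > 1\<close> the summand is a product of \<open>CARD('d)\<close>
  equal factors, each of which is bounded through a different coordinate of the integer vector. The
  lattice sum is dominated by a product of convergent one-dimensional sums.\<close>

lemma lattice_powr_integrable:
  fixes A :: "real ^ 'd ^ 'd::finite"
  assumes A: "invertible A" and s: "s > real CARD('d)"
  shows "integrable (count_space (lattice_of A)) (\<lambda>z. (1 + norm z) powr (- s))"
proof -
  obtain B where B: "B > 0" "\<And>v. B * norm v \<le> norm (A *v v)" using invertible_norm_lower_bound[OF A] by blast
  \<comment> \<open>In \<open>1 + norm (A *v v)\<close> the bound \<open>b \<le> 1\<close> serves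
    the constant and \<open>b \<le> B\<close> the norm, so that \<open>b\<close> can be factored out
    of both.\<close>
  define b where "b = min 1 B"
  have b: "b > 0" "b \<le> 1" "b \<le> B" using B by (auto simp: b_def)
  let ?t = "s / CARD('d)"
  have t: "?t > 1" using s by simp
  let ?f = "\<lambda>n::int. b powr (- ?t) * (1 + \<bar>real_of_int n\<bar>) powr (- ?t)"
  have "Infinite_Set_Sum.abs_summable_on (\<lambda>g. \<Prod>i\<in>UNIV. ?f (g i)) (PiE (UNIV::'d set) (\<lambda>_. UNIV))"
    by (intro abs_summable_on_prod_PiE abs_summable_on_cmult_right abs_summable_int_powr t) auto
  then have "Infinite_Set_Sum.abs_summable_on (\<lambda>g. \<Prod>i\<in>UNIV. ?f (g i)) (UNIV::('d \<Rightarrow> int) set)" by simp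
  also have "?this \<longleftrightarrow> Infinite_Set_Sum.abs_summable_on (\<lambda>n::int ^ 'd. \<Prod>i\<in>UNIV. ?f (n $ i)) UNIV"
  proof (rule abs_summable_on_reindex_bij_betw[symmetric])
    show "bij (($) :: int ^ 'd \<Rightarrow> 'd \<Rightarrow> int)"
    proof (rule bijI')
      show "\<exists>x. y = ($) x" for y :: "'d \<Rightarrow> int" by (rule exI[of _ "vec_lambda y"]) (simp add: fun_eq_iff)
    qed (simp add: vec_eq_iff fun_eq_iff)
  qed
  finally have 1: "Infinite_Set_Sum.abs_summable_on (\<lambda>n::int ^ 'd. \<Prod>i\<in>UNIV. ?f (n $ i)) UNIV" .
  have "Infinite_Set_Sum.abs_summable_on (\<lambda>n. (1 + norm (A *v of_int_vec n)) powr (- s)) (UNIV::(int ^ 'd) set)"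
  proof (rule abs_summable_on_comparison_test[OF 1])
    fix n :: "int ^ 'd"
    have "(1 + norm (A *v of_int_vec n)) powr (- s) = (\<Prod>i\<in>(UNIV::'d set). (1 + norm (A *v of_int_vec n)) powr (- ?t))"
      by (simp add: powr_powr add_nonneg_eq_0_iff flip: powr_realpow')
    also have "\<dots> \<le> (\<Prod>i\<in>UNIV. ?f (n $ i))"
    proof (rule prod_mono, intro conjI)
      fix i
      have "\<bar>real_of_int (n $ i)\<bar> \<le> norm (of_int_vec n)"
        using component_le_norm_cart[of "of_int_vec n" i] by simp
      then have "b * \<bar>real_of_int (n $ i)\<bar> \<le> B * norm (of_int_vec n)" using b by (intro mult_mono) auto
      then have "b * (1 + \<bar>real_of_int (n $ i)\<bar>) \<le> 1 + norm (A *v of_int_vec n)"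
        using B(2)[of "of_int_vec n"] b by (simp add: distrib_left)
      then have "(1 + norm (A *v of_int_vec n)) powr (- ?t) \<le> (b * (1 + \<bar>real_of_int (n $ i)\<bar>)) powr (- ?t)"
        using b t by (intro powr_mono2') auto
      then show "(1 + norm (A *v of_int_vec n)) powr (- ?t) \<le> ?f (n $ i)"
        using b by (simp add: powr_mult)
    qed simp
    also have "\<dots> \<le> norm (\<Prod>i\<in>UNIV. ?f (n $ i))" by simp
    finally show "norm ((1 + norm (A *v of_int_vec n)) powr (- s)) \<le> norm (\<Prod>i\<in>UNIV. ?f (n $ i))" by simp
  qed
  then have "Infinite_Set_Sum.abs_summable_on (\<lambda>z. (1 + norm z) powr (- s)) (range (\<lambda>n. A *v of_int_vec n))"
    using inj_lattice_map[OF A] abs_summable_on_reindex_iff by fastforce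
  then show ?thesis by (simp add: lattice_of_eq Infinite_Set_Sum.abs_summable_on_def)
qed

lemma lattice_sum_integrable:
  fixes A :: "real ^ 'd ^ 'd::finite" and f :: "real ^ 'd \<Rightarrow> complex"
  assumes A: "invertible A" and s: "s > real CARD('d)" and L: "L \<subseteq> lattice_of A"
    and f: "\<And>z. z \<in> L \<Longrightarrow> norm (f z) \<le> C * (1 + norm z) powr (- s)"
  shows "integrable (count_space L) f"
proof -
  have "Infinite_Set_Sum.abs_summable_on (\<lambda>z. C * (1 + norm z) powr (- s)) (lattice_of A)"
    using lattice_powr_integrable[OF A s]
    by (intro abs_summable_on_cmult_right) (simp add: Infinite_Set_Sum.abs_summable_on_def)
  then have "Infinite_Set_Sum.abs_summable_on (\<lambda>z. C * (1 + norm z) powr (- s)) L"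
    using L abs_summable_on_subset by blast
  then have "Infinite_Set_Sum.abs_summable_on f L"
    by (rule abs_summable_on_comparison_test') (use f in auto)
  then show ?thesis by (simp add: Infinite_Set_Sum.abs_summable_on_def)
qed

lemma lattice_bounded_finite:
  fixes A :: "real ^ 'd ^ 'd::finite"
  assumes A: "invertible A"
  shows "finite {z \<in> lattice_of A. norm z < R}"
proof -
  obtain B where B: "B > 0" "\<And>v. B * norm v \<le> norm (A *v v)" using invertible_norm_lower_bound[OF A] by blast
  define N where "N = \<lceil>R / B\<rceil>"
  have "{z \<in> lattice_of A. norm z < R} \<subseteq>
      (\<lambda>g. A *v of_int_vec (\<chi> i. g i)) ` PiE UNIV (\<lambda>_. {-N..N})"
  proof
    fix z assume "z \<in> {z \<in> lattice_of A. norm z < R}"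
    then obtain n where n: "z = A *v of_int_vec n" "norm z < R" by (auto simp: lattice_of_eq)
    have "n $ i \<in> {-N..N}" for i
    proof -
      have "B * \<bar>real_of_int (n $ i)\<bar> \<le> B * norm (of_int_vec n)"
        using component_le_norm_cart[of "of_int_vec n" i] B by simp
      then have "B * \<bar>real_of_int (n $ i)\<bar> \<le> R" using B(2)[of "of_int_vec n"] n(2)[unfolded n(1)] by linarith
      then have "\<bar>real_of_int (n $ i)\<bar> \<le> R / B" using B(1) by (simp add: field_simps)
      then show ?thesis unfolding N_def by (simp, linarith)
    qed
    then show "z \<in> (\<lambda>g. A *v of_int_vec (\<chi> i. g i)) ` PiE UNIV (\<lambda>_. {-N..N})"
      using n by (intro image_eqI[of _ _ "\<lambda>i. n $ i"]) auto
  qed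
  then show ?thesis by (rule finite_subset) (auto intro!: finite_PiE)
qed

section \<open>The complex domains of a lattice and Gaussian majorants\<close>

lemma norm_cdot_le: "norm (cdot u v) \<le> norm u * norm v"
proof -
  have "norm (cdot u v) \<le> (\<Sum>i\<in>UNIV. \<bar>norm (u $ i)\<bar> * \<bar>norm (v $ i)\<bar>)"
    unfolding cdot_def by (rule order_trans[OF norm_sum]) (simp add: norm_mult)
  also have "\<dots> \<le> norm u * norm v"
    unfolding norm_vec_def by (rule L2_set_mult_ineq)
  finally show ?thesis .
qed

lemma norm_vec_Re_Im: "(norm (Re_vec u))\<^sup>2 + (norm (Im_vec u))\<^sup>2 = (norm u)\<^sup>2"
  by (simp add: norm_vec_def L2_set_def sum_nonneg Re_vec_def Im_vec_def cmod_power2 sum.distrib)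

lemma Re_cdot_diff:
  "Re (cdot (u - cvec z) (u - cvec z)) = (norm (Re_vec u - z))\<^sup>2 - (norm (Im_vec u))\<^sup>2"
  by (simp add: cdot_def norm_vec_def L2_set_def sum_nonneg Re_vec_def Im_vec_def power2_eq_square sum_subtractf)

lemma cdomain_iff: "u \<in> cdomain L \<longleftrightarrow> (\<forall>z\<in>L. Re (cdot (u - cvec z) (u - cvec z)) > 0)"
proof -
  have sq: "b < a \<longleftrightarrow> 0 < a\<^sup>2 - b\<^sup>2" if "a \<ge> 0" "b \<ge> 0" for a b :: real
    using power_mono_iff[of a b 2] that by (simp add: not_le[symmetric])
  show ?thesis
    by (simp only: cdomain_def Re_cdot_diff mem_Collect_eq sq[OF norm_ge_zero norm_ge_zero])
qed

lemma Re_vec_cvec [simp]: "Re_vec (cvec x) = x"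
  by (simp add: Re_vec_def vec_eq_iff)

lemma Im_vec_cvec [simp]: "Im_vec (cvec x) = 0"
  by (simp add: Im_vec_def vec_eq_iff)

lemma cvec_in_cdomain: "cvec x \<in> cdomain L \<longleftrightarrow> x \<notin> L"
  by (auto simp: cdomain_def)

lemma norm_cvec [simp]: "norm (cvec x) = norm x"
  by (simp add: norm_vec_def)

lemma continuous_on_cdot [continuous_intros]:
  "continuous_on S f \<Longrightarrow> continuous_on S g \<Longrightarrow> continuous_on S (\<lambda>x. cdot (f x) (g x))"
  unfolding cdot_def by (intro continuous_intros)

text \<open>The lattice points of norm below \<open>4 * m\<close> are finitely many and are
  controlled by continuity at \<open>p\<close>. For the others \<open>Re_vec u\<close> and
  \<open>Im_vec u\<close> have norm at most \<open>m\<close>, so the real part of the square is at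
  least \<open>(norm z - m)\<^sup>2 - m\<^sup>2\<close>. This growth yields both the openness of
  \<open>cdomain\<close> and the Gaussian decay of the terms in Crandall's formula.\<close>

lemma cdomain_local_bound:
  fixes A :: "real ^ 'd ^ 'd::finite"
  assumes A: "invertible A" and L: "L \<subseteq> lattice_of A" and p: "p \<in> cdomain L"
  obtains r c where "r > 0" "c > 0"
    "\<And>u z. u \<in> ball p r \<Longrightarrow> z \<in> L \<Longrightarrow> c * (1 + norm z)\<^sup>2 \<le> Re (cdot (u - cvec z) (u - cvec z))"
proof -
  define m where "m = norm p + 1"
  have m: "m \<ge> 1" by (simp add: m_def)
  \<comment> \<open>From \<open>x = 4 * m\<close> on,
    \<open>x * (x - 2 * m) \<ge> x * x / 2\<close>, and \<open>1 + x \<le> 5/4 * x\<close> since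
    \<open>m \<ge> 1\<close>; together these leave room for the constant \<open>1/4\<close>.\<close>
  define S where "S = {z \<in> L. norm z < 4 * m}"
  have S: "finite S" unfolding S_def
    by (rule finite_subset[OF _ lattice_bounded_finite[OF A, of "4 * m"]]) (use L in auto)
  let ?\<phi> = "\<lambda>z u. Re (cdot (u - cvec z) (u - cvec z))"
  have pos: "?\<phi> z p > 0" if "z \<in> L" for z using p that by (simp add: cdomain_iff)
  have "\<exists>\<delta>>0. \<forall>z\<in>S. \<delta> < ?\<phi> z p"
  proof -
    have "\<exists>\<delta>>0. \<forall>z\<in>S. \<delta> \<le> ?\<phi> z p"
      using S pos by (intro exI[of _ "Min (insert 1 ((\<lambda>z. ?\<phi> z p) ` S))"]) (auto simp: S_def)
    then obtain \<delta> where "\<delta> > 0" "\<forall>z\<in>S. \<delta> \<le> ?\<phi> z p" by blast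
    then show ?thesis by (intro exI[of _ "\<delta> / 2"]) (auto intro: less_le_trans[of _ \<delta>])
  qed
  then obtain \<delta> where \<delta>: "\<delta> > 0" "\<And>z. z \<in> S \<Longrightarrow> \<delta> < ?\<phi> z p" by blast
  have "\<forall>\<^sub>F u in nhds p. \<forall>z\<in>S. \<delta> < ?\<phi> z u"
  proof (rule eventually_ball_finite[OF S], rule ballI)
    fix z assume z: "z \<in> S"
    have "continuous_on UNIV (?\<phi> z)" by (intro continuous_intros)
    then have "isCont (?\<phi> z) p" by (simp add: continuous_on_eq_continuous_at)
    then have "((?\<phi> z) \<longlongrightarrow> ?\<phi> z p) (nhds p)"
      using tendsto_at_iff_tendsto_nhds[of "?\<phi> z" p] by (simp only: isCont_def)
    then show "\<forall>\<^sub>F u in nhds p. \<delta> < ?\<phi> z u" using \<delta>(2)[OF z] by (rule order_tendstoD)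
  qed
  then obtain r where r: "r > 0" "\<And>u. dist u p < r \<Longrightarrow> \<forall>z\<in>S. \<delta> < ?\<phi> z u"
    unfolding eventually_nhds_metric by blast
  define c where "c = min (1/4) (\<delta> / (1 + 4 * m)\<^sup>2)"
  have c: "c > 0" using \<delta> m by (simp add: c_def)
  show thesis
  proof (rule that[of "min r 1" c])
    fix u z assume u: "u \<in> ball p (min r 1)" and z: "z \<in> L"
    show "c * (1 + norm z)\<^sup>2 \<le> ?\<phi> z u"
    proof (cases "z \<in> S")
      case True
      then have "(1 + norm z)\<^sup>2 \<le> (1 + 4 * m)\<^sup>2" by (intro power_mono) (auto simp: S_def)
      then have "c * (1 + norm z)\<^sup>2 \<le> \<delta> / (1 + 4 * m)\<^sup>2 * (1 + 4 * m)\<^sup>2"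
        using c \<delta> by (intro mult_mono) (auto simp: c_def)
      also have "\<dots> = \<delta>" using m by simp
      also have "\<delta> \<le> ?\<phi> z u" using r(2)[of u] u True by (auto simp: dist_commute less_imp_le)
      finally show ?thesis .
    next
      case False
      define x where "x = norm z"
      have x: "x \<ge> 4 * m" using False z by (auto simp: S_def x_def)
      have "norm u \<le> m"
        using u norm_triangle_ineq2[of u p] by (simp add: m_def dist_norm norm_minus_commute)
      then have um: "(norm u)\<^sup>2 \<le> m\<^sup>2" by (intro power_mono) auto
      have "(norm (Re_vec u))\<^sup>2 \<le> m\<^sup>2" and im: "(norm (Im_vec u))\<^sup>2 \<le> m\<^sup>2"
        using norm_vec_Re_Im[of u] um by (smt (verit) zero_le_power2)+
      then have re: "norm (Re_vec u) \<le> m" using m by (simp add: power2_le_iff_abs_le)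
      have "x - m \<le> norm (Re_vec u - z)"
        using norm_triangle_ineq2[of z "Re_vec u"] re by (simp add: x_def norm_minus_commute)
      then have "(x - m)\<^sup>2 \<le> (norm (Re_vec u - z))\<^sup>2" using x m by (intro power_mono) auto
      then have "(x - m)\<^sup>2 - m\<^sup>2 \<le> ?\<phi> z u" using im unfolding Re_cdot_diff by linarith
      moreover have "(1/4) * (1 + x)\<^sup>2 \<le> (x - m)\<^sup>2 - m\<^sup>2"
      proof -
        have 1: "(x - m)\<^sup>2 - m\<^sup>2 = x * (x - 2 * m)" by (simp add: power2_eq_square algebra_simps)
        have "x * (x / 2) \<le> x * (x - 2 * m)" using x m by (intro mult_left_mono) auto
        moreover have "(1 + x)\<^sup>2 \<le> (5/4 * x)\<^sup>2" using x m by (intro power_mono) auto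
        moreover have "0 \<le> x * x" "(5/4 * x)\<^sup>2 = 25/16 * (x * x)" "x * (x / 2) = x * x / 2"
          by (simp_all add: power2_eq_square)
        ultimately show ?thesis unfolding 1 by linarith
      qed
      moreover have "c \<le> 1/4" unfolding c_def by (rule min.cobounded1)
      then have "c * (1 + x)\<^sup>2 \<le> (1/4) * (1 + x)\<^sup>2" by (rule mult_right_mono) simp
      ultimately show ?thesis unfolding x_def by linarith
    qed
  qed (use r c in auto)
qed

lemma open_cdomain:
  fixes A :: "real ^ 'd ^ 'd::finite"
  assumes A: "invertible A" and L: "L \<subseteq> lattice_of A"
  shows "open (cdomain L)"
proof (rule openI)
  fix p assume "p \<in> cdomain L"
  then obtain r c where rc: "r > 0" "c > 0"
    "\<And>u z. u \<in> ball p r \<Longrightarrow> z \<in> L \<Longrightarrow> c * (1 + norm z)\<^sup>2 \<le> Re (cdot (u - cvec z) (u - cvec z))"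
    using cdomain_local_bound[OF A L] by blast
  have "ball p r \<subseteq> cdomain L"
  proof
    fix u assume u: "u \<in> ball p r"
    have "0 < Re (cdot (u - cvec z) (u - cvec z))" if "z \<in> L" for z
    proof -
      have "0 < c * (1 + norm z)\<^sup>2" using rc(2) norm_ge_zero[of z]
        by (intro mult_pos_pos zero_less_power) linarith+
      then show ?thesis using rc(3)[OF u that] by linarith
    qed
    then show "u \<in> cdomain L" by (simp add: cdomain_iff)
  qed
  then show "\<exists>e>0. ball p e \<subseteq> cdomain L" using rc by blast
qed

text \<open>By \<open>ln x \<le> x\<close> the power is absorbed into the linear term, and
  completing the square bounds the rest.\<close>

lemma gaussian_beats_powr:
  assumes c: "c > 0" and s: "s \<ge> 0"
  obtains K :: real where "\<And>x::real. x \<ge> 1 \<Longrightarrow> exp (C * x - c * x\<^sup>2) \<le> K * x powr (- s)"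
proof (rule that)
  fix x :: real assume x: "x \<ge> 1"
  have "(C + s) * x - c * x\<^sup>2 \<le> (C + s)\<^sup>2 / (4 * c)"
  proof -
    have "0 \<le> (C + s - 2 * c * x)\<^sup>2 / (4 * c)" using c by simp
    also have "\<dots> = (C + s)\<^sup>2 / (4 * c) - ((C + s) * x - c * x\<^sup>2)"
      using c by (simp add: power2_eq_square field_simps)
    finally show ?thesis by simp
  qed
  moreover have "s * ln x \<le> s * x" using x s ln_le_minus_one[of x] by (intro mult_left_mono) auto
  ultimately have "C * x - c * x\<^sup>2 \<le> (C + s)\<^sup>2 / (4 * c) + (- s) * ln x" by (simp add: algebra_simps)
  then have "exp (C * x - c * x\<^sup>2) \<le> exp ((C + s)\<^sup>2 / (4 * c) + (- s) * ln x)" by simp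
  also have "\<dots> = exp ((C + s)\<^sup>2 / (4 * c)) * x powr (- s)" using x by (simp add: powr_def flip: exp_add)
  finally show "exp (C * x - c * x\<^sup>2) \<le> exp ((C + s)\<^sup>2 / (4 * c)) * x powr (- s)" .
qed

lemma lattice_gaussian_integrable:
  fixes A :: "real ^ 'd ^ 'd::finite"
  assumes A: "invertible A" and L: "L \<subseteq> lattice_of A" and c: "c > 0"
  shows "integrable (count_space L) (\<lambda>z. K * exp (C * (1 + norm z) - c * (1 + norm z)\<^sup>2))"
proof -
  define s where "s = real CARD('d) + 1"
  have s: "s > real CARD('d)" "s \<ge> 0" by (simp_all add: s_def)
  obtain M where M: "\<And>x::real. x \<ge> 1 \<Longrightarrow> exp (C * x - c * x\<^sup>2) \<le> M * x powr (- s)"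
    using gaussian_beats_powr[OF c s(2)] by blast
  have "integrable (count_space L) (\<lambda>z. complex_of_real (exp (C * (1 + norm z) - c * (1 + norm z)\<^sup>2)))"
    by (rule lattice_sum_integrable[OF A s(1) L, of _ M]) (auto intro!: M simp: norm_exp_eq_Re)
  then have "integrable (count_space L) (\<lambda>z. exp (C * (1 + norm z) - c * (1 + norm z)\<^sup>2))"
    by (simp only: complex_of_real_integrable_eq)
  then show ?thesis by simp
qed

text \<open>The shape of the majorant is stable under what occurs later: phases and polynomial
  weights only enlarge \<open>C\<close>, while the rate \<open>c\<close> comes from
  \<open>cdomain_local_bound\<close> or, at a fixed scale, from the Gaussian itself.\<close>

lemma dominated_family_gaussian:
  fixes A :: "real ^ 'd ^ 'd::finite" and t :: "'a::complex_normed_vector \<Rightarrow> real ^ 'd \<Rightarrow> complex"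
  assumes A: "invertible A" and L: "L \<subseteq> lattice_of A" and U: "open U"
    and t: "\<And>z. z \<in> L \<Longrightarrow> (\<lambda>p. t p z) jointly_holomorphic_on U"
    and dom: "\<And>p. p \<in> U \<Longrightarrow> \<exists>r>0. \<exists>K C. \<exists>c>0. \<forall>q\<in>ball p r. \<forall>z\<in>L.
       norm (t q z) \<le> K * exp (C * (1 + norm z) - c * (1 + norm z)\<^sup>2)"
  shows "dominated_family (count_space L) U t"
  unfolding dominated_family_def
proof (intro conjI ballI)
  fix p assume p: "p \<in> U"
  then obtain r K C c where *: "r > 0" "c > 0"
    "\<forall>q\<in>ball p r. \<forall>z\<in>L. norm (t q z) \<le> K * exp (C * (1 + norm z) - c * (1 + norm z)\<^sup>2)"
    using dom by blast
  obtain e where "e > 0" "ball p e \<subseteq> U" using U p openE by blast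
  then show "\<exists>r>0. \<exists>g. ball p r \<subseteq> U \<and> integrable (count_space L) g \<and>
      (\<forall>q\<in>ball p r. \<forall>x\<in>space (count_space L). norm (t q x) \<le> g x)"
    using * lattice_gaussian_integrable[OF A L *(2), of K C]
    by (intro exI[of _ "min e r"] conjI exI[of _ "\<lambda>z. K * exp (C * (1 + norm z) - c * (1 + norm z)\<^sup>2)"]) auto
qed (use U t in auto)

section \<open>Incomplete Gamma functions\<close>

abbreviation pos_lborel :: "real measure" where
  "pos_lborel \<equiv> restrict_space lborel {0<..}"

lemma integrable_exp_minus:
  assumes "a > 0"
  shows "integrable pos_lborel (\<lambda>x. K * exp (- (a * x)))"
proof -
  have "((\<lambda>x. - exp (- (a * x)) / a) \<longlongrightarrow> - 0 / a) at_top"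
  proof (intro tendsto_divide tendsto_minus tendsto_const)
    have "filterlim (\<lambda>x. a * x) at_top at_top"
      using assms by (intro filterlim_tendsto_pos_mult_at_top[OF tendsto_const] filterlim_ident) auto
    then show "((\<lambda>x. exp (- (a * x))) \<longlongrightarrow> 0) at_top"
      by (intro filterlim_compose[OF exp_at_bot]) (simp add: filterlim_uminus_at_top)
  qed (use assms in auto)
  then have "(\<integral>\<^sup>+x. ennreal (exp (- (a * x))) * indicator {0..} x \<partial>lborel) = ennreal (- 0 / a - - exp (- (a * 0)) / a)"
    using assms by (intro nn_integral_FTC_atLeast) (auto intro!: derivative_eq_intros)
  then have "(\<integral>\<^sup>+x. ennreal (exp (- (a * x)) * indicator {0..} x) \<partial>lborel) = ennreal (1 / a)"
    by (simp add: ennreal_mult' ennreal_indicator)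
  then have "integrable lborel (\<lambda>x. exp (- (a * x)) * indicator {0..} x)"
    by (intro integrableI_nn_integral_finite[where x="1 / a"]) (use assms in auto)
  then have "set_integrable lborel {0..} (\<lambda>x. exp (- (a * x)))"
    by (simp add: set_integrable_def mult.commute)
  then have "set_integrable lborel {0<..} (\<lambda>x. exp (- (a * x)))"
    by (rule set_integrable_subset) auto
  then show ?thesis by (simp add: integrable_restrict_space set_integrable_def)
qed

lemma borel_measurable_pos_lborel:
  fixes f :: "real \<Rightarrow> 'a::real_normed_vector"
  shows "continuous_on UNIV f \<Longrightarrow> f \<in> borel_measurable pos_lborel"
  by (intro measurable_restrict_space1) (simp add: borel_measurable_continuous_onI)

text \<open>In the variable \<open>\<tau> = exp x\<close>, resp. \<open>\<tau> = exp (- x)\<close>, these are the integrals of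
  \<open>\<tau> powr (s - 1) * exp (- t * \<tau>)\<close> over \<open>\<tau> > 1\<close> and over \<open>0 < \<tau> < 1\<close>, i.e. the incomplete
  Gamma functions divided by \<open>t powr s\<close>. Both are free of branch cuts in \<open>t\<close>.\<close>

definition Qint :: "complex \<Rightarrow> complex \<Rightarrow> complex" where
  "Qint s t = (\<integral>x. exp (s * of_real x - t * of_real (exp x)) \<partial>pos_lborel)"

definition Pint :: "complex \<Rightarrow> complex \<Rightarrow> complex" where
  "Pint s t = (\<integral>x. exp (- s * of_real x - t * of_real (exp (- x))) \<partial>pos_lborel)"

text \<open>\<open>Re t * exp x\<close> is spent in two halves. One, with
  \<open>exp x \<ge> 1\<close>, keeps the decay \<open>exp (- (Re t / 2))\<close>; the other, with
  \<open>exp x \<ge> x\<^sup>2 / 2\<close> and \<open>Re t \<ge> \<delta>\<close>, absorbs the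
  growth \<open>(S + 1) * x\<close> and so leaves \<open>exp (- x)\<close>.\<close>

lemma Q_integrand_bound:
  assumes \<delta>: "\<delta> > 0"
  obtains K where "K \<ge> 0"
    "\<And>s t x. Re s \<le> S \<Longrightarrow> Re t \<ge> \<delta> \<Longrightarrow> x > 0 \<Longrightarrow>
       norm (exp (s * of_real x - t * of_real (exp x))) \<le> K * exp (- (Re t / 2)) * exp (- (1 * x))"
proof
  define K where "K = exp ((S + 1)\<^sup>2 / \<delta>)"
  show "K \<ge> 0" by (simp add: K_def)
  fix s t :: complex and x :: real assume s: "Re s \<le> S" and t: "Re t \<ge> \<delta>" and x: "x > 0"
  have "1 + x + x\<^sup>2 / 2 \<le> exp x" using x by (intro exp_lower_Taylor_quadratic) simp
  then have e: "x\<^sup>2 / 2 \<le> exp x" "1 \<le> exp x" using x by simp_all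
  have "Re t / 2 * 1 + \<delta> / 2 * (x\<^sup>2 / 2) \<le> Re t / 2 * exp x + Re t / 2 * exp x"
    using e t \<delta> by (intro add_mono mult_mono) auto
  moreover have "Re s * x \<le> S * x" using s x by simp
  moreover have "(S + 1) * x - \<delta> / 4 * x\<^sup>2 \<le> (S + 1)\<^sup>2 / \<delta>"
  proof -
    have "0 \<le> (S + 1 - \<delta> / 2 * x)\<^sup>2 / \<delta>" using \<delta> by simp
    also have "\<dots> = (S + 1)\<^sup>2 / \<delta> - ((S + 1) * x - \<delta> / 4 * x\<^sup>2)"
      using \<delta> by (simp add: power2_eq_square field_simps)
    finally show ?thesis by simp
  qed
  ultimately have "Re s * x - Re t * exp x \<le> (S + 1)\<^sup>2 / \<delta> + - (Re t / 2) + - (1 * x)"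
    by (simp add: algebra_simps)
  then have "exp (Re s * x - Re t * exp x) \<le> exp ((S + 1)\<^sup>2 / \<delta> + - (Re t / 2) + - (1 * x))" by simp
  then show "norm (exp (s * of_real x - t * of_real (exp x))) \<le> K * exp (- (Re t / 2)) * exp (- (1 * x))"
    by (simp add: K_def norm_exp_eq_Re flip: exp_add)
qed

lemma dominated_family_Q:
  "dominated_family pos_lborel (UNIV \<times> {t. Re t > 0})
     (\<lambda>p x. exp (fst p * of_real x - snd p * of_real (exp x)))"
  unfolding dominated_family_def
proof (intro conjI ballI)
  show "open (UNIV \<times> {t. Re t > 0} :: (complex \<times> complex) set)"
    by (intro open_Times open_halfspace_Re_gt open_UNIV)
  show "(\<lambda>p. exp (fst p * of_real x - snd p * of_real (exp x))) jointly_holomorphic_on UNIV \<times> {t. 0 < Re t}" for x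
    unfolding jointly_holomorphic_on_iff
    by (intro ballI cdiff_at_exp cdiff_at_diff cdiff_at_mult cdiff_at_fst cdiff_at_snd cdiff_at_const cdiff_at_ident)
  show "(\<lambda>x. exp (fst p * of_real x - snd p * of_real (exp x))) \<in> borel_measurable pos_lborel" for p :: "complex \<times> complex"
    by (intro borel_measurable_pos_lborel continuous_intros)
  fix p :: "complex \<times> complex" assume p: "p \<in> UNIV \<times> {t. 0 < Re t}"
  define \<delta> where "\<delta> = Re (snd p) / 2"
  have \<delta>: "\<delta> > 0" using p by (auto simp: \<delta>_def)
  obtain K where K: "K \<ge> 0" "\<And>s t x. Re s \<le> Re (fst p) + \<delta> \<Longrightarrow> Re t \<ge> \<delta> \<Longrightarrow> x > 0 \<Longrightarrow>
       norm (exp (s * of_real x - t * of_real (exp x))) \<le> K * exp (- (Re t / 2)) * exp (- (1 * x))"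
    using Q_integrand_bound[OF \<delta>] by metis
  have b: "Re (fst q) \<le> Re (fst p) + \<delta>" "Re (snd q) \<ge> \<delta>" if q: "q \<in> ball p \<delta>" for q
  proof -
    have "norm (fst q - fst p) \<le> norm (q - p)" "norm (snd q - snd p) \<le> norm (q - p)"
      by (metis fst_diff norm_fst_le prod.collapse) (metis snd_diff norm_snd_le prod.collapse)
    moreover have "norm (q - p) < \<delta>" using q by (simp add: dist_norm norm_minus_commute)
    ultimately show "Re (fst q) \<le> Re (fst p) + \<delta>" "Re (snd q) \<ge> \<delta>"
      using abs_Re_le_cmod[of "fst q - fst p"] abs_Re_le_cmod[of "snd q - snd p"]
      by (auto simp: \<delta>_def abs_le_iff)
  qed
  show "\<exists>r>0. \<exists>g. ball p r \<subseteq> UNIV \<times> {t. 0 < Re t} \<and> integrable pos_lborel g \<and>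
      (\<forall>q\<in>ball p r. \<forall>x\<in>space pos_lborel. norm (exp (fst q * of_real x - snd q * of_real (exp x))) \<le> g x)"
  proof (intro exI[of _ \<delta>] exI[of _ "\<lambda>x. K * exp (- (1 * x))"] conjI ballI)
    show "ball p \<delta> \<subseteq> UNIV \<times> {t. 0 < Re t}" using b(2) \<delta> by fastforce
    show "integrable pos_lborel (\<lambda>x. K * exp (- (1 * x)))" by (rule integrable_exp_minus) simp
    fix q and x :: real assume q: "q \<in> ball p \<delta>" and x: "x \<in> space pos_lborel"
    have "norm (exp (fst q * of_real x - snd q * of_real (exp x))) \<le> K * exp (- (Re (snd q) / 2)) * exp (- (1 * x))"
      using b[OF q] x by (intro K) (auto simp: space_restrict_space)
    also have "\<dots> \<le> K * 1 * exp (- (1 * x))"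
      using b(2)[OF q] \<delta> K(1) by (intro mult_right_mono mult_left_mono) auto
    finally show "norm (exp (fst q * of_real x - snd q * of_real (exp x))) \<le> K * exp (- (1 * x))" by simp
  qed (use \<delta> in simp)
qed

lemma Qint_jointly_holomorphic: "(\<lambda>p. Qint (fst p) (snd p)) jointly_holomorphic_on UNIV \<times> {t. Re t > 0}"
  unfolding Qint_def by (rule dominated_family_integral(1)[OF dominated_family_Q])

lemma cdiff_at_Qint [intro]:
  assumes "cdiff_at f p" "cdiff_at g p" "Re (g p) > 0"
  shows "cdiff_at (\<lambda>x. Qint (f x) (g x)) p"
proof -
  have "cdiff_at (\<lambda>p. Qint (fst p) (snd p)) (f p, g p)"
    using Qint_jointly_holomorphic assms(3) by (auto simp: jointly_holomorphic_on_iff)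
  from cdiff_at_compose[where g="\<lambda>x. (f x, g x)", OF this] show ?thesis using assms by auto
qed

lemma integrable_Q:
  assumes "Re t > 0"
  shows "integrable pos_lborel (\<lambda>x. exp (s * of_real x - t * of_real (exp x)))"
  using dominated_family_integrable[OF dominated_family_Q, of "(s, t)"] assms by simp

text \<open>The exponential decay in \<open>Re t\<close> becomes Gaussian decay in the lattice point
  once \<open>t\<close> is pi times a square.\<close>

lemma Qint_bound:
  assumes \<delta>: "\<delta> > 0"
  obtains K where "K \<ge> 0" "\<And>s t. Re s \<le> S \<Longrightarrow> Re t \<ge> \<delta> \<Longrightarrow> norm (Qint s t) \<le> K * exp (- (Re t / 2))"
proof -
  obtain K where K: "K \<ge> 0"
    "\<And>s t x. Re s \<le> S \<Longrightarrow> Re t \<ge> \<delta> \<Longrightarrow> x > 0 \<Longrightarrow>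
       norm (exp (s * of_real x - t * of_real (exp x))) \<le> K * exp (- (Re t / 2)) * exp (- (1 * x))"
    using Q_integrand_bound[OF \<delta>] by metis
  define I where "I = (\<integral>x. 1 * exp (- (1 * x)) \<partial>pos_lborel)"
  have I: "I \<ge> 0" unfolding I_def by (intro integral_nonneg_AE) simp
  have "norm (Qint s t) \<le> (K * I) * exp (- (Re t / 2))" if st: "Re s \<le> S" "Re t \<ge> \<delta>" for s t
  proof -
    have "norm (Qint s t) \<le> (\<integral>x. norm (exp (s * of_real x - t * of_real (exp x))) \<partial>pos_lborel)"
      unfolding Qint_def by (rule integral_norm_bound)
    also have "\<dots> \<le> (\<integral>x. K * exp (- (Re t / 2)) * exp (- (1 * x)) \<partial>pos_lborel)"
      using st \<delta> K(2)[OF st]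
      by (intro integral_mono integrable_norm integrable_Q integrable_exp_minus) (auto simp: space_restrict_space)
    also have "\<dots> = (K * I) * exp (- (Re t / 2))" by (simp add: I_def)
    finally show ?thesis .
  qed
  then show thesis using that[of "K * I"] K I by simp
qed

lemma integrable_P:
  assumes "Re s > 0"
  shows "integrable pos_lborel (\<lambda>x. exp (- s * of_real x - t * of_real (exp (- x))))"
proof (rule Bochner_Integration.integrable_bound)
  show "integrable pos_lborel (\<lambda>x. exp (norm t) * exp (- (Re s * x)))" by (rule integrable_exp_minus[OF assms])
  show "(\<lambda>x. exp (- s * of_real x - t * of_real (exp (- x)))) \<in> borel_measurable pos_lborel"
    by (intro borel_measurable_pos_lborel continuous_intros)
  show "AE x in pos_lborel. norm (exp (- s * of_real x - t * of_real (exp (- x)))) \<le> norm (exp (norm t) * exp (- (Re s * x)))"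
  proof (rule AE_I2)
    fix x assume "x \<in> space pos_lborel"
    then have x: "x > 0" by (simp add: space_restrict_space)
    have "\<bar>Re t * exp (- x)\<bar> \<le> norm t * 1"
      unfolding abs_mult using x abs_Re_le_cmod[of t] by (intro mult_mono) auto
    then have "- Re s * x - Re t * exp (- x) \<le> norm t + - (Re s * x)" by (simp add: abs_le_iff)
    then show "norm (exp (- s * of_real x - t * of_real (exp (- x)))) \<le> norm (exp (norm t) * exp (- (Re s * x)))"
      by (simp add: norm_exp_eq_Re flip: exp_add)
  qed
qed

lemma integral_exp_minus_complex:
  assumes "Re s > 0"
  shows "(\<integral>x. exp (- s * of_real x) \<partial>pos_lborel) = 1 / s"
proof -
  have int: "integrable pos_lborel (\<lambda>x. exp (- s * complex_of_real x))" using integrable_P[OF assms, of 0] by simp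
  have s: "s \<noteq> 0" using assms by auto
  let ?F = "\<lambda>x. - exp (- s * complex_of_real x) / s"
  have "(LBINT x=0..\<infinity>. exp (- s * complex_of_real x)) = 0 - (- 1 / s)"
  proof (rule interval_integral_FTC_integrable[where F="?F"])
    show "(?F has_vector_derivative exp (- s * complex_of_real x)) (at x)" for x
    proof -
      have "((\<lambda>z. - exp (- s * z) / s) has_field_derivative exp (- s * complex_of_real x)) (at (of_real x))"
        using s by (auto intro!: derivative_eq_intros)
      then show ?thesis by (rule has_vector_derivative_real_field)
    qed
    show "set_integrable lborel (einterval 0 \<infinity>) (\<lambda>x. exp (- s * complex_of_real x))"
      using int by (simp add: integrable_restrict_space set_integrable_def zero_ereal_def)
    have "(?F \<longlongrightarrow> - exp (- s * complex_of_real 0) / s) (at_right 0)"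
      using s by (intro tendsto_intros) auto
    then show "((?F \<circ> real_of_ereal) \<longlongrightarrow> - 1 / s) (at_right 0)"
      by (simp add: ereal_tendsto_simps zero_ereal_def)
    have "(?F \<longlongrightarrow> - 0 / s) at_top"
    proof (intro tendsto_divide tendsto_minus tendsto_const s)
      have "filterlim (\<lambda>x. Re s * x) at_top at_top"
        using assms by (intro filterlim_tendsto_pos_mult_at_top[OF tendsto_const] filterlim_ident) auto
      then have "((\<lambda>x. exp (- (Re s * x))) \<longlongrightarrow> 0) at_top"
        by (intro filterlim_compose[OF exp_at_bot]) (simp add: filterlim_uminus_at_top)
      then show "((\<lambda>x. exp (- s * complex_of_real x)) \<longlongrightarrow> 0) at_top"
        by (subst tendsto_norm_zero_iff[symmetric]) (simp add: norm_exp_eq_Re)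
    qed
    then show "((?F \<circ> real_of_ereal) \<longlongrightarrow> 0) (at_left \<infinity>)"
      by (simp add: ereal_tendsto_simps)
  qed (auto intro!: continuous_intros)
  moreover have "(LBINT x=0..\<infinity>. exp (- s * complex_of_real x)) = (\<integral>x. exp (- s * of_real x) \<partial>pos_lborel)"
    by (simp add: interval_lebesgue_integral_def integral_restrict_space set_lebesgue_integral_def zero_ereal_def)
  ultimately show ?thesis by simp
qed

text \<open>In the logarithmic variable the Mellin integral runs over the whole line: cutting at 0
  gives \<open>Qint\<close> and, after reflection, \<open>Pint\<close>, while dilation by
  \<open>t\<close> becomes translation by \<open>ln t\<close>.\<close>

lemma Gamma_exp_integral:
  assumes s: "Re s > 0" and t: "t > 0"
  shows "Gamma s * of_real t powr (- s) = Qint s (of_real t) + Pint s (of_real t)"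
proof -
  define h where "h a x = exp (s * of_real x - of_real a * of_real (exp x))" for a x :: real
  have split: "integrable lborel (h a) \<and> (\<integral>x. h a x \<partial>lborel) = Qint s (of_real a) + Pint s (of_real a)"
    if a: "a > 0" for a
  proof -
    have 1: "integrable lborel (\<lambda>x. indicator {0<..} x *\<^sub>R h a x)"
      "Qint s (of_real a) = (\<integral>x. indicator {0<..} x *\<^sub>R h a x \<partial>lborel)"
      using integrable_Q[of "of_real a" s] a
      by (simp_all add: integrable_restrict_space integral_restrict_space Qint_def h_def)
    have 2: "integrable lborel (\<lambda>x. indicator {0<..} x *\<^sub>R h a (- x))"
      "Pint s (of_real a) = (\<integral>x. indicator {0<..} x *\<^sub>R h a (- x) \<partial>lborel)"
      using integrable_P[OF s, of "of_real a"]
      by (simp_all add: integrable_restrict_space integral_restrict_space Pint_def h_def)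
    have ind: "indicator {0<..} (- x) = (indicator {..<0} x :: real)" for x :: real
      by (simp add: indicator_def)
    have 3: "integrable lborel (\<lambda>x. indicator {..<0} x *\<^sub>R h a x)"
      using lborel_integrable_real_affine[OF 2(1), of "-1" 0] ind by simp
    have 4: "Pint s (of_real a) = (\<integral>x. indicator {..<0} x *\<^sub>R h a x \<partial>lborel)"
      unfolding 2(2) using lborel_integral_real_affine[of "-1" "\<lambda>x. indicator {0<..} x *\<^sub>R h a (- x)" 0] ind
      by simp
    have ae: "AE x in lborel. indicator {0<..} x *\<^sub>R h a x + indicator {..<0} x *\<^sub>R h a x = h a x"
      using AE_lborel_singleton[of 0] by eventually_elim (auto simp: indicator_def)
    have m: "h a \<in> borel_measurable lborel"
    proof -
      have "h a \<in> borel_measurable borel"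
        unfolding h_def[abs_def] by (intro borel_measurable_continuous_onI continuous_intros)
      then show ?thesis by simp
    qed
    show ?thesis
    proof
      show "integrable lborel (h a)"
        using integrable_cong_AE[THEN iffD1, OF _ m ae] Bochner_Integration.integrable_add[OF 1(1) 3] by auto
      show "(\<integral>x. h a x \<partial>lborel) = Qint s (of_real a) + Pint s (of_real a)"
        unfolding 1(2) 4 Bochner_Integration.integral_add[OF 1(1) 3, symmetric]
        using Bochner_Integration.integrable_add[OF 1(1) 3]
        by (intro integral_cong_AE m borel_measurable_integrable) (use ae in auto)
    qed
  qed
  have G: "Gamma s = (\<integral>x. h 1 x \<partial>lborel)"
  proof -
    let ?f = "\<lambda>t. complex_of_real t powr (s - 1) / of_real (exp t)"
    have f_int: "set_integrable lborel {0<..} ?f"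
    proof -
      \<comment> \<open>Absolute integrability is known for the completed measure; Borel
        measurability of the integrand brings it down to \<open>lborel\<close>.\<close>
      have "?f \<in> borel_measurable borel" by measurable
      then have m: "(\<lambda>x. indicator {0<..} x *\<^sub>R ?f x) \<in> borel_measurable lborel" by measurable
      have "integrable (completion lborel) (\<lambda>x. indicator {0<..} x *\<^sub>R ?f x)"
        using absolutely_integrable_Gamma_integral'[OF s] by (simp add: set_integrable_def)
      then show ?thesis unfolding set_integrable_def using integrable_completion[OF m] by simp
    qed
    have eq: "exp x *\<^sub>R ?f (exp x) = h 1 x" for x
    proof -
      have "exp x *\<^sub>R ?f (exp x) = exp (of_real x) * exp ((s - 1) * of_real x) / exp (of_real (exp x))"
        by (simp add: powr_def scaleR_conv_of_real exp_of_real Ln_of_real)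
      also have "\<dots> = h 1 x" by (simp add: h_def exp_diff left_diff_distrib)
      finally show ?thesis .
    qed
    have "(LBINT x=0..\<infinity>. ?f x) = (LBINT x=-\<infinity>..\<infinity>. exp x *\<^sub>R ?f (exp x))"
    proof (rule interval_integral_substitution_integrable)
      show "isCont ?f (exp x)" for x :: real
        by (intro continuous_intros) (auto simp: complex_nonpos_Reals_iff)
      show "((ereal \<circ> exp \<circ> real_of_ereal) \<longlongrightarrow> 0) (at_right (- \<infinity>))"
      proof -
        have "((exp \<circ> real_of_ereal) \<longlongrightarrow> 0) (at_right (- \<infinity>))"
          using exp_at_bot by (simp only: ereal_tendsto_simps)
        then have "((\<lambda>x. ereal ((exp \<circ> real_of_ereal) x)) \<longlongrightarrow> ereal 0) (at_right (- \<infinity>))"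
          by (rule tendsto_ereal)
        then show ?thesis by (simp add: comp_def zero_ereal_def)
      qed
      show "((ereal \<circ> exp \<circ> real_of_ereal) \<longlongrightarrow> \<infinity>) (at_left \<infinity>)"
        using exp_at_top
        by (simp add: at_left_PInf filterlim_filtermap comp_def tendsto_PInfty_eq_at_top)
      show "set_integrable lborel (einterval (- \<infinity>) \<infinity>) (\<lambda>x. exp x *\<^sub>R ?f (exp x))"
        unfolding eq using split[of 1] by (simp add: set_integrable_def)
      show "set_integrable lborel (einterval 0 \<infinity>) ?f"
        using f_int by (simp add: zero_ereal_def)
    qed (auto intro!: derivative_eq_intros)
    then have "(\<integral>x. h 1 x \<partial>lborel) = set_lebesgue_integral lborel {0<..} ?f"
      unfolding eq by (simp add: interval_lebesgue_integral_def set_lebesgue_integral_def zero_ereal_def)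
    also have "\<dots> = Gamma s"
      using set_borel_integral_eq_integral(2)[OF f_int] integral_unique[OF Gamma_integral_complex'[OF s]] by simp
    finally show ?thesis by simp
  qed
  have "Gamma s = (\<integral>x. h 1 (ln t + 1 * x) \<partial>lborel)"
    unfolding G using lborel_integral_real_affine[of 1 "h 1" "ln t"] by simp
  also have "\<dots> = (\<integral>x. of_real t powr s * h t x \<partial>lborel)"
  proof (rule Bochner_Integration.integral_cong[OF refl])
    fix x
    have "h 1 (ln t + 1 * x) = exp (s * of_real (ln t) + (s * of_real x - of_real t * of_real (exp x)))"
      using t by (simp add: h_def exp_add algebra_simps)
    also have "\<dots> = of_real t powr s * h t x"
      unfolding exp_add using t by (simp add: powr_def h_def Ln_of_real)
    finally show "h 1 (ln t + 1 * x) = of_real t powr s * h t x" .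
  qed
  also have "\<dots> = of_real t powr s * (Qint s (of_real t) + Pint s (of_real t))" using split[OF t] by simp
  finally show ?thesis using t by (simp add: powr_minus divide_simps)
qed

lemma cdiff_at_imp_field_differentiable:
  fixes f :: "complex \<Rightarrow> complex"
  assumes "cdiff_at f p" shows "f field_differentiable (at p)"
proof -
  obtain D where D: "(f has_derivative D) (at p)" "\<And>c v. D (c * v) = c * D v"
    using assms unfolding cdiff_at_def scaleC_complex_def by blast
  have "D = (*) (D 1)"
  proof
    fix x
    have "D (x * 1) = x * D 1" by (rule D(2))
    then show "D x = D 1 * x" by (simp add: mult.commute[of x])
  qed
  then have "(f has_field_derivative D 1) (at p)" using D(1) by (simp add: has_field_derivative_def)
  then show ?thesis unfolding field_differentiable_def by blast
qed

lemma holomorphic_on_cdiff: "(\<And>z. z \<in> S \<Longrightarrow> cdiff_at f z) \<Longrightarrow> f holomorphic_on S"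
  unfolding holomorphic_on_def
  by (blast intro: field_differentiable_at_within[OF cdiff_at_imp_field_differentiable])

lemma isCont_cdiff: "cdiff_at f p \<Longrightarrow> isCont f p"
  unfolding cdiff_at_def using has_derivative_continuous by blast

text \<open>The Taylor series of \<open>Pint s\<close> in \<open>t\<close>, restricted to the terms in \<open>I\<close>; it continues
  \<open>Pint\<close> in \<open>s\<close>, the term \<open>n\<close> having its pole at \<open>s = - n\<close>.\<close>

definition Pser :: "nat set \<Rightarrow> complex \<Rightarrow> complex \<Rightarrow> complex" where
  "Pser I s t = (\<integral>n. (- t) ^ n / (fact n * (s + of_nat n)) \<partial>count_space I)"

definition off_poles :: "nat set \<Rightarrow> complex set" where
  "off_poles I = {s. \<forall>n\<in>I. s \<noteq> - of_nat n}"

lemma open_off_poles: "open (off_poles I)"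
proof -
  have "off_poles I = uminus -` (- (of_nat ` I))"
    by (auto simp: off_poles_def) (metis minus_minus)
  moreover have "open (- (of_nat ` I :: complex set))" using closed_of_nat_image by blast
  moreover have "continuous_on UNIV (uminus :: complex \<Rightarrow> complex)" by (intro continuous_intros)
  ultimately show ?thesis by (simp add: continuous_on_open_vimage)
qed

lemma integrable_exp_series:
  assumes "\<And>n. n \<in> I \<Longrightarrow> norm (f n) \<le> C * (T ^ n / fact n)"
  shows "integrable (count_space I) (f :: nat \<Rightarrow> 'a::{banach,second_countable_topology})"
proof -
  have "summable (\<lambda>n. norm (C * (T ^ n / fact n)))"
    using summable_exp_generic[of "\<bar>T\<bar>"] by (simp add: abs_mult power_abs divide_inverse mult.commute summable_mult)
  then have "Infinite_Set_Sum.abs_summable_on (\<lambda>n. C * (T ^ n / fact n)) UNIV"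
    by (simp add: abs_summable_on_nat_iff')
  then have "Infinite_Set_Sum.abs_summable_on (\<lambda>n. C * (T ^ n / fact n)) I"
    by (rule abs_summable_on_subset) simp
  then have "Infinite_Set_Sum.abs_summable_on f I"
    by (rule abs_summable_on_comparison_test') (use assms in auto)
  then show ?thesis by (simp add: Infinite_Set_Sum.abs_summable_on_def)
qed

lemma dominated_family_Pser:
  "dominated_family (count_space I) (off_poles I \<times> UNIV)
     (\<lambda>p n. (- snd p) ^ n / (fact n * (fst p + of_nat n)))"
  unfolding dominated_family_def
proof (intro conjI ballI)
  show "open (off_poles I \<times> UNIV :: (complex \<times> complex) set)"
    by (intro open_Times open_off_poles open_UNIV)
  fix n assume n: "n \<in> space (count_space I)"
  show "(\<lambda>p. (- snd p) ^ n / (fact n * (fst p + of_nat n))) jointly_holomorphic_on off_poles I \<times> UNIV"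
    unfolding jointly_holomorphic_on_iff
  proof
    fix p :: "complex \<times> complex" assume "p \<in> off_poles I \<times> UNIV"
    then have "fst p + of_nat n \<noteq> 0" using n by (auto simp: off_poles_def eq_neg_iff_add_eq_0)
    then have "cdiff_at (\<lambda>p. inverse (fst p + of_nat n)) p"
      by (intro cdiff_at_holomorphic[where g=inverse and S="-{0}"] holomorphic_intros cdiff_at_add cdiff_at_fst
        cdiff_at_ident cdiff_at_const) auto
    then have "cdiff_at (\<lambda>p. (- snd p) ^ n * (1 / fact n) * inverse (fst p + of_nat n)) p"
      by (intro cdiff_at_mult cdiff_at_power cdiff_at_minus cdiff_at_snd cdiff_at_ident cdiff_at_const)
    then show "cdiff_at (\<lambda>p. (- snd p) ^ n / (fact n * (fst p + of_nat n))) p" by (simp add: divide_inverse mult.assoc)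
  qed
next
  fix p :: "complex \<times> complex" assume p: "p \<in> off_poles I \<times> UNIV"
  then obtain e where e: "e > 0" "ball (fst p) e \<subseteq> off_poles I"
    using open_off_poles openE by (metis mem_Times_iff)
  \<comment> \<open>In the ball of radius \<open>e/2\<close> every \<open>s\<close> stays at
    distance at least \<open>e/2\<close> from the poles and \<open>norm t \<le> T\<close>, so the
    exponential series of \<open>T\<close> is a majorant.\<close>
  define T where "T = norm (snd p) + e"
  show "\<exists>r>0. \<exists>g. ball p r \<subseteq> off_poles I \<times> UNIV \<and> integrable (count_space I) g \<and>
      (\<forall>q\<in>ball p r. \<forall>n\<in>space (count_space I). norm ((- snd q) ^ n / (fact n * (fst q + of_nat n))) \<le> g n)"
  proof (intro exI[of _ "e/2"] exI[of _ "\<lambda>n. 2 / e * (T ^ n / fact n)"] conjI ballI)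
    have q: "norm (fst q - fst p) < e/2 \<and> norm (snd q - snd p) < e/2" if "q \<in> ball p (e/2)" for q
    proof -
      have "norm (fst q - fst p) \<le> norm (q - p)" "norm (snd q - snd p) \<le> norm (q - p)"
        by (metis fst_diff norm_fst_le prod.collapse) (metis snd_diff norm_snd_le prod.collapse)
      moreover have "norm (q - p) < e/2" using that by (simp add: dist_norm norm_minus_commute)
      ultimately show ?thesis by simp
    qed
    show "ball p (e/2) \<subseteq> off_poles I \<times> UNIV"
    proof
      fix x assume "x \<in> ball p (e/2)"
      then have "norm (fst p - fst x) < e" using q[of x] e(1) by (simp add: norm_minus_commute)
      then show "x \<in> off_poles I \<times> UNIV" using e(2) by (auto simp: dist_norm mem_Times_iff)
    qed
    have T: "T \<ge> 0" using e by (simp add: T_def)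
    show "integrable (count_space I) (\<lambda>n. 2 / e * (T ^ n / fact n))"
      by (rule integrable_exp_series[of _ _ "2 / e" T]) (use e T in auto)
    fix x n assume x: "x \<in> ball p (e/2)" and n: "n \<in> space (count_space I)"
    have 1: "e/2 \<le> norm (fst x + of_nat n)"
    proof (rule ccontr)
      assume "\<not> e/2 \<le> norm (fst x + of_nat n)"
      then have "norm (fst x + of_nat n - (fst x - fst p)) < e/2 + e/2"
        using q[OF x] norm_triangle_ineq4[of "fst x + of_nat n" "fst x - fst p"] by linarith
      then have "- of_nat n \<in> ball (fst p) e" by (simp add: dist_norm algebra_simps)
      then show False using e(2) n by (auto simp: off_poles_def)
    qed
    have "norm (snd x) \<le> T" using q[OF x] e norm_triangle_ineq2[of "snd x" "snd p"] by (simp add: T_def)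
    then have "norm (snd x) ^ n / (fact n * norm (fst x + of_nat n)) \<le> T ^ n / (fact n * (e/2))"
      using 1 e T by (intro frac_le power_mono mult_left_mono) auto
    then show "norm ((- snd x) ^ n / (fact n * (fst x + of_nat n))) \<le> 2 / e * (T ^ n / fact n)"
      by (simp add: norm_divide norm_mult norm_power mult.commute)
  qed (use e in simp)
qed auto

lemma cdiff_at_Pser [intro]:
  assumes "cdiff_at f p" "cdiff_at g p" "f p \<in> off_poles I"
  shows "cdiff_at (\<lambda>x. Pser I (f x) (g x)) p"
proof -
  have "(\<lambda>p. Pser I (fst p) (snd p)) jointly_holomorphic_on off_poles I \<times> UNIV"
    unfolding Pser_def by (rule dominated_family_integral(1)[OF dominated_family_Pser])
  then have "cdiff_at (\<lambda>p. Pser I (fst p) (snd p)) (f p, g p)"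
    using assms(3) by (auto simp: jointly_holomorphic_on_iff)
  from cdiff_at_compose[where g="\<lambda>x. (f x, g x)", OF this] show ?thesis using assms by auto
qed

lemma Pser_Un:
  assumes "s \<in> off_poles (I \<union> J)" "I \<inter> J = {}" "finite J"
  shows "Pser (I \<union> J) s t = Pser I s t + (\<Sum>n\<in>J. (- t) ^ n / (fact n * (s + of_nat n)))"
proof -
  have *: "Infinite_Set_Sum.abs_summable_on (\<lambda>n. (- t) ^ n / (fact n * (s + of_nat n))) (I \<union> J)"
    using dominated_family_integrable[OF dominated_family_Pser, of "(s, t)" "I \<union> J"] assms(1)
    by (simp add: Infinite_Set_Sum.abs_summable_on_def)
  have "Infinite_Set_Sum.abs_summable_on (\<lambda>n. (- t) ^ n / (fact n * (s + of_nat n))) I"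
    "Infinite_Set_Sum.abs_summable_on (\<lambda>n. (- t) ^ n / (fact n * (s + of_nat n))) J"
    using abs_summable_on_subset[OF *] by auto
  from infsetsum_Un_disjoint[OF this assms(2)] show ?thesis
    using assms(3) by (simp add: Pser_def infsetsum_def flip: infsetsum_finite)
qed

text \<open>The exponential of \<open>- t * exp (- x)\<close> is expanded and integrated termwise;
  \<open>exp (- (s + n) * x)\<close> integrates to \<open>1 / (s + n)\<close>, which is where the
  poles at the nonpositive integers come from.\<close>

lemma Pint_eq_Pser:
  assumes s: "Re s > 0"
  shows "Pint s t = Pser UNIV s t"
proof -
  let ?f = "\<lambda>n x. (- t) ^ n / fact n * exp (- (s + of_nat n) * complex_of_real x)"
  have re: "Re (s + of_nat n) > 0" for n using s by simp
  have int: "integrable pos_lborel (\<lambda>x. exp (- (s + of_nat n) * complex_of_real x))" for n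
    using integrable_P[OF re[of n], of 0] by simp
  have val: "integral\<^sup>L pos_lborel (?f n) = (- t) ^ n / (fact n * (s + of_nat n))" for n
    using integral_exp_minus_complex[OF re[of n]] int[of n] by simp
  have ser: "(\<lambda>n. ?f n x) sums exp (- s * of_real x - t * of_real (exp (- x)))" for x
  proof -
    have "(\<lambda>n. exp (- s * of_real x) * ((- t * of_real (exp (- x))) ^ n /\<^sub>R fact n)) sums
        (exp (- s * of_real x) * exp (- t * of_real (exp (- x))))"
      by (intro sums_mult exp_converges)
    moreover have "exp (- s * of_real x) * ((- t * of_real (exp (- x))) ^ n /\<^sub>R fact n) = ?f n x" for n
    proof -
      have "complex_of_real (exp (- x)) ^ n = exp (- of_nat n * of_real x)"
      proof -
        have "complex_of_real (exp (- x)) ^ n = exp (- of_real x) ^ n"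
          by (simp flip: exp_of_real)
        also have "\<dots> = exp (of_nat n * (- of_real x))" by (rule exp_of_nat_mult[symmetric])
        finally show ?thesis by simp
      qed
      then show ?thesis
        by (simp only: power_mult_distrib exp_add[symmetric] scaleR_conv_of_real)
          (simp add: algebra_simps exp_diff exp_add exp_minus divide_inverse)
    qed
    ultimately show ?thesis by (simp add: exp_diff exp_minus divide_inverse)
  qed
  have nrm: "norm (?f n x) \<le> norm t ^ n / fact n * exp (- (Re s * x))" if "x > 0" for n x
  proof -
    have "norm (?f n x) = norm t ^ n / fact n * exp (- (Re s * x) - x * real n)"
      by (simp add: norm_mult norm_divide norm_power norm_exp_eq_Re algebra_simps)
    also have "\<dots> \<le> norm t ^ n / fact n * exp (- (Re s * x))"
      using that by (intro mult_left_mono) simp_all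
    finally show ?thesis .
  qed
  define I where "I = (\<integral>x. 1 * exp (- (Re s * x)) \<partial>pos_lborel)"
  have "integral\<^sup>L pos_lborel (\<lambda>x. \<Sum>n. ?f n x) = (\<Sum>n. integral\<^sup>L pos_lborel (?f n))"
  proof (rule integral_suminf)
    show "integrable pos_lborel (?f n)" for n using int[of n] by simp
    have sx: "summable (\<lambda>n. norm t ^ n / fact n * c)" for c :: real
      using summable_exp_generic[of "norm t"] by (intro summable_mult2) (simp add: divide_inverse mult.commute)
    show "AE x in pos_lborel. summable (\<lambda>n. norm (?f n x))"
      by (rule AE_I2, rule summable_comparison_test[OF _ sx])
        (use nrm in \<open>auto simp: space_restrict_space simp del: of_real_exp\<close>)
    show "summable (\<lambda>n. \<integral>x. norm (?f n x) \<partial>pos_lborel)"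
    proof (rule summable_comparison_test[OF _ sx[of I]], intro exI allI impI)
      fix n
      have "(\<integral>x. norm (?f n x) \<partial>pos_lborel) \<le> (\<integral>x. norm t ^ n / fact n * exp (- (Re s * x)) \<partial>pos_lborel)"
        using int[of n] by (intro integral_mono integrable_norm integrable_exp_minus s nrm)
          (auto simp: space_restrict_space)
      also have "\<dots> = norm t ^ n / fact n * I" by (simp add: I_def)
      finally show "norm (\<integral>x. norm (?f n x) \<partial>pos_lborel) \<le> norm t ^ n / fact n * I" by simp
    qed
  qed
  moreover have "(\<Sum>n. ?f n x) = exp (- s * of_real x - t * of_real (exp (- x)))" for x
    using ser by (rule sums_unique[symmetric])
  moreover have "Pser UNIV s t = (\<Sum>n. (- t) ^ n / (fact n * (s + of_nat n)))"
  proof -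
    have "s \<noteq> - of_nat n" for n using s by auto
    then have "(s, t) \<in> off_poles UNIV \<times> UNIV" by (auto simp: off_poles_def)
    from dominated_family_integrable[OF dominated_family_Pser this] show ?thesis
      unfolding Pser_def by (intro integral_count_space_nat) simp
  qed
  ultimately show ?thesis unfolding Pint_def val by simp
qed

text \<open>Continuation in \<open>s\<close> from the right half plane. The identity theorem applies
  because the plane without the countably many poles is connected.\<close>

lemma Gamma_Qint_Pser:
  assumes s: "s \<in> off_poles UNIV" and t: "t > 0"
  shows "Qint s (of_real t) + Pser UNIV s (of_real t) = Gamma s * complex_of_real t powr (- s)"
proof -
  have eq: "off_poles UNIV = - \<int>\<^sub>\<le>\<^sub>0"
    by (auto simp: off_poles_def elim!: nonpos_Ints_cases')
  have "Qint s (of_real t) + Pser UNIV s (of_real t) = Gamma s * complex_of_real t powr (- s)"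
  proof (rule analytic_continuation_open[of "{s. Re s > 0}" "off_poles UNIV" _ _ s])
    show "open {s. Re s > 0}" by (rule open_halfspace_Re_gt)
    show "{s. Re s > 0} \<noteq> {}" by (auto intro: exI[of _ 1])
    have "countable (\<int>\<^sub>\<le>\<^sub>0 :: complex set)"
      by (rule countable_subset[of _ "range (\<lambda>n::nat. - of_nat n)"]) (auto elim!: nonpos_Ints_cases')
    then show "connected (off_poles UNIV)"
      unfolding eq Compl_eq_Diff_UNIV by (intro connected_open_diff_countable) auto
    show "{s. Re s > 0} \<subseteq> off_poles UNIV" by (auto simp: off_poles_def)
    show "(\<lambda>s. Qint s (of_real t) + Pser UNIV s (of_real t)) holomorphic_on off_poles UNIV"
      using t by (intro holomorphic_on_cdiff cdiff_at_add cdiff_at_Qint cdiff_at_Pser) auto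
    show "(\<lambda>s. Gamma s * complex_of_real t powr (- s)) holomorphic_on off_poles UNIV"
      unfolding eq using t by (intro holomorphic_intros) auto
    show "Qint z (of_real t) + Pser UNIV z (of_real t) = Gamma z * complex_of_real t powr (- z)" if "z \<in> {s. Re s > 0}" for z
      using that Gamma_exp_integral[OF _ t] Pint_eq_Pser by simp
  qed (use s open_off_poles in auto)
  then show ?thesis .
qed

text \<open>At \<open>s = -l\<close> the pole of \<open>Gamma s * t powr (-s)\<close> cancels against the term \<open>n = l\<close> of the
  series, leaving a logarithm; the value at \<open>t = 1\<close> fixes the remaining multiple of \<open>t ^ l\<close>.\<close>

lemma Qint_neg_nat:
  obtains c where "\<And>t. t > 0 \<Longrightarrow> Qint (- of_nat l) (of_real t) =
     of_real ((-1) ^ (l + 1) / fact l * t ^ l * ln t) + c * of_real t ^ l - Pser (- {l}) (- of_nat l) (of_real t)"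
proof
  fix t :: real assume t: "t > 0"
  let ?V = "off_poles (- {l})"
  define G where "G s t = Qint s (of_real t) + Pser (- {l}) s (of_real t)" for s and t :: real
  \<comment> \<open>Off the poles \<open>G s t\<close> is \<open>Gamma s * t powr (- s)\<close>
    minus the term with the pole at \<open>- l\<close>. Subtracting \<open>t powr (- s)\<close>
    times the value at 1 removes the Gamma function, and what is left is a difference quotient of
    \<open>t powr (- s)\<close> at \<open>s = - l\<close>; its limit is the logarithm.\<close>
  define E where "E s = G s t - complex_of_real t powr (- s) * G s 1" for s
  have l: "- of_nat l \<in> ?V" by (auto simp: off_poles_def)
  have "cdiff_at (\<lambda>s. complex_of_real t powr (- s)) (- of_nat l)"
    using t by (intro cdiff_at_field_differentiable holomorphic_on_imp_differentiable_at[of _ UNIV] holomorphic_intros) auto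
  then have "cdiff_at E (- of_nat l)"
    unfolding E_def[abs_def] G_def[abs_def] using t l
    by (intro cdiff_at_diff cdiff_at_add cdiff_at_mult cdiff_at_Qint cdiff_at_Pser cdiff_at_ident cdiff_at_const) auto
  then have lim1: "E \<midarrow>- of_nat l\<rightarrow> E (- of_nat l)" using isCont_cdiff isCont_def by blast
  have "((\<lambda>s. complex_of_real t powr (- s)) has_field_derivative - (complex_of_real t powr (of_nat l) * of_real (ln t)))
      (at (- of_nat l))"
  proof -
    have "complex_of_real t powr z = exp (z * of_real (ln t))" for z
      using t by (simp add: powr_def Ln_of_real)
    then show ?thesis by (auto intro!: derivative_eq_intros)
  qed
  then have "((\<lambda>s. (complex_of_real t powr (- s) - complex_of_real t powr (of_nat l)) / (s - - of_nat l)) \<longlongrightarrow>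
      - (complex_of_real t powr (of_nat l) * of_real (ln t))) (at (- of_nat l))"
    by (simp add: has_field_derivative_iff)
  then have lim2: "((\<lambda>s. (-1) ^ l / fact l * ((complex_of_real t powr (- s) - complex_of_real t powr (of_nat l)) / (s - - of_nat l))) \<longlongrightarrow>
      (-1) ^ l / fact l * (- (complex_of_real t powr (of_nat l) * of_real (ln t)))) (at (- of_nat l))"
    by (rule tendsto_mult_left)
  have E: "E s = (-1) ^ l / fact l * ((complex_of_real t powr (- s) - complex_of_real t powr (of_nat l)) / (s - - of_nat l))"
    if s: "s \<in> ?V" "s \<noteq> - of_nat l" for s
  proof -
    have ni: "s \<in> off_poles UNIV" using s by (auto simp: off_poles_def)
    have sl: "s + of_nat l \<noteq> 0" using s(2) by (auto simp: eq_neg_iff_add_eq_0)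
    have G: "G s a = Gamma s * of_real a powr (- s) - (- of_real a) ^ l / (fact l * (s + of_nat l))" if "a > 0" for a
      using Gamma_Qint_Pser[OF ni that] Pser_Un[of s "- {l}" "{l}" "of_real a"] ni by (simp add: G_def Un_commute algebra_simps)
    have "E s = - ((- of_real t) ^ l / (fact l * (s + of_nat l))) + complex_of_real t powr (- s) * ((- 1) ^ l / (fact l * (s + of_nat l)))"
    proof -
      have "G s 1 = Gamma s - (- 1) ^ l / (fact l * (s + of_nat l))" using G[of 1] by simp
      moreover have "g * x - a - x * (g - b) = - a + x * b" for g x a b :: complex
        by (simp add: algebra_simps)
      ultimately show ?thesis unfolding E_def G[OF t] by simp
    qed
    also have "(- of_real t) ^ l = (-1) ^ l * complex_of_real t powr (of_nat l :: complex)"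
      using t by (simp add: powr_nat power_minus[of "of_real t"])
    finally have "E s = - ((-1) ^ l * complex_of_real t powr (of_nat l) / (fact l * (s + of_nat l))) +
        complex_of_real t powr (- s) * ((- 1) ^ l / (fact l * (s + of_nat l)))" .
    also have "- (m * a / (f * d)) + b * (m / (f * d)) = m / f * ((b - a) / d)" for m a f d b :: complex
      by (cases "f = 0"; cases "d = 0"; simp add: field_simps)
    finally show ?thesis by simp
  qed
  have ev: "\<forall>\<^sub>F s in at (- of_nat l). (-1) ^ l / fact l * ((complex_of_real t powr (- s) - complex_of_real t powr (of_nat l)) / (s - - of_nat l)) = E s"
    using eventually_at_in_open[OF open_off_poles l] by eventually_elim (use E in auto)
  from LIM_unique[OF lim1 Lim_transform_eventually[OF lim2 ev]]
  have "E (- of_nat l) = (-1) ^ l / fact l * (- (complex_of_real t powr (of_nat l) * of_real (ln t)))" .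
  then have "Qint (- of_nat l) (of_real t) + Pser (- {l}) (- of_nat l) (of_real t) - of_real t ^ l * G (- of_nat l) 1 =
      (-1) ^ l / fact l * (- (of_real t ^ l * of_real (ln t)))"
    using t by (simp add: E_def G_def[of _ t] powr_nat)
  moreover have "a = - (m * T * L) + g * T - p" if "a + p - T * g = m * (- (T * L))" for a p T g m L :: complex
    using that by (simp add: algebra_simps)
  ultimately have "Qint (- of_nat l) (of_real t) =
     - ((-1) ^ l / fact l * of_real t ^ l * of_real (ln t)) + G (- of_nat l) 1 * of_real t ^ l - Pser (- {l}) (- of_nat l) (of_real t)"
    by blast
  then show "Qint (- of_nat l) (of_real t) =
     of_real ((-1) ^ (l + 1) / fact l * t ^ l * ln t) + G (- of_nat l) 1 * of_real t ^ l - Pser (- {l}) (- of_nat l) (of_real t)"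
    by simp
qed

section \<open>Gaussian integrals\<close>

lemma prod_Basis_cart:
  fixes f :: "real ^ 'n \<Rightarrow> 'a::comm_monoid_mult"
  shows "(\<Prod>b\<in>Basis. f b) = (\<Prod>i\<in>UNIV. f (axis i 1))"
proof -
  have B: "(Basis :: (real ^ 'n) set) = range (\<lambda>i. axis i 1)" by (auto simp: Basis_vec_def)
  have "inj (\<lambda>i::'n. axis i (1::real))" by (auto simp: inj_on_def axis_eq_axis)
  then show ?thesis unfolding B by (simp add: prod.reindex)
qed

lemma sum_Basis_cart:
  fixes f :: "real ^ 'n \<Rightarrow> 'a::comm_monoid_add"
  shows "(\<Sum>b\<in>Basis. f b) = (\<Sum>i\<in>UNIV. f (axis i 1))"
proof -
  have B: "(Basis :: (real ^ 'n) set) = range (\<lambda>i. axis i 1)" by (auto simp: Basis_vec_def)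
  have "inj (\<lambda>i::'n. axis i (1::real))" by (auto simp: inj_on_def axis_eq_axis)
  then show ?thesis unfolding B by (simp add: sum.reindex)
qed

lemma measurable_vec_lambda [measurable]:
  "(\<lambda>f. \<chi> i. f i) \<in> PiM UNIV (\<lambda>_::'n::finite. lborel :: real measure) \<rightarrow>\<^sub>M (borel :: (real ^ 'n) measure)"
proof (rule borel_measurable_euclidean_space[THEN iffD2], rule ballI)
  fix b :: "real ^ 'n" assume "b \<in> Basis"
  then obtain i where "b = axis i 1" by (auto simp: Basis_vec_def)
  then show "(\<lambda>f. (\<chi> i. f i) \<bullet> b) \<in> borel_measurable (PiM UNIV (\<lambda>_. lborel))"
    by (simp add: inner_axis)
qed

lemma product_sigma_finite_lborel: "product_sigma_finite (\<lambda>_. lborel :: real measure)"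
  by standard

text \<open>Identifies Lebesgue measure on vectors with a product measure, for which coordinates can
  be integrated one at a time.\<close>

lemma lborel_cart:
  "(lborel :: (real ^ 'n::finite) measure) = distr (PiM UNIV (\<lambda>_. lborel)) borel (\<lambda>f. \<chi> i. f i)"
proof (rule lborel_eqI)
  interpret product_sigma_finite "\<lambda>_::'n. lborel :: real measure" by (rule product_sigma_finite_lborel)
  fix l u :: "real ^ 'n" assume le: "\<And>b. b \<in> Basis \<Longrightarrow> l \<bullet> b \<le> u \<bullet> b"
  have le': "l $ i \<le> u $ i" for i using le[of "axis i 1"] by (simp add: inner_axis axis_in_Basis_iff)
  have "emeasure (distr (PiM UNIV (\<lambda>_. lborel)) borel (\<lambda>f. \<chi> i. f i)) (box l u) =
      emeasure (PiM UNIV (\<lambda>_::'n. lborel :: real measure)) (PiE UNIV (\<lambda>i. {l $ i<..<u $ i}))"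
    by (subst emeasure_distr) (auto intro!: arg_cong2[where f=emeasure] simp: mem_box_cart space_PiM PiE_def Pi_iff)
  also have "\<dots> = (\<Prod>i\<in>UNIV. emeasure lborel {l $ i<..<u $ i})" by (rule emeasure_PiM) auto
  also have "\<dots> = ennreal (\<Prod>b\<in>Basis. (u - l) \<bullet> b)"
    using le' by (simp add: prod_Basis_cart inner_axis prod_ennreal inner_diff_left)
  finally show "emeasure (distr (PiM UNIV (\<lambda>_. lborel)) borel (\<lambda>f. \<chi> i. f i)) (box l u) =
    ennreal (\<Prod>b\<in>Basis. (u - l) \<bullet> b)" .
qed simp

lemma integral_prod_cart:
  fixes f :: "'n::finite \<Rightarrow> real \<Rightarrow> complex"
  assumes f: "\<And>i. integrable lborel (f i)"
  shows "integrable lborel (\<lambda>x::real ^ 'n. \<Prod>i\<in>UNIV. f i (x $ i))"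
    and "(\<integral>x. (\<Prod>i\<in>UNIV. f i (x $ i)) \<partial>(lborel :: (real ^ 'n) measure)) = (\<Prod>i\<in>UNIV. (\<integral>t. f i t \<partial>lborel))"
proof -
  interpret product_sigma_finite "\<lambda>_::'n. lborel :: real measure" by (rule product_sigma_finite_lborel)
  have [measurable]: "f i \<in> borel_measurable borel" for i using borel_measurable_integrable[OF f[of i]] by simp
  have [measurable]: "(\<lambda>x::real ^ 'n. f i (x $ i)) \<in> borel_measurable borel" for i
  proof (rule measurable_compose[where f="\<lambda>x::real ^ 'n. x $ i" and g="f i" and N=borel])
    show "(\<lambda>x::real ^ 'n. x $ i) \<in> borel_measurable borel"
      by (intro borel_measurable_continuous_onI continuous_intros)
  qed measurable
  have int: "integrable (PiM UNIV (\<lambda>_. lborel)) (\<lambda>x. \<Prod>i\<in>UNIV. f i (x i))"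
    by (rule product_integrable_prod) (use f in auto)
  show "integrable lborel (\<lambda>x::real ^ 'n. \<Prod>i\<in>UNIV. f i (x $ i))"
    unfolding lborel_cart by (subst integrable_distr_eq) (use int in auto)
  have "(\<integral>x. (\<Prod>i\<in>UNIV. f i (x $ i)) \<partial>(lborel :: (real ^ 'n) measure)) = (\<integral>x. (\<Prod>i\<in>UNIV. f i (x i)) \<partial>PiM UNIV (\<lambda>_. lborel))"
    by (subst lborel_cart, subst integral_distr) auto
  also have "\<dots> = (\<Prod>i\<in>UNIV. (\<integral>t. f i t \<partial>lborel))"
    by (rule product_integral_prod) (use f in auto)
  finally show "(\<integral>x. (\<Prod>i\<in>UNIV. f i (x $ i)) \<partial>(lborel :: (real ^ 'n) measure)) = (\<Prod>i\<in>UNIV. (\<integral>t. f i t \<partial>lborel))" .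
qed

section \<open>Linear change of variables for Lebesgue measure\<close>

lemma measurable_matrix_vector [measurable]:
  "(\<lambda>x. A *v x) \<in> (borel :: (real ^ 'n) measure) \<rightarrow>\<^sub>M (borel :: (real ^ 'm::finite) measure)"
  by (intro borel_measurable_continuous_onI linear_continuous_on matrix_vector_mul_bounded_linear)

text \<open>Induction over elementary matrices. Quantifying over all Borel functions
  \<open>h\<close> lets a product be treated by applying the claim for one factor to
  \<open>h\<close> composed with the other; a zero row contradicts the nonzero determinant.\<close>

lemma nn_integral_linear_change:
  fixes A :: "real ^ 'n ^ 'n::finite"
  shows "det A \<noteq> 0 \<longrightarrow> (\<forall>h\<in>borel_measurable borel.
     ennreal \<bar>det A\<bar> * (\<integral>\<^sup>+x. h (A *v x) \<partial>lborel) = (\<integral>\<^sup>+x. h x \<partial>lborel))"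
proof (rule induct_matrix_elementary_alt[of "\<lambda>A. det A \<noteq> 0 \<longrightarrow> (\<forall>h\<in>borel_measurable borel.
     ennreal \<bar>det A\<bar> * (\<integral>\<^sup>+x. h (A *v x) \<partial>lborel) = (\<integral>\<^sup>+x. h x \<partial>lborel))"]; (intro impI ballI)?)
  fix A B :: "real ^ 'n ^ 'n" and h :: "real ^ 'n \<Rightarrow> ennreal"
  assume A: "det A \<noteq> 0 \<longrightarrow> (\<forall>h\<in>borel_measurable borel. ennreal \<bar>det A\<bar> * (\<integral>\<^sup>+x. h (A *v x) \<partial>lborel) = (\<integral>\<^sup>+x. h x \<partial>lborel))"
    and B: "det B \<noteq> 0 \<longrightarrow> (\<forall>h\<in>borel_measurable borel. ennreal \<bar>det B\<bar> * (\<integral>\<^sup>+x. h (B *v x) \<partial>lborel) = (\<integral>\<^sup>+x. h x \<partial>lborel))"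
    and AB: "det (A ** B) \<noteq> 0" and h [measurable]: "h \<in> borel_measurable borel"
  have nz: "det A \<noteq> 0" "det B \<noteq> 0" using AB by (auto simp: det_mul)
  have "(\<lambda>x. h (A *v x)) \<in> borel_measurable borel" by measurable
  from B[THEN mp, OF nz(2), THEN bspec, OF this]
  have "ennreal \<bar>det B\<bar> * (\<integral>\<^sup>+x. h (A *v (B *v x)) \<partial>lborel) = (\<integral>\<^sup>+x. h (A *v x) \<partial>lborel)" .
  moreover have "ennreal \<bar>det A\<bar> * (\<integral>\<^sup>+x. h (A *v x) \<partial>lborel) = (\<integral>\<^sup>+x. h x \<partial>lborel)" using A nz h by blast
  ultimately show "ennreal \<bar>det (A ** B)\<bar> * (\<integral>\<^sup>+x. h (A ** B *v x) \<partial>lborel) = (\<integral>\<^sup>+x. h x \<partial>lborel)"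
    by (simp add: det_mul abs_mult ennreal_mult matrix_vector_mul_assoc[symmetric] mult.assoc)
next
  fix A :: "real ^ 'n ^ 'n" and i and h :: "real ^ 'n \<Rightarrow> ennreal"
  assume "row i A = 0" "det A \<noteq> 0"
  then show "ennreal \<bar>det A\<bar> * (\<integral>\<^sup>+x. h (A *v x) \<partial>lborel) = (\<integral>\<^sup>+x. h x \<partial>lborel)"
    using det_zero_row(1) by blast
next
  fix A :: "real ^ 'n ^ 'n" and h :: "real ^ 'n \<Rightarrow> ennreal"
  assume diag: "\<And>i j. i \<noteq> j \<Longrightarrow> A $ i $ j = 0" and nz: "det A \<noteq> 0" and h [measurable]: "h \<in> borel_measurable borel"
  have det: "det A = (\<Prod>i\<in>UNIV. A $ i $ i)" by (rule det_diagonal) (use diag in auto)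
  define c :: "real ^ 'n \<Rightarrow> real" where "c b = b \<bullet> (A *v b)" for b
  have c: "c (axis i 1) = A $ i $ i" for i
    by (simp add: c_def inner_axis' matrix_vector_mult_basis column_def)
  have T: "0 + (\<Sum>j\<in>Basis. (c j * (x \<bullet> j)) *\<^sub>R j) = A *v x" for x
  proof -
    have "(A *v x) $ i = (\<Sum>j\<in>UNIV. if j = i then A $ i $ i * x $ i else 0)" for i
      unfolding matrix_vector_mult_def by (subst vec_lambda_beta, rule sum.cong) (auto simp: diag)
    moreover have "(\<Sum>j\<in>Basis. (c j * (x \<bullet> j)) *\<^sub>R j) $ i = (\<Sum>j\<in>UNIV. if j = i then A $ i $ i * x $ i else 0)" for i
      unfolding sum_Basis_cart sum_component c inner_axis by (rule sum.cong) (auto simp: axis_def)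
    ultimately show ?thesis by (simp add: vec_eq_iff)
  qed
  have nz': "c j \<noteq> 0" if "j \<in> Basis" for j
    using that nz unfolding det by (auto simp: Basis_vec_def c)
  have "(lborel :: (real ^ 'n) measure) = density (distr lborel borel (\<lambda>x. A *v x)) (\<lambda>_. ennreal (\<Prod>j\<in>Basis. \<bar>c j\<bar>))"
    using lborel_affine_euclidean[of c 0, OF nz'] unfolding T .
  then have "(\<integral>\<^sup>+x. h x \<partial>lborel) = (\<integral>\<^sup>+x. h x \<partial>density (distr lborel borel (\<lambda>x. A *v x)) (\<lambda>_. ennreal (\<Prod>j\<in>Basis. \<bar>c j\<bar>)))"
    by simp
  also have "\<dots> = ennreal \<bar>det A\<bar> * (\<integral>\<^sup>+x. h (A *v x) \<partial>lborel)"
    by (subst nn_integral_density) (auto simp: nn_integral_distr nn_integral_cmult prod_Basis_cart c det abs_prod)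
  finally show "ennreal \<bar>det A\<bar> * (\<integral>\<^sup>+x. h (A *v x) \<partial>lborel) = (\<integral>\<^sup>+x. h x \<partial>lborel)" by simp
next
  fix m n :: 'n and h :: "real ^ 'n \<Rightarrow> ennreal"
  assume mn: "m \<noteq> n" and h [measurable]: "h \<in> borel_measurable borel"
  let ?\<pi> = "Transposition.transpose m n"
  let ?A = "(\<chi> i j. mat 1 $ i $ ?\<pi> j) :: real ^ 'n ^ 'n"
  have A: "(?A *v x) $ i = x $ ?\<pi> i" for x i
  proof -
    have "(?A *v x) $ i = (\<Sum>j\<in>UNIV. if j = ?\<pi> i then x $ ?\<pi> i else 0)"
      unfolding matrix_vector_mult_def by (subst vec_lambda_beta, rule sum.cong) (auto simp: mat_def)
    then show ?thesis by simp
  qed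
  have "\<bar>det ?A\<bar> = 1"
  proof -
    have "?A = (\<chi> i. (mat 1 :: real ^ 'n ^ 'n) $ ?\<pi> i)" by (auto simp: vec_eq_iff mat_def)
    then have "det ?A = of_int (sign ?\<pi>) * det (mat 1 :: real ^ 'n ^ 'n)"
      using det_permute_rows[of ?\<pi> "mat 1 :: real ^ 'n ^ 'n"] by (simp add: permutes_swap_id)
    then show ?thesis by (simp add: sign_def)
  qed
  moreover have "(lborel :: (real ^ 'n) measure) = distr lborel borel (\<lambda>x. ?A *v x)"
  proof (rule lborel_eqI)
    fix l u :: "real ^ 'n" assume le: "\<And>b. b \<in> Basis \<Longrightarrow> l \<bullet> b \<le> u \<bullet> b"
    have le': "l $ i \<le> u $ i" for i using le[of "axis i 1"] by (simp add: inner_axis axis_in_Basis_iff)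
    have "(\<lambda>x. ?A *v x) -` box l u = box (\<chi> i. l $ ?\<pi> i) (\<chi> i. u $ ?\<pi> i)"
    proof -
      have "(\<forall>i. l $ i < x $ ?\<pi> i \<and> x $ ?\<pi> i < u $ i) \<longleftrightarrow> (\<forall>i. l $ ?\<pi> i < x $ i \<and> x $ i < u $ ?\<pi> i)" for x :: "real ^ 'n"
        by (metis transpose_involutory)
      then show ?thesis by (auto simp: mem_box_cart A)
    qed
    then have "emeasure (distr lborel borel (\<lambda>x. ?A *v x)) (box l u) = emeasure lborel (box (\<chi> i. l $ ?\<pi> i) (\<chi> i. u $ ?\<pi> i))"
      by (subst emeasure_distr) auto
    also have "\<dots> = ennreal (\<Prod>i\<in>UNIV. u $ ?\<pi> i - l $ ?\<pi> i)"
    proof (subst emeasure_lborel_box)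
      show "(\<chi> i. l $ ?\<pi> i) \<bullet> b \<le> (\<chi> i. u $ ?\<pi> i) \<bullet> b" if "b \<in> Basis" for b
        using that le' by (auto simp: Basis_vec_def inner_axis)
    qed (simp add: prod_Basis_cart inner_diff_left inner_axis)
    also have "(\<Prod>i\<in>UNIV. u $ ?\<pi> i - l $ ?\<pi> i) = (\<Prod>i\<in>UNIV. u $ i - l $ i)"
      by (rule prod.reindex_bij_betw[of ?\<pi> UNIV UNIV "\<lambda>i. u $ i - l $ i"]) simp
    also have "\<dots> = (\<Prod>b\<in>Basis. (u - l) \<bullet> b)" by (simp add: prod_Basis_cart inner_axis inner_diff_left)
    finally show "emeasure (distr lborel borel (\<lambda>x. ?A *v x)) (box l u) = ennreal (\<Prod>b\<in>Basis. (u - l) \<bullet> b)" .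
  qed simp
  then have "(\<integral>\<^sup>+x. h x \<partial>lborel) = (\<integral>\<^sup>+x. h x \<partial>distr lborel borel (\<lambda>x. ?A *v x))" by simp
  then have "(\<integral>\<^sup>+x. h x \<partial>lborel) = (\<integral>\<^sup>+x. h (?A *v x) \<partial>lborel)" by (simp add: nn_integral_distr)
  ultimately show "ennreal \<bar>det ?A\<bar> * (\<integral>\<^sup>+x. h (?A *v x) \<partial>lborel) = (\<integral>\<^sup>+x. h x \<partial>lborel)" by simp
next
  fix m n :: 'n and h :: "real ^ 'n \<Rightarrow> ennreal"
  assume mn: "m \<noteq> n" and h [measurable]: "h \<in> borel_measurable borel"
  let ?A = "(\<chi> i j. of_bool (i = m \<and> j = n \<or> i = j)) :: real ^ 'n ^ 'n"
  have A: "?A *v (\<chi> i. (x(m := y)) i) = (\<chi> i. (x(m := x n + 1 * y)) i)" for x y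
  proof -
    have "(?A *v (\<chi> i. (x(m := y)) i)) $ i = (\<chi> i. (x(m := x n + 1 * y)) i) $ i" for i
    proof (cases "i = m")
      case True
      have "(?A *v (\<chi> i. (x(m := y)) i)) $ i = (\<Sum>j\<in>UNIV. (if j = m then y else 0) + (if j = n then x n else 0))"
        unfolding matrix_vector_mult_def using True mn by (subst vec_lambda_beta, intro sum.cong) auto
      then show ?thesis using True by (simp add: sum.distrib)
    next
      case False
      have "(?A *v (\<chi> i. (x(m := y)) i)) $ i = (\<Sum>j\<in>UNIV. if j = i then x i else 0)"
        unfolding matrix_vector_mult_def using False by (subst vec_lambda_beta, intro sum.cong) auto
      then show ?thesis using False by simp
    qed
    then show ?thesis by (intro vec_eq_iff[THEN iffD2] allI)
  qed
  interpret product_sigma_finite "\<lambda>_::'n. lborel :: real measure" by (rule product_sigma_finite_lborel)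
  \<comment> \<open>With coordinate \<open>m\<close> innermost, the shear adds \<open>x n\<close> to
    it and thus acts on the inner integral as a translation.\<close>
  have ins: "(\<integral>\<^sup>+x. g x \<partial>lborel) = (\<integral>\<^sup>+x. \<integral>\<^sup>+y. g (\<chi> i. (x(m := y)) i) \<partial>lborel \<partial>PiM (UNIV - {m}) (\<lambda>_. lborel))"
    if [measurable]: "g \<in> borel_measurable borel" for g :: "real ^ 'n \<Rightarrow> ennreal"
  proof -
    have "(\<integral>\<^sup>+x. g x \<partial>lborel) = (\<integral>\<^sup>+x. g (\<chi> i. x i) \<partial>PiM UNIV (\<lambda>_. lborel))"
      by (subst lborel_cart) (simp add: nn_integral_distr)
    also have "\<dots> = (\<integral>\<^sup>+x. g (\<chi> i. x i) \<partial>PiM (insert m (UNIV - {m})) (\<lambda>_. lborel))"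
      by (simp add: insert_absorb)
    also have "\<dots> = (\<integral>\<^sup>+x. \<integral>\<^sup>+y. g (\<chi> i. (x(m := y)) i) \<partial>lborel \<partial>PiM (UNIV - {m}) (\<lambda>_. lborel))"
      by (rule product_nn_integral_insert) (simp_all add: insert_absorb)
    finally show ?thesis .
  qed
  have "(\<integral>\<^sup>+x. h (?A *v x) \<partial>lborel) =
     (\<integral>\<^sup>+x. \<integral>\<^sup>+y. h (\<chi> i. (x(m := x n + 1 * y)) i) \<partial>lborel \<partial>PiM (UNIV - {m}) (\<lambda>_. lborel))"
    by (subst ins) (simp_all only: A, measurable)
  also have "\<dots> = (\<integral>\<^sup>+x. \<integral>\<^sup>+y. h (\<chi> i. (x(m := y)) i) \<partial>lborel \<partial>PiM (UNIV - {m}) (\<lambda>_. lborel))"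
  proof (rule nn_integral_cong)
    fix x :: "'n \<Rightarrow> real"
    have m: "(\<lambda>y. h (\<chi> i. (x(m := y)) i)) \<in> borel_measurable borel"
    proof (rule measurable_compose[OF _ h], rule borel_measurable_continuous_onI)
      show "continuous_on UNIV (\<lambda>y. \<chi> i. (x(m := y)) i)"
      proof (rule continuous_on_vec_lambda)
        show "continuous_on UNIV (\<lambda>y. (x(m := y)) i)" for i
          by (cases "i = m") (simp_all add: continuous_on_id)
      qed
    qed
    show "(\<integral>\<^sup>+y. h (\<chi> i. (x(m := x n + 1 * y)) i) \<partial>lborel) = (\<integral>\<^sup>+y. h (\<chi> i. (x(m := y)) i) \<partial>lborel)"
      using nn_integral_real_affine[OF m, of 1 "x n"] by simp
  qed
  also have "\<dots> = (\<integral>\<^sup>+x. h x \<partial>lborel)" by (rule ins[symmetric]) measurable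
  finally have "(\<integral>\<^sup>+x. h (?A *v x) \<partial>lborel) = (\<integral>\<^sup>+x. h x \<partial>lborel)" .
  moreover have "det ?A = 1"
  proof -
    let ?B = "(mat 1) :: real ^ 'n ^ 'n"
    have "?A = (\<chi> k. if k = m then row m ?B + 1 *s row n ?B else row k ?B)"
      using mn by (auto simp: vec_eq_iff row_def mat_def of_bool_def)
    then show ?thesis using det_row_operation[OF mn, of ?B 1] by simp
  qed
  ultimately show "ennreal \<bar>det ?A\<bar> * (\<integral>\<^sup>+x. h (?A *v x) \<partial>lborel) = (\<integral>\<^sup>+x. h x \<partial>lborel)" by simp
qed

lemma integral_linear_change:
  fixes A :: "real ^ 'n ^ 'n::finite" and f :: "real ^ 'n \<Rightarrow> complex"
  assumes A: "invertible A" and f: "f \<in> borel_measurable borel"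
  shows "integrable lborel (\<lambda>x. f (A *v x)) \<longleftrightarrow> integrable lborel f"
    and "(\<integral>x. f (A *v x) \<partial>lborel) = (\<integral>x. f x \<partial>lborel) / of_real \<bar>det A\<bar>"
proof -
  have nz: "det A \<noteq> 0" using A by (simp add: invertible_det_nz)
  have eq: "(lborel :: (real ^ 'n) measure) = density (distr lborel borel (\<lambda>x. A *v x)) (\<lambda>_. ennreal \<bar>det A\<bar>)"
  proof (rule measure_eqI)
    fix S :: "(real ^ 'n) set" assume "S \<in> sets lborel"
    then have [measurable]: "S \<in> sets borel" by simp
    have "emeasure lborel S = (\<integral>\<^sup>+x. indicator S x \<partial>lborel)" by simp
    also have "\<dots> = ennreal \<bar>det A\<bar> * (\<integral>\<^sup>+x. indicator S (A *v x) \<partial>lborel)"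
      using nn_integral_linear_change[of A] nz by (metis \<open>S \<in> sets borel\<close> borel_measurable_indicator)
    also have "\<dots> = ennreal \<bar>det A\<bar> * (\<integral>\<^sup>+x. indicator S x \<partial>distr lborel borel (\<lambda>x. A *v x))"
      by (subst nn_integral_distr) auto
    also have "\<dots> = (\<integral>\<^sup>+x. ennreal \<bar>det A\<bar> * indicator S x \<partial>distr lborel borel (\<lambda>x. A *v x))"
      by (subst nn_integral_cmult) auto
    also have "\<dots> = emeasure (density (distr lborel borel (\<lambda>x. A *v x)) (\<lambda>_. ennreal \<bar>det A\<bar>)) S"
      by (subst emeasure_density) auto
    finally show "emeasure lborel S = emeasure (density (distr lborel borel (\<lambda>x. A *v x)) (\<lambda>_. ennreal \<bar>det A\<bar>)) S" .
  qed simp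
  have 1: "integrable lborel f \<longleftrightarrow> integrable (density (distr lborel borel (\<lambda>x. A *v x)) (\<lambda>_. ennreal \<bar>det A\<bar>)) f"
    by (subst eq) simp
  also have "\<dots> \<longleftrightarrow> integrable lborel (\<lambda>x. \<bar>det A\<bar> *\<^sub>R f (A *v x))"
    using f nz by (subst integrable_density) (auto simp: integrable_distr_eq)
  also have "\<dots> \<longleftrightarrow> integrable lborel (\<lambda>x. f (A *v x))"
  proof
    assume "integrable lborel (\<lambda>x. \<bar>det A\<bar> *\<^sub>R f (A *v x))"
    then have "integrable lborel (\<lambda>x. inverse \<bar>det A\<bar> *\<^sub>R (\<bar>det A\<bar> *\<^sub>R f (A *v x)))"
      by (rule integrable_scaleR_right)
    then show "integrable lborel (\<lambda>x. f (A *v x))" using nz by simp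
  qed (rule integrable_scaleR_right)
  finally show "integrable lborel (\<lambda>x. f (A *v x)) \<longleftrightarrow> integrable lborel f" by simp
  have "(\<integral>x. f x \<partial>lborel) = (\<integral>x. f x \<partial>density (distr lborel borel (\<lambda>x. A *v x)) (\<lambda>_. ennreal \<bar>det A\<bar>))"
    by (subst eq) simp
  also have "\<dots> = of_real \<bar>det A\<bar> * (\<integral>x. f (A *v x) \<partial>lborel)"
    using f by (subst integral_density) (auto simp: integral_distr scaleR_conv_of_real)
  finally show "(\<integral>x. f (A *v x) \<partial>lborel) = (\<integral>x. f x \<partial>lborel) / of_real \<bar>det A\<bar>" using nz by simp
qed

text \<open>A rescaling of the characteristic function of the standard normal distribution:
  \<open>c\<close> makes the density at \<open>c * t\<close> a multiple of
  \<open>exp (- (pi * \<tau> * t\<^sup>2))\<close>, and \<open>s\<close> is fixed by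
  \<open>s * c = - 2 * pi * \<xi>\<close>.\<close>

lemma gaussian_fourier_real:
  assumes \<tau>: "\<tau> > 0"
  shows "integrable lborel (\<lambda>t. exp (- 2 * pi * \<i> * of_real \<xi> * of_real t - of_real (pi * \<tau> * t\<^sup>2)))"
    and "(\<integral>t. exp (- 2 * pi * \<i> * of_real \<xi> * of_real t - of_real (pi * \<tau> * t\<^sup>2)) \<partial>lborel) =
       of_real (exp (- pi * \<xi>\<^sup>2 / \<tau>) / sqrt \<tau>)"
proof -
  define c where "c = sqrt (2 * pi * \<tau>)"
  have c: "c > 0" "c\<^sup>2 = 2 * pi * \<tau>" using \<tau> by (simp_all add: c_def)
  define s where "s = - 2 * pi * \<xi> / c"
  interpret prob_space std_normal_distribution
    by (rule real_distribution.axioms(1)[OF real_dist_normal_dist])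
  define g where "g x = std_normal_density x *\<^sub>R exp (\<i> * complex_of_real (s * x))" for x
  have m: "(\<lambda>x. exp (\<i> * complex_of_real (s * x))) \<in> borel_measurable lborel" by measurable
  have "integrable std_normal_distribution (\<lambda>x. exp (\<i> * complex_of_real (s * x)))"
    by (intro integrable_iexp) auto
  then have int: "integrable lborel g"
    unfolding g_def using m by (subst (asm) integrable_density) auto
  have val: "(\<integral>x. g x \<partial>lborel) = of_real (exp (- s\<^sup>2 / 2))"
  proof -
    have "(\<integral>x. exp (\<i> * complex_of_real (s * x)) \<partial>std_normal_distribution) = of_real (exp (- s\<^sup>2 / 2))"
      using fun_cong[OF char_std_normal_distribution, of s] by (simp add: char_def)
    then show ?thesis unfolding g_def using m by (subst (asm) integral_density) auto
  qed
  have g: "g (0 + c * t) = of_real (1 / sqrt (2 * pi)) * exp (- 2 * pi * \<i> * of_real \<xi> * of_real t - of_real (pi * \<tau> * t\<^sup>2))" for t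
  proof -
    have "std_normal_density (c * t) = 1 / sqrt (2 * pi) * exp (- (pi * \<tau> * t\<^sup>2))"
      using c(2) by (simp add: std_normal_density_def power_mult_distrib)
    moreover have "s * (c * t) = - 2 * pi * \<xi> * t" using c by (simp add: s_def)
    ultimately have "g (0 + c * t) = of_real (1 / sqrt (2 * pi)) * (exp (of_real (- (pi * \<tau> * t\<^sup>2))) * exp (\<i> * complex_of_real (- 2 * pi * \<xi> * t)))"
      unfolding g_def by (simp add: scaleR_conv_of_real) (simp flip: exp_of_real)
    also have "exp (of_real (- (pi * \<tau> * t\<^sup>2))) * exp (\<i> * complex_of_real (- 2 * pi * \<xi> * t)) =
        exp (- 2 * pi * \<i> * of_real \<xi> * of_real t - of_real (pi * \<tau> * t\<^sup>2))"
      unfolding exp_add[symmetric] by (rule arg_cong[where f=exp]) (simp add: algebra_simps)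
    finally show ?thesis .
  qed
  have 2: "sqrt (2 * pi) \<noteq> 0" by simp
  have "integrable lborel (\<lambda>t. g (0 + c * t))"
    by (rule lborel_integrable_real_affine[OF int]) (use c in simp)
  then show "integrable lborel (\<lambda>t. exp (- 2 * pi * \<i> * of_real \<xi> * of_real t - of_real (pi * \<tau> * t\<^sup>2)))"
    unfolding g
  proof -
    assume h: "integrable lborel (\<lambda>t. of_real (1 / sqrt (2 * pi)) * exp (- 2 * pi * \<i> * of_real \<xi> * of_real t - of_real (pi * \<tau> * t\<^sup>2)))"
    have "integrable lborel (\<lambda>t. of_real (sqrt (2 * pi)) * (of_real (1 / sqrt (2 * pi)) *
        exp (- 2 * pi * \<i> * of_real \<xi> * of_real t - of_real (pi * \<tau> * t\<^sup>2))))"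
      by (rule integrable_mult_right[OF h])
    moreover have "complex_of_real (sqrt (2 * pi)) * (of_real (1 / sqrt (2 * pi)) * z) = z" for z
      by simp
    ultimately show ?thesis by (simp only:)
  qed
  have "of_real (exp (- s\<^sup>2 / 2)) = c *\<^sub>R (\<integral>t. g (0 + c * t) \<partial>lborel)"
    using lborel_integral_real_affine[of c g 0] c val by simp
  also have "\<dots> = of_real (c / sqrt (2 * pi)) * (\<integral>t. exp (- 2 * pi * \<i> * of_real \<xi> * of_real t - of_real (pi * \<tau> * t\<^sup>2)) \<partial>lborel)"
    unfolding g by (simp add: scaleR_conv_of_real)
  also have "c / sqrt (2 * pi) = sqrt \<tau>" using \<tau> by (simp add: c_def real_sqrt_mult)
  also have "- s\<^sup>2 / 2 = - pi * \<xi>\<^sup>2 / \<tau>" using c \<tau> by (simp add: s_def power_divide power_mult_distrib power2_eq_square[of pi])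
  finally show "(\<integral>t. exp (- 2 * pi * \<i> * of_real \<xi> * of_real t - of_real (pi * \<tau> * t\<^sup>2)) \<partial>lborel) =
       of_real (exp (- pi * \<xi>\<^sup>2 / \<tau>) / sqrt \<tau>)" using \<tau> by (simp add: field_simps)
qed

lemma gaussian_fourier_cart:
  fixes \<xi> :: "real ^ 'n::finite"
  assumes \<tau>: "\<tau> > 0"
  shows "integrable lborel (\<lambda>v. exp (- 2 * pi * \<i> * of_real (\<xi> \<bullet> v) - of_real (pi * \<tau> * (norm v)\<^sup>2)))"
    and "(\<integral>v. exp (- 2 * pi * \<i> * of_real (\<xi> \<bullet> v) - of_real (pi * \<tau> * (norm v)\<^sup>2)) \<partial>lborel) =
       of_real (exp (- pi * (norm \<xi>)\<^sup>2 / \<tau>) / sqrt \<tau> ^ CARD('n))"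
proof -
  have eq: "exp (- 2 * pi * \<i> * of_real (\<xi> \<bullet> v) - of_real (pi * \<tau> * (norm v)\<^sup>2)) =
     (\<Prod>i\<in>UNIV. exp (- 2 * pi * \<i> * of_real (\<xi> $ i) * of_real (v $ i) - of_real (pi * \<tau> * (v $ i)\<^sup>2)))" for v
    by (simp add: exp_sum[symmetric] inner_vec_def norm_vec_def L2_set_def sum_nonneg sum_subtractf sum_distrib_left
        sum_negf algebra_simps)
  show "integrable lborel (\<lambda>v. exp (- 2 * pi * \<i> * of_real (\<xi> \<bullet> v) - of_real (pi * \<tau> * (norm v)\<^sup>2)))"
    unfolding eq by (rule integral_prod_cart(1)) (rule gaussian_fourier_real(1)[OF \<tau>])
  have "(\<integral>v. exp (- 2 * pi * \<i> * of_real (\<xi> \<bullet> v) - of_real (pi * \<tau> * (norm v)\<^sup>2)) \<partial>lborel) =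
      (\<Prod>i\<in>UNIV. of_real (exp (- pi * (\<xi> $ i)\<^sup>2 / \<tau>) / sqrt \<tau>))"
    unfolding eq by (subst integral_prod_cart(2)) (simp_all only: gaussian_fourier_real[OF \<tau>])
  also have "\<dots> = of_real ((\<Prod>i\<in>UNIV. exp (- pi * (\<xi> $ i)\<^sup>2 / \<tau>)) / sqrt \<tau> ^ CARD('n))"
    by (simp add: prod_dividef)
  also have "(\<Prod>i\<in>UNIV. exp (- pi * (\<xi> $ i)\<^sup>2 / \<tau>)) = exp (- pi * (norm \<xi>)\<^sup>2 / \<tau>)"
    by (simp add: exp_sum[symmetric] norm_vec_def L2_set_def sum_nonneg sum_distrib_left sum_divide_distrib sum_negf)
  finally show "(\<integral>v. exp (- 2 * pi * \<i> * of_real (\<xi> \<bullet> v) - of_real (pi * \<tau> * (norm v)\<^sup>2)) \<partial>lborel) =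
       of_real (exp (- pi * (norm \<xi>)\<^sup>2 / \<tau>) / sqrt \<tau> ^ CARD('n))" .
qed

section \<open>Poisson summation\<close>

text \<open>The second conclusion expresses absolute convergence in the other order, which is what
  \<open>count_space_integral_swap'\<close> takes as hypothesis; \<open>integral_unfold\<close>
  passes it on to translated pieces.\<close>

lemma count_space_integral_swap:
  fixes f :: "'i \<Rightarrow> 'x \<Rightarrow> complex"
  assumes M: "sigma_finite_measure M" and I: "countable I"
    and meas: "\<And>i. i \<in> I \<Longrightarrow> f i \<in> borel_measurable M"
    and int: "integrable M (\<lambda>x. \<integral>i. norm (f i x) \<partial>count_space I)"
    and sum: "\<And>x. x \<in> space M \<Longrightarrow> integrable (count_space I) (\<lambda>i. f i x)"
  shows "(\<integral>i. (\<integral>x. f i x \<partial>M) \<partial>count_space I) = (\<integral>x. (\<integral>i. f i x \<partial>count_space I) \<partial>M)"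
    and "integrable (count_space I) (\<lambda>i. \<integral>x. norm (f i x) \<partial>M)"
proof -
  interpret M: sigma_finite_measure M by (rule M)
  interpret I: sigma_finite_measure "count_space I" by (rule sigma_finite_measure_count_space_countable[OF I])
  interpret P: pair_sigma_finite M "count_space I" ..
  have m: "(\<lambda>p. f (fst p) (snd p)) \<in> borel_measurable (count_space I \<Otimes>\<^sub>M M)"
    using meas by (intro measurable_pair_measure_countable1 I) simp
  have "(\<lambda>(x, i). f i x) \<in> borel_measurable (M \<Otimes>\<^sub>M count_space I)"
    using measurable_compose[OF measurable_pair_swap' m] by (simp add: case_prod_beta)
  then have *: "integrable (M \<Otimes>\<^sub>M count_space I) (\<lambda>(x, i). f i x)"
    by (rule P.Fubini_integrable) (use int sum in auto)
  from P.Fubini_integral[OF *]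
  show "(\<integral>i. (\<integral>x. f i x \<partial>M) \<partial>count_space I) = (\<integral>x. (\<integral>i. f i x \<partial>count_space I) \<partial>M)" .
  have "integrable (M \<Otimes>\<^sub>M count_space I) (\<lambda>(x, i). norm (f i x))"
    using integrable_norm[OF *] by (simp add: case_prod_beta')
  from P.integrable_snd[OF this] show "integrable (count_space I) (\<lambda>i. \<integral>x. norm (f i x) \<partial>M)" .
qed

lemma count_space_integral_swap':
  fixes f :: "'i \<Rightarrow> 'x \<Rightarrow> complex"
  assumes M: "sigma_finite_measure M" and I: "countable I"
    and f: "\<And>i. i \<in> I \<Longrightarrow> integrable M (f i)"
    and int: "integrable (count_space I) (\<lambda>i. \<integral>x. norm (f i x) \<partial>M)"
  shows "(\<integral>i. (\<integral>x. f i x \<partial>M) \<partial>count_space I) = (\<integral>x. (\<integral>i. f i x \<partial>count_space I) \<partial>M)"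
proof -
  interpret M: sigma_finite_measure M by (rule M)
  interpret I: sigma_finite_measure "count_space I" by (rule sigma_finite_measure_count_space_countable[OF I])
  interpret P: pair_sigma_finite "count_space I" M ..
  have m: "(\<lambda>(i, x). f i x) \<in> borel_measurable (count_space I \<Otimes>\<^sub>M M)"
    using f by (intro measurable_pair_measure_countable1 I) (auto intro: borel_measurable_integrable)
  have "integrable (count_space I \<Otimes>\<^sub>M M) (\<lambda>(i, x). f i x)"
    by (rule P.Fubini_integrable[OF m]) (use int f in auto)
  from P.Fubini_integral[OF this] show ?thesis by simp
qed

section \<open>Periodization and Fourier coefficients\<close>

definition fourier_char :: "int ^ 'd::finite \<Rightarrow> real ^ 'd \<Rightarrow> complex" where
  "fourier_char m x = exp (2 * pi * \<i> * complex_of_real (of_int_vec m \<bullet> x))"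

text \<open>Half-open, so that its integer translates tile the space, and centred at
  \<open>a\<close>, so that a neighbourhood of \<open>a\<close> lies inside.\<close>

definition unit_cell :: "real ^ 'd::finite \<Rightarrow> (real ^ 'd) set" where
  "unit_cell a = {x. \<forall>i. a $ i - 1/2 \<le> x $ i \<and> x $ i < a $ i + 1/2}"

lemma of_int_vec_add: "of_int_vec (m + n) = of_int_vec m + of_int_vec n"
  by (simp add: vec_eq_iff)

lemma fourier_char_add: "fourier_char (m + n) x = fourier_char m x * fourier_char n x"
  by (simp add: fourier_char_def of_int_vec_add inner_add_left algebra_simps exp_add)

lemma norm_fourier_char [simp]: "norm (fourier_char m x) = 1"
  by (simp add: fourier_char_def norm_exp_eq_Re)

lemma continuous_fourier_char [continuous_intros]: "continuous_on S (fourier_char m)"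
  unfolding fourier_char_def[abs_def] by (intro continuous_intros)

lemma fourier_char_periodic: "fourier_char m (x + of_int_vec n) = fourier_char m x"
proof -
  have "of_int_vec m \<bullet> of_int_vec n = real_of_int (\<Sum>i\<in>UNIV. m $ i * n $ i)"
    by (simp add: inner_vec_def)
  then have "exp (2 * pi * \<i> * complex_of_real (of_int_vec m \<bullet> of_int_vec n)) = exp (2 * of_int (\<Sum>i\<in>UNIV. m $ i * n $ i) * pi * \<i>)"
    by (simp add: algebra_simps)
  also have "\<dots> = 1" by (rule exp_integer_2pi, rule Ints_of_int)
  finally show ?thesis by (simp add: fourier_char_def inner_add_right algebra_simps exp_add)
qed

lemma unit_cell_borel [measurable]: "unit_cell a \<in> sets borel"
  unfolding unit_cell_def by measurable

lemma unit_cell_unique_translate: "\<exists>!n. x - of_int_vec n \<in> unit_cell a"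
proof (rule ex1I)
  let ?n = "\<chi> i. \<lfloor>x $ i - a $ i + 1/2\<rfloor>"
  show "x - of_int_vec ?n \<in> unit_cell a"
    unfolding unit_cell_def by (simp, intro allI conjI; linarith)
  fix n assume "x - of_int_vec n \<in> unit_cell a"
  then have "n $ i = \<lfloor>x $ i - a $ i + 1/2\<rfloor>" for i
    unfolding unit_cell_def by (intro floor_unique[symmetric]) (auto simp: algebra_simps dest: spec[of _ i])
  then show "n = ?n" by (simp add: vec_eq_iff)
qed

lemma unit_cell_subset: "unit_cell a \<subseteq> cbox (a - (\<chi> i. 1/2)) (a + (\<chi> i. 1/2))"
  by (auto simp: unit_cell_def mem_box_cart less_imp_le)

lemma emeasure_unit_cell: "emeasure lborel (unit_cell a) < \<infinity>"
proof -
  have "emeasure lborel (unit_cell a) \<le> emeasure lborel (cbox (a - (\<chi> i. 1/2)) (a + (\<chi> i. 1/2)))"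
    by (intro emeasure_mono unit_cell_subset) simp
  also have "\<dots> < \<infinity>" by (rule emeasure_lborel_cbox_finite)
  finally show ?thesis .
qed

lemma integrable_on_unit_cell:
  fixes g :: "real ^ 'd::finite \<Rightarrow> complex"
  assumes "continuous_on UNIV g"
  shows "integrable lborel (\<lambda>x. indicator (unit_cell a) x *\<^sub>R g x)"
proof -
  let ?K = "cbox (a - (\<chi> i. 1/2)) (a + (\<chi> i. 1/2))"
  have "set_integrable lborel ?K g"
    unfolding set_integrable_def
    by (rule borel_integrable_compact[OF compact_cbox continuous_on_subset[OF assms]]) simp
  then have "set_integrable lborel (unit_cell a) g"
    by (rule set_integrable_subset) (auto intro: unit_cell_subset[THEN subsetD])
  then show ?thesis by (simp add: set_integrable_def)
qed

lemma countable_int_vec: "countable (UNIV :: (int ^ 'd::finite) set)"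
proof -
  have "surj (\<lambda>g::'d \<Rightarrow> int. \<chi> i. g i)" by (metis surjI vec_nth_inverse)
  moreover have "countable (UNIV :: ('d \<Rightarrow> int) set)"
    using countable_PiE[of "UNIV::'d set" "\<lambda>_. UNIV::int set"] by simp
  ultimately show ?thesis by (metis countable_image)
qed

lemma lborel_integrable_shift:
  fixes g :: "'a::euclidean_space \<Rightarrow> 'b::{banach,second_countable_topology}"
  assumes g: "integrable lborel g"
  shows "integrable lborel (\<lambda>x. g (c + x))"
proof -
  have "integrable (distr lborel borel ((+) c)) g" using g by (simp add: lborel_distr_plus)
  then show ?thesis using borel_measurable_integrable[OF g] by (subst (asm) integrable_distr_eq) auto
qed

text \<open>\<open>f n\<close> is \<open>G\<close> restricted to the \<open>n\<close>-th translate
  of the cell. Every point lies in exactly one translate, so the pieces add up to \<open>G\<close>;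
  translating them back into the cell produces the periodization. Sum and integral are exchanged
  once before and once after this translation.\<close>

lemma integral_unfold:
  fixes G :: "real ^ 'd::finite \<Rightarrow> complex"
  assumes G: "integrable lborel G"
  shows "(\<integral>x. indicator (unit_cell a) x *\<^sub>R (\<integral>n. G (x + of_int_vec n) \<partial>count_space UNIV) \<partial>lborel) = (\<integral>v. G v \<partial>lborel)"
proof -
  have [measurable]: "G \<in> borel_measurable borel" using borel_measurable_integrable[OF G] by simp
  define f where "f n v = indicator (unit_cell a) (v - of_int_vec n) *\<^sub>R G v" for n :: "int ^ 'd" and v
  have f: "f n v = (if n = (THE n. v - of_int_vec n \<in> unit_cell a) then G v else 0)" for n v
    using theI'[OF unit_cell_unique_translate[of v a]] unit_cell_unique_translate[of v a]
    unfolding f_def indicator_def by auto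
  have supp: "(\<lambda>n. f n v) = (\<lambda>n. indicator {THE n. v - of_int_vec n \<in> unit_cell a} n *\<^sub>R G v)" for v
    by (auto simp: f)
  have sum: "integrable (count_space UNIV) (\<lambda>n. f n v)" "(\<integral>n. f n v \<partial>count_space UNIV) = G v"
    and sumn: "(\<integral>n. norm (f n v) \<partial>count_space UNIV) = norm (G v)" for v
  proof -
    show "integrable (count_space UNIV) (\<lambda>n. f n v)" unfolding supp
      by (intro integrable_scaleR_left) (simp add: integrable_real_indicator)
    show "(\<integral>n. f n v \<partial>count_space UNIV) = G v" unfolding supp by simp
    have "(\<lambda>n. norm (f n v)) = (\<lambda>n. indicator {THE n. v - of_int_vec n \<in> unit_cell a} n *\<^sub>R norm (G v))"
      by (auto simp: f)
    then show "(\<integral>n. norm (f n v) \<partial>count_space UNIV) = norm (G v)" by simp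
  qed
  have meas [measurable]: "f n \<in> borel_measurable borel" for n unfolding f_def[abs_def] by measurable
  have int: "integrable lborel (\<lambda>v. \<integral>n. norm (f n v) \<partial>count_space UNIV)" unfolding sumn using G by simp
  note sf = sigma_finite_lborel
  have 1: "(\<integral>n. (\<integral>v. f n v \<partial>lborel) \<partial>count_space UNIV) = (\<integral>v. (\<integral>n. f n v \<partial>count_space UNIV) \<partial>lborel)"
    and 2: "integrable (count_space UNIV) (\<lambda>n. \<integral>v. norm (f n v) \<partial>lborel)"
    using count_space_integral_swap[OF sf countable_int_vec _ int sum(1)] meas by simp_all
  define h where "h n x = indicator (unit_cell a) x *\<^sub>R G (x + of_int_vec n)" for n x
  have h: "h n x = f n (of_int_vec n + x)" for n x by (simp add: h_def f_def add.commute)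
  have shift: "(\<integral>v. g v \<partial>lborel) = (\<integral>x. g (of_int_vec n + x) \<partial>lborel)" if [measurable]: "g \<in> borel_measurable borel"
    for n and g :: "real ^ 'd \<Rightarrow> 'b::{banach,second_countable_topology}"
  proof -
    have "(\<integral>v. g v \<partial>lborel) = (\<integral>v. g v \<partial>distr lborel borel ((+) (of_int_vec n)))"
      by (simp add: lborel_distr_plus)
    also have "\<dots> = (\<integral>x. g (of_int_vec n + x) \<partial>lborel)" by (rule integral_distr) auto
    finally show ?thesis .
  qed
  have "integrable lborel (f n)" for n
    by (rule Bochner_Integration.integrable_bound[OF G]) (auto simp: f_def indicator_def)
  then have hint: "integrable lborel (h n)" for n
    unfolding h[abs_def] using lborel_integrable_shift by blast
  have "(\<integral>n. (\<integral>x. h n x \<partial>lborel) \<partial>count_space UNIV) = (\<integral>x. (\<integral>n. h n x \<partial>count_space UNIV) \<partial>lborel)"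
  proof (rule count_space_integral_swap'[OF sf countable_int_vec hint])
    have "(\<lambda>n. \<integral>x. norm (h n x) \<partial>lborel) = (\<lambda>n. \<integral>v. norm (f n v) \<partial>lborel)"
      unfolding h by (rule ext, rule shift[symmetric]) measurable
    then show "integrable (count_space UNIV) (\<lambda>n. \<integral>x. norm (h n x) \<partial>lborel)" using 2 by simp
  qed
  moreover have "(\<integral>x. h n x \<partial>lborel) = (\<integral>v. f n v \<partial>lborel)" for n
    unfolding h by (rule shift[symmetric]) measurable
  ultimately show ?thesis using 1 sum(2) by (simp add: h_def)
qed

text \<open>The integral factors over the coordinates, and a nonzero frequency integrates to zero
  over a full period. Half-open and closed intervals differ by a null set.\<close>

lemma integral_fourier_char_cell:
  fixes m :: "int ^ 'd::finite"
  shows "(\<integral>x. indicator (unit_cell a) x *\<^sub>R fourier_char m x \<partial>lborel) = (if m = 0 then 1 else 0)"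
proof -
  define f where "f i t = indicator {a $ i - 1/2..<a $ i + 1/2} t *\<^sub>R exp (2 * pi * \<i> * of_int (m $ i) * complex_of_real t)" for i t
  define g where "g i t = exp (2 * pi * \<i> * of_int (m $ i) * complex_of_real t)" for i t
  have "indicator (unit_cell a) x *\<^sub>R fourier_char m x = (\<Prod>i\<in>UNIV. f i (x $ i))" for x
  proof -
    have "fourier_char m x = (\<Prod>i\<in>UNIV. exp (2 * pi * \<i> * of_int (m $ i) * complex_of_real (x $ i)))"
      by (simp add: fourier_char_def exp_sum[symmetric] inner_vec_def sum_distrib_left algebra_simps)
    moreover have "indicator (unit_cell a) x = (\<Prod>i\<in>UNIV. indicator {a $ i - 1/2..<a $ i + 1/2} (x $ i) :: real)"
    proof (cases "x \<in> unit_cell a")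
      case True
      then show ?thesis by (simp add: unit_cell_def)
    next
      case False
      then obtain i where "x $ i \<notin> {a $ i - 1/2..<a $ i + 1/2}" by (auto simp: unit_cell_def)
      then have "(\<Prod>i\<in>UNIV. indicator {a $ i - 1/2..<a $ i + 1/2} (x $ i) :: real) = 0"
        by (intro prod_zero bexI[of _ i]) simp_all
      then show ?thesis using False by simp
    qed
    ultimately show ?thesis by (simp add: f_def scaleR_conv_of_real prod.distrib)
  qed
  moreover have "integrable lborel (f i) \<and> (\<integral>t. f i t \<partial>lborel) = (if m $ i = 0 then 1 else 0)" for i
  proof -
    define lo where "lo = a $ i - 1/2"
    have ae: "AE t in lborel. indicator {lo..lo + 1} t *\<^sub>R g i t = f i t"
      using AE_lborel_singleton[of "lo + 1"]
      by eventually_elim (auto simp: f_def g_def lo_def indicator_def)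
    have meas: "f i \<in> borel_measurable lborel" "(\<lambda>t. indicator {lo..lo + 1} t *\<^sub>R g i t) \<in> borel_measurable lborel"
      unfolding f_def[abs_def] g_def[abs_def] by measurable
    have "has_bochner_integral lborel (\<lambda>t. indicator {lo..lo + 1} t *\<^sub>R g i t) (if m $ i = 0 then 1 else 0)"
    proof (cases "m $ i = 0")
      case True
      then show ?thesis using has_bochner_integral_real_indicator[of "{lo..lo+1}" lborel]
        by (simp add: g_def has_bochner_integral_iff scaleR_conv_of_real)
    next
      case False
      define k where "k = 2 * pi * \<i> * of_int (m $ i)"
      have k: "k \<noteq> 0" using False by (simp add: k_def)
      have "has_bochner_integral lborel (\<lambda>t. indicator {lo..lo + 1} t *\<^sub>R exp (k * complex_of_real t))
          (exp (k * complex_of_real (lo + 1)) / k - exp (k * complex_of_real lo) / k)"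
      proof (rule has_bochner_integral_FTC_Icc)
        show "((\<lambda>t. exp (k * complex_of_real t) / k) has_vector_derivative exp (k * complex_of_real x)) (at x within {lo..lo + 1})" for x
        proof -
          have "((\<lambda>z. exp (k * z) / k) has_field_derivative exp (k * complex_of_real x)) (at (of_real x))"
            using k by (auto intro!: derivative_eq_intros)
          then show ?thesis using has_vector_derivative_real_field has_vector_derivative_at_within by blast
        qed
      qed (auto intro!: continuous_intros)
      moreover have "exp (k * complex_of_real (lo + 1)) = exp (k * complex_of_real lo)"
      proof -
        have "exp (k * complex_of_real (lo + 1)) = exp (k * complex_of_real lo) * exp (2 * of_int (m $ i) * pi * \<i>)"
          by (simp add: exp_add[symmetric] k_def algebra_simps)
        then show ?thesis by (simp only: exp_integer_2pi[OF Ints_of_int] mult_1_right)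
      qed
      ultimately show ?thesis using False by (simp add: g_def k_def)
    qed
    then have "has_bochner_integral lborel (f i) (if m $ i = 0 then 1 else 0)"
      using has_bochner_integral_cong_AE[OF meas(2,1) ae] by blast
    then show ?thesis by (simp add: has_bochner_integral_iff)
  qed
  ultimately have "(\<integral>x. indicator (unit_cell a) x *\<^sub>R fourier_char m x \<partial>lborel) = (\<Prod>i\<in>UNIV. if m $ i = 0 then 1 else 0)"
    using integral_prod_cart(2)[of f] by simp
  also have "\<dots> = (if m = 0 then 1 else 0)" by (auto simp: vec_eq_iff)
  finally show ?thesis .
qed

lemma continuous_greater_nearby:
  fixes f :: "'a::metric_space \<Rightarrow> real"
  assumes "continuous_on UNIV f" "f a > c"
  obtains \<delta> where "\<delta> > 0" "\<And>x. dist x a < \<delta> \<Longrightarrow> f x > c"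
proof -
  have "open {x. f x > c}" using assms(1) by (intro open_Collect_less) auto
  then obtain \<delta> where "\<delta> > 0" "ball a \<delta> \<subseteq> {x. f x > c}" using assms(2) openE by blast
  then show thesis by (intro that[of \<delta>]) (auto simp: subset_iff dist_commute)
qed

text \<open>If \<open>D a \<noteq> 0\<close>, then high powers of the trigonometric polynomial \<open>base\<close>, which peaks on the
  translates of \<open>a\<close>, concentrate the integral at \<open>a\<close>.\<close>

lemma periodic_fourier_unique:
  fixes D :: "real ^ 'd::finite \<Rightarrow> complex"
  assumes D: "continuous_on UNIV D"
    and coeff: "\<And>m. (\<integral>x. indicator (unit_cell a) x *\<^sub>R (D x * fourier_char m x) \<partial>lborel) = 0"
  shows "D a = 0"
proof (rule ccontr)
  assume Da: "D a \<noteq> 0"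
  define d where "d = real CARD('d)"
  have d: "d > 0" by (simp add: d_def)
  \<comment> \<open>The mean of \<open>(1 + cos (2 * pi * (x $ i - a $ i))) / 2\<close> over the
    coordinates: a trigonometric polynomial with values between 0 and 1.\<close>
  define base where "base x = (\<Sum>i\<in>UNIV. 1 + cos (2 * pi * (x $ i - a $ i))) / (2 * d)" for x :: "real ^ 'd"
  have base_cont: "continuous_on S base" for S
    unfolding base_def[abs_def] using d by (intro continuous_intros) auto
  have base01: "0 \<le> base x" "base x \<le> 1" for x
  proof -
    show "0 \<le> base x" unfolding base_def using d
      by (intro divide_nonneg_pos sum_nonneg) (auto simp: add_nonneg_eq_0_iff intro: order_trans[OF _ add_left_mono[OF cos_ge_minus_one]])
    have "(\<Sum>i\<in>UNIV. 1 + cos (2 * pi * (x $ i - a $ i))) \<le> (\<Sum>i\<in>(UNIV::'d set). 2)" by (intro sum_mono) simp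
    then show "base x \<le> 1" using d unfolding base_def by (simp add: d_def)
  qed
  define II where "II g = (\<integral>x. indicator (unit_cell a) x *\<^sub>R g x \<partial>lborel)" for g :: "real ^ 'd \<Rightarrow> complex"
  have II_add: "II (\<lambda>x. f x + g x) = II f + II g" if "continuous_on UNIV f" "continuous_on UNIV g" for f g
    unfolding II_def scaleR_add_right
    using integrable_on_unit_cell[OF that(1), of a] integrable_on_unit_cell[OF that(2), of a] by simp
  have II_cmult: "II (\<lambda>x. c * f x) = c * II f" for f c
    unfolding II_def by (simp flip: mult_scaleR_right)
  have II_sum: "II (\<lambda>x. \<Sum>i\<in>J. f i x) = (\<Sum>i\<in>J. II (f i))" if "\<And>i. continuous_on UNIV (f i)" for f and J :: "'d set"
    unfolding II_def scaleR_sum_right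
    using integrable_on_unit_cell[OF that, of a] by (intro Bochner_Integration.integral_sum) simp
  have lin: "II (\<lambda>x. k * (P x + (u * Q x + v * R x))) = 0"
    if c: "continuous_on UNIV P" "continuous_on UNIV Q" "continuous_on UNIV R"
      and z: "II P = 0" "II Q = 0" "II R = 0" for k u v P Q R
  proof -
    have uv: "continuous_on UNIV (\<lambda>x. u * Q x)" "continuous_on UNIV (\<lambda>x. v * R x)"
      by (intro continuous_on_mult_left c)+
    have "II (\<lambda>x. u * Q x + v * R x) = 0" unfolding II_add[OF uv] II_cmult z by simp
    then have "II (\<lambda>x. P x + (u * Q x + v * R x)) = 0"
      unfolding II_add[OF c(1) continuous_on_add[OF uv]] z by simp
    then show ?thesis unfolding II_cmult by simp
  qed
  \<comment> \<open>Multiplication by \<open>base\<close> combines frequencies that differ by at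
    most a unit vector, so the vanishing of all Fourier coefficients passes from \<open>D\<close> to
    its product with any power of \<open>base\<close>.\<close>
  have zero: "continuous_on UNIV (\<lambda>x. of_real (base x ^ N) * D x) \<and>
      (\<forall>m. II (\<lambda>x. of_real (base x ^ N) * D x * fourier_char m x) = 0)" for N
  proof (induction N)
    case 0
    then show ?case using D coeff by (simp add: II_def)
  next
    case (Suc N)
    let ?p = "\<lambda>x. of_real (base x ^ N) * D x"
    have p: "continuous_on UNIV ?p" and IH: "\<And>m. II (\<lambda>x. ?p x * fourier_char m x) = 0" using Suc by auto
    have pc: "continuous_on UNIV (\<lambda>x. ?p x * fourier_char m x)" for m
      by (rule continuous_on_mult[OF p continuous_fourier_char])
    define \<omega> where "\<omega> i = exp (- 2 * pi * \<i> * complex_of_real (a $ i))" for i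
    have cosi: "complex_of_real (1 + cos (2 * pi * (x $ i - a $ i))) =
        1 + \<omega> i / 2 * fourier_char (axis i 1) x + inverse (\<omega> i) / 2 * fourier_char (- axis i 1) x" for x i
    proof -
      have ax: "of_int_vec (axis i 1) \<bullet> x = x $ i" "of_int_vec (- axis i 1) \<bullet> x = - x $ i"
      proof -
        have "of_int_vec (axis i 1) = (axis i 1 :: real ^ 'd)" "of_int_vec (- axis i 1) = (- axis i 1 :: real ^ 'd)"
          by (auto simp: vec_eq_iff axis_def)
        then show "of_int_vec (axis i 1) \<bullet> x = x $ i" "of_int_vec (- axis i 1) \<bullet> x = - x $ i"
          by (simp_all add: inner_axis')
      qed
      have "complex_of_real (cos (2 * pi * (x $ i - a $ i))) = (exp (\<i> * of_real (2 * pi * (x $ i - a $ i))) + exp (- (\<i> * of_real (2 * pi * (x $ i - a $ i))))) / 2"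
        by (simp only: cos_of_real[symmetric] cos_exp_eq)
      also have "exp (\<i> * of_real (2 * pi * (x $ i - a $ i))) = \<omega> i * fourier_char (axis i 1) x"
        unfolding \<omega>_def fourier_char_def ax exp_add[symmetric] by (rule arg_cong[where f=exp]) (simp add: algebra_simps)
      also have "exp (- (\<i> * of_real (2 * pi * (x $ i - a $ i)))) = inverse (\<omega> i) * fourier_char (- axis i 1) x"
        unfolding \<omega>_def fourier_char_def ax exp_minus[symmetric] exp_add[symmetric]
        by (rule arg_cong[where f=exp]) (simp add: algebra_simps)
      finally show ?thesis by (simp add: add_divide_distrib)
    qed
    have "II (\<lambda>x. of_real (base x ^ Suc N) * D x * fourier_char m x) = 0" for m
    proof -
      have "of_real (base x ^ Suc N) * D x * fourier_char m x = (\<Sum>i\<in>UNIV. 1 / (2 * d) * (?p x * fourier_char m x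
         + (\<omega> i / 2 * (?p x * fourier_char (axis i 1 + m) x) + inverse (\<omega> i) / 2 * (?p x * fourier_char (- axis i 1 + m) x))))" for x
      proof -
        have "complex_of_real (base x) = (\<Sum>i\<in>UNIV. complex_of_real (1 + cos (2 * pi * (x $ i - a $ i))) / (2 * d))"
          by (simp only: base_def of_real_divide of_real_sum sum_divide_distrib)
        moreover have "of_real (base x ^ Suc N) * D x * fourier_char m x = complex_of_real (base x) * (?p x * fourier_char m x)"
          by (simp add: mult.assoc)
        ultimately have "of_real (base x ^ Suc N) * D x * fourier_char m x =
            (\<Sum>i\<in>UNIV. complex_of_real (1 + cos (2 * pi * (x $ i - a $ i))) / (2 * d) * (?p x * fourier_char m x))"
          by (simp only: sum_distrib_right)
        also have "\<dots> = (\<Sum>i\<in>UNIV. 1 / (2 * d) * (?p x * fourier_char m x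
         + (\<omega> i / 2 * (?p x * fourier_char (axis i 1 + m) x) + inverse (\<omega> i) / 2 * (?p x * fourier_char (- axis i 1 + m) x))))"
          unfolding cosi fourier_char_add by (intro sum.cong refl) (simp add: algebra_simps add_divide_distrib)
        finally show ?thesis .
      qed
      then have "II (\<lambda>x. of_real (base x ^ Suc N) * D x * fourier_char m x) =
          (\<Sum>i\<in>UNIV. II (\<lambda>x. 1 / (2 * d) * (?p x * fourier_char m x
         + (\<omega> i / 2 * (?p x * fourier_char (axis i 1 + m) x) + inverse (\<omega> i) / 2 * (?p x * fourier_char (- axis i 1 + m) x)))))"
        by (simp only:) (intro II_sum continuous_intros pc)
      also have "\<dots> = 0"
        by (intro sum.neutral ballI lin pc IH)
      finally show ?thesis .
    qed
    moreover have "continuous_on UNIV (\<lambda>x. of_real (base x ^ Suc N) * D x)"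
      by (intro continuous_intros base_cont D)
    ultimately show ?case by blast
  qed
  \<comment> \<open>Rotated so that the value at \<open>a\<close> is
    \<open>(norm (D a))\<^sup>2\<close>; the argument is about a real function that is positive near
    \<open>a\<close>.\<close>
  define h where "h x = Re (cnj (D a) * D x)" for x
  have h_cont: "continuous_on S h" for S
    unfolding h_def[abs_def] by (intro continuous_intros continuous_on_subset[OF D]) auto
  have "h a = (norm (D a))\<^sup>2" by (simp add: h_def cmod_power2 flip: power2_eq_square)
  define \<eta> where "\<eta> = h a / 2"
  have \<eta>: "\<eta> > 0" "h a > \<eta>" using Da \<open>h a = (norm (D a))\<^sup>2\<close> by (simp_all add: \<eta>_def)
  have int_h: "integrable lborel (\<lambda>x. indicator (unit_cell a) x * (h x * base x ^ N))"
    and zero_h: "(\<integral>x. indicator (unit_cell a) x * (h x * base x ^ N) \<partial>lborel) = 0" for N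
  proof -
    let ?G = "\<lambda>x. indicator (unit_cell a) x *\<^sub>R (cnj (D a) * (of_real (base x ^ N) * D x))"
    have int: "integrable lborel ?G"
      using zero[of N] by (intro integrable_on_unit_cell continuous_on_mult_left) blast
    have re: "Re (?G x) = indicator (unit_cell a) x * (h x * base x ^ N)" for x
      by (simp add: h_def algebra_simps)
    show "integrable lborel (\<lambda>x. indicator (unit_cell a) x * (h x * base x ^ N))"
      using integrable_Re[OF int] unfolding re .
    have "(\<integral>x. ?G x \<partial>lborel) = cnj (D a) * II (\<lambda>x. of_real (base x ^ N) * D x)"
      using II_cmult[of "cnj (D a)" "\<lambda>x. of_real (base x ^ N) * D x"] by (simp add: II_def)
    also have "II (\<lambda>x. of_real (base x ^ N) * D x) = II (\<lambda>x. of_real (base x ^ N) * D x * fourier_char 0 x)"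
      by (simp add: fourier_char_def of_int_vec_def flip: zero_vec_def)
    finally have "(\<integral>x. ?G x \<partial>lborel) = 0" using zero[of N] by simp
    then have "(\<integral>x. Re (?G x) \<partial>lborel) = 0" using integral_Re[OF int] by simp
    then show "(\<integral>x. indicator (unit_cell a) x * (h x * base x ^ N) \<partial>lborel) = 0" unfolding re .
  qed
  let ?box = "cbox (a - (\<chi> i. 1/2)) (a + (\<chi> i. 1/2))"
  obtain \<delta>0 where \<delta>0: "\<delta>0 > 0" "\<And>x. dist x a < \<delta>0 \<Longrightarrow> h x > \<eta>"
    using continuous_greater_nearby[OF h_cont \<eta>(2)] by blast
  define \<delta> where "\<delta> = min \<delta>0 (1/2)"
  have \<delta>: "\<delta> > 0" "\<delta> \<le> 1/2" "\<And>x. x \<in> ball a \<delta> \<Longrightarrow> h x > \<eta>"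
    using \<delta>0 by (auto simp: \<delta>_def dist_commute)
  have "bounded (h ` ?box)" by (intro compact_imp_bounded compact_continuous_image h_cont compact_cbox)
  then obtain M where "M > 0" "\<forall>y\<in>h ` ?box. norm y \<le> M" unfolding bounded_pos by blast
  then have M: "M > 0" "\<And>x. x \<in> ?box \<Longrightarrow> \<bar>h x\<bar> \<le> M" by (simp_all only: ball_simps real_norm_def)
  \<comment> \<open>The value 1 forces every cosine to be 1, hence integer coordinate differences;
    in the closed cell these are at most \<open>1/2\<close> in absolute value and so vanish.\<close>
  have lt1: "base x < 1" if x: "x \<in> ?box" "x \<noteq> a" for x
  proof (rule ccontr)
    assume "\<not> base x < 1"
    then have "base x = 1" using base01(2)[of x] by simp
    then have "(\<Sum>i\<in>UNIV. 1 + cos (2 * pi * (x $ i - a $ i))) = 2 * d" using d by (simp add: base_def)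
    then have s0: "(\<Sum>i\<in>UNIV. 1 - cos (2 * pi * (x $ i - a $ i))) = 0"
      by (simp add: sum.distrib sum_subtractf d_def)
    have "x $ i = a $ i" for i
    proof -
      have "\<forall>i\<in>UNIV. 1 - cos (2 * pi * (x $ i - a $ i)) = 0"
        by (subst sum_nonneg_eq_0_iff[symmetric]) (use s0 in auto)
      then have "cos (2 * pi * (x $ i - a $ i)) = 1" by simp
      then obtain n :: int where "2 * pi * (x $ i - a $ i) = n * 2 * pi" using cos_one_2pi_int by auto
      then have n: "x $ i - a $ i = n" by simp
      moreover have "a $ i \<le> x $ i + 1/2 \<and> x $ i \<le> a $ i + 1/2" using x(1) by (simp add: mem_box_cart algebra_simps)
      then have "\<bar>x $ i - a $ i\<bar> \<le> 1/2" by linarith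
      ultimately have "\<bar>real_of_int n\<bar> < 1" by linarith
      then have "n = 0" by linarith
      then show ?thesis using n by simp
    qed
    then show False using x(2) by (simp add: vec_eq_iff)
  qed
  have "\<exists>q. 0 \<le> q \<and> q < 1 \<and> (\<forall>x\<in>?box - ball a \<delta>. base x \<le> q)"
  proof (cases "?box - ball a \<delta> = {}")
    case False
    have "compact (?box - ball a \<delta>)" by (intro compact_diff compact_cbox open_ball)
    from continuous_attains_sup[OF this False base_cont]
    obtain x0 where "x0 \<in> ?box - ball a \<delta>" "\<forall>x\<in>?box - ball a \<delta>. base x \<le> base x0" by blast
    moreover from this have "x0 \<noteq> a" using \<delta>(1) by auto
    ultimately show ?thesis using lt1[of x0] base01[of x0] by (intro exI[of _ "base x0"]) auto
  qed (auto intro: exI[of _ 0])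
  then obtain q where q: "0 \<le> q" "q < 1" "\<And>x. x \<in> ?box - ball a \<delta> \<Longrightarrow> base x \<le> q" by blast
  \<comment> \<open>Strictly between the bound \<open>q\<close> for \<open>base\<close> away from
    \<open>a\<close> and the value 1 at \<open>a\<close>. Near \<open>a\<close> the integrand is at
    least \<open>\<eta> * q' ^ N\<close>, away from it at most \<open>M * q ^ N\<close> in absolute
    value, and the total is zero; this fails for large \<open>N\<close>.\<close>
  define q' where "q' = (1 + q) / 2"
  have q': "q < q'" "q' < 1" "q' > 0" using q by (auto simp: q'_def)
  have "base a = 1" using d by (simp add: base_def d_def)
  then have "base a > q'" using q'(2) by simp
  then obtain \<delta>1 where \<delta>1: "\<delta>1 > 0" "\<And>x. dist x a < \<delta>1 \<Longrightarrow> base x > q'"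
    using continuous_greater_nearby[OF base_cont] by blast
  define \<delta>' where "\<delta>' = min \<delta>1 \<delta>"
  have \<delta>': "\<delta>' > 0" "ball a \<delta>' \<subseteq> ball a \<delta>" "\<And>x. x \<in> ball a \<delta>' \<Longrightarrow> base x > q'"
    using \<delta>1 \<delta> by (auto simp: \<delta>'_def dist_commute)
  have cell: "ball a \<delta> \<subseteq> unit_cell a"
  proof
    fix x assume "x \<in> ball a \<delta>"
    then have nx: "norm (x - a) < 1/2" using \<delta>(2) by (simp add: dist_norm norm_minus_commute)
    have "a $ i - 1/2 \<le> x $ i \<and> x $ i < a $ i + 1/2" for i
    proof -
      have "\<bar>x $ i - a $ i\<bar> \<le> norm (x - a)" using component_le_norm_cart[of "x - a" i] by simp
      then show ?thesis using nx by linarith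
    qed
    then show "x \<in> unit_cell a" by (simp add: unit_cell_def)
  qed
  define \<mu> where "\<mu> = measure lborel (ball a \<delta>')"
  have \<mu>: "\<mu> > 0" unfolding \<mu>_def by (rule content_ball_pos[OF \<delta>'(1)])
  define V where "V = measure lborel (unit_cell a)"
  have key: "\<eta> * \<mu> \<le> M * V * (q / q') ^ N" for N
  proof -
    have ptw: "indicator (ball a \<delta>') x * (\<eta> * q' ^ N) - indicator (unit_cell a) x * (M * q ^ N)
       \<le> indicator (unit_cell a) x * (h x * base x ^ N)" for x
    proof -
      consider "x \<notin> unit_cell a" | "x \<in> ball a \<delta>'" | "x \<in> ball a \<delta>" "x \<notin> ball a \<delta>'" | "x \<in> unit_cell a" "x \<notin> ball a \<delta>"
        by blast
      then show ?thesis
      proof cases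
        case 1
        then have "x \<notin> ball a \<delta>'" using cell \<delta>' by blast
        then show ?thesis using 1 by simp
      next
        case 2
        then have "x \<in> unit_cell a" using cell \<delta>' by blast
        moreover have "\<eta> * q' ^ N \<le> h x * base x ^ N"
          using \<delta>(3)[of x] \<delta>'(2,3) 2 q' \<eta> by (intro mult_mono power_mono) (auto intro: less_imp_le)
        moreover have "0 \<le> M * q ^ N" using M q by simp
        ultimately show ?thesis using 2 by (simp add: algebra_simps)
      next
        case 3
        then have "x \<in> unit_cell a" using cell by blast
        moreover have "0 \<le> h x * base x ^ N" using \<delta>(3)[OF 3(1)] \<eta> base01[of x] by (intro mult_nonneg_nonneg) auto
        moreover have "0 \<le> M * q ^ N" using M q by simp
        ultimately show ?thesis using 3 by (simp add: algebra_simps)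
      next
        case 4
        then have xb: "x \<in> ?box - ball a \<delta>" using unit_cell_subset by blast
        then have "\<bar>h x * base x ^ N\<bar> \<le> M * q ^ N"
          unfolding abs_mult using M q base01[of x] by (intro mult_mono) (auto simp: power_abs intro!: power_mono)
        moreover have "x \<notin> ball a \<delta>'" using 4 \<delta>' by blast
        ultimately show ?thesis using 4 by (simp add: abs_le_iff)
      qed
    qed
    have i1: "integrable lborel (\<lambda>x. indicator (ball a \<delta>') x * (\<eta> * q' ^ N))"
    proof (intro integrable_mult_left integrable_real_indicator)
      show "emeasure lborel (ball a \<delta>') < \<infinity>" by (rule emeasure_bounded_finite) simp
    qed simp
    have i2: "integrable lborel (\<lambda>x. indicator (unit_cell a) x * (M * q ^ N))"
      by (intro integrable_mult_left integrable_real_indicator emeasure_unit_cell) simp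
    have "(\<integral>x. indicator (ball a \<delta>') x * (\<eta> * q' ^ N) - indicator (unit_cell a) x * (M * q ^ N) \<partial>lborel) \<le> 0"
      unfolding zero_h[of N, symmetric] by (intro integral_mono ptw int_h Bochner_Integration.integrable_diff i1 i2)
    then have "\<mu> * (\<eta> * q' ^ N) \<le> V * (M * q ^ N)"
      using i1 i2 by (simp add: \<mu>_def V_def)
    then have "\<mu> * (\<eta> * q' ^ N) / q' ^ N \<le> V * (M * q ^ N) / q' ^ N"
      using q' by (intro divide_right_mono) auto
    then show ?thesis using q' by (simp add: power_divide mult.commute mult.left_commute)
  qed
  have "(\<lambda>N. M * V * (q / q') ^ N) \<longlonglongrightarrow> M * V * 0"
    using q q' by (intro tendsto_mult_left LIMSEQ_power_zero) simp
  then have "\<eta> * \<mu> \<le> M * V * 0" by (rule LIMSEQ_le_const) (use key in blast)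
  then show False using \<eta> \<mu> by (simp add: mult_le_0_iff)
qed

text \<open>Unfolding gives the Fourier coefficients of the periodization, orthogonality those of
  the series. They agree, so the continuous difference vanishes at \<open>x\<close>, the centre of
  the cell over which the coefficients are taken.\<close>

theorem poisson_summation:
  fixes f :: "real ^ 'd::finite \<Rightarrow> complex"
  assumes f: "integrable lborel f"
    and c: "\<And>m. c m = (\<integral>v. f v * fourier_char (- m) v \<partial>lborel)"
    and cint: "integrable (count_space UNIV) c"
    and cont1: "continuous_on UNIV (\<lambda>x. \<integral>n. f (x + of_int_vec n) \<partial>count_space UNIV)"
    and cont2: "continuous_on UNIV (\<lambda>x. \<integral>m. c m * fourier_char m x \<partial>count_space UNIV)"
  shows "(\<integral>n. f (x + of_int_vec n) \<partial>count_space UNIV) = (\<integral>m. c m * fourier_char m x \<partial>count_space UNIV)"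
proof -
  define F where "F x = (\<integral>n. f (x + of_int_vec n) \<partial>count_space UNIV)" for x
  define S where "S x = (\<integral>m. c m * fourier_char m x \<partial>count_space UNIV)" for x
  have FS: "continuous_on UNIV F" "continuous_on UNIV S" using cont1 cont2 by (simp_all add: F_def[abs_def] S_def[abs_def])
  have "(\<integral>y. indicator (unit_cell x) y *\<^sub>R ((F y - S y) * fourier_char m y) \<partial>lborel) = 0" for m
  proof -
    have cfc: "continuous_on UNIV (\<lambda>y. F y * fourier_char m y)" "continuous_on UNIV (\<lambda>y. S y * fourier_char m y)"
      by (intro continuous_on_mult FS continuous_fourier_char)+
    have G: "integrable lborel (\<lambda>v. f v * fourier_char m v)"
    proof (rule Bochner_Integration.integrable_bound[OF f])
      have "f \<in> borel_measurable lborel" "fourier_char m \<in> borel_measurable lborel"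
        using borel_measurable_integrable[OF f] borel_measurable_continuous_onI[OF continuous_fourier_char]
        by simp_all
      then show "(\<lambda>v. f v * fourier_char m v) \<in> borel_measurable lborel" by measurable
    qed (simp add: norm_mult)
    have "(\<integral>y. indicator (unit_cell x) y *\<^sub>R (F y * fourier_char m y) \<partial>lborel) = (\<integral>v. f v * fourier_char m v \<partial>lborel)"
      using integral_unfold[OF G, of x] by (simp add: fourier_char_periodic F_def)
    also have "\<dots> = c (- m)" by (simp add: c)
    finally have 1: "(\<integral>y. indicator (unit_cell x) y *\<^sub>R (F y * fourier_char m y) \<partial>lborel) = c (- m)" .
    define g where "g k y = indicator (unit_cell x) y *\<^sub>R (c k * fourier_char (k + m) y)" for k y
    have gint: "integrable lborel (g k)" for k
      unfolding g_def[abs_def] by (intro integrable_on_unit_cell continuous_intros)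
    have "(\<integral>k. (\<integral>y. g k y \<partial>lborel) \<partial>count_space UNIV) = (\<integral>y. (\<integral>k. g k y \<partial>count_space UNIV) \<partial>lborel)"
    proof (rule count_space_integral_swap'[OF sigma_finite_lborel countable_int_vec gint])
      have "(\<integral>y. norm (g k y) \<partial>lborel) = measure lborel (unit_cell x) * norm (c k)" for k
        using emeasure_unit_cell[of x] by (simp add: g_def norm_mult)
      then show "integrable (count_space UNIV) (\<lambda>k. \<integral>y. norm (g k y) \<partial>lborel)" using cint by simp
    qed
    moreover have "(\<integral>k. g k y \<partial>count_space UNIV) = indicator (unit_cell x) y *\<^sub>R (S y * fourier_char m y)" for y
      by (simp add: g_def S_def fourier_char_add flip: mult.assoc)
    moreover have "(\<integral>y. g k y \<partial>lborel) = indicator {- m} k *\<^sub>R c (- m)" for k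
    proof -
      have "(\<integral>y. g k y \<partial>lborel) = c k * (\<integral>y. indicator (unit_cell x) y *\<^sub>R fourier_char (k + m) y \<partial>lborel)"
        by (simp add: g_def flip: mult_scaleR_right)
      also have "\<dots> = c k * (if k + m = 0 then 1 else 0)" by (simp only: integral_fourier_char_cell)
      finally show ?thesis by (auto simp flip: eq_neg_iff_add_eq_0)
    qed
    ultimately have 2: "(\<integral>y. indicator (unit_cell x) y *\<^sub>R (S y * fourier_char m y) \<partial>lborel) = c (- m)" by simp
    have "(\<integral>y. indicator (unit_cell x) y *\<^sub>R ((F y - S y) * fourier_char m y) \<partial>lborel) =
        (\<integral>y. indicator (unit_cell x) y *\<^sub>R (F y * fourier_char m y) - indicator (unit_cell x) y *\<^sub>R (S y * fourier_char m y) \<partial>lborel)"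
      by (simp add: left_diff_distrib scaleR_diff_right)
    also have "\<dots> = 0"
      using integrable_on_unit_cell[OF cfc(1), of x] integrable_on_unit_cell[OF cfc(2), of x] 1 2 by simp
    finally show ?thesis .
  qed
  from periodic_fourier_unique[of "\<lambda>y. F y - S y" x, OF continuous_on_diff[OF FS] this]
  have "F x - S x = 0" .
  then show ?thesis by (simp add: F_def S_def)
qed

section \<open>The theta transformation\<close>

lemma cdot_minus_minus: "cdot (- u) (- v) = cdot u v"
  by (simp add: cdot_def)

lemma cdot_minus_right: "cdot u (- v) = - cdot u v"
  by (simp add: cdot_def sum_negf)

lemma cvec_add: "cvec (x + y) = cvec x + cvec y"
  by (simp add: vec_eq_iff)

lemma cvec_diff: "cvec (x - y) = cvec x - cvec y"
  by (simp add: vec_eq_iff)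

lemma cvec_minus: "cvec (- x) = - cvec x"
  by (simp add: vec_eq_iff)

lemma cdiff_at_vec_diff [intro]:
  fixes f g :: "'a::complex_normed_vector \<Rightarrow> complex ^ 'd::finite"
  assumes "cdiff_at f p" "cdiff_at g p" shows "cdiff_at (\<lambda>x. f x - g x) p"
proof -
  have "cdiff_at (\<lambda>x. - g x) p"
    by (rule cdiff_at_compose[where f=uminus, OF _ assms(2)], rule cdiff_at_bounded_linear)
      (auto simp: scaleC_vec_def scaleC_complex_def vec_eq_iff intro: bounded_linear_minus bounded_linear_ident)
  from cdiff_at_add[OF assms(1) this] show ?thesis by simp
qed

text \<open>Valid for every complex \<open>u\<close>, with a loss that is only linear in
  \<open>norm z\<close>: at a fixed scale the Gaussian sums are entire. The domain condition enters
  only when the scale is integrated.\<close>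

lemma quad_lower_bound:
  fixes z :: "real ^ 'd::finite"
  assumes "norm u \<le> m"
  shows "(1 + norm z)\<^sup>2 - (2 + 2 * m + m\<^sup>2) * (1 + norm z) \<le> Re (cdot (cvec z - u) (cvec z - u))"
proof -
  have m: "m \<ge> 0" using assms norm_ge_zero[of u] by linarith
  have um: "(norm u)\<^sup>2 \<le> m\<^sup>2" using assms by (intro power_mono) auto
  have sq: "(norm (Re_vec u))\<^sup>2 + (norm (Im_vec u))\<^sup>2 \<le> m\<^sup>2" using um norm_vec_Re_Im[of u] by simp
  have "(norm (Re_vec u))\<^sup>2 \<le> m\<^sup>2" and im: "(norm (Im_vec u))\<^sup>2 \<le> m\<^sup>2"
    using sq zero_le_power2[of "norm (Re_vec u)"] zero_le_power2[of "norm (Im_vec u)"] by linarith+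
  then have re: "norm (Re_vec u) \<le> m" using m by (simp add: power2_le_iff_abs_le)
  have "\<bar>norm z - norm (Re_vec u)\<bar> \<le> norm (Re_vec u - z)"
    by (metis norm_triangle_ineq3 norm_minus_commute)
  then have "(norm z - norm (Re_vec u))\<^sup>2 \<le> (norm (Re_vec u - z))\<^sup>2"
    by (simp add: abs_le_square_iff[symmetric])
  moreover have "(norm z)\<^sup>2 - 2 * m * norm z \<le> (norm z - norm (Re_vec u))\<^sup>2"
  proof -
    have "norm z * norm (Re_vec u) \<le> norm z * m" by (intro mult_left_mono re) simp
    then have "2 * norm z * norm (Re_vec u) \<le> 2 * m * norm z" by (simp add: mult.commute)
    then show ?thesis using zero_le_power2[of "norm (Re_vec u)"] unfolding power2_diff by linarith
  qed
  moreover have "(1 + norm z)\<^sup>2 - (2 + 2 * m + m\<^sup>2) * (1 + norm z) \<le> (norm z)\<^sup>2 - 2 * m * norm z - m\<^sup>2"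
  proof -
    have "0 \<le> 1 + 2 * m + m\<^sup>2 * norm z" using m by simp
    then show ?thesis by (simp add: power2_eq_square algebra_simps)
  qed
  ultimately have "(1 + norm z)\<^sup>2 - (2 + 2 * m + m\<^sup>2) * (1 + norm z) \<le> Re (cdot (u - cvec z) (u - cvec z))"
    using im unfolding Re_cdot_diff by linarith
  then show ?thesis using cdot_minus_minus[of "u - cvec z" "u - cvec z"] by simp
qed

text \<open>The phase is taken at \<open>z - u\<close> instead of \<open>z\<close>. This absorbs the
  factor \<open>exp (2 * pi * \<i> * (x \<bullet> y))\<close> of the regularized function, and
  derivatives in \<open>w\<close> bring down monomials in \<open>z - u\<close>.\<close>

definition gauss_direct :: "real \<Rightarrow> real ^ 'd::finite \<Rightarrow> complex ^ 'd \<Rightarrow> complex ^ 'd \<Rightarrow> complex" where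
  "gauss_direct \<tau> z u w = exp (- (of_real (pi * \<tau>) * cdot (cvec z - u) (cvec z - u))) *
     exp ((- 2 * pi * \<i>) * cdot w (cvec z - u))"

definition gauss_dual :: "real \<Rightarrow> real ^ 'd::finite \<Rightarrow> complex ^ 'd \<Rightarrow> complex ^ 'd \<Rightarrow> complex" where
  "gauss_dual \<tau> k u w = exp ((- 2 * pi * \<i>) * cdot (cvec k) u) *
     exp (- (of_real (pi * \<tau>) * cdot (cvec k + w) (cvec k + w)))"

lemma norm_exp_cdot_le:
  "norm (exp ((- 2 * pi * \<i>) * cdot u v)) \<le> exp (2 * pi * (norm u * norm v))"
proof -
  have "Re ((- 2 * pi * \<i>) * cdot u v) \<le> norm ((- 2 * pi * \<i>) * cdot u v)" by (rule complex_Re_le_cmod)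
  also have "\<dots> = 2 * pi * norm (cdot u v)" by (simp add: norm_mult)
  also have "\<dots> \<le> 2 * pi * (norm u * norm v)" by (intro mult_left_mono norm_cdot_le) simp
  finally show ?thesis by (simp add: norm_exp_eq_Re)
qed

lemma in_ball_norm_le: "q \<in> ball p 1 \<Longrightarrow> norm q \<le> norm p + 1"
  using norm_triangle_ineq2[of q p] by (simp add: dist_norm norm_minus_commute)

lemma cdiff_at_cvec_diff [intro]: "cdiff_at f p \<Longrightarrow> cdiff_at (\<lambda>x. cvec z - f x) p"
  by (intro cdiff_at_vec_diff cdiff_at_const)

lemma dominated_family_gauss_direct:
  fixes A :: "real ^ 'd ^ 'd::finite"
  assumes A: "invertible A" and L: "L \<subseteq> lattice_of A" and \<tau>: "\<tau> > 0"
  shows "dominated_family (count_space L) UNIV (\<lambda>p z. gauss_direct \<tau> z (fst p) (snd p))"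
proof (rule dominated_family_gaussian[OF A L open_UNIV])
  show "(\<lambda>p. gauss_direct \<tau> z (fst p) (snd p)) jointly_holomorphic_on UNIV" for z :: "real ^ 'd"
    unfolding gauss_direct_def jointly_holomorphic_on_iff
    by (intro ballI cdiff_at_mult cdiff_at_exp cdiff_at_minus cdiff_at_const cdiff_at_cdot
        cdiff_at_cvec_diff cdiff_at_fst cdiff_at_snd cdiff_at_ident)
next
  fix p :: "(complex ^ 'd) \<times> (complex ^ 'd)"
  define m where "m = norm p + 1"
  have m: "m \<ge> 0" by (simp add: m_def)
  define C where "C = 2 * pi * m * (1 + m) + pi * \<tau> * (2 + 2 * m + m\<^sup>2)"
  have "norm (gauss_direct \<tau> z (fst q) (snd q)) \<le> 1 * exp (C * (1 + norm z) - (pi * \<tau>) * (1 + norm z)\<^sup>2)"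
    if q: "q \<in> ball p 1" for q z
  proof -
    have n: "norm (fst q) \<le> m" "norm (snd q) \<le> m"
      using in_ball_norm_le[OF q] norm_fst_le[of "fst q" "snd q"] norm_snd_le[of "snd q" "fst q"]
      by (simp_all add: m_def)
    have "pi * \<tau> * ((1 + norm z)\<^sup>2 - (2 + 2 * m + m\<^sup>2) * (1 + norm z)) \<le> pi * \<tau> * Re (cdot (cvec z - fst q) (cvec z - fst q))"
      using \<tau> by (intro mult_left_mono quad_lower_bound n) auto
    then have "- (pi * \<tau> * Re (cdot (cvec z - fst q) (cvec z - fst q))) \<le> pi * \<tau> * (2 + 2 * m + m\<^sup>2) * (1 + norm z) - pi * \<tau> * (1 + norm z)\<^sup>2"
      by (simp add: algebra_simps)
    then have 1: "norm (exp (- (complex_of_real (pi * \<tau>) * cdot (cvec z - fst q) (cvec z - fst q))))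
       \<le> exp (pi * \<tau> * (2 + 2 * m + m\<^sup>2) * (1 + norm z) - pi * \<tau> * (1 + norm z)\<^sup>2)"
      by (simp add: norm_exp_eq_Re)
    have "norm (cvec z - fst q) \<le> (1 + m) * (1 + norm z)"
    proof -
      have "norm (cvec z - fst q) \<le> norm z + m" using norm_triangle_ineq4[of "cvec z" "fst q"] n by simp
      also have "\<dots> \<le> (1 + m) * (1 + norm z)" using m by (simp add: algebra_simps)
      finally show ?thesis .
    qed
    then have "norm (snd q) * norm (cvec z - fst q) \<le> m * ((1 + m) * (1 + norm z))"
      using n m by (intro mult_mono) auto
    then have "2 * pi * (norm (snd q) * norm (cvec z - fst q)) \<le> 2 * pi * (m * ((1 + m) * (1 + norm z)))"
      by (intro mult_left_mono) auto
    then have 2: "norm (exp ((- 2 * pi * \<i>) * cdot (snd q) (cvec z - fst q))) \<le> exp (2 * pi * m * (1 + m) * (1 + norm z))"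
      by (intro order_trans[OF norm_exp_cdot_le]) (simp add: algebra_simps)
    have "norm (gauss_direct \<tau> z (fst q) (snd q)) \<le>
       exp (pi * \<tau> * (2 + 2 * m + m\<^sup>2) * (1 + norm z) - pi * \<tau> * (1 + norm z)\<^sup>2) * exp (2 * pi * m * (1 + m) * (1 + norm z))"
      unfolding gauss_direct_def norm_mult by (intro mult_mono 1 2) auto
    also have "\<dots> = 1 * exp (C * (1 + norm z) - (pi * \<tau>) * (1 + norm z)\<^sup>2)"
      unfolding exp_add[symmetric] by (simp add: C_def algebra_simps)
    finally show ?thesis .
  qed
  moreover have "pi * \<tau> > 0" using \<tau> by simp
  ultimately show "\<exists>r>0. \<exists>K C. \<exists>c>0. \<forall>q\<in>ball p r. \<forall>z\<in>L.
      norm (gauss_direct \<tau> z (fst q) (snd q)) \<le> K * exp (C * (1 + norm z) - c * (1 + norm z)\<^sup>2)"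
    by (meson zero_less_one)
qed

lemma dominated_family_gauss_dual:
  fixes A :: "real ^ 'd ^ 'd::finite"
  assumes A: "invertible A" and L: "L \<subseteq> lattice_of A" and \<tau>: "\<tau> > 0"
  shows "dominated_family (count_space L) UNIV (\<lambda>p k. gauss_dual \<tau> k (fst p) (snd p))"
proof (rule dominated_family_gaussian[OF A L open_UNIV])
  show "(\<lambda>p. gauss_dual \<tau> z (fst p) (snd p)) jointly_holomorphic_on UNIV" for z :: "real ^ 'd"
    unfolding gauss_dual_def jointly_holomorphic_on_iff
    by (intro ballI cdiff_at_mult cdiff_at_exp cdiff_at_minus cdiff_at_const cdiff_at_cdot
        cdiff_at_add cdiff_at_fst cdiff_at_snd cdiff_at_ident)
next
  fix p :: "(complex ^ 'd) \<times> (complex ^ 'd)"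
  define m where "m = norm p + 1"
  have m: "m \<ge> 0" by (simp add: m_def)
  define C where "C = 2 * pi * m + pi * \<tau> * (2 + 2 * m + m\<^sup>2)"
  have "norm (gauss_dual \<tau> z (fst q) (snd q)) \<le> 1 * exp (C * (1 + norm z) - (pi * \<tau>) * (1 + norm z)\<^sup>2)"
    if q: "q \<in> ball p 1" for q z
  proof -
    have n: "norm (fst q) \<le> m" "norm (- snd q) \<le> m"
      using in_ball_norm_le[OF q] norm_fst_le[of "fst q" "snd q"] norm_snd_le[of "snd q" "fst q"]
      by (simp_all add: m_def)
    have "pi * \<tau> * ((1 + norm z)\<^sup>2 - (2 + 2 * m + m\<^sup>2) * (1 + norm z)) \<le> pi * \<tau> * Re (cdot (cvec z - (- snd q)) (cvec z - (- snd q)))"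
      using \<tau> by (intro mult_left_mono quad_lower_bound n) auto
    then have "- (pi * \<tau> * Re (cdot (cvec z + snd q) (cvec z + snd q))) \<le> pi * \<tau> * (2 + 2 * m + m\<^sup>2) * (1 + norm z) - pi * \<tau> * (1 + norm z)\<^sup>2"
      by (simp add: algebra_simps)
    then have 1: "norm (exp (- (complex_of_real (pi * \<tau>) * cdot (cvec z + snd q) (cvec z + snd q))))
       \<le> exp (pi * \<tau> * (2 + 2 * m + m\<^sup>2) * (1 + norm z) - pi * \<tau> * (1 + norm z)\<^sup>2)"
      by (simp add: norm_exp_eq_Re)
    have "norm (cvec z) * norm (fst q) \<le> (1 + norm z) * m"
      using n m by (intro mult_mono) auto
    then have "2 * pi * (norm (cvec z) * norm (fst q)) \<le> 2 * pi * ((1 + norm z) * m)"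
      by (intro mult_left_mono) auto
    then have 2: "norm (exp ((- 2 * pi * \<i>) * cdot (cvec z) (fst q))) \<le> exp (2 * pi * m * (1 + norm z))"
      by (intro order_trans[OF norm_exp_cdot_le]) (simp add: algebra_simps)
    have "norm (gauss_dual \<tau> z (fst q) (snd q)) \<le>
       exp (2 * pi * m * (1 + norm z)) * exp (pi * \<tau> * (2 + 2 * m + m\<^sup>2) * (1 + norm z) - pi * \<tau> * (1 + norm z)\<^sup>2)"
      unfolding gauss_dual_def norm_mult by (intro mult_mono 1 2) auto
    also have "\<dots> = 1 * exp (C * (1 + norm z) - (pi * \<tau>) * (1 + norm z)\<^sup>2)"
      unfolding exp_add[symmetric] by (simp add: C_def algebra_simps)
    finally show ?thesis .
  qed
  moreover have "pi * \<tau> > 0" using \<tau> by simp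
  ultimately show "\<exists>r>0. \<exists>K C. \<exists>c>0. \<forall>q\<in>ball p r. \<forall>z\<in>L.
      norm (gauss_dual \<tau> z (fst q) (snd q)) \<le> K * exp (C * (1 + norm z) - c * (1 + norm z)\<^sup>2)"
    by (meson zero_less_one)
qed

lemma continuous_on_cvec_linear:
  assumes "f jointly_holomorphic_on UNIV"
  shows "continuous_on UNIV (\<lambda>x. f (cvec (B *v x + b), w))"
proof (rule continuous_on_compose2[of UNIV f])
  show "continuous_on UNIV f"
    using assms jointly_holomorphic_on_isCont by (auto simp: continuous_on_eq_continuous_at)
  have "continuous_on UNIV (\<lambda>x. B *v x + b)"
    by (intro continuous_intros linear_continuous_on matrix_vector_mul_bounded_linear)
  then show "continuous_on UNIV (\<lambda>x. (cvec (B *v x + b), w))"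
    unfolding cvec_def by (intro continuous_intros)
qed simp

lemma uminus_matrix_vector: "(- A) *v x = - (A *v x)" "A *v (- x) = - (A *v x)" for A :: "real ^ 'n ^ 'm"
  by (simp_all add: matrix_vector_mult_def vec_eq_iff sum_negf)

lemma bij_lattice_map:
  fixes A :: "real ^ 'd ^ 'd::finite"
  assumes "invertible A"
  shows "bij_betw (\<lambda>n. A *v of_int_vec n) UNIV (lattice_of A)"
  using inj_lattice_map[OF assms] by (simp add: bij_betw_def lattice_of_eq)

lemma integral_lattice:
  fixes A :: "real ^ 'd ^ 'd::finite" and f :: "real ^ 'd \<Rightarrow> complex"
  assumes "invertible A"
  shows "(\<integral>z. f z \<partial>count_space (lattice_of A)) = (\<integral>n. f (A *v of_int_vec n) \<partial>count_space UNIV)"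
    and "integrable (count_space (lattice_of A)) f \<longleftrightarrow> integrable (count_space UNIV) (\<lambda>n. f (A *v of_int_vec n))"
  using integral_bij_count_space[OF bij_lattice_map[OF assms], of f]
    integrable_bij_count_space[OF bij_lattice_map[OF assms], of f] by simp_all

text \<open>Poisson summation over integer vectors for a Gaussian composed with \<open>A\<close>.
  The determinant comes from the linear change of variables, the dual lattice from
  \<open>inner_dual_matrix\<close>.\<close>

theorem theta_transformation:
  fixes A :: "real ^ 'd ^ 'd::finite"
  assumes A: "invertible A" and \<tau>: "\<tau> > 0"
  shows "(\<integral>z. gauss_direct \<tau> z (cvec x) (cvec y) \<partial>count_space (lattice_of A)) =
     of_real (1 / (\<bar>det A\<bar> * sqrt \<tau> ^ CARD('d))) *
     (\<integral>k. gauss_dual (1 / \<tau>) k (cvec x) (cvec y) \<partial>count_space (dual_lattice_of A))"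
proof -
  define B where "B = transpose (matrix_inv A)"
  have B: "invertible B" unfolding B_def by (rule invertible_dual[OF A])
  have AB: "(B *v m) \<bullet> (A *v n) = m \<bullet> n" for m n unfolding B_def by (rule inner_dual_matrix[OF A])
  have \<tau>': "1 / \<tau> > 0" using \<tau> by simp
  define F where "F v = exp (- 2 * pi * \<i> * of_real (y \<bullet> v) - of_real (pi * \<tau> * (norm v)\<^sup>2))" for v
  define f where "f v = F (A *v v)" for v
  have F_direct: "F (v - x) = gauss_direct \<tau> v (cvec x) (cvec y)" for v x
    unfolding gauss_direct_def F_def cvec_diff[symmetric] cdot_cvec exp_add[symmetric] power2_norm_eq_inner
    by (rule arg_cong[where f=exp]) simp
  have Fb: "F \<in> borel_measurable borel"
    unfolding F_def[abs_def] by (intro borel_measurable_continuous_onI continuous_intros)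
  have f: "integrable lborel f"
  proof -
    have "integrable lborel F" unfolding F_def[abs_def] by (rule gaussian_fourier_cart(1)[OF \<tau>])
    then show ?thesis using integral_linear_change(1)[OF A Fb] by (simp add: f_def[abs_def])
  qed
  define V where "V = 1 / (\<bar>det A\<bar> * sqrt \<tau> ^ CARD('d))"
  define c where "c m = (\<integral>v. f v * fourier_char (- m) v \<partial>lborel)" for m
  have c: "c m = of_real V * exp (- of_real (pi * (1 / \<tau>)) * cdot (cvec (B *v of_int_vec m) + cvec y) (cvec (B *v of_int_vec m) + cvec y))" for m
  proof -
    define k where "k = B *v of_int_vec m"
    define G where "G v = exp (- 2 * pi * \<i> * of_real ((k + y) \<bullet> v) - of_real (pi * \<tau> * (norm v)\<^sup>2))" for v
    have "of_int_vec (- m) = - of_int_vec m" by (simp add: vec_eq_iff)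
    then have "of_int_vec (- m) \<bullet> v = - (k \<bullet> (A *v v))" for v
      by (simp add: k_def AB)
    then have "f v * fourier_char (- m) v = G (A *v v)" for v
      unfolding f_def F_def fourier_char_def G_def exp_add[symmetric]
      by (intro arg_cong[where f=exp]) (simp add: inner_add_left algebra_simps)
    then have "c m = (\<integral>v. G (A *v v) \<partial>lborel)" by (simp add: c_def)
    also have "\<dots> = (\<integral>v. G v \<partial>lborel) / of_real \<bar>det A\<bar>"
      by (rule integral_linear_change(2)[OF A]) (unfold G_def[abs_def], intro borel_measurable_continuous_onI continuous_intros)
    also have "(\<integral>v. G v \<partial>lborel) = of_real (exp (- pi * (norm (k + y))\<^sup>2 / \<tau>) / sqrt \<tau> ^ CARD('d))"
      unfolding G_def[abs_def] by (rule gaussian_fourier_cart(2)[OF \<tau>])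
    also have "\<dots> / of_real \<bar>det A\<bar> = of_real V * of_real (exp (- pi * (norm (k + y))\<^sup>2 / \<tau>))"
      by (simp add: V_def)
    also have "complex_of_real (exp (- pi * (norm (k + y))\<^sup>2 / \<tau>)) =
        exp (- of_real (pi * (1 / \<tau>)) * cdot (cvec k + cvec y) (cvec k + cvec y))"
      unfolding cvec_add[symmetric] cdot_cvec exp_of_real[symmetric] power2_norm_eq_inner
      by (rule arg_cong[where f=exp]) simp
    finally show ?thesis unfolding k_def .
  qed
  have dual: "c m * fourier_char m X = of_real V * gauss_dual (1 / \<tau>) (B *v of_int_vec m) (cvec (- (A *v X))) (cvec y)" for m X
  proof -
    have "of_int_vec m \<bullet> X = (B *v of_int_vec m) \<bullet> (A *v X)" by (rule AB[symmetric])
    then show ?thesis unfolding c fourier_char_def gauss_dual_def by (simp add: cdot_cvec cvec_minus cdot_minus_right)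
  qed
  have dom1: "dominated_family (count_space (lattice_of A)) UNIV (\<lambda>p z. gauss_direct \<tau> z (fst p) (snd p))"
    by (rule dominated_family_gauss_direct[OF A order_refl \<tau>])
  have dom2: "dominated_family (count_space (lattice_of B)) UNIV (\<lambda>p z. gauss_dual (1 / \<tau>) z (fst p) (snd p))"
    by (rule dominated_family_gauss_dual[OF B order_refl \<tau>'])
  \<comment> \<open>The direct terms contain \<open>z - x\<close>, so the periodization at
    \<open>X\<close> corresponds to \<open>x = - (A *v X)\<close>. At the end \<open>X\<close> is
    chosen as \<open>- (matrix_inv A *v x)\<close>.\<close>
  have s1: "(\<integral>n. f (X + of_int_vec n) \<partial>count_space UNIV) =
      (\<integral>z. gauss_direct \<tau> z (cvec ((- A) *v X + 0)) (cvec y) \<partial>count_space (lattice_of A))" for X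
    unfolding integral_lattice(1)[OF A] F_direct[symmetric]
    by (simp add: f_def matrix_vector_right_distrib uminus_matrix_vector add.commute)
  have s2: "(\<integral>m. c m * fourier_char m X \<partial>count_space UNIV) =
      of_real V * (\<integral>k. gauss_dual (1 / \<tau>) k (cvec ((- A) *v X + 0)) (cvec y) \<partial>count_space (lattice_of B))" for X
    unfolding integral_lattice(1)[OF B] dual
    by (simp add: uminus_matrix_vector)
  have cint: "integrable (count_space UNIV) c"
  proof -
    have "integrable (count_space (lattice_of B)) (\<lambda>k. gauss_dual (1 / \<tau>) k 0 (cvec y))"
      using dominated_family_integrable[OF dom2, of "(0, cvec y)"] by simp
    then have "integrable (count_space UNIV) (\<lambda>m. of_real V * gauss_dual (1 / \<tau>) (B *v of_int_vec m) 0 (cvec y))"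
      unfolding integral_lattice(2)[OF B] by (rule integrable_mult_right)
    moreover have "of_real V * gauss_dual (1 / \<tau>) (B *v of_int_vec m) 0 (cvec y) = c m" for m
      unfolding c gauss_dual_def by (simp add: cdot_def)
    ultimately show ?thesis by simp
  qed
  have "(\<integral>n. f (X + of_int_vec n) \<partial>count_space UNIV) = (\<integral>m. c m * fourier_char m X \<partial>count_space UNIV)" for X
  proof (rule poisson_summation[OF f c_def cint])
    show "continuous_on UNIV (\<lambda>X. \<integral>n. f (X + of_int_vec n) \<partial>count_space UNIV)"
      unfolding s1
      using continuous_on_cvec_linear[OF dominated_family_integral(1)[OF dom1], of "- A" 0 "cvec y"] by simp
    show "continuous_on UNIV (\<lambda>X. \<integral>m. c m * fourier_char m X \<partial>count_space UNIV)"
      unfolding s2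
      using continuous_on_cvec_linear[OF dominated_family_integral(1)[OF dom2], of "- A" 0 "cvec y"]
      by (intro continuous_on_mult_left) simp
  qed
  then have "(\<integral>z. gauss_direct \<tau> z (cvec ((- A) *v X + 0)) (cvec y) \<partial>count_space (lattice_of A)) =
      of_real V * (\<integral>k. gauss_dual (1 / \<tau>) k (cvec ((- A) *v X + 0)) (cvec y) \<partial>count_space (lattice_of B))" for X
    unfolding s1 s2 .
  moreover have X: "(- A) *v (- (matrix_inv A *v x)) + 0 = x"
    unfolding uminus_matrix_vector
    by (simp only: minus_minus add_0_right matrix_vector_mul_assoc matrix_inv_mult[OF A] matrix_vector_mul_lid)
  ultimately
  have "(\<integral>z. gauss_direct \<tau> z (cvec x) (cvec y) \<partial>count_space (lattice_of A)) =
      of_real V * (\<integral>k. gauss_dual (1 / \<tau>) k (cvec x) (cvec y) \<partial>count_space (lattice_of B))"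
    by (metis X)
  then show ?thesis by (simp add: V_def dual_lattice_of_def B_def)
qed

section \<open>Crandall's representation\<close>

lemma dominated_family_slice:
  fixes h :: "'a::complex_normed_vector \<times> 'b::complex_normed_vector \<Rightarrow> 'x \<Rightarrow> complex"
  assumes "dominated_family M U h"
  shows "dominated_family M {w. (a, w) \<in> U} (\<lambda>w. h (a, w))"
  unfolding dominated_family_def
proof (intro conjI ballI)
  have "continuous_on UNIV (\<lambda>w. (a, w))" by (intro continuous_intros)
  then have "open ((\<lambda>w. (a, w)) -` U)"
    using assms unfolding dominated_family_def continuous_on_open_vimage[OF open_UNIV] by auto
  then show "open {w. (a, w) \<in> U}" by (simp add: vimage_def)
next
  fix x assume "x \<in> space M"
  then have jh: "(\<lambda>p. h p x) jointly_holomorphic_on U" using assms by (simp add: dominated_family_def)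
  show "(\<lambda>w. h (a, w) x) jointly_holomorphic_on {w. (a, w) \<in> U}"
    unfolding jointly_holomorphic_on_iff
  proof
    fix w assume "w \<in> {w. (a, w) \<in> U}"
    then have "cdiff_at (\<lambda>p. h p x) (a, w)" using jh by (simp add: jointly_holomorphic_on_iff)
    then show "cdiff_at (\<lambda>w. h (a, w) x) w"
      by (rule cdiff_at_compose[where f="\<lambda>p. h p x"]) auto
  qed
next
  fix w assume w: "w \<in> {w. (a, w) \<in> U}"
  then show "h (a, w) \<in> borel_measurable M" using assms by (simp add: dominated_family_def)
  obtain r g where rg: "r > 0" "ball (a, w) r \<subseteq> U" "integrable M g"
    "\<And>q x. q \<in> ball (a, w) r \<Longrightarrow> x \<in> space M \<Longrightarrow> norm (h q x) \<le> g x"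
    using assms w unfolding dominated_family_def by blast
  have "(a, w') \<in> ball (a, w) r" if "w' \<in> ball w r" for w' using that by (simp add: dist_Pair_Pair)
  then show "\<exists>r>0. \<exists>g. ball w r \<subseteq> {w. (a, w) \<in> U} \<and> integrable M g \<and>
      (\<forall>q\<in>ball w r. \<forall>x\<in>space M. norm (h (a, q) x) \<le> g x)"
    using rg by (intro exI[of _ r] conjI exI[of _ g]) auto
qed

lemma cdomain_minus:
  assumes "\<And>z. z \<in> L \<Longrightarrow> - z \<in> L" "w \<in> cdomain L"
  shows "- w \<in> cdomain L"
  unfolding cdomain_iff
proof
  fix z assume "z \<in> L"
  then have "Re (cdot (w - cvec (- z)) (w - cvec (- z))) > 0" using assms unfolding cdomain_iff by blast
  moreover have "cdot (w - cvec (- z)) (w - cvec (- z)) = cdot (- w - cvec z) (- w - cvec z)"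
    using cdot_minus_minus[of "- w - cvec z" "- w - cvec z"] by (simp add: cvec_minus add.commute)
  ultimately show "0 < Re (cdot (- w - cvec z) (- w - cvec z))" by simp
qed

lemma cdot_swap_diff: "cdot (cvec z - u) (cvec z - u) = cdot (u - cvec z) (u - cvec z)"
  using cdot_minus_minus[of "cvec z - u" "cvec z - u"] by simp

text \<open>\<open>direct_sum\<close> and \<open>dual_sum\<close> are the two halves of Crandall's representation.\<close>

definition direct_term :: "nat ^ 'd::finite \<Rightarrow> complex \<times> (complex ^ 'd) \<times> (complex ^ 'd) \<Rightarrow> real ^ 'd \<Rightarrow> complex" where
  "direct_term \<alpha> p z = (\<Prod>i\<in>UNIV. (cvec z - fst (snd p)) $ i ^ (\<alpha> $ i)) *
     exp ((- 2 * pi * \<i>) * cdot (snd (snd p)) (cvec z - fst (snd p))) *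
     Qint (fst p / 2) (of_real pi * cdot (cvec z - fst (snd p)) (cvec z - fst (snd p)))"

definition dual_term :: "complex \<times> (complex ^ 'd::finite) \<times> (complex ^ 'd) \<Rightarrow> real ^ 'd \<Rightarrow> complex" where
  "dual_term p k = exp ((- 2 * pi * \<i>) * cdot (cvec k) (fst (snd p))) *
     Qint ((of_nat CARD('d) - fst p) / 2) (of_real pi * cdot (cvec k + snd (snd p)) (cvec k + snd (snd p)))"

definition direct_sum :: "(real ^ 'd::finite) set \<Rightarrow> nat ^ 'd \<Rightarrow> complex \<times> (complex ^ 'd) \<times> (complex ^ 'd) \<Rightarrow> complex" where
  "direct_sum L \<alpha> p = (\<integral>z. direct_term \<alpha> p z \<partial>count_space L)"

definition dual_sum :: "(real ^ 'd::finite) set \<Rightarrow> complex \<times> (complex ^ 'd) \<times> (complex ^ 'd) \<Rightarrow> complex" where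
  "dual_sum L p = (\<integral>k. dual_term p k \<partial>count_space L)"

lemma norm_components_le:
  fixes q p :: "complex \<times> (complex ^ 'd::finite) \<times> (complex ^ 'd)"
  shows "norm (fst q - fst p) \<le> norm (q - p)" "norm (fst (snd q) - fst (snd p)) \<le> norm (q - p)"
    "norm (snd (snd q) - snd (snd p)) \<le> norm (q - p)"
proof -
  have 1: "norm (fst x) \<le> norm x" "norm (snd x) \<le> norm x" for x :: "'x::real_normed_vector \<times> 'y::real_normed_vector"
    by (metis norm_fst_le prod.collapse) (metis norm_snd_le prod.collapse)
  show "norm (fst q - fst p) \<le> norm (q - p)" using 1(1)[of "q - p"] by simp
  have 2: "norm (snd (q - p)) \<le> norm (q - p)" by (rule 1)
  show "norm (fst (snd q) - fst (snd p)) \<le> norm (q - p)"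
    using order_trans[OF 1(1) 2] by simp
  show "norm (snd (snd q) - snd (snd p)) \<le> norm (q - p)"
    using order_trans[OF 1(2) 2] by simp
qed

lemma norm_mi_prod_le:
  fixes v :: "complex ^ 'd::finite"
  assumes "norm v \<le> X" shows "norm (\<Prod>i\<in>UNIV. v $ i ^ (\<alpha> $ i)) \<le> X ^ mi_abs \<alpha>"
proof -
  have "norm (\<Prod>i\<in>UNIV. v $ i ^ (\<alpha> $ i)) = (\<Prod>i\<in>UNIV. norm (v $ i) ^ (\<alpha> $ i))"
    by (simp add: prod_norm[symmetric] norm_power)
  also have "\<dots> \<le> (\<Prod>i\<in>UNIV. X ^ (\<alpha> $ i))"
    using assms order_trans[OF Finite_Cartesian_Product.norm_nth_le assms]
    by (intro prod_mono conjI power_mono) auto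
  finally show ?thesis by (simp add: mi_abs_def power_sum)
qed

text \<open>Weight and phase cost at most an exponential that is linear in \<open>norm z\<close>.
  The factor \<open>Qint\<close> decays like \<open>exp (- (Re t / 2))\<close>, and
  \<open>cdomain_local_bound\<close> makes \<open>Re t\<close> at least
  \<open>pi * c * (1 + norm z)\<^sup>2\<close>.\<close>

lemma dominated_family_direct_term:
  fixes A :: "real ^ 'd ^ 'd::finite"
  assumes A: "invertible A" and L: "L \<subseteq> lattice_of A"
  shows "dominated_family (count_space L) (UNIV \<times> cdomain L \<times> UNIV) (direct_term \<alpha>)"
proof (rule dominated_family_gaussian[OF A L])
  show "open (UNIV \<times> cdomain L \<times> UNIV :: (complex \<times> (complex ^ 'd) \<times> (complex ^ 'd)) set)"
    by (intro open_Times open_cdomain[OF A L] open_UNIV)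
  fix z assume z: "z \<in> L"
  show "(\<lambda>p. direct_term \<alpha> p z) jointly_holomorphic_on UNIV \<times> cdomain L \<times> UNIV"
    unfolding jointly_holomorphic_on_iff
  proof
    fix p :: "complex \<times> (complex ^ 'd) \<times> (complex ^ 'd)" assume "p \<in> UNIV \<times> cdomain L \<times> UNIV"
    then have "0 < Re (cdot (cvec z - fst (snd p)) (cvec z - fst (snd p)))"
      using z by (auto simp: cdomain_iff cdot_swap_diff)
    then have re: "0 < Re (complex_of_real pi * cdot (cvec z - fst (snd p)) (cvec z - fst (snd p)))" by simp
    have c1: "cdiff_at (\<lambda>p. cvec z - fst (snd p)) p"
      by (intro cdiff_at_cvec_diff cdiff_at_fst cdiff_at_snd cdiff_at_ident)
    have c2: "cdiff_at (\<lambda>p. fst p / 2) p"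
      using cdiff_at_mult[OF cdiff_at_fst[OF cdiff_at_ident] cdiff_at_const[of "1/2"], of p] by simp
    show "cdiff_at (\<lambda>p. direct_term \<alpha> p z) p"
      unfolding direct_term_def
      by (intro cdiff_at_mult cdiff_at_prod cdiff_at_power cdiff_at_vec_nth c1 cdiff_at_exp cdiff_at_const
        cdiff_at_cdot cdiff_at_snd cdiff_at_ident cdiff_at_Qint c2 re)
  qed
next
  fix p :: "complex \<times> (complex ^ 'd) \<times> (complex ^ 'd)" assume "p \<in> UNIV \<times> cdomain L \<times> UNIV"
  then have "fst (snd p) \<in> cdomain L" by auto
  then obtain r c where r: "r > 0" and c: "c > 0" and cb:
    "\<And>u z. u \<in> ball (fst (snd p)) r \<Longrightarrow> z \<in> L \<Longrightarrow> c * (1 + norm z)\<^sup>2 \<le> Re (cdot (u - cvec z) (u - cvec z))"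
    using cdomain_local_bound[OF A L] by metis
  have \<delta>: "pi * c > 0" using c by simp
  obtain K where K: "K \<ge> 0" "\<And>s t. Re s \<le> (Re (fst p) + 1) / 2 \<Longrightarrow> Re t \<ge> pi * c \<Longrightarrow> norm (Qint s t) \<le> K * exp (- (Re t / 2))"
    using Qint_bound[OF \<delta>] by metis
  define m where "m = norm p + 1"
  have m: "m \<ge> 0" by (simp add: m_def)
  define C where "C = real (mi_abs \<alpha>) * (1 + m) + 2 * pi * m * (1 + m)"
  have "norm (direct_term \<alpha> q z) \<le> K * exp (C * (1 + norm z) - (pi * c / 2) * (1 + norm z)\<^sup>2)"
    if q: "q \<in> ball p (min r 1)" and z: "z \<in> L" for q z
  proof -
    define v where "v = cvec z - fst (snd q)"
    have qp: "norm (q - p) < min r 1" using q by (simp add: dist_norm norm_minus_commute)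
    have n: "norm (fst (snd q)) \<le> m" "norm (snd (snd q)) \<le> m"
      using norm_components_le(2,3)[of q 0] in_ball_norm_le[of q p] q by (auto simp: m_def)
    have re: "Re (fst q / 2) \<le> (Re (fst p) + 1) / 2"
      using norm_components_le(1)[of q p] qp abs_Re_le_cmod[of "fst q - fst p"] by (simp add: abs_le_iff)
    have "fst (snd q) \<in> ball (fst (snd p)) r"
      using norm_components_le(2)[of q p] qp by (simp add: dist_norm norm_minus_commute)
    then have "pi * (c * (1 + norm z)\<^sup>2) \<le> pi * Re (cdot v v)"
      using cb[OF _ z] unfolding v_def cdot_swap_diff by (intro mult_left_mono) auto
    then have t: "pi * c * (1 + norm z)\<^sup>2 \<le> Re (of_real pi * cdot v v)" by simp
    have "1 \<le> (1 + norm z)\<^sup>2" by (simp add: one_le_power)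
    then have "pi * c * 1 \<le> pi * c * (1 + norm z)\<^sup>2" using \<delta> by (intro mult_left_mono) auto
    then have t1: "pi * c \<le> Re (of_real pi * cdot v v)" using t by linarith
    have Q: "norm (Qint (fst q / 2) (of_real pi * cdot v v)) \<le> K * exp (- (pi * c / 2) * (1 + norm z)\<^sup>2)"
    proof -
      have "norm (Qint (fst q / 2) (of_real pi * cdot v v)) \<le> K * exp (- (Re (of_real pi * cdot v v) / 2))"
        by (rule K(2)[OF re t1])
      also have "\<dots> \<le> K * exp (- (pi * c / 2) * (1 + norm z)\<^sup>2)"
        using t K(1) by (intro mult_left_mono) auto
      finally show ?thesis .
    qed
    have nv: "norm v \<le> (1 + m) * (1 + norm z)"
    proof -
      have "norm v \<le> norm z + m" using norm_triangle_ineq4[of "cvec z" "fst (snd q)"] n by (simp add: v_def)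
      also have "\<dots> \<le> (1 + m) * (1 + norm z)" using m by (simp add: algebra_simps)
      finally show ?thesis .
    qed
    have X: "0 \<le> (1 + m) * (1 + norm z)" using m by simp
    have P: "norm (\<Prod>i\<in>UNIV. v $ i ^ (\<alpha> $ i)) \<le> exp (real (mi_abs \<alpha>) * ((1 + m) * (1 + norm z)))"
    proof -
      have "norm (\<Prod>i\<in>UNIV. v $ i ^ (\<alpha> $ i)) \<le> ((1 + m) * (1 + norm z)) ^ mi_abs \<alpha>" by (rule norm_mi_prod_le[OF nv])
      also have "\<dots> \<le> exp ((1 + m) * (1 + norm z)) ^ mi_abs \<alpha>"
        using X exp_ge_add_one_self[of "(1 + m) * (1 + norm z)"] by (intro power_mono) linarith+
      finally show ?thesis by (simp add: exp_of_nat_mult[symmetric])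
    qed
    have "norm (snd (snd q)) * norm v \<le> m * ((1 + m) * (1 + norm z))"
      using n m nv by (intro mult_mono) auto
    then have "2 * pi * (norm (snd (snd q)) * norm v) \<le> 2 * pi * (m * ((1 + m) * (1 + norm z)))"
      by (intro mult_left_mono) auto
    then have E: "norm (exp ((- 2 * pi * \<i>) * cdot (snd (snd q)) v)) \<le> exp (2 * pi * (m * ((1 + m) * (1 + norm z))))"
      by (intro order_trans[OF norm_exp_cdot_le]) simp
    have "norm (direct_term \<alpha> q z) \<le> exp (real (mi_abs \<alpha>) * ((1 + m) * (1 + norm z))) *
       exp (2 * pi * (m * ((1 + m) * (1 + norm z)))) * (K * exp (- (pi * c / 2) * (1 + norm z)\<^sup>2))"
      unfolding direct_term_def v_def[symmetric] norm_mult
      by (intro mult_mono P E Q) (auto intro!: mult_nonneg_nonneg)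
    also have "\<dots> = K * (exp (real (mi_abs \<alpha>) * ((1 + m) * (1 + norm z))) *
       exp (2 * pi * (m * ((1 + m) * (1 + norm z)))) * exp (- (pi * c / 2) * (1 + norm z)\<^sup>2))" by simp
    also have "\<dots> = K * exp (C * (1 + norm z) - (pi * c / 2) * (1 + norm z)\<^sup>2)"
      unfolding exp_add[symmetric] C_def by (simp add: algebra_simps)
    finally show ?thesis .
  qed
  moreover have "pi * c / 2 > 0" "min r 1 > 0" using c r by auto
  ultimately show "\<exists>r>0. \<exists>K C. \<exists>c>0. \<forall>q\<in>ball p r. \<forall>z\<in>L.
      norm (direct_term \<alpha> q z) \<le> K * exp (C * (1 + norm z) - c * (1 + norm z)\<^sup>2)"
    by blast
qed

text \<open>Here \<open>k + w\<close> replaces \<open>z - u\<close>, so the domain condition is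
  required at \<open>- w\<close>; the symmetry of \<open>L\<close> provides it.\<close>

lemma dominated_family_dual_term:
  fixes A :: "real ^ 'd ^ 'd::finite"
  assumes A: "invertible A" and L: "L \<subseteq> lattice_of A" and sym: "\<And>z. z \<in> L \<Longrightarrow> - z \<in> L"
  shows "dominated_family (count_space L) (UNIV \<times> UNIV \<times> cdomain L) dual_term"
proof (rule dominated_family_gaussian[OF A L])
  show "open (UNIV \<times> UNIV \<times> cdomain L :: (complex \<times> (complex ^ 'd) \<times> (complex ^ 'd)) set)"
    by (intro open_Times open_cdomain[OF A L] open_UNIV)
  fix z assume z: "z \<in> L"
  show "(\<lambda>p. dual_term p z) jointly_holomorphic_on UNIV \<times> UNIV \<times> cdomain L"
    unfolding jointly_holomorphic_on_iff
  proof
    fix p :: "complex \<times> (complex ^ 'd) \<times> (complex ^ 'd)" assume "p \<in> UNIV \<times> UNIV \<times> cdomain L"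
    then have "- snd (snd p) \<in> cdomain L" using cdomain_minus[OF sym] by auto
    then have "0 < Re (cdot (cvec z + snd (snd p)) (cvec z + snd (snd p)))"
      using z cdot_swap_diff[of z "- snd (snd p)"] by (auto simp: cdomain_iff)
    then have re: "0 < Re (complex_of_real pi * cdot (cvec z + snd (snd p)) (cvec z + snd (snd p)))" by simp
    have c2: "cdiff_at (\<lambda>p. (of_nat CARD('d) - fst p) / 2) p"
      using cdiff_at_mult[OF cdiff_at_diff[OF cdiff_at_const[of "of_nat CARD('d)"] cdiff_at_fst[OF cdiff_at_ident]] cdiff_at_const[of "1/2"], of p]
      by simp
    show "cdiff_at (\<lambda>p. dual_term p z) p"
      unfolding dual_term_def
      by (intro cdiff_at_mult cdiff_at_add cdiff_at_exp cdiff_at_const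
        cdiff_at_cdot cdiff_at_fst cdiff_at_snd cdiff_at_ident cdiff_at_Qint c2 re)
  qed
next
  fix p :: "complex \<times> (complex ^ 'd) \<times> (complex ^ 'd)" assume "p \<in> UNIV \<times> UNIV \<times> cdomain L"
  then have "- snd (snd p) \<in> cdomain L" using cdomain_minus[OF sym] by auto
  then obtain r c where r: "r > 0" and c: "c > 0" and cb:
    "\<And>u z. u \<in> ball (- snd (snd p)) r \<Longrightarrow> z \<in> L \<Longrightarrow> c * (1 + norm z)\<^sup>2 \<le> Re (cdot (u - cvec z) (u - cvec z))"
    using cdomain_local_bound[OF A L] by metis
  have \<delta>: "pi * c > 0" using c by simp
  obtain K where K: "K \<ge> 0" "\<And>s t. Re s \<le> (CARD('d) - Re (fst p) + 1) / 2 \<Longrightarrow> Re t \<ge> pi * c \<Longrightarrow> norm (Qint s t) \<le> K * exp (- (Re t / 2))"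
    using Qint_bound[OF \<delta>] by metis
  define m where "m = norm p + 1"
  have m: "m \<ge> 0" by (simp add: m_def)
  define C where "C = 2 * pi * m"
  have "norm (dual_term q z) \<le> K * exp (C * (1 + norm z) - (pi * c / 2) * (1 + norm z)\<^sup>2)"
    if q: "q \<in> ball p (min r 1)" and z: "z \<in> L" for q z
  proof -
    define v where "v = cvec z + snd (snd q)"
    have qp: "norm (q - p) < min r 1" using q by (simp add: dist_norm norm_minus_commute)
    have n: "norm (fst (snd q)) \<le> m"
      using norm_components_le(2)[of q 0] in_ball_norm_le[of q p] q by (auto simp: m_def)
    have re: "Re ((of_nat CARD('d) - fst q) / 2) \<le> (CARD('d) - Re (fst p) + 1) / 2"
      using norm_components_le(1)[of q p] qp abs_Re_le_cmod[of "fst q - fst p"] by (simp add: abs_le_iff)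
    have "- snd (snd q) \<in> ball (- snd (snd p)) r"
      using norm_components_le(3)[of q p] qp by (simp add: dist_norm)
    then have "pi * (c * (1 + norm z)\<^sup>2) \<le> pi * Re (cdot v v)"
      using cb[OF _ z] cdot_swap_diff[of z "- snd (snd q)"] unfolding v_def by (intro mult_left_mono) auto
    then have t: "pi * c * (1 + norm z)\<^sup>2 \<le> Re (of_real pi * cdot v v)" by simp
    have "1 \<le> (1 + norm z)\<^sup>2" by (simp add: one_le_power)
    then have "pi * c * 1 \<le> pi * c * (1 + norm z)\<^sup>2" using \<delta> by (intro mult_left_mono) auto
    then have t1: "pi * c \<le> Re (of_real pi * cdot v v)" using t by linarith
    have Q: "norm (Qint ((of_nat CARD('d) - fst q) / 2) (of_real pi * cdot v v)) \<le> K * exp (- (pi * c / 2) * (1 + norm z)\<^sup>2)"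
    proof -
      have "norm (Qint ((of_nat CARD('d) - fst q) / 2) (of_real pi * cdot v v)) \<le> K * exp (- (Re (of_real pi * cdot v v) / 2))"
        by (rule K(2)[OF re t1])
      also have "\<dots> \<le> K * exp (- (pi * c / 2) * (1 + norm z)\<^sup>2)"
        using t K(1) by (intro mult_left_mono) auto
      finally show ?thesis .
    qed
    have "norm (cvec z) * norm (fst (snd q)) \<le> (1 + norm z) * m"
      using n m by (intro mult_mono) auto
    then have "2 * pi * (norm (cvec z) * norm (fst (snd q))) \<le> 2 * pi * ((1 + norm z) * m)"
      by (intro mult_left_mono) auto
    then have E: "norm (exp ((- 2 * pi * \<i>) * cdot (cvec z) (fst (snd q)))) \<le> exp (2 * pi * ((1 + norm z) * m))"
      by (intro order_trans[OF norm_exp_cdot_le]) simp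
    have "norm (dual_term q z) \<le> exp (2 * pi * ((1 + norm z) * m)) * (K * exp (- (pi * c / 2) * (1 + norm z)\<^sup>2))"
      unfolding dual_term_def v_def[symmetric] norm_mult
      by (intro mult_mono E Q) auto
    also have "\<dots> = K * (exp (2 * pi * ((1 + norm z) * m)) * exp (- (pi * c / 2) * (1 + norm z)\<^sup>2))" by simp
    also have "\<dots> = K * exp (C * (1 + norm z) - (pi * c / 2) * (1 + norm z)\<^sup>2)"
      unfolding exp_add[symmetric] C_def by (simp add: algebra_simps)
    finally show ?thesis .
  qed
  moreover have "pi * c / 2 > 0" "min r 1 > 0" using c r by auto
  ultimately show "\<exists>r>0. \<exists>K C. \<exists>c>0. \<forall>q\<in>ball p r. \<forall>z\<in>L.
      norm (dual_term q z) \<le> K * exp (C * (1 + norm z) - c * (1 + norm z)\<^sup>2)"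
    by blast
qed

lemma sigma_finite_pos_lborel: "sigma_finite_measure pos_lborel"
  by (rule sigma_finite_measure_restrict_space[OF sigma_finite_lborel]) simp

section \<open>The differentiated theta identity\<close>

lemma dominated_family_cmi_deriv:
  assumes "dominated_family M U h"
  shows "dominated_family M U (\<lambda>p x. cmi_deriv \<alpha> (\<lambda>p. h p x) p)"
    and "p \<in> U \<Longrightarrow> cmi_deriv \<alpha> (\<lambda>p. \<integral>x. h p x \<partial>M) p = (\<integral>x. cmi_deriv \<alpha> (\<lambda>p. h p x) p \<partial>M)"
  unfolding cmi_deriv_def using dominated_family_foldr_dir_deriv[OF assms] by blast+

lemma cmi_deriv_cong:
  assumes "open U" "\<And>q. q \<in> U \<Longrightarrow> f q = g q" "p \<in> U"
  shows "cmi_deriv \<alpha> f p = cmi_deriv \<alpha> g p"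
  unfolding cmi_deriv_def by (rule foldr_dir_deriv_cong[OF assms])

lemma cmi_deriv_cmult:
  assumes "open U" "f jointly_holomorphic_on U" "p \<in> U"
  shows "cmi_deriv \<alpha> (\<lambda>p. c * f p) p = c * cmi_deriv \<alpha> f p"
  unfolding cmi_deriv_def by (rule foldr_dir_deriv_cmult[OF assms])

lemma cmi_deriv_gauss_direct:
  "cmi_deriv \<alpha> (gauss_direct \<tau> z u) w =
     (- 2 * pi * \<i>) ^ mi_abs \<alpha> * ((\<Prod>i\<in>UNIV. (cvec z - u) $ i ^ (\<alpha> $ i)) * gauss_direct \<tau> z u w)"
  unfolding gauss_direct_def using cmi_deriv_exp_cdot[of \<alpha> _ "- 2 * pi * \<i>"] by simp

lemma cvec_mi_prod: "(\<Prod>i\<in>UNIV. (cvec z - cvec x) $ i ^ (\<alpha> $ i)) = of_real (mi_power (z - x) \<alpha>)"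
  by (simp add: mi_power_def)

text \<open>The theta identity is available at real arguments only. Both sides are entire in
  \<open>w\<close>, so their derivatives at \<open>cvec y\<close> are given by real partial
  derivatives; on the direct side these bring down the weight and the power of
  \<open>- 2 * pi * \<i>\<close>.\<close>

lemma theta_transformation_deriv:
  fixes A :: "real ^ 'd ^ 'd::finite"
  assumes A: "invertible A" and \<tau>: "\<tau> > 0"
  shows "(- 2 * pi * \<i>) ^ mi_abs \<alpha> *
       (\<integral>z. of_real (mi_power (z - x) \<alpha>) * gauss_direct \<tau> z (cvec x) (cvec y) \<partial>count_space (lattice_of A)) =
     of_real (1 / (\<bar>det A\<bar> * sqrt \<tau> ^ CARD('d))) *
     cmi_deriv \<alpha> (\<lambda>w. \<integral>k. gauss_dual (1 / \<tau>) k (cvec x) w \<partial>count_space (dual_lattice_of A)) (cvec y)"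
proof -
  define G1 where "G1 w = (\<integral>z. gauss_direct \<tau> z (cvec x) w \<partial>count_space (lattice_of A))" for w
  define G2 where "G2 w = (\<integral>k. gauss_dual (1 / \<tau>) k (cvec x) w \<partial>count_space (dual_lattice_of A))" for w
  let ?V = "complex_of_real (1 / (\<bar>det A\<bar> * sqrt \<tau> ^ CARD('d)))"
  have d1: "dominated_family (count_space (lattice_of A)) UNIV (\<lambda>w z. gauss_direct \<tau> z (cvec x) w)"
    using dominated_family_slice[OF dominated_family_gauss_direct[OF A order_refl \<tau>], of "cvec x"] by simp
  have \<tau>': "1 / \<tau> > 0" using \<tau> by simp
  have d2: "dominated_family (count_space (dual_lattice_of A)) UNIV (\<lambda>w k. gauss_dual (1 / \<tau>) k (cvec x) w)"
    using dominated_family_slice[OF dominated_family_gauss_dual[OF invertible_dual[OF A] order_refl \<tau>'], of "cvec x"]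
    by (simp add: dual_lattice_of_def)
  have j1: "G1 jointly_holomorphic_on UNIV" and j2: "G2 jointly_holomorphic_on UNIV"
    unfolding G1_def[abs_def] G2_def[abs_def]
    using dominated_family_integral(1)[OF d1] dominated_family_integral(1)[OF d2] .
  have j3: "(\<lambda>w. ?V * G2 w) jointly_holomorphic_on UNIV"
    using j2 unfolding jointly_holomorphic_on_iff by (intro ballI cdiff_at_mult cdiff_at_const) blast
  have eq: "G1 (cvec y) = ?V * G2 (cvec y)" for y
    unfolding G1_def G2_def by (rule theta_transformation[OF A \<tau>])
  have "cmi_deriv \<alpha> G1 (cvec y) = mi_deriv \<alpha> (\<lambda>y. G1 (cvec y)) y"
    by (rule mi_deriv_eq_cmi_deriv[symmetric, of UNIV _ _ UNIV]) (use j1 in auto)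
  also have "\<dots> = cmi_deriv \<alpha> (\<lambda>w. ?V * G2 w) (cvec y)"
    by (rule mi_deriv_eq_cmi_deriv[of UNIV _ _ UNIV]) (use j3 eq in auto)
  also have "\<dots> = ?V * cmi_deriv \<alpha> G2 (cvec y)" by (rule cmi_deriv_cmult[OF open_UNIV j2]) simp
  also have "cmi_deriv \<alpha> G1 (cvec y) = (\<integral>z. cmi_deriv \<alpha> (gauss_direct \<tau> z (cvec x)) (cvec y) \<partial>count_space (lattice_of A))"
    unfolding G1_def[abs_def] by (rule dominated_family_cmi_deriv(2)[OF d1]) simp
  finally show ?thesis unfolding G2_def[abs_def] cmi_deriv_gauss_direct cvec_mi_prod by simp
qed

text \<open>The complementary integral over scales above 1 is nonnegative and is dropped from the
  Gamma integral. This gives the decay in \<open>norm (z - x)\<close> that makes the sum over small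
  scales converge.\<close>

lemma integral_exp_P_real_le:
  assumes s: "s > 0" and t: "t > 0"
  shows "(\<integral>x. exp (- s * x - t * exp (- x)) \<partial>pos_lborel) \<le> Gamma s * t powr (- s)"
proof -
  define P where "P = (\<integral>x. exp (- s * x - t * exp (- x)) \<partial>pos_lborel)"
  define Q where "Q = (\<integral>x. exp (s * x - t * exp x) \<partial>pos_lborel)"
  have P: "Pint (of_real s) (of_real t) = of_real P"
    unfolding Pint_def P_def integral_complex_of_real[symmetric]
    by (simp flip: exp_of_real)
  have Q: "Qint (of_real s) (of_real t) = of_real Q"
    unfolding Qint_def Q_def integral_complex_of_real[symmetric]
    by (simp flip: exp_of_real)
  have "complex_of_real (Gamma s * t powr (- s)) = of_real (Q + P)"
    using Gamma_exp_integral[of "of_real s" t] s t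
    by (simp add: P Q Gamma_complex_of_real powr_of_real[symmetric])
  then have "Gamma s * t powr (- s) = Q + P" by (simp only: of_real_eq_iff)
  moreover have "Q \<ge> 0" unfolding Q_def by (intro integral_nonneg_AE) simp
  ultimately show ?thesis by (simp add: P_def)
qed

section \<open>Moving the small scales to the dual lattice\<close>

lemma abs_mi_power_le: "\<bar>mi_power v \<alpha>\<bar> \<le> norm v ^ mi_abs \<alpha>"
  using norm_mi_prod_le[of "cvec v" "norm v" \<alpha>] by (simp add: mi_power_def prod_norm[symmetric] abs_prod norm_power power_abs)

text \<open>The real case of \<open>cdomain_local_bound\<close>: \<open>cvec x\<close> lies in the
  domain of the lattice without \<open>x\<close>, and the real part of the square is the squared
  distance.\<close>

lemma lattice_point_distance:
  fixes A :: "real ^ 'd ^ 'd::finite"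
  assumes A: "invertible A"
  obtains c where "c > 0" "\<And>z. z \<in> lattice_of A - {x} \<Longrightarrow> c * (1 + norm z) \<le> norm (z - x)"
proof -
  have "cvec x \<in> cdomain (lattice_of A - {x})" by (simp add: cvec_in_cdomain)
  then obtain r c where rc: "r > 0" "c > 0" "\<And>u z. u \<in> ball (cvec x) r \<Longrightarrow> z \<in> lattice_of A - {x} \<Longrightarrow>
      c * (1 + norm z)\<^sup>2 \<le> Re (cdot (u - cvec z) (u - cvec z))"
    using cdomain_local_bound[OF A, of "lattice_of A - {x}"] by blast
  have "sqrt c * (1 + norm z) \<le> norm (z - x)" if z: "z \<in> lattice_of A - {x}" for z
  proof -
    have "c * (1 + norm z)\<^sup>2 \<le> Re (cdot (cvec x - cvec z) (cvec x - cvec z))"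
      using rc(1) by (intro rc(3) z) simp
    also have "\<dots> = (norm (z - x))\<^sup>2"
      by (simp add: cdot_cvec power2_norm_eq_inner norm_minus_commute flip: cvec_diff)
    finally have "(sqrt c * (1 + norm z))\<^sup>2 \<le> (norm (z - x))\<^sup>2" using rc(2) by (simp add: power_mult_distrib)
    then show ?thesis by (rule power2_le_imp_le) simp
  qed
  then show thesis using that[of "sqrt c"] rc(2) by simp
qed

lemma lattice_powr_bound:
  fixes A :: "real ^ 'd ^ 'd::finite" and f :: "real ^ 'd \<Rightarrow> complex"
  assumes A: "invertible A" and s: "s > real CARD('d)"
    and f: "\<And>z. z \<in> lattice_of A - {x} \<Longrightarrow> norm (f z) \<le> C * norm (z - x) powr (- s)"
  shows "integrable (count_space (lattice_of A)) f"
proof -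
  obtain c where c: "c > 0" "\<And>z. z \<in> lattice_of A - {x} \<Longrightarrow> c * (1 + norm z) \<le> norm (z - x)"
    using lattice_point_distance[OF A] by blast
  \<comment> \<open>The second summand accounts for the point \<open>z = x\<close>, about which the
    hypothesis says nothing.\<close>
  define K where "K = \<bar>C\<bar> * c powr (- s) + norm (f x) * (1 + norm x) powr s"
  have "norm (f z) \<le> K * (1 + norm z) powr (- s)" if z: "z \<in> lattice_of A" for z
  proof (cases "z = x")
    case True
    have "(1 + norm x) powr s * (1 + norm x) powr (- s) = 1"
      using norm_ge_zero[of x] by (simp add: powr_add[symmetric] add_nonneg_eq_0_iff)
    then have "norm (f x) = (norm (f x) * (1 + norm x) powr s) * (1 + norm x) powr (- s)" by simp
    also have "\<dots> \<le> K * (1 + norm x) powr (- s)" unfolding K_def by (intro mult_right_mono) auto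
    finally show ?thesis using True by simp
  next
    case False
    then have z': "z \<in> lattice_of A - {x}" using z by simp
    have pos: "0 < c * (1 + norm z)" using c(1) norm_ge_zero[of z] by (intro mult_pos_pos) linarith+
    have "norm (f z) \<le> C * norm (z - x) powr (- s)" by (rule f[OF z'])
    also have "\<dots> \<le> \<bar>C\<bar> * norm (z - x) powr (- s)" by (intro mult_right_mono) auto
    also have "\<dots> \<le> \<bar>C\<bar> * (c * (1 + norm z)) powr (- s)"
      using c(2)[OF z'] pos s by (intro mult_left_mono powr_mono2') auto
    also have "\<dots> = \<bar>C\<bar> * c powr (- s) * (1 + norm z) powr (- s)" using c(1) by (simp add: powr_mult)
    also have "\<dots> \<le> K * (1 + norm z) powr (- s)" unfolding K_def by (intro mult_right_mono) auto
    finally show ?thesis .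
  qed
  then show ?thesis by (rule lattice_sum_integrable[OF A s order_refl])
qed

lemma lattice_uminus: "z \<in> lattice_of A \<Longrightarrow> - z \<in> lattice_of A"
proof -
  assume "z \<in> lattice_of A"
  then obtain n where "z = A *v of_int_vec n" by (auto simp: lattice_of_eq)
  then have "- z = A *v of_int_vec (- n)"
    by (simp add: of_int_vec_def matrix_vector_mult_def vec_eq_iff sum_negf)
  then show ?thesis by (simp add: lattice_of_eq)
qed

lemma dual_lattice_uminus: "z \<in> dual_lattice_of A \<Longrightarrow> - z \<in> dual_lattice_of A"
  unfolding dual_lattice_of_def by (rule lattice_uminus)

lemma countable_dual_lattice [simp]: "countable (dual_lattice_of A)"
  by (simp add: dual_lattice_of_def)

lemma open_cdomain_dual:
  assumes "invertible A" "L \<subseteq> dual_lattice_of A" shows "open (cdomain L)"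
  using open_cdomain[OF invertible_dual] assms by (auto simp: dual_lattice_of_def)

text \<open>\<open>t\<close> is the logarithm of the dual scale and \<open>h\<close> the dual theta
  series with its Mellin weight. Domination over \<open>t > 0\<close> lets the derivative in
  \<open>w\<close> pass through the scale integral, and exchanging sum and integral identifies that
  integral with \<open>dual_sum\<close>.\<close>

lemma dominated_family_dual_scale:
  fixes A :: "real ^ 'd ^ 'd::finite" and x :: "real ^ 'd" and \<nu> :: complex
  assumes A: "invertible A"
  defines "h \<equiv> \<lambda>w t. exp ((of_nat CARD('d) - \<nu>) / 2 * of_real t) *
     (\<integral>k. gauss_dual (exp t) k (cvec x) w \<partial>count_space (dual_lattice_of A))"
  shows "dominated_family pos_lborel (cdomain (dual_lattice_of A)) h"
    and "w \<in> cdomain (dual_lattice_of A) \<Longrightarrow> (\<integral>t. h w t \<partial>pos_lborel) = dual_sum (dual_lattice_of A) (\<nu>, cvec x, w)"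
proof -
  let ?D = "dual_lattice_of A"
  define s where "s = (of_nat CARD('d) - \<nu>) / 2"
  have U: "open (cdomain ?D)" by (rule open_cdomain_dual[OF A order_refl])
  have slice: "dominated_family (count_space ?D) UNIV (\<lambda>w k. gauss_dual (exp t) k (cvec x) w)" for t
    using dominated_family_slice[OF dominated_family_gauss_dual[OF invertible_dual[OF A] order_refl, of "exp t"], of "cvec x"]
    by (simp add: dual_lattice_of_def)
  define g where "g w k t = exp (s * of_real t) * gauss_dual (exp t) k (cvec x) w" for w k t
  have h: "h w t = (\<integral>k. g w k t \<partial>count_space ?D)" for w t
    by (simp add: h_def g_def s_def)
  have g_alt: "g w k t = exp ((- 2 * pi * \<i>) * cdot (cvec k) (cvec x)) *
      exp (s * of_real t - (of_real pi * cdot (cvec k + w) (cvec k + w)) * of_real (exp t))" for w k t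
    unfolding g_def gauss_dual_def exp_diff by (simp add: exp_minus divide_inverse algebra_simps)
  have phase: "norm (exp ((- 2 * pi * \<i>) * cdot (cvec k) (cvec x))) = 1" for k :: "real ^ 'd"
    by (simp add: cdot_cvec norm_exp_eq_Re)
  \<comment> \<open>The majorant factors into a Gaussian in \<open>k\<close> and
    \<open>exp (- t)\<close>: summed over \<open>k\<close> it dominates \<open>h\<close> in
    \<open>t\<close>, and integrated over \<open>t\<close> it gives summability in \<open>k\<close>.
    The coefficient 0 is the value of \<open>C\<close> in
    \<open>lattice_gaussian_integrable\<close>.\<close>
  define bnd where "bnd p r K c \<longleftrightarrow> r > 0 \<and> K \<ge> 0 \<and> c > 0 \<and> (\<forall>q\<in>ball p r. \<forall>k\<in>?D. Re (of_real pi * cdot (cvec k + q) (cvec k + q)) > 0 \<and>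
      (\<forall>t>0. norm (g q k t) \<le> K * exp (0 * (1 + norm k) - c * (1 + norm k)\<^sup>2) * exp (- (1 * t))))" for p r K c
  have bound: "\<exists>r K c. bnd p r K c"
    if p: "p \<in> cdomain ?D" for p
  proof -
    have "- p \<in> cdomain ?D" by (rule cdomain_minus[OF dual_lattice_uminus p])
    then obtain r c where r: "r > 0" and c: "c > 0" and cb:
      "\<And>u z. u \<in> ball (- p) r \<Longrightarrow> z \<in> ?D \<Longrightarrow> c * (1 + norm z)\<^sup>2 \<le> Re (cdot (u - cvec z) (u - cvec z))"
      using cdomain_local_bound[OF invertible_dual[OF A], of ?D] unfolding dual_lattice_of_def by blast
    have \<delta>: "pi * c > 0" using c by simp
    obtain K where K: "K \<ge> 0" "\<And>s' t x. Re s' \<le> Re s \<Longrightarrow> Re t \<ge> pi * c \<Longrightarrow> x > 0 \<Longrightarrow>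
       norm (exp (s' * of_real x - t * of_real (exp x))) \<le> K * exp (- (Re t / 2)) * exp (- (1 * x))"
      using Q_integrand_bound[OF \<delta>] by metis
    have "Re (of_real pi * cdot (cvec k + q) (cvec k + q)) > 0 \<and>
      (\<forall>t>0. norm (g q k t) \<le> K * exp (0 * (1 + norm k) - (pi * c / 2) * (1 + norm k)\<^sup>2) * exp (- (1 * t)))"
      if q: "q \<in> ball p r" and k: "k \<in> ?D" for q k
    proof -
      have "- q \<in> ball (- p) r" using q by (simp add: dist_norm norm_minus_commute)
      then have "pi * (c * (1 + norm k)\<^sup>2) \<le> pi * Re (cdot (cvec k + q) (cvec k + q))"
        using cb[OF _ k] cdot_swap_diff[of k "- q"] by (intro mult_left_mono) auto
      then have t: "pi * c * (1 + norm k)\<^sup>2 \<le> Re (of_real pi * cdot (cvec k + q) (cvec k + q))" by simp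
      have "1 \<le> (1 + norm k)\<^sup>2" by (simp add: one_le_power)
      then have "pi * c * 1 \<le> pi * c * (1 + norm k)\<^sup>2" using \<delta> by (intro mult_left_mono) auto
      then have t1: "pi * c \<le> Re (of_real pi * cdot (cvec k + q) (cvec k + q))" using t by linarith
      have "norm (g q k t') \<le> K * exp (0 * (1 + norm k) - (pi * c / 2) * (1 + norm k)\<^sup>2) * exp (- (1 * t'))" if t': "t' > 0" for t'
      proof -
        have "norm (g q k t') \<le> K * exp (- (Re (of_real pi * cdot (cvec k + q) (cvec k + q)) / 2)) * exp (- (1 * t'))"
          unfolding g_alt norm_mult phase using K(2)[OF order_refl t1 t'] by simp
        also have "\<dots> \<le> K * exp (0 * (1 + norm k) - (pi * c / 2) * (1 + norm k)\<^sup>2) * exp (- (1 * t'))"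
          using t K(1) by (intro mult_right_mono mult_left_mono) auto
        finally show ?thesis .
      qed
      moreover have "Re (of_real pi * cdot (cvec k + q) (cvec k + q)) > 0" using t1 \<delta> by linarith
      ultimately show ?thesis by blast
    qed
    moreover have "pi * c / 2 > 0" using c by simp
    ultimately have "bnd p r K (pi * c / 2)" unfolding bnd_def using r K(1) by blast
    then show ?thesis by blast
  qed
  have gauss_int: "integrable (count_space ?D) (\<lambda>k. K * exp (0 * (1 + norm k) - c * (1 + norm k)\<^sup>2))" if "c > 0" for K c :: real
    unfolding dual_lattice_of_def by (rule lattice_gaussian_integrable[OF invertible_dual[OF A] order_refl that])
  have g_int_k: "integrable (count_space ?D) (\<lambda>k. g w k t)" for w t
    unfolding g_def using dominated_family_integrable[OF slice, of w t] by simp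
  have g_meas: "g w k \<in> borel_measurable pos_lborel" for w k
    unfolding g_alt[abs_def] by (intro borel_measurable_pos_lborel continuous_intros)
  show "dominated_family pos_lborel (cdomain ?D) h"
    unfolding dominated_family_def
  proof (intro conjI ballI U)
    fix t :: real
    have "(\<lambda>w. \<integral>k. gauss_dual (exp t) k (cvec x) w \<partial>count_space ?D) jointly_holomorphic_on UNIV"
      by (rule dominated_family_integral(1)[OF slice])
    then show "(\<lambda>w. h w t) jointly_holomorphic_on cdomain ?D"
      unfolding h_def jointly_holomorphic_on_iff by (intro ballI cdiff_at_mult cdiff_at_const) auto
  next
    fix w
    interpret I: sigma_finite_measure "count_space ?D" by (rule sigma_finite_measure_count_space_countable) simp
    have "(\<lambda>p. g w (fst p) (snd p)) \<in> borel_measurable (count_space ?D \<Otimes>\<^sub>M pos_lborel)"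
      using g_meas by (intro measurable_pair_measure_countable1) simp_all
    from measurable_compose[OF measurable_pair_swap' this]
    have "(\<lambda>(t, k). g w k t) \<in> borel_measurable (pos_lborel \<Otimes>\<^sub>M count_space ?D)" by (simp add: case_prod_beta)
    from I.borel_measurable_lebesgue_integral[OF this]
    show "h w \<in> borel_measurable pos_lborel" unfolding h[abs_def] .
  next
    fix p assume p: "p \<in> cdomain ?D"
    then obtain r K c where bnd: "bnd p r K c" using bound by blast
    have r: "r > 0" and K: "K \<ge> 0" and c: "c > 0" using bnd by (simp_all add: bnd_def)
    have b: "norm (g q k t) \<le> K * exp (0 * (1 + norm k) - c * (1 + norm k)\<^sup>2) * exp (- (1 * t))"
      if "q \<in> ball p r" "k \<in> ?D" "t > 0" for q k t
      using bnd that unfolding bnd_def by blast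
    obtain e where e: "e > 0" "ball p e \<subseteq> cdomain ?D" using U p openE by blast
    define I where "I = (\<integral>k. K * exp (0 * (1 + norm k) - c * (1 + norm k)\<^sup>2) \<partial>count_space ?D)"
    have "norm (h q t) \<le> I * exp (- (1 * t))" if "q \<in> ball p (min e r)" "t \<in> space pos_lborel" for q t
    proof -
      have t: "t > 0" using that by (simp add: space_restrict_space)
      have "norm (h q t) \<le> (\<integral>k. norm (g q k t) \<partial>count_space ?D)" unfolding h by (rule integral_norm_bound)
      also have "\<dots> \<le> (\<integral>k. K * exp (0 * (1 + norm k) - c * (1 + norm k)\<^sup>2) * exp (- (1 * t)) \<partial>count_space ?D)"
        using that t by (intro integral_mono integrable_norm g_int_k integrable_mult_left gauss_int c b) auto
      also have "\<dots> = I * exp (- (1 * t))" by (simp add: I_def)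
      finally show ?thesis .
    qed
    then show "\<exists>r>0. \<exists>g. ball p r \<subseteq> cdomain ?D \<and> integrable pos_lborel g \<and>
        (\<forall>q\<in>ball p r. \<forall>t\<in>space pos_lborel. norm (h q t) \<le> g t)"
      using r e integrable_exp_minus[of 1 I]
      by (intro exI[of _ "min e r"] conjI exI[of _ "\<lambda>t. I * exp (- (1 * t))"]) auto
  qed
  show "(\<integral>t. h w t \<partial>pos_lborel) = dual_sum ?D (\<nu>, cvec x, w)" if w: "w \<in> cdomain ?D"
  proof -
    obtain r K c where bnd: "bnd w r K c" using bound[OF w] by blast
    have r: "r > 0" and K: "K \<ge> 0" and c: "c > 0" using bnd by (simp_all add: bnd_def)
    have b: "norm (g q k t) \<le> K * exp (0 * (1 + norm k) - c * (1 + norm k)\<^sup>2) * exp (- (1 * t))"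
      and re: "Re (of_real pi * cdot (cvec k + q) (cvec k + q)) > 0"
      if "q \<in> ball w r" "k \<in> ?D" "t > 0" for q k t
      using bnd that unfolding bnd_def by blast+
    have ww: "w \<in> ball w r" using r by simp
    have gi: "integrable pos_lborel (g w k)" if "k \<in> ?D" for k
      unfolding g_alt[abs_def] by (intro integrable_mult_right integrable_Q re[OF ww that zero_less_one])
    define J where "J = (\<integral>t. 1 * exp (- (1 * t)) \<partial>pos_lborel)"
    have "(\<integral>k. (\<integral>t. g w k t \<partial>pos_lborel) \<partial>count_space ?D) = (\<integral>t. (\<integral>k. g w k t \<partial>count_space ?D) \<partial>pos_lborel)"
    proof (rule count_space_integral_swap'[OF sigma_finite_pos_lborel _ gi])
      show "integrable (count_space ?D) (\<lambda>k. \<integral>t. norm (g w k t) \<partial>pos_lborel)"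
      proof (rule Bochner_Integration.integrable_bound)
        show "integrable (count_space ?D) (\<lambda>k. K * J * exp (0 * (1 + norm k) - c * (1 + norm k)\<^sup>2))" by (rule gauss_int[OF c])
        show "AE k in count_space ?D. norm (\<integral>t. norm (g w k t) \<partial>pos_lborel) \<le> norm (K * J * exp (0 * (1 + norm k) - c * (1 + norm k)\<^sup>2))"
        proof (rule AE_I2)
          fix k assume "k \<in> space (count_space ?D)"
          then have k: "k \<in> ?D" by simp
          have "(\<integral>t. norm (g w k t) \<partial>pos_lborel) \<le> (\<integral>t. K * exp (0 * (1 + norm k) - c * (1 + norm k)\<^sup>2) * exp (- (1 * t)) \<partial>pos_lborel)"
            using b[OF ww k] by (intro integral_mono integrable_norm gi k integrable_exp_minus) (auto simp: space_restrict_space)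
          also have "\<dots> = K * J * exp (0 * (1 + norm k) - c * (1 + norm k)\<^sup>2)" by (simp add: J_def)
          finally have "(\<integral>t. norm (g w k t) \<partial>pos_lborel) \<le> K * J * exp (0 * (1 + norm k) - c * (1 + norm k)\<^sup>2)" .
          moreover have "(\<integral>t. norm (g w k t) \<partial>pos_lborel) \<ge> 0" by (intro integral_nonneg_AE) simp
          ultimately show "norm (\<integral>t. norm (g w k t) \<partial>pos_lborel) \<le> norm (K * J * exp (0 * (1 + norm k) - c * (1 + norm k)\<^sup>2))"
            unfolding real_norm_def by linarith
        qed
      qed simp
    qed simp
    moreover have "(\<integral>t. g w k t \<partial>pos_lborel) = dual_term (\<nu>, cvec x, w) k" for k
      unfolding g_alt dual_term_def Qint_def by (simp add: s_def)
    ultimately show ?thesis unfolding h dual_sum_def by simp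
  qed
qed

text \<open>The Mellin integral over scales below 1. It is kept for all lattice points, including
  \<open>z = x\<close>, because Poisson summation acts on the full lattice.\<close>

definition small_scale_term :: "nat ^ 'd::finite \<Rightarrow> complex \<Rightarrow> real ^ 'd \<Rightarrow> real ^ 'd \<Rightarrow> real ^ 'd \<Rightarrow> complex" where
  "small_scale_term \<alpha> \<nu> x y z = of_real (mi_power (z - x) \<alpha>) * exp (- 2 * pi * \<i> * of_real (y \<bullet> (z - x))) *
     Pint (\<nu> / 2) (of_real (pi * (norm (z - x))\<^sup>2))"

text \<open>With scale \<open>exp (- t)\<close>, the sum is exchanged with the scale integral, which
  is where \<open>Re \<nu>\<close> must be large; the differentiated theta identity is applied at
  each scale and the derivative is taken out of the integral. Since \<open>y\<close> is off the dual
  lattice, \<open>cvec y\<close> lies in the domain on which this is allowed.\<close>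

lemma small_scale_sum:
  fixes A :: "real ^ 'd ^ 'd::finite" and \<alpha> :: "nat ^ 'd" and x y :: "real ^ 'd" and \<nu> :: complex
  assumes A: "invertible A" and \<nu>: "Re \<nu> > real (CARD('d) + mi_abs \<alpha>)"
    and y: "y \<notin> dual_lattice_of A"
  shows "integrable (count_space (lattice_of A)) (small_scale_term \<alpha> \<nu> x y)"
    and "(\<integral>z. small_scale_term \<alpha> \<nu> x y z \<partial>count_space (lattice_of A)) =
      1 / ((- 2 * pi * \<i>) ^ mi_abs \<alpha> * of_real \<bar>det A\<bar>) *
      cmi_deriv \<alpha> (\<lambda>w. dual_sum (dual_lattice_of A) (\<nu>, cvec x, w)) (cvec y)"
proof -
  let ?D = "dual_lattice_of A" and ?L = "lattice_of A"
  define \<sigma> where "\<sigma> = Re \<nu>"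
  have \<sigma>: "\<sigma> > 0" "\<sigma> - mi_abs \<alpha> > real CARD('d)" using \<nu> by (simp_all add: \<sigma>_def)
  define q where "q z t = exp (- (\<nu> / 2) * of_real t) *
      (of_real (mi_power (z - x) \<alpha>) * gauss_direct (exp (- t)) z (cvec x) (cvec y))" for z t
  define e where "e z = complex_of_real (mi_power (z - x) \<alpha>) * exp (- 2 * pi * \<i> * of_real (y \<bullet> (z - x)))" for z
  have q: "q z t = e z * exp (- (\<nu> / 2) * of_real t - of_real (pi * (norm (z - x))\<^sup>2) * of_real (exp (- t)))" for z t
  proof -
    have "gauss_direct (exp (- t)) z (cvec x) (cvec y) =
      exp (- (of_real (pi * (norm (z - x))\<^sup>2) * of_real (exp (- t)))) * exp (- 2 * pi * \<i> * of_real (y \<bullet> (z - x)))"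
      unfolding gauss_direct_def cvec_diff[symmetric] cdot_cvec power2_norm_eq_inner by (simp add: mult_ac)
    moreover have "exp (- (\<nu> / 2) * of_real t - of_real (pi * (norm (z - x))\<^sup>2) * of_real (exp (- t))) =
      exp (- (\<nu> / 2) * of_real t) * exp (- (of_real (pi * (norm (z - x))\<^sup>2) * of_real (exp (- t))))"
      unfolding exp_add[symmetric] by (simp only: diff_conv_add_uminus)
    ultimately show ?thesis unfolding q_def e_def by (simp only: mult_ac)
  qed
  have re: "Re (\<nu> / 2) > 0" using \<sigma> by (simp add: \<sigma>_def)
  have q_int: "integrable pos_lborel (q z)" for z
    unfolding q[abs_def] by (intro integrable_mult_right integrable_P re)
  have q_val: "(\<integral>t. q z t \<partial>pos_lborel) = small_scale_term \<alpha> \<nu> x y z" for z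
    unfolding q small_scale_term_def Pint_def e_def by simp
  have norm_q: "norm (q z t) = \<bar>mi_power (z - x) \<alpha>\<bar> * exp (- (\<sigma> / 2) * t - (pi * (norm (z - x))\<^sup>2) * exp (- t))" for z t
    unfolding q e_def norm_mult by (simp add: norm_exp_eq_Re \<sigma>_def)
  have q_bound: "(\<integral>t. norm (q z t) \<partial>pos_lborel) \<le> Gamma (\<sigma> / 2) * pi powr (- (\<sigma> / 2)) * norm (z - x) powr (- (\<sigma> - mi_abs \<alpha>))"
    if z: "z \<in> ?L - {x}" for z
  proof -
    define v where "v = norm (z - x)"
    have v: "v > 0" using z by (simp add: v_def)
    have "(\<integral>t. norm (q z t) \<partial>pos_lborel) = \<bar>mi_power (z - x) \<alpha>\<bar> * (\<integral>t. exp (- (\<sigma> / 2) * t - (pi * v\<^sup>2) * exp (- t)) \<partial>pos_lborel)"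
      unfolding norm_q v_def by simp
    also have "\<dots> \<le> v ^ mi_abs \<alpha> * (Gamma (\<sigma> / 2) * (pi * v\<^sup>2) powr (- (\<sigma> / 2)))"
      using abs_mi_power_le[of "z - x" \<alpha>] v \<sigma>
      by (intro mult_mono integral_exp_P_real_le integral_nonneg_AE) (auto simp: v_def)
    also have "(pi * v\<^sup>2) powr (- (\<sigma> / 2)) = pi powr (- (\<sigma> / 2)) * v powr (- \<sigma>)"
      using v by (simp add: powr_mult powr_powr flip: powr_numeral)
    also have "v ^ mi_abs \<alpha> * (Gamma (\<sigma> / 2) * (pi powr (- (\<sigma> / 2)) * v powr (- \<sigma>))) =
        Gamma (\<sigma> / 2) * pi powr (- (\<sigma> / 2)) * (v powr real (mi_abs \<alpha>) * v powr (- \<sigma>))"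
      using v by (simp add: powr_realpow)
    also have "v powr real (mi_abs \<alpha>) * v powr (- \<sigma>) = v powr (- (\<sigma> - mi_abs \<alpha>))"
      by (simp add: powr_add[symmetric])
    finally show ?thesis by (simp add: v_def)
  qed
  have nonneg: "(\<integral>t. norm (q z t) \<partial>pos_lborel) \<ge> 0" for z by (intro integral_nonneg_AE) simp
  have "integrable (count_space ?L) (\<lambda>z. complex_of_real (\<integral>t. norm (q z t) \<partial>pos_lborel))"
  proof (rule lattice_powr_bound[OF A \<sigma>(2), where x=x])
    show "norm (complex_of_real (\<integral>t. norm (q z t) \<partial>pos_lborel)) \<le>
        Gamma (\<sigma> / 2) * pi powr (- (\<sigma> / 2)) * norm (z - x) powr (- (\<sigma> - mi_abs \<alpha>))" if "z \<in> ?L - {x}" for z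
      using q_bound[OF that] nonneg[of z] by (simp only: norm_of_real abs_of_nonneg)
  qed
  then have q_sum: "integrable (count_space ?L) (\<lambda>z. \<integral>t. norm (q z t) \<partial>pos_lborel)"
    by (simp only: complex_of_real_integrable_eq)
  show "integrable (count_space ?L) (small_scale_term \<alpha> \<nu> x y)"
  proof (rule Bochner_Integration.integrable_bound[OF q_sum])
    show "AE z in count_space ?L. norm (small_scale_term \<alpha> \<nu> x y z) \<le> norm (\<integral>t. norm (q z t) \<partial>pos_lborel)"
    proof (rule AE_I2)
      fix z
      have "norm (small_scale_term \<alpha> \<nu> x y z) \<le> (\<integral>t. norm (q z t) \<partial>pos_lborel)"
        unfolding q_val[symmetric] by (rule integral_norm_bound)
      then show "norm (small_scale_term \<alpha> \<nu> x y z) \<le> norm (\<integral>t. norm (q z t) \<partial>pos_lborel)" by simp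
    qed
  qed simp
  have swap: "(\<integral>z. small_scale_term \<alpha> \<nu> x y z \<partial>count_space ?L) = (\<integral>t. (\<integral>z. q z t \<partial>count_space ?L) \<partial>pos_lborel)"
    unfolding q_val[symmetric]
    by (rule count_space_integral_swap'[OF sigma_finite_pos_lborel _ q_int q_sum]) simp
  define h where "h w t = exp ((of_nat CARD('d) - \<nu>) / 2 * of_real t) *
     (\<integral>k. gauss_dual (exp t) k (cvec x) w \<partial>count_space ?D)" for w t
  note dom = dominated_family_dual_scale[OF A, where \<nu> = \<nu> and x = x, folded h_def]
  have dom1: "dominated_family pos_lborel (cdomain ?D) h" using dom(1) by (simp add: h_def[abs_def])
  have yD: "cvec y \<in> cdomain ?D" using y by (simp add: cvec_in_cdomain)
  have U: "open (cdomain ?D)" by (rule open_cdomain_dual[OF A order_refl])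
  let ?c = "(- 2 * pi * \<i>) ^ mi_abs \<alpha> :: complex"
  have "cmi_deriv \<alpha> (\<lambda>w. dual_sum ?D (\<nu>, cvec x, w)) (cvec y) = cmi_deriv \<alpha> (\<lambda>w. \<integral>t. h w t \<partial>pos_lborel) (cvec y)"
    by (rule cmi_deriv_cong[OF U _ yD]) (simp add: dom(2))
  also have "\<dots> = (\<integral>t. cmi_deriv \<alpha> (\<lambda>w. h w t) (cvec y) \<partial>pos_lborel)"
    by (rule dominated_family_cmi_deriv(2)[OF dom1 yD])
  also have "\<dots> = (\<integral>t. (?c * of_real \<bar>det A\<bar>) * (\<integral>z. q z t \<partial>count_space ?L) \<partial>pos_lborel)"
  proof (rule Bochner_Integration.integral_cong[OF refl])
    fix t :: real
    define G where "G w = (\<integral>k. gauss_dual (exp t) k (cvec x) w \<partial>count_space ?D)" for w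
    have "dominated_family (count_space ?D) UNIV (\<lambda>w k. gauss_dual (exp t) k (cvec x) w)"
      using dominated_family_slice[OF dominated_family_gauss_dual[OF invertible_dual[OF A] order_refl, of "exp t"], of "cvec x"]
      by (simp add: dual_lattice_of_def)
    then have G: "G jointly_holomorphic_on UNIV" unfolding G_def[abs_def] by (rule dominated_family_integral(1))
    have H1: "cmi_deriv \<alpha> (\<lambda>w. h w t) (cvec y) = exp ((of_nat CARD('d) - \<nu>) / 2 * of_real t) * cmi_deriv \<alpha> G (cvec y)"
      unfolding h_def G_def[symmetric] by (rule cmi_deriv_cmult[OF open_UNIV G]) simp
    have "of_real (1 / (\<bar>det A\<bar> * sqrt (exp (- t)) ^ CARD('d))) * cmi_deriv \<alpha> G (cvec y) =
        ?c * (\<integral>z. of_real (mi_power (z - x) \<alpha>) * gauss_direct (exp (- t)) z (cvec x) (cvec y) \<partial>count_space ?L)"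
      using theta_transformation_deriv[OF A, of "exp (- t)" \<alpha> x y] by (simp add: G_def[abs_def] exp_minus inverse_eq_divide)
    then have H2: "cmi_deriv \<alpha> G (cvec y) = of_real (\<bar>det A\<bar> * sqrt (exp (- t)) ^ CARD('d)) * (?c *
        (\<integral>z. of_real (mi_power (z - x) \<alpha>) * gauss_direct (exp (- t)) z (cvec x) (cvec y) \<partial>count_space ?L))"
      using A by (simp add: invertible_det_nz field_simps)
    \<comment> \<open>The power of the square root of the scale in the theta identity exchanges the
      Mellin weights of \<open>\<nu> / 2\<close> and
      \<open>(of_nat CARD('d) - \<nu>) / 2\<close>.\<close>
    have H3: "exp ((of_nat CARD('d) - \<nu>) / 2 * of_real t) * of_real (sqrt (exp (- t)) ^ CARD('d)) = exp (- (\<nu> / 2) * of_real t)"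
    proof -
      have "sqrt (exp (- t)) = exp (- t / 2)"
        by (rule real_sqrt_unique) (simp_all add: power2_eq_square flip: exp_add)
      then have "sqrt (exp (- t)) ^ CARD('d) = exp (real CARD('d) * (- t / 2))"
        by (simp only: exp_of_nat_mult)
      then have "complex_of_real (sqrt (exp (- t)) ^ CARD('d)) = exp (of_real (real CARD('d) * (- t / 2)))"
        by (simp only: exp_of_real)
      then show ?thesis unfolding exp_add[symmetric] by (simp add: exp_add[symmetric] algebra_simps diff_divide_distrib)
    qed
    have H4: "(\<integral>z. q z t \<partial>count_space ?L) = exp (- (\<nu> / 2) * of_real t) *
        (\<integral>z. of_real (mi_power (z - x) \<alpha>) * gauss_direct (exp (- t)) z (cvec x) (cvec y) \<partial>count_space ?L)"
      unfolding q_def by simp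
    show "cmi_deriv \<alpha> (\<lambda>w. h w t) (cvec y) = (?c * of_real \<bar>det A\<bar>) * (\<integral>z. q z t \<partial>count_space ?L)"
      unfolding H1 H2 H4 H3[symmetric] of_real_mult by (simp only: mult_ac)
  qed
  also have "\<dots> = (?c * of_real \<bar>det A\<bar>) * (\<integral>z. small_scale_term \<alpha> \<nu> x y z \<partial>count_space ?L)"
    unfolding swap by simp
  finally show "(\<integral>z. small_scale_term \<alpha> \<nu> x y z \<partial>count_space ?L) =
      1 / (?c * of_real \<bar>det A\<bar>) * cmi_deriv \<alpha> (\<lambda>w. dual_sum ?D (\<nu>, cvec x, w)) (cvec y)"
    using A by (simp add: invertible_det_nz)
qed

text \<open>The reciprocal of the Mellin normalization, entire in \<nu>. \<open>s_hat\<close>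
  carries the same factor, so its singular part can be cancelled inside the bracket.\<close>

definition zeta_prefactor :: "complex \<Rightarrow> complex" where
  "zeta_prefactor \<nu> = complex_of_real pi powr (\<nu> / 2) * rGamma (\<nu> / 2)"

text \<open>For \<open>x\<close> on the lattice the omitted term \<open>z = x\<close> contributes only if \<open>\<alpha> = 0\<close>.\<close>

definition lattice_correction :: "(real ^ 'd::finite) set \<Rightarrow> nat ^ 'd \<Rightarrow> real ^ 'd \<Rightarrow> complex \<Rightarrow> complex" where
  "lattice_correction \<Lambda> \<alpha> x \<nu> = (if x \<in> \<Lambda> \<and> \<alpha> = 0 then complex_of_real pi powr (\<nu> / 2) * rGamma (\<nu> / 2 + 1) else 0)"

definition crandall :: "real ^ 'd ^ 'd::finite \<Rightarrow> nat ^ 'd \<Rightarrow> real ^ 'd \<Rightarrow> real ^ 'd \<Rightarrow> complex \<Rightarrow> complex" where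
  "crandall A \<alpha> x y \<nu> = zeta_prefactor \<nu> * (direct_sum (lattice_of A - {x}) \<alpha> (\<nu>, cvec x, cvec y) +
     1 / ((- 2 * pi * \<i>) ^ mi_abs \<alpha> * of_real \<bar>det A\<bar>) *
      cmi_deriv \<alpha> (\<lambda>w. dual_sum (dual_lattice_of A) (\<nu>, cvec x, w)) (cvec y)) -
     lattice_correction (lattice_of A) \<alpha> x \<nu>"

lemma mi_power_zero: "mi_power 0 \<alpha> = (if \<alpha> = 0 then 1 else 0)"
proof (cases "\<alpha> = 0")
  case False
  then obtain i where "\<alpha> $ i \<noteq> 0" by (auto simp: vec_eq_iff)
  then show ?thesis using False unfolding mi_power_def by (auto intro!: prod_zero bexI[of _ i])
qed (simp add: mi_power_def)

text \<open>For \<open>z \<noteq> x\<close> the two ranges of scales add up to a full Gamma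
  integral, which the prefactor normalizes to \<open>norm (z - x) powr (- \<nu>)\<close>. Completing
  the small-scale sum by \<open>z = x\<close> is paid for by
  \<open>lattice_correction\<close>.\<close>

lemma crandall_half_plane:
  fixes A :: "real ^ 'd ^ 'd::finite"
  assumes A: "invertible A" and \<nu>: "Re \<nu> > real (CARD('d) + mi_abs \<alpha>)"
    and y: "y \<notin> dual_lattice_of A"
  shows "exp (2 * pi * \<i> * of_real (x \<bullet> y)) *
      (\<Sum>\<^sub>\<infinity>z\<in>lattice_of A - {x}. exp (- 2 * pi * \<i> * complex_of_real (y \<bullet> z)) *
         complex_of_real (mi_power (z - x) \<alpha>) * complex_of_real (norm (z - x)) powr (- \<nu>)) = crandall A \<alpha> x y \<nu>"
proof -
  let ?L = "lattice_of A"
  let ?f = "\<lambda>z. exp (- 2 * pi * \<i> * complex_of_real (y \<bullet> z)) *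
         complex_of_real (mi_power (z - x) \<alpha>) * complex_of_real (norm (z - x)) powr (- \<nu>)"
  have re: "Re (\<nu> / 2) > 0" using \<nu> by simp
  have G: "Gamma (\<nu> / 2) * rGamma (\<nu> / 2) = 1"
  proof -
    have "\<nu> / 2 \<notin> \<int>\<^sub>\<le>\<^sub>0" using re by (auto elim!: nonpos_Ints_cases')
    then show ?thesis by (simp add: rGamma_inverse_Gamma Gamma_eq_zero_iff)
  qed
  define dt where "dt = direct_term \<alpha> (\<nu>, cvec x, cvec y)"
  define st where "st = small_scale_term \<alpha> \<nu> x y"
  have dt: "dt z = of_real (mi_power (z - x) \<alpha>) * exp (- 2 * pi * \<i> * of_real (y \<bullet> (z - x))) *
     Qint (\<nu> / 2) (of_real (pi * (norm (z - x))\<^sup>2))" for z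
    unfolding dt_def direct_term_def fst_conv snd_conv cvec_mi_prod unfolding cvec_diff[symmetric] cdot_cvec power2_norm_eq_inner
    by simp
  have dt_int: "integrable (count_space (?L - {x})) dt"
    unfolding dt_def
    by (rule dominated_family_integrable[OF dominated_family_direct_term[OF A]]) (auto simp: cvec_in_cdomain)
  have st_int': "Infinite_Set_Sum.abs_summable_on st ?L"
    using small_scale_sum(1)[OF A \<nu> y] by (simp add: st_def Infinite_Set_Sum.abs_summable_on_def)
  have st_int: "integrable (count_space (?L - {x})) st"
    using abs_summable_on_subset[OF st_int', of "?L - {x}"] by (auto simp: Infinite_Set_Sum.abs_summable_on_def)
  have term_eq: "zeta_prefactor \<nu> * (dt z + st z) = exp (2 * pi * \<i> * of_real (x \<bullet> y)) * ?f z" if z: "z \<in> ?L - {x}" for z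
  proof -
    define v where "v = norm (z - x)"
    have v: "v > 0" using z by (simp add: v_def)
    have "Qint (\<nu> / 2) (of_real (pi * v\<^sup>2)) + Pint (\<nu> / 2) (of_real (pi * v\<^sup>2)) = Gamma (\<nu> / 2) * of_real (pi * v\<^sup>2) powr (- (\<nu> / 2))"
      using v by (intro Gamma_exp_integral[symmetric] re) simp
    also have "of_real (pi * v\<^sup>2) powr (- (\<nu> / 2)) = complex_of_real pi powr (- (\<nu> / 2)) * of_real v powr (- \<nu>)"
    proof -
      have pos: "pi * v\<^sup>2 > 0" using v by simp
      have "ln (pi * v\<^sup>2) = ln pi + 2 * ln v" using v by (simp add: ln_mult ln_realpow)
      then have l: "Ln (of_real (pi * v\<^sup>2)) = of_real (ln pi) + 2 * of_real (ln v)"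
        unfolding Ln_of_real[OF pos] by simp
      have "complex_of_real (pi * v\<^sup>2) powr (- (\<nu> / 2)) = exp (- (\<nu> / 2) * (of_real (ln pi) + 2 * of_real (ln v)))"
        using v unfolding powr_def l by simp
      also have "\<dots> = exp (- (\<nu> / 2) * of_real (ln pi)) * exp (- \<nu> * of_real (ln v))"
        unfolding exp_add[symmetric] by (rule arg_cong[where f=exp]) (simp add: field_simps)
      finally show ?thesis using v by (simp add: powr_def Ln_of_real)
    qed
    finally have QP: "Qint (\<nu> / 2) (of_real (pi * v\<^sup>2)) + Pint (\<nu> / 2) (of_real (pi * v\<^sup>2)) =
        Gamma (\<nu> / 2) * (complex_of_real pi powr (- (\<nu> / 2)) * of_real v powr (- \<nu>))" .
    define e where "e = complex_of_real (mi_power (z - x) \<alpha>) * exp (- 2 * pi * \<i> * of_real (y \<bullet> (z - x)))"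
    have "dt z + st z = e * (Qint (\<nu> / 2) (of_real (pi * v\<^sup>2)) + Pint (\<nu> / 2) (of_real (pi * v\<^sup>2)))"
      unfolding dt st_def small_scale_term_def e_def v_def by (simp only: distrib_left)
    then have "zeta_prefactor \<nu> * (dt z + st z) =
        (complex_of_real pi powr (\<nu> / 2) * complex_of_real pi powr (- (\<nu> / 2))) * (Gamma (\<nu> / 2) * rGamma (\<nu> / 2)) * e * of_real v powr (- \<nu>)"
      unfolding QP zeta_prefactor_def by (simp only: mult_ac)
    moreover have "complex_of_real pi powr (\<nu> / 2) * complex_of_real pi powr (- (\<nu> / 2)) = 1"
      by (simp add: powr_add[symmetric])
    moreover have "exp (- 2 * pi * \<i> * of_real (y \<bullet> (z - x))) = exp (2 * pi * \<i> * of_real (x \<bullet> y)) * exp (- 2 * pi * \<i> * complex_of_real (y \<bullet> z))"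
      unfolding exp_add[symmetric] by (rule arg_cong[where f=exp]) (simp add: inner_diff_right inner_commute algebra_simps)
    then have "e = exp (2 * pi * \<i> * of_real (x \<bullet> y)) * exp (- 2 * pi * \<i> * complex_of_real (y \<bullet> z)) * complex_of_real (mi_power (z - x) \<alpha>)"
      unfolding e_def by (simp only: mult_ac)
    ultimately show ?thesis using G v_def by (simp only: mult_1_left mult.assoc)
  qed
  have integrable_term: "integrable (count_space (?L - {x})) (\<lambda>z. zeta_prefactor \<nu> * (dt z + st z)) =
      integrable (count_space (?L - {x})) (\<lambda>z. exp (2 * pi * \<i> * of_real (x \<bullet> y)) * ?f z)"
    by (rule Bochner_Integration.integrable_cong[OF refl], rule term_eq) simp
  have sum_int: "integrable (count_space (?L - {x})) (\<lambda>z. exp (2 * pi * \<i> * of_real (x \<bullet> y)) * ?f z)"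
  proof -
    have "integrable (count_space (?L - {x})) (\<lambda>z. zeta_prefactor \<nu> * (dt z + st z))"
      by (intro integrable_mult_right Bochner_Integration.integrable_add dt_int st_int)
    then show ?thesis unfolding integrable_term .
  qed
  have "integrable (count_space (?L - {x})) (\<lambda>z. exp (- (2 * pi * \<i> * of_real (x \<bullet> y))) * (exp (2 * pi * \<i> * of_real (x \<bullet> y)) * ?f z))"
    by (rule integrable_mult_right[OF sum_int])
  then have f_int: "integrable (count_space (?L - {x})) ?f"
    by (simp add: exp_minus flip: mult.assoc)
  have "exp (2 * pi * \<i> * of_real (x \<bullet> y)) * (\<Sum>\<^sub>\<infinity>z\<in>?L - {x}. ?f z) = exp (2 * pi * \<i> * of_real (x \<bullet> y)) * (\<integral>z. ?f z \<partial>count_space (?L - {x}))"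
    using infsetsum_infsum[of ?f "?L - {x}"] f_int by (simp add: infsetsum_def Infinite_Set_Sum.abs_summable_on_def)
  also have "\<dots> = (\<integral>z. exp (2 * pi * \<i> * of_real (x \<bullet> y)) * ?f z \<partial>count_space (?L - {x}))" by simp
  also have "\<dots> = (\<integral>z. zeta_prefactor \<nu> * (dt z + st z) \<partial>count_space (?L - {x}))"
    by (rule Bochner_Integration.integral_cong[OF refl], rule term_eq[symmetric]) simp
  also have "\<dots> = zeta_prefactor \<nu> * (direct_sum (?L - {x}) \<alpha> (\<nu>, cvec x, cvec y) + (\<integral>z. st z \<partial>count_space (?L - {x})))"
    using dt_int st_int by (simp add: direct_sum_def dt_def)
  finally have 1: "exp (2 * pi * \<i> * of_real (x \<bullet> y)) * (\<Sum>\<^sub>\<infinity>z\<in>?L - {x}. ?f z) =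
      zeta_prefactor \<nu> * (direct_sum (?L - {x}) \<alpha> (\<nu>, cvec x, cvec y) + (\<integral>z. st z \<partial>count_space (?L - {x})))" .
  have 2: "zeta_prefactor \<nu> * (\<integral>z. st z \<partial>count_space (?L - {x})) =
      zeta_prefactor \<nu> * (\<integral>z. st z \<partial>count_space ?L) - lattice_correction ?L \<alpha> x \<nu>"
  proof (cases "x \<in> ?L")
    case True
    have "(\<integral>z. st z \<partial>count_space ?L) = (\<integral>z. st z \<partial>count_space (?L - {x})) + st x"
    proof -
      have "infsetsum st ((?L - {x}) \<union> {x}) = infsetsum st (?L - {x}) + infsetsum st {x}"
        by (rule infsetsum_Un_disjoint[OF _ abs_summable_on_finite]) (use st_int in \<open>auto simp: Infinite_Set_Sum.abs_summable_on_def\<close>)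
      moreover have "(?L - {x}) \<union> {x} = ?L" using True by auto
      ultimately show ?thesis by (simp add: infsetsum_def[symmetric])
    qed
    moreover have "zeta_prefactor \<nu> * st x = lattice_correction ?L \<alpha> x \<nu>"
    proof -
      \<comment> \<open>At distance zero the small-scale integral is elementary, and its factor
        \<open>2 / \<nu>\<close> is absorbed by the reciprocal Gamma function; hence the argument
        \<open>\<nu> / 2 + 1\<close> in \<open>lattice_correction\<close>.\<close>
      have "Pint (\<nu> / 2) 0 = 2 / \<nu>" using integral_exp_minus_complex[OF re] by (simp add: Pint_def)
      moreover have "rGamma (\<nu> / 2) * (2 / \<nu>) = rGamma (\<nu> / 2 + 1)"
      proof -
        have "\<nu> \<noteq> 0" using re by auto
        then show ?thesis unfolding rGamma_plus1[of "\<nu> / 2", symmetric] by simp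
      qed
      ultimately show ?thesis using True
        by (simp add: st_def small_scale_term_def mi_power_zero lattice_correction_def zeta_prefactor_def del: times_divide_eq_right)
    qed
    ultimately show ?thesis by (simp add: algebra_simps)
  qed (simp add: lattice_correction_def)
  show ?thesis unfolding 1 crandall_def distrib_left 2 unfolding st_def small_scale_sum(2)[OF A \<nu> y] by simp
qed

section \<open>Analytic continuation in the exponent\<close>

text \<open>A meromorphic difference either vanishes or avoids zero near every point, punctured; a
  point inside the half plane rules out the latter. So \<open>F\<close> has the limit
  \<open>G z\<close> at each \<open>z\<close>, there is no pole, and nice meromorphy makes the value
  equal to the limit.\<close>

lemma nicely_meromorphic_eq_entire:
  assumes F: "F nicely_meromorphic_on UNIV" and G: "G holomorphic_on UNIV"
    and eq: "\<And>s. Re s > c \<Longrightarrow> F s = G s"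
  shows "F = G"
proof
  fix z
  have "(\<lambda>s. F s - G s) meromorphic_on UNIV"
    using F G unfolding nicely_meromorphic_on_def
    by (intro meromorphic_intros) (auto intro: analytic_on_imp_meromorphic_on simp: analytic_on_open)
  then have "eventually (\<lambda>s. F s - G s = 0) (cosparse UNIV) \<or> eventually (\<lambda>s. F s - G s \<noteq> 0) (cosparse UNIV)"
    by (rule meromorphic_imp_constant_or_avoid) auto
  then show "F z = G z"
  proof
    assume "eventually (\<lambda>s. F s - G s = 0) (cosparse UNIV)"
    then have ev: "eventually (\<lambda>s. F s - G s = 0) (at z)"
      by (rule eventually_cosparse_imp_eventually_at) simp
    have "G \<midarrow>z\<rightarrow> G z"
      using holomorphic_on_imp_continuous_on[OF G] by (simp add: continuous_on_eq_continuous_at isCont_def)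
    then have lim: "F \<midarrow>z\<rightarrow> G z"
      by (rule Lim_transform_eventually) (use ev in \<open>simp add: eventually_mono\<close>)
    then have "\<not> is_pole F z"
      unfolding is_pole_def using not_tendsto_and_filterlim_at_infinity[OF trivial_limit_at lim] by blast
    then have "F \<midarrow>z\<rightarrow> F z" using F unfolding nicely_meromorphic_on_def by blast
    then show ?thesis by (rule tendsto_unique[OF trivial_limit_at _ lim])
  next
    assume "eventually (\<lambda>s. F s - G s \<noteq> 0) (cosparse UNIV)"
    then have "eventually (\<lambda>s. F s - G s \<noteq> 0) (at (of_real (c + 1)))"
      by (rule eventually_cosparse_imp_eventually_at) simp
    moreover have "eventually (\<lambda>s. F s - G s = 0) (at (of_real (c + 1)))"
      by (rule eventually_at_in_open'[OF open_halfspace_Re_gt[of c], THEN eventually_mono]) (use eq in auto)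
    ultimately have "eventually (\<lambda>s::complex. False) (at (of_real (c + 1)))"
      by eventually_elim simp
    then show ?thesis by simp
  qed
qed

text \<open>\<open>foldr_dir_deriv_Pair\<close> applied twice reaches the third component.\<close>

lemma cmi_deriv_joint:
  fixes F :: "'a::complex_normed_vector \<times> 'b::complex_normed_vector \<times> (complex ^ 'd::finite) \<Rightarrow> complex"
  assumes "open U" "F jointly_holomorphic_on U"
  shows "(\<lambda>p. cmi_deriv \<alpha> (\<lambda>w. F (fst p, fst (snd p), w)) (snd (snd p))) jointly_holomorphic_on U"
proof -
  let ?vs = "map (\<lambda>i. axis i 1 :: complex ^ 'd) (mi_list \<alpha>)"
  have "cmi_deriv \<alpha> (\<lambda>w. F (fst p, fst (snd p), w)) (snd (snd p)) =
      foldr dir_deriv (map (Pair 0) (map (Pair 0) ?vs)) F p" for p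
  proof -
    obtain a b w where p: "p = (a, b, w)" by (cases p) auto
    show ?thesis unfolding p foldr_dir_deriv_Pair cmi_deriv_def by simp
  qed
  then show ?thesis using foldr_dir_deriv_jointly_holomorphic[OF assms] by simp
qed

lemma cdiff_at_rGamma [intro]:
  fixes f :: "'a::complex_normed_vector \<Rightarrow> complex"
  shows "cdiff_at f p \<Longrightarrow> cdiff_at (\<lambda>x. rGamma (f x)) p"
  by (rule cdiff_at_holomorphic[of rGamma UNIV]) (auto intro: holomorphic_intros)

lemma cdiff_at_pi_powr [intro]: "cdiff_at f p \<Longrightarrow> cdiff_at (\<lambda>x. complex_of_real pi powr f x) p"
  by (rule cdiff_at_holomorphic[of "\<lambda>s. complex_of_real pi powr s" UNIV]) (auto intro!: holomorphic_intros)

lemma cdiff_at_half [intro]: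
  fixes f :: "'a::complex_normed_vector \<Rightarrow> complex"
  shows "cdiff_at f p \<Longrightarrow> cdiff_at (\<lambda>x. f x / 2) p"
  using cdiff_at_mult[OF cdiff_at_const[of "1/2"], of f p] by simp

lemma cdiff_at_zeta_prefactor [intro]: "cdiff_at f p \<Longrightarrow> cdiff_at (\<lambda>x. zeta_prefactor (f x)) p"
  unfolding zeta_prefactor_def by (intro cdiff_at_mult cdiff_at_pi_powr cdiff_at_rGamma cdiff_at_half)

lemma cdiff_at_lattice_correction [intro]:
  assumes "cdiff_at f p" shows "cdiff_at (\<lambda>x. lattice_correction \<Lambda> \<alpha> y (f x)) p"
proof (cases "y \<in> \<Lambda> \<and> \<alpha> = 0")
  case True
  show ?thesis unfolding lattice_correction_def if_P[OF True]
    by (intro cdiff_at_mult cdiff_at_pi_powr cdiff_at_rGamma cdiff_at_half cdiff_at_add cdiff_at_const assms)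
next
  case False
  show ?thesis unfolding lattice_correction_def if_not_P[OF False] by (rule cdiff_at_const)
qed

lemma direct_sum_jointly_holomorphic:
  fixes A :: "real ^ 'd ^ 'd::finite"
  assumes "invertible A" "L \<subseteq> lattice_of A"
  shows "direct_sum L \<alpha> jointly_holomorphic_on UNIV \<times> cdomain L \<times> UNIV"
  unfolding direct_sum_def[abs_def] by (rule dominated_family_integral(1)[OF dominated_family_direct_term[OF assms]])

lemma dual_sum_jointly_holomorphic:
  fixes A :: "real ^ 'd ^ 'd::finite"
  assumes "invertible A" "L \<subseteq> dual_lattice_of A" "\<And>k. k \<in> L \<Longrightarrow> - k \<in> L"
  shows "dual_sum L jointly_holomorphic_on UNIV \<times> UNIV \<times> cdomain L"
  unfolding dual_sum_def[abs_def]
  by (rule dominated_family_integral(1)[OF dominated_family_dual_term[OF invertible_dual[OF assms(1)]]])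
    (use assms in \<open>simp_all add: dual_lattice_of_def\<close>)

lemma cdiff_at_direct_sum:
  fixes A :: "real ^ 'd ^ 'd::finite" and p :: "'a::complex_normed_vector"
  assumes "invertible A" "L \<subseteq> lattice_of A"
    and "cdiff_at f p" "cdiff_at g p" "cdiff_at h p" "g p \<in> cdomain L"
  shows "cdiff_at (\<lambda>p. direct_sum L \<alpha> (f p, g p, h p)) p"
proof (rule cdiff_at_compose[of "direct_sum L \<alpha>"])
  show "cdiff_at (direct_sum L \<alpha>) (f p, g p, h p)"
    using direct_sum_jointly_holomorphic[OF assms(1,2)] assms(6) by (simp add: jointly_holomorphic_on_iff)
qed (intro cdiff_at_Pair assms)

lemma cdiff_at_dual_sum_deriv:
  fixes A :: "real ^ 'd ^ 'd::finite" and p :: "'a::complex_normed_vector"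
  assumes A: "invertible A" and L: "L \<subseteq> dual_lattice_of A" "\<And>k. k \<in> L \<Longrightarrow> - k \<in> L"
    and "cdiff_at f p" "cdiff_at g p" "cdiff_at h p" "h p \<in> cdomain L"
  shows "cdiff_at (\<lambda>p. cmi_deriv \<alpha> (\<lambda>w. dual_sum L (f p, g p, w)) (h p)) p"
proof -
  let ?F = "\<lambda>p. cmi_deriv \<alpha> (\<lambda>w. dual_sum L (fst p, fst (snd p), w)) (snd (snd p))"
  have "open (UNIV \<times> UNIV \<times> cdomain L :: (complex \<times> (complex ^ 'd) \<times> (complex ^ 'd)) set)"
    by (intro open_Times open_UNIV open_cdomain_dual[OF A L(1)])
  from cmi_deriv_joint[OF this dual_sum_jointly_holomorphic[OF A L]]
  have "cdiff_at ?F (f p, g p, h p)"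
    using assms(7) by (simp add: jointly_holomorphic_on_iff)
  from cdiff_at_compose[of ?F "\<lambda>p. (f p, g p, h p)", OF this] show ?thesis
    using assms by (simp add: cdiff_at_Pair)
qed

lemma cdiff_at_crandall:
  fixes A :: "real ^ 'd ^ 'd::finite"
  assumes A: "invertible A" and y: "y \<notin> dual_lattice_of A"
  shows "cdiff_at (crandall A \<alpha> x y) \<nu>"
  unfolding crandall_def[abs_def] using y
  by (intro cdiff_at_diff cdiff_at_mult cdiff_at_add cdiff_at_const cdiff_at_ident cdiff_at_zeta_prefactor
      cdiff_at_lattice_correction cdiff_at_direct_sum[OF A] cdiff_at_dual_sum_deriv[OF A] dual_lattice_uminus)
    (auto simp: cvec_in_cdomain)

text \<open>Off the dual lattice the formula is entire in \<nu>, so the continuation asked for in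
  the definition exists, is unique and has no poles.\<close>

lemma epstein_zeta_eq_crandall:
  fixes A :: "real ^ 'd ^ 'd::finite"
  assumes A: "invertible A" and y: "y \<notin> dual_lattice_of A"
  shows "exp (2 * pi * \<i> * of_real (x \<bullet> y)) * epstein_zeta (lattice_of A) \<nu> \<alpha> x y = crandall A \<alpha> x y \<nu>"
proof -
  define e where "e = exp (2 * pi * \<i> * of_real (x \<bullet> y))"
  have e: "e \<noteq> 0" by (simp add: e_def)
  define Z where "Z s = (\<Sum>\<^sub>\<infinity>z\<in>lattice_of A - {x}. exp (- 2 * pi * \<i> * complex_of_real (y \<bullet> z)) *
         complex_of_real (mi_power (z - x) \<alpha>) * complex_of_real (norm (z - x)) powr (- s))" for s
  define G where "G s = crandall A \<alpha> x y s / e" for s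
  have ZG: "Z s = G s" if "Re s > real (CARD('d) + mi_abs \<alpha>)" for s
    using crandall_half_plane[OF A that y, of x] e by (simp add: Z_def G_def e_def field_simps)
  have "crandall A \<alpha> x y holomorphic_on UNIV" by (rule holomorphic_on_cdiff, rule cdiff_at_crandall[OF A y])
  then have G: "G holomorphic_on UNIV" unfolding G_def using e by (intro holomorphic_intros)
  have "(THE F. F nicely_meromorphic_on UNIV \<and> (\<forall>s. Re s > real (CARD('d) + mi_abs \<alpha>) \<longrightarrow> F s = Z s)) = G"
  proof (rule the_equality)
    show "G nicely_meromorphic_on UNIV \<and> (\<forall>s. Re s > real (CARD('d) + mi_abs \<alpha>) \<longrightarrow> G s = Z s)"
      using G ZG by (auto intro!: analytic_on_imp_nicely_meromorphic_on simp: analytic_on_open)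
    fix F assume "F nicely_meromorphic_on UNIV \<and> (\<forall>s. Re s > real (CARD('d) + mi_abs \<alpha>) \<longrightarrow> F s = Z s)"
    then show "F = G" using nicely_meromorphic_eq_entire[OF _ G] ZG by metis
  qed
  then have "epstein_zeta (lattice_of A) \<nu> \<alpha> x y = G \<nu>" unfolding epstein_zeta_def Z_def by simp
  then show ?thesis using e by (simp add: G_def e_def)
qed

section \<open>The singularity at the origin\<close>

lemma cmi_deriv_add:
  assumes "open U" "f jointly_holomorphic_on U" "g jointly_holomorphic_on U" "p \<in> U"
  shows "cmi_deriv \<alpha> (\<lambda>p. f p + g p) p = cmi_deriv \<alpha> f p + cmi_deriv \<alpha> g p"
  unfolding cmi_deriv_def by (rule foldr_dir_deriv_add[OF assms])

lemma cmi_deriv_sum: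
  assumes "open U" "\<And>i. i \<in> I \<Longrightarrow> f i jointly_holomorphic_on U" "p \<in> U"
  shows "cmi_deriv \<alpha> (\<lambda>p. \<Sum>i\<in>I. f i p) p = (\<Sum>i\<in>I. cmi_deriv \<alpha> (f i) p)"
  unfolding cmi_deriv_def by (rule foldr_dir_deriv_sum[OF assms])

text \<open>The first argument of the incomplete Gamma function in the dual sum; the
  \<open>itself\<close> argument fixes the dimension.\<close>

definition mellin_exponent :: "'d::finite itself \<Rightarrow> complex \<Rightarrow> complex" where
  "mellin_exponent _ \<nu> = (of_nat CARD('d) - \<nu>) / 2"

lemma cdiff_at_mellin_exponent: "cdiff_at f p \<Longrightarrow> cdiff_at (\<lambda>x. mellin_exponent d (f x)) p"
  unfolding mellin_exponent_def by (intro cdiff_at_half cdiff_at_diff cdiff_at_const)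

lemma mellin_exponent_eq_iff:
  "mellin_exponent TYPE('d::finite) \<nu> = - of_nat l \<longleftrightarrow> \<nu> = of_nat (CARD('d) + 2 * l)"
  by (auto simp: mellin_exponent_def field_simps)

text \<open>Exceptional exponents come from the poles of those series terms that
  \<open>cmi_deriv_power_cdot_self\<close> leaves.\<close>

lemma not_exceptional_iff:
  fixes \<alpha> :: "nat ^ 'd::finite"
  shows "\<nu> \<notin> exceptional_exponents \<alpha> \<longleftrightarrow> mellin_exponent TYPE('d) \<nu> \<in> off_poles {mi_abs (mi_half_ceil \<alpha>)..}"
proof -
  let ?N = "mi_abs (mi_half_ceil \<alpha>)"
  have "\<nu> \<in> exceptional_exponents \<alpha> \<longleftrightarrow> (\<exists>l\<ge>?N. \<nu> = of_nat (CARD('d) + 2 * l))"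
  proof
    assume "\<nu> \<in> exceptional_exponents \<alpha>"
    then obtain n where "\<nu> = of_nat (CARD('d) + 2 * ?N + 2 * n)" unfolding exceptional_exponents_def by blast
    then show "\<exists>l\<ge>?N. \<nu> = of_nat (CARD('d) + 2 * l)" by (intro exI[of _ "?N + n"]) (simp add: algebra_simps)
  next
    assume "\<exists>l\<ge>?N. \<nu> = of_nat (CARD('d) + 2 * l)"
    then obtain l where l: "l \<ge> ?N" "\<nu> = of_nat (CARD('d) + 2 * l)" by blast
    then have "CARD('d) + 2 * l = CARD('d) + 2 * ?N + 2 * (l - ?N)" by simp
    then show "\<nu> \<in> exceptional_exponents \<alpha>" unfolding exceptional_exponents_def l(2) by (metis rangeI)
  qed
  then show ?thesis unfolding off_poles_def by (auto simp: mellin_exponent_eq_iff)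
qed

lemma open_not_exceptional: "open (UNIV - exceptional_exponents (\<alpha> :: nat ^ 'd::finite))"
proof -
  have "UNIV - exceptional_exponents \<alpha> = mellin_exponent TYPE('d) -` off_poles {mi_abs (mi_half_ceil \<alpha>)..}"
    using not_exceptional_iff[of _ \<alpha>] by auto
  moreover have "continuous_on UNIV (mellin_exponent TYPE('d))"
    unfolding mellin_exponent_def by (intro continuous_intros) auto
  ultimately show ?thesis using open_off_poles by (simp add: continuous_on_open_vimage)
qed

text \<open>The logarithm in \<open>Qint\<close> at \<open>- l\<close> has exactly the coefficient
  that \<open>s_hat\<close> has at this exponent. What remains is an entire series without its term
  \<open>l\<close>, plus a multiple of the \<open>l\<close>-th power, which is harmless for fixed
  \<nu>.\<close>

lemma s_hat_log:
  fixes \<nu> :: complex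
  assumes \<nu>: "\<nu> = of_nat (CARD('d::finite) + 2 * l)"
  obtains c where "\<And>y :: real ^ 'd. y \<noteq> 0 \<Longrightarrow> s_hat \<nu> y = zeta_prefactor \<nu> *
    (Qint (- of_nat l) (of_real pi * cdot (cvec y) (cvec y)) +
     (Pser (- {l}) (- of_nat l) (of_real pi * cdot (cvec y) (cvec y)) + c * (of_real pi * cdot (cvec y) (cvec y)) ^ l))"
proof -
  obtain c where c: "\<And>t. t > 0 \<Longrightarrow> Qint (- of_nat l) (of_real t) =
     of_real ((-1) ^ (l + 1) / fact l * t ^ l * ln t) + c * of_real t ^ l - Pser (- {l}) (- of_nat l) (of_real t)"
    using Qint_neg_nat[of l] by metis
  have "s_hat \<nu> y = zeta_prefactor \<nu> *
    (Qint (- of_nat l) (of_real pi * cdot (cvec y) (cvec y)) +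
     (Pser (- {l}) (- of_nat l) (of_real pi * cdot (cvec y) (cvec y)) + (- c) * (of_real pi * cdot (cvec y) (cvec y)) ^ l))"
    if y: "y \<noteq> 0" for y :: "real ^ 'd"
  proof -
    define t where "t = pi * (norm y)\<^sup>2"
    have t: "t > 0" using y by (simp add: t_def)
    have tc: "of_real pi * cdot (cvec y) (cvec y) = complex_of_real t"
      by (simp add: t_def cdot_cvec power2_norm_eq_inner)
    define b where "b = real l + real CARD('d) / 2"
    have b: "b > 0" by (simp add: b_def add_nonneg_pos)
    have ex: "\<exists>l::nat. \<nu> = of_nat (CARD('d) + 2 * l)" using \<nu> by blast
    have the: "(THE l::nat. \<nu> = of_nat (CARD('d) + 2 * l)) = l"
      using \<nu> by (intro the_equality) (simp, metis add_left_cancel mult_left_cancel of_nat_eq_iff zero_neq_numeral)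
    have "s_hat \<nu> y = complex_of_real (pi powr b / Gamma b * ((-1) ^ (l + 1) / fact l) * t ^ l * ln t)"
      unfolding s_hat_def if_P[OF ex] the Let_def by (simp only: b_def t_def)
    also have "\<dots> = complex_of_real (pi powr b / Gamma b) * complex_of_real ((-1) ^ (l + 1) / fact l * t ^ l * ln t)"
      unfolding of_real_mult[symmetric] by (simp only: mult.assoc)
    also have "complex_of_real (pi powr b / Gamma b) = zeta_prefactor \<nu>"
    proof -
      have n2: "\<nu> / 2 = of_real b" unfolding \<nu> b_def by simp
      have "rGamma (complex_of_real b) = of_real (inverse (Gamma b))"
        by (simp add: rGamma_inverse_Gamma Gamma_complex_of_real)
      then show ?thesis unfolding zeta_prefactor_def n2 using powr_of_real[of pi b] by (simp add: divide_inverse)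
    qed
    finally show ?thesis unfolding tc c[OF t] by simp
  qed
  then show thesis by (rule that)
qed

text \<open>\<open>s_hat\<close> is given by two formulas, and logarithms can occur even at
  exponents that are not exceptional. Both cases are brought to one form whose tail
  \<open>Pser {N..}\<close> is holomorphic in \<nu>. The coefficients \<open>c n\<close> may jump
  with \<nu>, but they belong to powers that the \<alpha>-th derivative removes.\<close>

lemma s_hat_regular:
  fixes \<alpha> :: "nat ^ 'd::finite" and \<nu> :: complex
  assumes \<nu>: "\<nu> \<notin> exceptional_exponents \<alpha>"
  defines "N \<equiv> mi_abs (mi_half_ceil \<alpha>)" and "s \<equiv> mellin_exponent TYPE('d) \<nu>"
  obtains c where "\<And>y :: real ^ 'd. y \<noteq> 0 \<Longrightarrow> s_hat \<nu> y = zeta_prefactor \<nu> *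
    (Qint s (of_real pi * cdot (cvec y) (cvec y)) +
     (Pser {N..} s (of_real pi * cdot (cvec y) (cvec y)) + (\<Sum>n<N. c n * cdot (cvec y) (cvec y) ^ n)))"
proof (cases "\<exists>l::nat. \<nu> = of_nat (CARD('d) + 2 * l)")
  case True
  then obtain l where l: "\<nu> = of_nat (CARD('d) + 2 * l)" by blast
  have s: "s = - of_nat l" unfolding s_def mellin_exponent_eq_iff by (rule l)
  have lN: "l < N" using \<nu> s unfolding not_exceptional_iff off_poles_def N_def s_def by auto
  obtain c where c: "\<And>y :: real ^ 'd. y \<noteq> 0 \<Longrightarrow> s_hat \<nu> y = zeta_prefactor \<nu> *
    (Qint (- of_nat l) (of_real pi * cdot (cvec y) (cvec y)) +
     (Pser (- {l}) (- of_nat l) (of_real pi * cdot (cvec y) (cvec y)) + c * (of_real pi * cdot (cvec y) (cvec y)) ^ l))"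
    using s_hat_log[OF l] by blast
  \<comment> \<open>The term \<open>n = l\<close> of the series would be singular; its place is
    taken by the constant that the logarithmic case leaves.\<close>
  define c' where "c' n = (if n = l then c * of_real pi ^ n else (- of_real pi) ^ n / (fact n * (s + of_nat n)))" for n
  have un: "- {l} = {N..} \<union> ({..<N} - {l})" using lN by auto
  have "Pser (- {l}) s (of_real pi * q) + c * (of_real pi * q) ^ l = Pser {N..} s (of_real pi * q) + (\<Sum>n<N. c' n * q ^ n)" for q
  proof -
    have "Pser (- {l}) s (of_real pi * q) = Pser {N..} s (of_real pi * q) +
        (\<Sum>n\<in>{..<N} - {l}. (- (of_real pi * q)) ^ n / (fact n * (s + of_nat n)))"
      unfolding un by (rule Pser_Un) (use lN in \<open>auto simp: off_poles_def s\<close>)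
    also have "(\<Sum>n\<in>{..<N} - {l}. (- (of_real pi * q)) ^ n / (fact n * (s + of_nat n))) = (\<Sum>n\<in>{..<N} - {l}. c' n * q ^ n)"
      by (rule sum.cong) (auto simp: c'_def power_mult_distrib[symmetric])
    also have "\<dots> = (\<Sum>n<N. c' n * q ^ n) - c' l * q ^ l"
      using lN by (simp add: sum_diff1)
    finally show ?thesis by (simp add: c'_def power_mult_distrib)
  qed
  then show thesis using c unfolding s[symmetric] by (intro that[of c']) simp
next
  case False
  have s: "s \<in> off_poles UNIV" using False unfolding off_poles_def s_def by (simp add: mellin_exponent_eq_iff)
  define c where "c n = (- of_real pi) ^ n / (fact n * (s + of_nat n))" for n
  have un: "UNIV = {N..} \<union> {..<N}" by auto
  have P: "Pser UNIV s (of_real pi * q) = Pser {N..} s (of_real pi * q) + (\<Sum>n<N. c n * q ^ n)" for q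
  proof -
    have "Pser UNIV s (of_real pi * q) = Pser {N..} s (of_real pi * q) +
        (\<Sum>n<N. (- (of_real pi * q)) ^ n / (fact n * (s + of_nat n)))"
      unfolding un by (rule Pser_Un) (use s un in auto)
    then show ?thesis by (simp add: c_def power_mult_distrib[symmetric])
  qed
  have "s_hat \<nu> y = zeta_prefactor \<nu> *
    (Qint s (of_real pi * cdot (cvec y) (cvec y)) +
     (Pser {N..} s (of_real pi * cdot (cvec y) (cvec y)) + (\<Sum>n<N. c n * cdot (cvec y) (cvec y) ^ n)))"
    if y: "y \<noteq> 0" for y :: "real ^ 'd"
  proof -
    have t: "pi * (norm y)\<^sup>2 > 0" using y by simp
    have tc: "complex_of_real (pi * (norm y)\<^sup>2) = of_real pi * cdot (cvec y) (cvec y)"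
      by (simp add: cdot_cvec power2_norm_eq_inner)
    have s': "(of_nat CARD('d) - \<nu>) / 2 = s" "(\<nu> - of_nat CARD('d)) / 2 = - s"
      by (simp_all add: s_def mellin_exponent_def field_simps)
    have "s_hat \<nu> y = zeta_prefactor \<nu> * (Gamma s * complex_of_real (pi * (norm y)\<^sup>2) powr (- s))"
      unfolding s_hat_def if_not_P[OF False] s' zeta_prefactor_def by (simp only: mult.assoc)
    then show ?thesis unfolding Gamma_Qint_Pser[OF s t, symmetric] unfolding tc P .
  qed
  then show thesis by (rule that)
qed

lemma cvec_zero [simp]: "cvec 0 = 0"
  by (simp add: cvec_def vec_eq_iff)

lemma cdomain_origin: "w \<in> cdomain {0} \<longleftrightarrow> Re (cdot w w) > 0"
  by (simp add: cdomain_iff)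

lemma cdiff_at_cdot_self: "cdiff_at (\<lambda>w. of_real pi * cdot w w) w"
  by (intro cdiff_at_mult cdiff_at_const cdiff_at_cdot cdiff_at_ident)

lemma open_cdomain_origin: "open (cdomain {0 :: real ^ 'd::finite})"
  by (rule open_cdomain[of "mat 1"]) (auto simp: invertible_def zero_in_lattice intro!: exI[of _ "mat 1"])

lemma Qint_cdot_jointly_holomorphic:
  "(\<lambda>w. Qint s (of_real pi * cdot w w)) jointly_holomorphic_on cdomain {0}"
  unfolding jointly_holomorphic_on_iff
  by (intro ballI cdiff_at_Qint cdiff_at_const cdiff_at_cdot_self) (simp add: cdomain_origin)

lemma mi_deriv_s_hat:
  fixes \<alpha> :: "nat ^ 'd::finite"
  assumes R: "R jointly_holomorphic_on UNIV"
    and eq: "\<And>y :: real ^ 'd. y \<noteq> 0 \<Longrightarrow> s_hat \<nu> y = b * (Qint s (of_real pi * cdot (cvec y) (cvec y)) + R (cvec y))"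
    and y: "y \<noteq> 0"
  shows "mi_deriv \<alpha> (s_hat \<nu>) y =
    b * (cmi_deriv \<alpha> (\<lambda>w. Qint s (of_real pi * cdot w w)) (cvec y) + cmi_deriv \<alpha> R (cvec y))"
proof -
  let ?U = "cdomain {0 :: real ^ 'd}" and ?Q = "\<lambda>w. Qint s (of_real pi * cdot w w)"
  note U = open_cdomain_origin[where 'd='d]
  have R': "R jointly_holomorphic_on ?U" using jointly_holomorphic_on_subset[OF R subset_UNIV] .
  have Q: "?Q jointly_holomorphic_on ?U" by (rule Qint_cdot_jointly_holomorphic)
  have QR: "(\<lambda>w. ?Q w + R w) jointly_holomorphic_on ?U"
    using Q R' by (simp add: jointly_holomorphic_on_iff cdiff_at_add)
  have yU: "cvec y \<in> ?U" using y by (simp add: cvec_in_cdomain)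
  have "mi_deriv \<alpha> (s_hat \<nu>) y = cmi_deriv \<alpha> (\<lambda>w. b * (?Q w + R w)) (cvec y)"
  proof (rule mi_deriv_eq_cmi_deriv[of "- {0}" _ _ ?U])
    show "(\<lambda>w. b * (?Q w + R w)) jointly_holomorphic_on ?U"
      using QR by (simp add: jointly_holomorphic_on_iff cdiff_at_mult cdiff_at_const)
  qed (use eq y U in \<open>auto simp: cvec_in_cdomain\<close>)
  also have "\<dots> = b * (cmi_deriv \<alpha> ?Q (cvec y) + cmi_deriv \<alpha> R (cvec y))"
    unfolding cmi_deriv_cmult[OF U QR yU] cmi_deriv_add[OF U Q R' yU] ..
  finally show ?thesis .
qed

lemma Pser_cdot_jointly_holomorphic:
  "s \<in> off_poles I \<Longrightarrow> (\<lambda>w. Pser I s (of_real pi * cdot w w)) jointly_holomorphic_on UNIV"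
  unfolding jointly_holomorphic_on_iff
  by (intro ballI cdiff_at_Pser cdiff_at_const cdiff_at_cdot_self)

lemma cdot_power_jointly_holomorphic:
  "(\<lambda>w. c * cdot w w ^ n) jointly_holomorphic_on UNIV"
  unfolding jointly_holomorphic_on_iff
  by (intro ballI cdiff_at_mult cdiff_at_const cdiff_at_power cdiff_at_cdot cdiff_at_ident)

text \<open>Outside the exceptional exponents the terms of \<open>s_hat\<close> that are polynomial in \<open>y\<^sup>2\<close> and could
  have a pole in \<open>\<nu>\<close> are killed by the derivative.\<close>

lemma mi_deriv_s_hat_regular:
  fixes \<alpha> :: "nat ^ 'd::finite"
  assumes \<nu>: "\<nu> \<notin> exceptional_exponents \<alpha>" and y: "y \<noteq> 0"
  defines "s \<equiv> mellin_exponent TYPE('d) \<nu>"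
  shows "mi_deriv \<alpha> (s_hat \<nu>) y = zeta_prefactor \<nu> *
    (cmi_deriv \<alpha> (\<lambda>w. Qint s (of_real pi * cdot w w)) (cvec y) +
     cmi_deriv \<alpha> (\<lambda>w. Pser {mi_abs (mi_half_ceil \<alpha>)..} s (of_real pi * cdot w w)) (cvec y))"
proof -
  let ?N = "mi_abs (mi_half_ceil \<alpha>)"
  obtain c where c: "\<And>y :: real ^ 'd. y \<noteq> 0 \<Longrightarrow> s_hat \<nu> y = zeta_prefactor \<nu> *
    (Qint s (of_real pi * cdot (cvec y) (cvec y)) +
     (Pser {?N..} s (of_real pi * cdot (cvec y) (cvec y)) + (\<Sum>n<?N. c n * cdot (cvec y) (cvec y) ^ n)))"
    using s_hat_regular[OF \<nu>] unfolding s_def by blast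
  let ?P = "\<lambda>w. Pser {?N..} s (of_real pi * cdot w w)" and ?S = "\<lambda>w. \<Sum>n<?N. c n * cdot w w ^ n"
  have P: "?P jointly_holomorphic_on UNIV"
    using \<nu> unfolding not_exceptional_iff s_def by (rule Pser_cdot_jointly_holomorphic)
  have S: "?S jointly_holomorphic_on UNIV"
    using cdot_power_jointly_holomorphic unfolding jointly_holomorphic_on_iff by (intro ballI cdiff_at_sum) blast
  have PS: "(\<lambda>w. ?P w + ?S w) jointly_holomorphic_on UNIV"
    using P S unfolding jointly_holomorphic_on_iff by (intro ballI cdiff_at_add) blast+
  have "cmi_deriv \<alpha> ?S (cvec y) = (\<Sum>n<?N. cmi_deriv \<alpha> (\<lambda>w. c n * cdot w w ^ n) (cvec y))"
    by (rule cmi_deriv_sum[OF open_UNIV cdot_power_jointly_holomorphic UNIV_I])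
  also have "\<dots> = 0"
  proof (rule sum.neutral, rule ballI)
    fix n assume n: "n \<in> {..<?N}"
    have "cmi_deriv \<alpha> (\<lambda>w. c n * cdot w w ^ n) (cvec y) = c n * cmi_deriv \<alpha> (\<lambda>w. cdot w w ^ n) (cvec y)"
      using cdot_power_jointly_holomorphic[of 1 n] by (intro cmi_deriv_cmult[OF open_UNIV _ UNIV_I]) simp
    then show "cmi_deriv \<alpha> (\<lambda>w. c n * cdot w w ^ n) (cvec y) = 0" using n cmi_deriv_power_cdot_self[of n \<alpha>] by simp
  qed
  finally have S0: "cmi_deriv \<alpha> ?S (cvec y) = 0" .
  have "mi_deriv \<alpha> (s_hat \<nu>) y = zeta_prefactor \<nu> *
    (cmi_deriv \<alpha> (\<lambda>w. Qint s (of_real pi * cdot w w)) (cvec y) + cmi_deriv \<alpha> (\<lambda>w. ?P w + ?S w) (cvec y))"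
    by (rule mi_deriv_s_hat[OF PS c y])
  then show ?thesis unfolding cmi_deriv_add[OF open_UNIV P S UNIV_I] S0 by simp
qed

section \<open>Cancellation of the dual term at the origin\<close>

lemma dual_sum_split_origin:
  fixes A :: "real ^ 'd ^ 'd::finite"
  assumes A: "invertible A" and w: "w \<in> cdomain (dual_lattice_of A)"
  shows "dual_sum (dual_lattice_of A) (\<nu>, u, w) = dual_sum (dual_lattice_of A - {0}) (\<nu>, u, w) +
    Qint (mellin_exponent TYPE('d) \<nu>) (of_real pi * cdot w w)"
proof -
  let ?D = "dual_lattice_of A" and ?f = "dual_term (\<nu>, u, w)"
  have "integrable (count_space ?D) ?f"
    by (rule dominated_family_integrable[OF dominated_family_dual_term[OF invertible_dual[OF A]]])
      (use w in \<open>auto simp: dual_lattice_of_def lattice_uminus\<close>)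
  then have int: "Infinite_Set_Sum.abs_summable_on ?f ?D" by (simp add: Infinite_Set_Sum.abs_summable_on_def)
  have "infsetsum ?f ((?D - {0}) \<union> {0}) = infsetsum ?f (?D - {0}) + infsetsum ?f {0}"
    by (rule infsetsum_Un_disjoint[OF abs_summable_on_subset[OF int] abs_summable_on_finite]) auto
  moreover have "(?D - {0}) \<union> {0} = ?D" using zero_in_lattice by (auto simp: dual_lattice_of_def)
  moreover have "?f 0 = Qint (mellin_exponent TYPE('d) \<nu>) (of_real pi * cdot w w)"
    by (simp add: dual_term_def mellin_exponent_def cdot_def)
  ultimately show ?thesis by (simp add: dual_sum_def infsetsum_def[symmetric])
qed

text \<open>The argument \<open>r\<close> stands for the derivative of the part of \<open>s_hat\<close> that remains after its
  singular part at \<open>y = 0\<close> has cancelled against the term \<open>k = 0\<close> of the dual sum.\<close>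

definition crandall_reg :: "real ^ 'd ^ 'd::finite \<Rightarrow> nat ^ 'd \<Rightarrow> (real ^ 'd) set \<Rightarrow>
    complex \<Rightarrow> complex ^ 'd \<Rightarrow> complex ^ 'd \<Rightarrow> complex \<Rightarrow> complex" where
  "crandall_reg A \<alpha> L \<nu> u w r = zeta_prefactor \<nu> * (direct_sum L \<alpha> (\<nu>, u, w) +
     1 / ((- 2 * pi * \<i>) ^ mi_abs \<alpha> * of_real \<bar>det A\<bar>) *
      (cmi_deriv \<alpha> (\<lambda>w. dual_sum (dual_lattice_of A - {0}) (\<nu>, u, w)) w - r))"

lemma cdiff_at_crandall_reg:
  fixes A :: "real ^ 'd ^ 'd::finite" and p :: "'a::complex_normed_vector"
  assumes A: "invertible A" and L: "L \<subseteq> lattice_of A"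
    and "cdiff_at f p" "cdiff_at g p" "cdiff_at h p" "cdiff_at r p"
    and "g p \<in> cdomain L" "h p \<in> cdomain (dual_lattice_of A - {0})"
  shows "cdiff_at (\<lambda>p. crandall_reg A \<alpha> L (f p) (g p) (h p) (r p)) p"
  unfolding crandall_reg_def using assms
  by (intro cdiff_at_diff cdiff_at_mult cdiff_at_add cdiff_at_const cdiff_at_zeta_prefactor
      cdiff_at_direct_sum[OF A] cdiff_at_dual_sum_deriv[OF A]) (auto simp: dual_lattice_uminus)

lemma epstein_zeta_reg_raw_eq:
  fixes A :: "real ^ 'd ^ 'd::finite"
  assumes A: "invertible A" and y: "y \<notin> dual_lattice_of A"
    and s_hat: "mi_deriv \<alpha> (s_hat \<nu>) y = zeta_prefactor \<nu> *
      (cmi_deriv \<alpha> (\<lambda>w. Qint (mellin_exponent TYPE('d) \<nu>) (of_real pi * cdot w w)) (cvec y) + r)"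
  shows "epstein_zeta_reg_raw A \<nu> \<alpha> x y =
    crandall_reg A \<alpha> (lattice_of A - {x}) \<nu> (cvec x) (cvec y) r - lattice_correction (lattice_of A) \<alpha> x \<nu>"
proof -
  let ?D = "dual_lattice_of A"
  let ?q = "\<lambda>w. Qint (mellin_exponent TYPE('d) \<nu>) (of_real pi * cdot w w)"
  let ?d = "\<lambda>L w. dual_sum L (\<nu>, cvec x, w)"
  let ?c = "(- 2 * pi * \<i>) ^ mi_abs \<alpha> * complex_of_real \<bar>det A\<bar>"
  have U: "open (cdomain ?D)" by (rule open_cdomain_dual[OF A order_refl])
  have yU: "cvec y \<in> cdomain ?D" using y by (simp add: cvec_in_cdomain)
  have sub: "cdomain ?D \<subseteq> cdomain (?D - {0})" "cdomain ?D \<subseteq> cdomain {0}"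
  proof -
    have "0 \<in> ?D" unfolding dual_lattice_of_def by (rule zero_in_lattice)
    then show "cdomain ?D \<subseteq> cdomain (?D - {0})" "cdomain ?D \<subseteq> cdomain {0}"
      unfolding cdomain_def by blast+
  qed
  have d: "?d (?D - {0}) jointly_holomorphic_on cdomain ?D"
    unfolding jointly_holomorphic_on_iff
  proof
    fix w assume "w \<in> cdomain ?D"
    then have "cdiff_at (dual_sum (?D - {0})) (\<nu>, cvec x, w)"
      using dual_sum_jointly_holomorphic[OF A, of "?D - {0}"] sub(1)
      by (auto simp: jointly_holomorphic_on_iff dual_lattice_uminus)
    then show "cdiff_at (?d (?D - {0})) w"
      by (rule cdiff_at_compose) (intro cdiff_at_Pair cdiff_at_const cdiff_at_ident)
  qed
  have q: "?q jointly_holomorphic_on cdomain ?D"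
    by (rule jointly_holomorphic_on_subset[OF Qint_cdot_jointly_holomorphic sub(2)])
  have "cmi_deriv \<alpha> (?d ?D) (cvec y) = cmi_deriv \<alpha> (\<lambda>w. ?d (?D - {0}) w + ?q w) (cvec y)"
    by (rule cmi_deriv_cong[OF U dual_sum_split_origin[OF A] yU])
  also have "\<dots> = cmi_deriv \<alpha> (?d (?D - {0})) (cvec y) + cmi_deriv \<alpha> ?q (cvec y)"
    by (rule cmi_deriv_add[OF U d q yU])
  finally have dual: "cmi_deriv \<alpha> (?d ?D) (cvec y) = cmi_deriv \<alpha> (?d (?D - {0})) (cvec y) + cmi_deriv \<alpha> ?q (cvec y)" .
  \<comment> \<open>\<open>q\<close> stands for the dual term \<open>k = 0\<close>, which occurs in
    the dual sum and in \<open>s_hat\<close> with the same factor and cancels; \<open>l\<close> is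
    the lattice correction.\<close>
  have alg: "z * (a + 1 / c * (e + q)) - l - z * (q + r) / c = z * (a + 1 / c * (e - r)) - l"
    for z a c e q l r :: complex
    by (simp add: algebra_simps add_divide_distrib diff_divide_distrib)
  show ?thesis
    unfolding epstein_zeta_reg_raw_def epstein_zeta_eq_crandall[OF A y] s_hat crandall_def dual crandall_reg_def
    by (rule alg)
qed

text \<open>The value at \<open>y = 0\<close> is defined as a limit and is recovered by continuity
  of \<open>G\<close>. Openness of the domain of the punctured dual lattice supplies a neighbourhood
  of 0 that meets the dual lattice only in 0.\<close>

lemma epstein_zeta_reg_eq:
  fixes A :: "real ^ 'd ^ 'd::finite" and G :: "complex ^ 'd \<Rightarrow> complex"
  assumes A: "invertible A" and G: "G jointly_holomorphic_on cdomain (dual_lattice_of A - {0})"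
    and raw: "\<And>y. y \<notin> dual_lattice_of A \<Longrightarrow> epstein_zeta_reg_raw A \<nu> \<alpha> x y = G (cvec y)"
    and y: "y \<in> (UNIV - dual_lattice_of A) \<union> {0}"
  shows "G (cvec y) = epstein_zeta_reg A \<nu> \<alpha> x y"
proof (cases "y = 0")
  case True
  let ?V = "cdomain (dual_lattice_of A - {0})"
  have cont: "continuous_on UNIV (cvec :: real ^ 'd \<Rightarrow> complex ^ 'd)"
    unfolding cvec_def by (intro continuous_intros)
  then have V: "open (cvec -` ?V)"
    using open_cdomain_dual[OF A, of "dual_lattice_of A - {0}"] by (auto simp: continuous_on_open_vimage)
  have zero: "0 \<in> ?V" using cvec_in_cdomain[of 0 "dual_lattice_of A - {0}"] by simp
  have "isCont (\<lambda>y. G (cvec y)) 0"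
  proof (rule isCont_o2[where f=cvec and g=G])
    show "isCont cvec (0 :: real ^ 'd)" using cont by (simp add: continuous_on_eq_continuous_at)
    show "isCont G (cvec (0 :: real ^ 'd))" using jointly_holomorphic_on_isCont[OF G zero] by simp
  qed
  then have "((\<lambda>y. G (cvec y)) \<longlongrightarrow> G (cvec 0)) (at 0)" by (simp add: isCont_def)
  then have "(epstein_zeta_reg_raw A \<nu> \<alpha> x \<longlongrightarrow> G (cvec 0)) (at 0)"
  proof (rule Lim_transform_eventually)
    have "eventually (\<lambda>y. y \<in> (cvec -` ?V) - {0}) (at 0)"
      using zero by (intro eventually_at_in_open V) simp
    then show "eventually (\<lambda>y. G (cvec y) = epstein_zeta_reg_raw A \<nu> \<alpha> x y) (at 0)"
      by (rule eventually_mono) (use raw in \<open>auto simp: cvec_in_cdomain\<close>)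
  qed
  then have "Lim (at 0) (epstein_zeta_reg_raw A \<nu> \<alpha> x) = G (cvec 0)"
    by (rule tendsto_Lim[OF trivial_limit_at])
  then show ?thesis using True by (simp add: epstein_zeta_reg_def)
qed (use y raw in \<open>simp add: epstein_zeta_reg_def\<close>)

text \<open>The middle component is a placeholder that gives the parameters the triple form of
  \<open>cmi_deriv_joint\<close>; it is later filled with 0.\<close>

lemma remainder_jointly_holomorphic:
  fixes \<alpha> :: "nat ^ 'd::finite"
  shows "(\<lambda>p :: complex \<times> complex \<times> (complex ^ 'd). cmi_deriv \<alpha> (\<lambda>w. Pser {mi_abs (mi_half_ceil \<alpha>)..}
      (mellin_exponent TYPE('d) (fst p)) (of_real pi * cdot w w)) (snd (snd p)))
    jointly_holomorphic_on (UNIV - exceptional_exponents \<alpha>) \<times> UNIV \<times> UNIV"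
proof -
  let ?U = "(UNIV - exceptional_exponents \<alpha>) \<times> UNIV \<times> UNIV :: (complex \<times> complex \<times> (complex ^ 'd)) set"
  let ?F = "\<lambda>p :: complex \<times> complex \<times> (complex ^ 'd). Pser {mi_abs (mi_half_ceil \<alpha>)..}
      (mellin_exponent TYPE('d) (fst p)) (of_real pi * cdot (snd (snd p)) (snd (snd p)))"
  have U: "open ?U" by (intro open_Times open_not_exceptional open_UNIV)
  have "?F jointly_holomorphic_on ?U"
    unfolding jointly_holomorphic_on_iff
    by (intro ballI cdiff_at_Pser cdiff_at_mellin_exponent cdiff_at_mult cdiff_at_const cdiff_at_cdot
        cdiff_at_fst cdiff_at_snd cdiff_at_ident) (auto simp: not_exceptional_iff)
  from cmi_deriv_joint[OF U this] show ?thesis by simp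
qed

lemma cdiff_at_remainder:
  fixes \<alpha> :: "nat ^ 'd::finite" and p :: "'a::complex_normed_vector"
  assumes "cdiff_at f p" "cdiff_at h p" "f p \<notin> exceptional_exponents \<alpha>"
  shows "cdiff_at (\<lambda>p. cmi_deriv \<alpha> (\<lambda>w. Pser {mi_abs (mi_half_ceil \<alpha>)..}
      (mellin_exponent TYPE('d) (f p)) (of_real pi * cdot w w)) (h p)) p"
proof -
  let ?F = "\<lambda>p :: complex \<times> complex \<times> (complex ^ 'd). cmi_deriv \<alpha> (\<lambda>w. Pser {mi_abs (mi_half_ceil \<alpha>)..}
      (mellin_exponent TYPE('d) (fst p)) (of_real pi * cdot w w)) (snd (snd p))"
  have "cdiff_at ?F (f p, 0, h p)"
    using remainder_jointly_holomorphic[of \<alpha>] assms(3) by (simp add: jointly_holomorphic_on_iff)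
  from cdiff_at_compose[of ?F "\<lambda>p. (f p, 0, h p)", OF this] show ?thesis
    using assms by (simp add: cdiff_at_Pair cdiff_at_const)
qed

theorem theorem2p22:
  fixes A :: "real ^ 'd ^ 'd::finite" and \<alpha> :: "nat ^ 'd"
  assumes "invertible A"
  shows
    "(\<exists>F :: complex \<times> (complex ^ 'd) \<times> (complex ^ 'd) \<Rightarrow> complex.
        F jointly_holomorphic_on
          ((UNIV - exceptional_exponents \<alpha>) \<times> cdomain (lattice_of A) \<times>
             cdomain (dual_lattice_of A - {0})) \<and>
        (\<forall>\<nu> x y. \<nu> \<notin> exceptional_exponents \<alpha> \<longrightarrow> x \<notin> lattice_of A \<longrightarrow>
           y \<in> (UNIV - dual_lattice_of A) \<union> {0} \<longrightarrow>
           F (\<nu>, cvec x, cvec y) = epstein_zeta_reg A \<nu> \<alpha> x y))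
     \<and>
     (\<forall>\<nu> \<in> exceptional_exponents \<alpha>.
        \<exists>F :: (complex ^ 'd) \<times> (complex ^ 'd) \<Rightarrow> complex.
          F jointly_holomorphic_on
            (cdomain (lattice_of A) \<times> cdomain (dual_lattice_of A - {0})) \<and>
          (\<forall>x y. x \<notin> lattice_of A \<longrightarrow> y \<in> (UNIV - dual_lattice_of A) \<union> {0} \<longrightarrow>
             F (cvec x, cvec y) = epstein_zeta_reg A \<nu> \<alpha> x y))
     \<and>
     (\<forall>x \<in> lattice_of A.
        \<exists>F :: complex \<times> (complex ^ 'd) \<Rightarrow> complex.
          F jointly_holomorphic_on
            ((UNIV - exceptional_exponents \<alpha>) \<times> cdomain (dual_lattice_of A - {0})) \<and>
          (\<forall>\<nu> y. \<nu> \<notin> exceptional_exponents \<alpha> \<longrightarrow>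
             y \<in> (UNIV - dual_lattice_of A) \<union> {0} \<longrightarrow>
             F (\<nu>, cvec y) = epstein_zeta_reg A \<nu> \<alpha> x y))"
proof -
  let ?L = "lattice_of A" and ?D = "dual_lattice_of A" and ?E = "exceptional_exponents \<alpha>"
  note A = assms
  have zero: "y \<noteq> 0" if "y \<notin> ?D" for y
    using that zero_in_lattice by (auto simp: dual_lattice_of_def)
  define rem where "rem \<nu> w = cmi_deriv \<alpha> (\<lambda>w. Pser {mi_abs (mi_half_ceil \<alpha>)..}
      (mellin_exponent TYPE('d) \<nu>) (of_real pi * cdot w w)) w" for \<nu> w
  have raw: "epstein_zeta_reg_raw A \<nu> \<alpha> x y =
      crandall_reg A \<alpha> (?L - {x}) \<nu> (cvec x) (cvec y) (rem \<nu> (cvec y)) - lattice_correction ?L \<alpha> x \<nu>"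
    if "\<nu> \<notin> ?E" "y \<notin> ?D" for \<nu> x y
    unfolding rem_def using that(1) zero[OF that(2)]
    by (intro epstein_zeta_reg_raw_eq[OF A that(2)] mi_deriv_s_hat_regular)
  show ?thesis
  proof (intro conjI ballI)
    \<comment> \<open>For \<open>x\<close> off the lattice \<open>?L - {x}\<close> is
      \<open>?L\<close> and the correction vanishes, so a single formula serves all
      \<open>x\<close>.\<close>
    let ?F = "\<lambda>p. crandall_reg A \<alpha> ?L (fst p) (fst (snd p)) (snd (snd p)) (rem (fst p) (snd (snd p)))"
    have hol: "?F jointly_holomorphic_on (UNIV - ?E) \<times> cdomain ?L \<times> cdomain (?D - {0})"
      unfolding jointly_holomorphic_on_iff rem_def
      by (intro ballI cdiff_at_crandall_reg[OF A order_refl] cdiff_at_remainder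
          cdiff_at_fst cdiff_at_snd cdiff_at_ident) auto
    have val: "?F (\<nu>, cvec x, cvec y) = epstein_zeta_reg A \<nu> \<alpha> x y"
      if \<nu>: "\<nu> \<notin> ?E" and x: "x \<notin> ?L" and y: "y \<in> (UNIV - ?D) \<union> {0}" for \<nu> x y
    proof -
      \<comment> \<open>Agreement is checked with \<nu> and \<open>x\<close> fixed: only the slice
        in \<open>w\<close> matters for the limit at \<open>y = 0\<close>.\<close>
      let ?G = "\<lambda>w. crandall_reg A \<alpha> ?L \<nu> (cvec x) w (rem \<nu> w)"
      have "?G (cvec y) = epstein_zeta_reg A \<nu> \<alpha> x y"
      proof (rule epstein_zeta_reg_eq[OF A _ _ y])
        show "?G jointly_holomorphic_on cdomain (?D - {0})"
          unfolding jointly_holomorphic_on_iff rem_def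
          by (intro ballI cdiff_at_crandall_reg[OF A order_refl] cdiff_at_remainder
              cdiff_at_const cdiff_at_ident) (use \<nu> x in \<open>auto simp: cvec_in_cdomain\<close>)
        show "epstein_zeta_reg_raw A \<nu> \<alpha> x y = ?G (cvec y)" if "y \<notin> ?D" for y
          using raw[OF \<nu> that, of x] x by (simp add: lattice_correction_def)
      qed
      then show ?thesis by simp
    qed
    show "\<exists>F. F jointly_holomorphic_on (UNIV - ?E) \<times> cdomain ?L \<times> cdomain (?D - {0}) \<and>
        (\<forall>\<nu> x y. \<nu> \<notin> ?E \<longrightarrow> x \<notin> ?L \<longrightarrow> y \<in> (UNIV - ?D) \<union> {0} \<longrightarrow>
           F (\<nu>, cvec x, cvec y) = epstein_zeta_reg A \<nu> \<alpha> x y)"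
      by (intro exI[of _ ?F] conjI allI impI hol val)
  next
    fix \<nu> assume "\<nu> \<in> ?E"
    then obtain n where "\<nu> = of_nat (CARD('d) + 2 * mi_abs (mi_half_ceil \<alpha>) + 2 * n)"
      unfolding exceptional_exponents_def by blast
    then obtain l where l: "\<nu> = of_nat (CARD('d) + 2 * l)"
      by (metis add.assoc distrib_left)
    then have s: "mellin_exponent TYPE('d) \<nu> = - of_nat l" by (simp only: mellin_exponent_eq_iff)
    obtain c where c: "\<And>y :: real ^ 'd. y \<noteq> 0 \<Longrightarrow> s_hat \<nu> y = zeta_prefactor \<nu> *
      (Qint (- of_nat l) (of_real pi * cdot (cvec y) (cvec y)) +
       (Pser (- {l}) (- of_nat l) (of_real pi * cdot (cvec y) (cvec y)) + c * (of_real pi * cdot (cvec y) (cvec y)) ^ l))"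
      using s_hat_log[OF l] by blast
    \<comment> \<open>At a fixed exceptional exponent the pole is replaced by the logarithm in
      \<open>s_hat\<close>. The remainder is kept in full, including the power \<open>l\<close>, and
      only holomorphy in the vectors is claimed.\<close>
    define R where "R w = Pser (- {l}) (- of_nat l) (of_real pi * cdot w w) + c * (of_real pi * cdot w w) ^ l"
      for w :: "complex ^ 'd"
    have "- of_nat l \<in> off_poles (- {l})" by (auto simp: off_poles_def)
    then have R: "R jointly_holomorphic_on UNIV"
      unfolding jointly_holomorphic_on_iff R_def
      by (intro ballI cdiff_at_add cdiff_at_Pser cdiff_at_mult cdiff_at_power cdiff_at_const cdiff_at_cdot cdiff_at_ident)
    have cR: "cdiff_at (cmi_deriv \<alpha> R) w" for w
      using cmi_deriv_jointly_holomorphic[OF open_UNIV R, of \<alpha>] by (simp add: jointly_holomorphic_on_iff)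
    let ?F = "\<lambda>p. crandall_reg A \<alpha> ?L \<nu> (fst p) (snd p) (cmi_deriv \<alpha> R (snd p))"
    have hol: "cdiff_at ?F p" if "p \<in> cdomain ?L \<times> cdomain (?D - {0})" for p
      using that by (intro cdiff_at_crandall_reg[OF A order_refl] cdiff_at_compose[of "cmi_deriv \<alpha> R" snd]
        cR cdiff_at_const cdiff_at_fst cdiff_at_snd cdiff_at_ident) auto
    have val: "?F (cvec x, cvec y) = epstein_zeta_reg A \<nu> \<alpha> x y"
      if x: "x \<notin> ?L" and y: "y \<in> (UNIV - ?D) \<union> {0}" for x y
    proof -
      let ?G = "\<lambda>w. crandall_reg A \<alpha> ?L \<nu> (cvec x) w (cmi_deriv \<alpha> R w)"
      have "?G (cvec y) = epstein_zeta_reg A \<nu> \<alpha> x y"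
      proof (rule epstein_zeta_reg_eq[OF A _ _ y])
        show "?G jointly_holomorphic_on cdomain (?D - {0})"
          unfolding jointly_holomorphic_on_iff
          by (intro ballI cdiff_at_crandall_reg[OF A order_refl] cR
              cdiff_at_const cdiff_at_ident) (use x in \<open>auto simp: cvec_in_cdomain\<close>)
        show "epstein_zeta_reg_raw A \<nu> \<alpha> x y = ?G (cvec y)" if y: "y \<notin> ?D" for y
        proof -
          have "mi_deriv \<alpha> (s_hat \<nu>) y = zeta_prefactor \<nu> *
            (cmi_deriv \<alpha> (\<lambda>w. Qint (mellin_exponent TYPE('d) \<nu>) (of_real pi * cdot w w)) (cvec y) + cmi_deriv \<alpha> R (cvec y))"
            unfolding s by (rule mi_deriv_s_hat[OF R _ zero[OF y]]) (simp add: c R_def)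
          from epstein_zeta_reg_raw_eq[OF A y this, of x] show ?thesis using x by (simp add: lattice_correction_def)
        qed
      qed
      then show ?thesis by simp
    qed
    show "\<exists>F. F jointly_holomorphic_on cdomain ?L \<times> cdomain (?D - {0}) \<and>
          (\<forall>x y. x \<notin> ?L \<longrightarrow> y \<in> (UNIV - ?D) \<union> {0} \<longrightarrow> F (cvec x, cvec y) = epstein_zeta_reg A \<nu> \<alpha> x y)"
      unfolding jointly_holomorphic_on_iff by (intro exI[of _ ?F] conjI allI impI ballI hol val)
  next
    fix x assume "x \<in> ?L"
    \<comment> \<open>With \<open>x\<close> on the lattice and fixed, the direct sum omits
      \<open>x\<close>, so that its domain contains \<open>cvec x\<close>; the correction is entire
      in \<nu>.\<close>
    let ?F = "\<lambda>p. crandall_reg A \<alpha> (?L - {x}) (fst p) (cvec x) (snd p) (rem (fst p) (snd p)) -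
      lattice_correction ?L \<alpha> x (fst p)"
    have x: "cvec x \<in> cdomain (?L - {x})" by (simp add: cvec_in_cdomain)
    have hol: "?F jointly_holomorphic_on (UNIV - ?E) \<times> cdomain (?D - {0})"
      unfolding jointly_holomorphic_on_iff rem_def
      by (intro ballI cdiff_at_diff cdiff_at_crandall_reg[OF A] cdiff_at_remainder cdiff_at_lattice_correction
          cdiff_at_const cdiff_at_fst cdiff_at_snd cdiff_at_ident) (use x in auto)
    have val: "?F (\<nu>, cvec y) = epstein_zeta_reg A \<nu> \<alpha> x y"
      if \<nu>: "\<nu> \<notin> ?E" and y: "y \<in> (UNIV - ?D) \<union> {0}" for \<nu> y
    proof -
      let ?G = "\<lambda>w. crandall_reg A \<alpha> (?L - {x}) \<nu> (cvec x) w (rem \<nu> w) - lattice_correction ?L \<alpha> x \<nu>"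
      have "?G (cvec y) = epstein_zeta_reg A \<nu> \<alpha> x y"
      proof (rule epstein_zeta_reg_eq[OF A _ raw[OF \<nu>] y])
        show "?G jointly_holomorphic_on cdomain (?D - {0})"
          unfolding jointly_holomorphic_on_iff rem_def
          by (intro ballI cdiff_at_diff cdiff_at_crandall_reg[OF A] cdiff_at_remainder
              cdiff_at_const cdiff_at_ident) (use \<nu> x in auto)
      qed
      then show ?thesis by simp
    qed
    show "\<exists>F. F jointly_holomorphic_on (UNIV - ?E) \<times> cdomain (?D - {0}) \<and>
          (\<forall>\<nu> y. \<nu> \<notin> ?E \<longrightarrow> y \<in> (UNIV - ?D) \<union> {0} \<longrightarrow> F (\<nu>, cvec y) = epstein_zeta_reg A \<nu> \<alpha> x y)"
      by (intro exI[of _ ?F] conjI allI impI hol val)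
  qed
qed

end
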